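(* Let $R$ be a commutative noetherian integral domain, and let $\mathcal C_{\mathrm A}(R)$ be the category of Abel complexes of controlled absolute growth and all chain maps between them, with cofibrations the injective chain maps in $\mathcal C_{\mathrm A}(R)$ and weak equivalences the quasi-isomorphisms in $\mathcal C_{\mathrm A}(R)$. (a) With this structure, $\mathcal C_{\mathrm A}(R)$ is a category with cofibrations and weak equivalences in the sense of Waldhausen satisfying the saturation axiom and the extension axiom. (b) The usual mapping cylinder construction for chain complexes provides a cylinder functor on $\mathcal C_{\mathrm A}(R)$ satisfying the cylinder axiom.
   Context: $\mathbb{N}$ includes $0$. $R$ is a commutative noetherian integral domain with field of quotients $Q$; the rank of an $R$-module $M$ is $\mathrm{rank}\,M=\dim_Q (M\otimes_R Q)$. All chain complexes are complexes of $R$-modules with differentials $C_{n}\to C_{n-1}$ and are positive: $C_n=0$ for $n<0$. For a sequence $\mathbf a=(a_n)_{n\in\mathbb N}$ of real numbers put $\bar\chi(\mathbf a)=\sum_{k\ge 0}a_kx^k$, and let $|\mathbf a|=(|a_n|)_n$. The sequence $\mathbf a$ is an Abel sequence if its power series $\bar\chi(\mathbf a)$ has radius of convergence at least $1$ and $\lim_{x\to1^-}(1-x)\bar\chi(\mathbf a)$ exists as a finite real number. It is of controlled absolute growth if its power series has radius of convergence at least $1$ and $(1-x)^2\,\bar\chi(|\mathbf a|)\to0$ as $x\to1^-$. For a positive chain complex $C$ whose homology modules all have finite rank, $\mathbf HC$ is the sequence $(\mathbf HC)_n=(-1)^n\,\mathrm{rank}\,H_nC$. $C$ is an Abel complex if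 $\mathbf HC$ is an Abel sequence, and is of controlled absolute growth if $\mathbf HC$ is. The notions "category with cofibrations and weak equivalences", "saturation axiom" (two-out-of-three for weak equivalences), "extension axiom" (for a map of cofibration sequences, if the maps on the subobjects and on the quotients are weak equivalences, then so is the map on the middle objects), "cylinder functor" and "cylinder axiom" (the projection $T(f)\to D$ is a weak equivalence for each $f\colon C\to D$) are those of Waldhausen's "Algebraic $K$-theory of spaces". The mapping cylinder $T(f)$ of a chain map $f\colon C\to D$ has chain modules $T(f)_n=C_n\oplus C_{n-1}\oplus D_n$ with the usual differential. *)

theory Defs
  imports
    "HOL-Analysis.Summation_Tests"
    "HOL-Algebra.Ring_Divisibility"
    "HOL-Algebra.Generated_Groups"
    "HOL-Algebra.Free_Abelian_Groups"
    "Jordan_Normal_Form.Missing_VectorSpace"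
begin

section \<open>Categories with cofibrations and weak equivalences\<close>

record ('o, 'm) category =
  Ob :: "'o set"
  Arr :: "'m set"
  Dom :: "'m \<Rightarrow> 'o"
  Cod :: "'m \<Rightarrow> 'o"
  Idn :: "'o \<Rightarrow> 'm"
  Comp :: "'m \<Rightarrow> 'm \<Rightarrow> 'm"  (infixr \<open>\<cdot>\<index>\<close> 75)

locale category =
  fixes W :: "('o, 'm, 'z) category_scheme" (structure)
  assumes Dom_Ob: "f \<in> Arr W \<Longrightarrow> Dom W f \<in> Ob W"
    and Cod_Ob: "f \<in> Arr W \<Longrightarrow> Cod W f \<in> Ob W"
    and Idn_Arr: "A \<in> Ob W \<Longrightarrow> Idn W A \<in> Arr W"
    and Dom_Idn: "A \<in> Ob W \<Longrightarrow> Dom W (Idn W A) = A"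
    and Cod_Idn: "A \<in> Ob W \<Longrightarrow> Cod W (Idn W A) = A"
    and Comp_Arr: "\<lbrakk>f \<in> Arr W; g \<in> Arr W; Cod W f = Dom W g\<rbrakk> \<Longrightarrow> g \<cdot> f \<in> Arr W"
    and Dom_Comp: "\<lbrakk>f \<in> Arr W; g \<in> Arr W; Cod W f = Dom W g\<rbrakk> \<Longrightarrow> Dom W (g \<cdot> f) = Dom W f"
    and Cod_Comp: "\<lbrakk>f \<in> Arr W; g \<in> Arr W; Cod W f = Dom W g\<rbrakk> \<Longrightarrow> Cod W (g \<cdot> f) = Cod W g"
    and Comp_Idn: "f \<in> Arr W \<Longrightarrow> f \<cdot> Idn W (Dom W f) = f"
    and Idn_Comp: "f \<in> Arr W \<Longrightarrow> Idn W (Cod W f) \<cdot> f = f"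
    and Comp_assoc: "\<lbrakk>f \<in> Arr W; g \<in> Arr W; h \<in> Arr W; Cod W f = Dom W g; Cod W g = Dom W h\<rbrakk>
      \<Longrightarrow> (h \<cdot> g) \<cdot> f = h \<cdot> (g \<cdot> f)"

definition Hom :: "('o, 'm, 'z) category_scheme \<Rightarrow> 'o \<Rightarrow> 'o \<Rightarrow> 'm set" where
  "Hom W A B = {f \<in> Arr W. Dom W f = A \<and> Cod W f = B}"

definition is_iso_arrow :: "('o, 'm, 'z) category_scheme \<Rightarrow> 'm \<Rightarrow> bool" where
  "is_iso_arrow W f \<longleftrightarrow> f \<in> Arr W \<and>
     (\<exists>g \<in> Hom W (Cod W f) (Dom W f).
        g \<cdot>\<^bsub>W\<^esub> f = Idn W (Dom W f) \<and> f \<cdot>\<^bsub>W\<^esub> g = Idn W (Cod W f))"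

definition is_zero_object :: "('o, 'm, 'z) category_scheme \<Rightarrow> 'o \<Rightarrow> bool" where
  "is_zero_object W Z \<longleftrightarrow> Z \<in> Ob W \<and>
     (\<forall>A \<in> Ob W. (\<exists>!f. f \<in> Hom W Z A) \<and> (\<exists>!f. f \<in> Hom W A Z))"

text \<open>The square with edges \<open>f : A \<rightarrow> B\<close>, \<open>g : A \<rightarrow> C\<close>, \<open>i : B \<rightarrow> P\<close>, \<open>j : C \<rightarrow> P\<close> is a pushout.\<close>

definition is_pushout :: "('o, 'm, 'z) category_scheme \<Rightarrow> 'm \<Rightarrow> 'm \<Rightarrow> 'm \<Rightarrow> 'm \<Rightarrow> bool" where
  "is_pushout W f g i j \<longleftrightarrow>
     f \<in> Arr W \<and> g \<in> Arr W \<and> i \<in> Arr W \<and> j \<in> Arr W \<and>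
     Dom W f = Dom W g \<and> Dom W i = Cod W f \<and> Dom W j = Cod W g \<and> Cod W i = Cod W j \<and>
     i \<cdot>\<^bsub>W\<^esub> f = j \<cdot>\<^bsub>W\<^esub> g \<and>
     (\<forall>X \<in> Ob W. \<forall>u \<in> Hom W (Cod W f) X. \<forall>v \<in> Hom W (Cod W g) X.
        u \<cdot>\<^bsub>W\<^esub> f = v \<cdot>\<^bsub>W\<^esub> g \<longrightarrow>
        (\<exists>!h. h \<in> Hom W (Cod W i) X \<and> h \<cdot>\<^bsub>W\<^esub> i = u \<and> h \<cdot>\<^bsub>W\<^esub> j = v))"

definition is_coproduct :: "('o, 'm, 'z) category_scheme \<Rightarrow> 'o \<Rightarrow> 'o \<Rightarrow> 'm \<Rightarrow> 'm \<Rightarrow> bool" where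
  "is_coproduct W A B i j \<longleftrightarrow>
     i \<in> Arr W \<and> j \<in> Arr W \<and> Dom W i = A \<and> Dom W j = B \<and> Cod W i = Cod W j \<and>
     (\<forall>X \<in> Ob W. \<forall>u \<in> Hom W A X. \<forall>v \<in> Hom W B X.
        \<exists>!h. h \<in> Hom W (Cod W i) X \<and> h \<cdot>\<^bsub>W\<^esub> i = u \<and> h \<cdot>\<^bsub>W\<^esub> j = v)"

text \<open>The arrow \<open>A \<or> B \<rightarrow> X\<close> assembled from \<open>u : A \<rightarrow> X\<close> and \<open>v : B \<rightarrow> X\<close>, where
  \<open>i\<close> and \<open>j\<close> are the inclusions of \<open>A\<close> and \<open>B\<close> into their coproduct.\<close>

definition copair :: "('o, 'm, 'z) category_scheme \<Rightarrow> 'm \<Rightarrow> 'm \<Rightarrow> 'm \<Rightarrow> 'm \<Rightarrow> 'm" where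
  "copair W i j u v =
     (THE h. h \<in> Hom W (Cod W i) (Cod W u) \<and> h \<cdot>\<^bsub>W\<^esub> i = u \<and> h \<cdot>\<^bsub>W\<^esub> j = v)"

definition is_functor :: "('o, 'm, 'z) category_scheme \<Rightarrow> ('p, 'n, 'y) category_scheme \<Rightarrow>
    ('o \<Rightarrow> 'p) \<Rightarrow> ('m \<Rightarrow> 'n) \<Rightarrow> bool" where
  "is_functor V W Fo Fm \<longleftrightarrow>
     (\<forall>A \<in> Ob V. Fo A \<in> Ob W \<and> Fm (Idn V A) = Idn W (Fo A)) \<and>
     (\<forall>f \<in> Arr V. Fm f \<in> Hom W (Fo (Dom V f)) (Fo (Cod V f))) \<and>
     (\<forall>f \<in> Arr V. \<forall>g \<in> Arr V. Cod V f = Dom V g \<longrightarrow> Fm (g \<cdot>\<^bsub>V\<^esub> f) = Fm g \<cdot>\<^bsub>W\<^esub> Fm f)"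

record ('o, 'm) waldhausen = "('o, 'm) category" +
  Zero :: 'o
  Cof :: "'m set"
  Weq :: "'m set"

locale category_with_cofibrations = category W
  for W :: "('o, 'm, 'z) waldhausen_scheme" (structure) +
  assumes Zero: "is_zero_object W (Zero W)"
    and Cof_Arr: "Cof W \<subseteq> Arr W"
    and Cof_Comp: "\<lbrakk>f \<in> Cof W; g \<in> Cof W; Cod W f = Dom W g\<rbrakk> \<Longrightarrow> g \<cdot> f \<in> Cof W"
    and Cof1: "is_iso_arrow W f \<Longrightarrow> f \<in> Cof W"
    and Cof2: "\<lbrakk>A \<in> Ob W; f \<in> Hom W (Zero W) A\<rbrakk> \<Longrightarrow> f \<in> Cof W"
    and Cof3_ex: "\<lbrakk>f \<in> Cof W; g \<in> Arr W; Dom W f = Dom W g\<rbrakk> \<Longrightarrow> \<exists>i j. is_pushout W f g i j"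
    and Cof3: "\<lbrakk>f \<in> Cof W; is_pushout W f g i j\<rbrakk> \<Longrightarrow> j \<in> Cof W"

locale waldhausen_category = category_with_cofibrations W
  for W :: "('o, 'm, 'z) waldhausen_scheme" (structure) +
  assumes Weq_Arr: "Weq W \<subseteq> Arr W"
    and Weq_Comp: "\<lbrakk>f \<in> Weq W; g \<in> Weq W; Cod W f = Dom W g\<rbrakk> \<Longrightarrow> g \<cdot> f \<in> Weq W"
    and Weq1: "is_iso_arrow W f \<Longrightarrow> f \<in> Weq W"
    and Weq2: "\<lbrakk>f \<in> Cof W; is_pushout W f g i j; f' \<in> Cof W; is_pushout W f' g' i' j';
        a \<in> Weq W; a \<in> Hom W (Dom W f) (Dom W f');
        b \<in> Weq W; b \<in> Hom W (Cod W f) (Cod W f');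
        c \<in> Weq W; c \<in> Hom W (Cod W g) (Cod W g');
        b \<cdot> f = f' \<cdot> a; c \<cdot> g = g' \<cdot> a;
        h \<in> Hom W (Cod W i) (Cod W i'); h \<cdot> i = i' \<cdot> b; h \<cdot> j = j' \<cdot> c\<rbrakk> \<Longrightarrow> h \<in> Weq W"

definition saturation_axiom :: "('o, 'm, 'z) waldhausen_scheme \<Rightarrow> bool" where
  "saturation_axiom W \<longleftrightarrow>
     (\<forall>f \<in> Arr W. \<forall>g \<in> Arr W. Cod W f = Dom W g \<longrightarrow>
        (f \<in> Weq W \<and> g \<in> Weq W \<longrightarrow> g \<cdot>\<^bsub>W\<^esub> f \<in> Weq W) \<and>
        (f \<in> Weq W \<and> g \<cdot>\<^bsub>W\<^esub> f \<in> Weq W \<longrightarrow> g \<in> Weq W) \<and>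
        (g \<in> Weq W \<and> g \<cdot>\<^bsub>W\<^esub> f \<in> Weq W \<longrightarrow> f \<in> Weq W))"

text \<open>\<open>A \<rightarrow> B \<rightarrow> B/A\<close>, where \<open>B/A\<close> is a cobase change of the cofibration \<open>f : A \<rightarrow> B\<close>
  along \<open>A \<rightarrow> *\<close>.\<close>

definition is_cofibration_sequence :: "('o, 'm, 'z) waldhausen_scheme \<Rightarrow> 'm \<Rightarrow> 'm \<Rightarrow> bool" where
  "is_cofibration_sequence W f q \<longleftrightarrow> f \<in> Cof W \<and>
     (\<exists>t \<in> Hom W (Dom W f) (Zero W). \<exists>z \<in> Hom W (Zero W) (Cod W q). is_pushout W f t q z)"

definition extension_axiom :: "('o, 'm, 'z) waldhausen_scheme \<Rightarrow> bool" where
  "extension_axiom W \<longleftrightarrow>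
     (\<forall>f q f' q' a b c.
        is_cofibration_sequence W f q \<and> is_cofibration_sequence W f' q' \<and>
        a \<in> Hom W (Dom W f) (Dom W f') \<and> b \<in> Hom W (Cod W f) (Cod W f') \<and>
        c \<in> Hom W (Cod W q) (Cod W q') \<and>
        b \<cdot>\<^bsub>W\<^esub> f = f' \<cdot>\<^bsub>W\<^esub> a \<and> c \<cdot>\<^bsub>W\<^esub> q = q' \<cdot>\<^bsub>W\<^esub> b \<and>
        a \<in> Weq W \<and> c \<in> Weq W \<longrightarrow> b \<in> Weq W)"


section \<open>Cylinder functors\<close>

text \<open>A morphism of arrows from \<open>f\<close> to \<open>g\<close> is a tuple \<open>(f, a, b, g)\<close> with \<open>b \<cdot> f = g \<cdot> a\<close>.
  Cofibrations and weak equivalences in \<open>Ar W\<close> are defined pointwise.\<close>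

definition arrow_category ::
    "('o, 'm, 'z) waldhausen_scheme \<Rightarrow> ('m, 'm \<times> 'm \<times> 'm \<times> 'm) waldhausen" where
  "arrow_category W =
     \<lparr>Ob = Arr W,
      Arr = {(f, a, b, g). f \<in> Arr W \<and> g \<in> Arr W \<and>
        a \<in> Hom W (Dom W f) (Dom W g) \<and> b \<in> Hom W (Cod W f) (Cod W g) \<and>
        b \<cdot>\<^bsub>W\<^esub> f = g \<cdot>\<^bsub>W\<^esub> a},
      Dom = (\<lambda>(f, a, b, g). f),
      Cod = (\<lambda>(f, a, b, g). g),
      Idn = (\<lambda>f. (f, Idn W (Dom W f), Idn W (Cod W f), f)),
      Comp = (\<lambda>(g, a', b', h) (f, a, b, _). (f, a' \<cdot>\<^bsub>W\<^esub> a, b' \<cdot>\<^bsub>W\<^esub> b, h)),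
      Zero = Idn W (Zero W),
      Cof = {(f, a, b, g). f \<in> Arr W \<and> g \<in> Arr W \<and>
        a \<in> Hom W (Dom W f) (Dom W g) \<and> b \<in> Hom W (Cod W f) (Cod W g) \<and>
        b \<cdot>\<^bsub>W\<^esub> f = g \<cdot>\<^bsub>W\<^esub> a \<and> a \<in> Cof W \<and> b \<in> Cof W},
      Weq = {(f, a, b, g). f \<in> Arr W \<and> g \<in> Arr W \<and>
        a \<in> Hom W (Dom W f) (Dom W g) \<and> b \<in> Hom W (Cod W f) (Cod W g) \<and>
        b \<cdot>\<^bsub>W\<^esub> f = g \<cdot>\<^bsub>W\<^esub> a \<and> a \<in> Weq W \<and> b \<in> Weq W}\<rparr>"

text \<open>Waldhausen's category \<open>F\<^sub>1 W\<close>: the full subcategory of \<open>Ar W\<close> on the cofibrations.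
  A morphism \<open>(f : A \<rightarrow> B) \<rightarrow> (g : A' \<rightarrow> B')\<close> is a cofibration of \<open>F\<^sub>1 W\<close> iff
  \<open>A \<rightarrow> A'\<close> and the induced arrow from the pushout of \<open>B\<close> and \<open>A'\<close> over \<open>A\<close> to \<open>B'\<close> are
  cofibrations of \<open>W\<close>.\<close>

definition F1_category ::
    "('o, 'm, 'z) waldhausen_scheme \<Rightarrow> ('m, 'm \<times> 'm \<times> 'm \<times> 'm) waldhausen" where
  "F1_category W = (arrow_category W)
     \<lparr>Ob := Cof W,
      Arr := {(f, a, b, g) \<in> Arr (arrow_category W). f \<in> Cof W \<and> g \<in> Cof W},
      Cof := {(f, a, b, g) \<in> Arr (arrow_category W). f \<in> Cof W \<and> g \<in> Cof W \<and> a \<in> Cof W \<and>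
        (\<exists>i j h. is_pushout W f a i j \<and> h \<in> Hom W (Cod W i) (Cod W g) \<and>
           h \<cdot>\<^bsub>W\<^esub> i = b \<and> h \<cdot>\<^bsub>W\<^esub> j = g \<and> h \<in> Cof W)},
      Weq := {(f, a, b, g) \<in> Weq (arrow_category W). f \<in> Cof W \<and> g \<in> Cof W}\<rparr>"

text \<open>The distinguished zero object is preserved up to unique isomorphism.\<close>

definition exact_functor :: "('o, 'm, 'z) waldhausen_scheme \<Rightarrow> ('p, 'n, 'y) waldhausen_scheme \<Rightarrow>
    ('o \<Rightarrow> 'p) \<Rightarrow> ('m \<Rightarrow> 'n) \<Rightarrow> bool" where
  "exact_functor V W Fo Fm \<longleftrightarrow>
     is_functor V W Fo Fm \<and>
     is_zero_object W (Fo (Zero V)) \<and>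
     Fm ` Cof V \<subseteq> Cof W \<and>
     Fm ` Weq V \<subseteq> Weq W \<and>
     (\<forall>f g i j. f \<in> Cof V \<and> is_pushout V f g i j \<longrightarrow> is_pushout W (Fm f) (Fm g) (Fm i) (Fm j))"

text \<open>The data of a functor from \<open>Ar W\<close> to diagrams \<open>A \<rightarrow> T(f) \<leftarrow> B\<close>, \<open>T(f) \<rightarrow> B\<close> (for
  \<open>f : A \<rightarrow> B\<close>): the object \<open>T(f)\<close>, the arrow induced by a morphism of arrows, the front and back
  inclusions and the projection.\<close>

record ('o, 'm) cylinder =
  Cyl :: "'m \<Rightarrow> 'o"
  Cyl_map :: "'m \<times> 'm \<times> 'm \<times> 'm \<Rightarrow> 'm"
  front_incl :: "'m \<Rightarrow> 'm"
  back_incl :: "'m \<Rightarrow> 'm"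
  proj :: "'m \<Rightarrow> 'm"

definition cylinder_diagram ::
    "('o, 'm, 'z) waldhausen_scheme \<Rightarrow> ('o, 'm) cylinder \<Rightarrow> bool" where
  "cylinder_diagram W T \<longleftrightarrow>
     is_functor (arrow_category W) W (Cyl T) (Cyl_map T) \<and>
     (\<forall>f \<in> Arr W.
        front_incl T f \<in> Hom W (Dom W f) (Cyl T f) \<and>
        back_incl T f \<in> Hom W (Cod W f) (Cyl T f) \<and>
        proj T f \<in> Hom W (Cyl T f) (Cod W f) \<and>
        proj T f \<cdot>\<^bsub>W\<^esub> front_incl T f = f \<and>
        proj T f \<cdot>\<^bsub>W\<^esub> back_incl T f = Idn W (Cod W f)) \<and>
     (\<forall>(f, a, b, g) \<in> Arr (arrow_category W).
        Cyl_map T (f, a, b, g) \<cdot>\<^bsub>W\<^esub> front_incl T f = front_incl T g \<cdot>\<^bsub>W\<^esub> a \<and>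
        Cyl_map T (f, a, b, g) \<cdot>\<^bsub>W\<^esub> back_incl T f = back_incl T g \<cdot>\<^bsub>W\<^esub> b \<and>
        proj T g \<cdot>\<^bsub>W\<^esub> Cyl_map T (f, a, b, g) = b \<cdot>\<^bsub>W\<^esub> proj T f)"

text \<open>Cyl 1: the inclusions assemble to an exact functor \<open>Ar W \<rightarrow> F\<^sub>1 W\<close>,
  \<open>(f : A \<rightarrow> B) \<mapsto> (A \<or> B \<rightarrow> T(f))\<close>. The condition does not depend on the choice of the coproducts
  \<open>A \<or> B\<close>, given here by their inclusions \<open>i A B\<close> and \<open>j A B\<close>.\<close>

definition Cyl1 :: "('o, 'm, 'z) waldhausen_scheme \<Rightarrow> ('o, 'm) cylinder \<Rightarrow> bool" where
  "Cyl1 W T \<longleftrightarrow>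
     (\<forall>i j. (\<forall>A \<in> Ob W. \<forall>B \<in> Ob W. is_coproduct W A B (i A B) (j A B)) \<longrightarrow>
        (let incl = (\<lambda>f. copair W (i (Dom W f) (Cod W f)) (j (Dom W f) (Cod W f))
                           (front_incl T f) (back_incl T f));
             sum_map = (\<lambda>a b. copair W (i (Dom W a) (Dom W b)) (j (Dom W a) (Dom W b))
                           (i (Cod W a) (Cod W b) \<cdot>\<^bsub>W\<^esub> a) (j (Cod W a) (Cod W b) \<cdot>\<^bsub>W\<^esub> b))
         in exact_functor (arrow_category W) (F1_category W) incl
              (\<lambda>(f, a, b, g). (incl f, sum_map a b, Cyl_map T (f, a, b, g), incl g))))"

definition Cyl2 :: "('o, 'm, 'z) waldhausen_scheme \<Rightarrow> ('o, 'm) cylinder \<Rightarrow> bool" where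
  "Cyl2 W T \<longleftrightarrow>
     (\<forall>A \<in> Ob W. \<forall>f \<in> Hom W (Zero W) A.
        Cyl T f = A \<and> back_incl T f = Idn W A \<and> proj T f = Idn W A)"

definition cylinder_functor ::
    "('o, 'm, 'z) waldhausen_scheme \<Rightarrow> ('o, 'm) cylinder \<Rightarrow> bool" where
  "cylinder_functor W T \<longleftrightarrow> cylinder_diagram W T \<and> Cyl1 W T \<and> Cyl2 W T"

definition cylinder_axiom :: "('o, 'm, 'z) waldhausen_scheme \<Rightarrow> ('o, 'm) cylinder \<Rightarrow> bool" where
  "cylinder_axiom W T \<longleftrightarrow> (\<forall>f \<in> Arr W. proj T f \<in> Weq W)"

text \<open>The usual mapping cylinder of \<open>* \<rightarrow> A\<close> is \<open>0 \<oplus> 0 \<oplus> A\<close>, which is \<open>A\<close> only after the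
  customary identification along the mutually inverse isomorphisms \<open>back_incl\<close> and \<open>proj\<close>. As Cyl 2
  demands an equality of objects, the identification has to be carried out:
  \<open>identify_Cyl2 W T\<close> replaces \<open>T(* \<rightarrow> A)\<close> by \<open>A\<close>, and agrees with \<open>T\<close> on arrows with
  source different from \<open>*\<close>.\<close>

definition Cyl2_up_to_iso :: "('o, 'm, 'z) waldhausen_scheme \<Rightarrow> ('o, 'm) cylinder \<Rightarrow> bool" where
  "Cyl2_up_to_iso W T \<longleftrightarrow>
     (\<forall>A \<in> Ob W. \<forall>f \<in> Hom W (Zero W) A.
        back_incl T f \<in> Hom W A (Cyl T f) \<and> proj T f \<in> Hom W (Cyl T f) A \<and>
        proj T f \<cdot>\<^bsub>W\<^esub> back_incl T f = Idn W A \<and> back_incl T f \<cdot>\<^bsub>W\<^esub> proj T f = Idn W (Cyl T f))"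

definition identify_Cyl2 ::
    "('o, 'm, 'z) waldhausen_scheme \<Rightarrow> ('o, 'm) cylinder \<Rightarrow> ('o, 'm) cylinder" where
  "identify_Cyl2 W T =
     (let from = (\<lambda>f. if Dom W f = Zero W then back_incl T f else Idn W (Cyl T f));
          to = (\<lambda>f. if Dom W f = Zero W then proj T f else Idn W (Cyl T f))
      in \<lparr>Cyl = (\<lambda>f. if Dom W f = Zero W then Cod W f else Cyl T f),
          Cyl_map = (\<lambda>(f, a, b, g). to g \<cdot>\<^bsub>W\<^esub> Cyl_map T (f, a, b, g) \<cdot>\<^bsub>W\<^esub> from f),
          front_incl = (\<lambda>f. to f \<cdot>\<^bsub>W\<^esub> front_incl T f),
          back_incl = (\<lambda>f. to f \<cdot>\<^bsub>W\<^esub> back_incl T f),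
          proj = (\<lambda>f. proj T f \<cdot>\<^bsub>W\<^esub> from f)\<rparr>)"


section \<open>The rank of a module over a domain\<close>

definition fraction_rel :: "('a, 'r) ring_scheme \<Rightarrow> (('a \<times> 'a) \<times> ('a \<times> 'a)) set" where
  "fraction_rel R = {((a, b), (c, d)).
     a \<in> carrier R \<and> b \<in> carrier R - {\<zero>\<^bsub>R\<^esub>} \<and> c \<in> carrier R \<and> d \<in> carrier R - {\<zero>\<^bsub>R\<^esub>} \<and>
     a \<otimes>\<^bsub>R\<^esub> d = c \<otimes>\<^bsub>R\<^esub> b}"

definition fraction :: "('a, 'r) ring_scheme \<Rightarrow> 'a \<Rightarrow> 'a \<Rightarrow> ('a \<times> 'a) set" where
  "fraction R a b = fraction_rel R `` {(a, b)}"

definition fraction_field :: "('a, 'r) ring_scheme \<Rightarrow> ('a \<times> 'a) set ring" where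
  "fraction_field R =
     \<lparr>carrier = (carrier R \<times> (carrier R - {\<zero>\<^bsub>R\<^esub>})) // fraction_rel R,
      monoid.mult = (\<lambda>X Y. \<Union>(a, b) \<in> X. \<Union>(c, d) \<in> Y. fraction R (a \<otimes>\<^bsub>R\<^esub> c) (b \<otimes>\<^bsub>R\<^esub> d)),
      one = fraction R \<one>\<^bsub>R\<^esub> \<one>\<^bsub>R\<^esub>,
      ring.zero = fraction R \<zero>\<^bsub>R\<^esub> \<one>\<^bsub>R\<^esub>,
      add = (\<lambda>X Y. \<Union>(a, b) \<in> X. \<Union>(c, d) \<in> Y.
        fraction R (a \<otimes>\<^bsub>R\<^esub> d \<oplus>\<^bsub>R\<^esub> c \<otimes>\<^bsub>R\<^esub> b) (b \<otimes>\<^bsub>R\<^esub> d))\<rparr>"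

text \<open>The field of quotients as an \<open>R\<close>-module. The ring fields \<open>mult\<close> and \<open>one\<close> of a module record
  carry no meaning.\<close>

definition fraction_module :: "('a, 'r) ring_scheme \<Rightarrow> ('a, ('a \<times> 'a) set) module" where
  "fraction_module R =
     \<lparr>carrier = carrier (fraction_field R), monoid.mult = undefined, one = undefined,
      ring.zero = ring.zero (fraction_field R), add = add (fraction_field R),
      smult = (\<lambda>a x. fraction R a \<one>\<^bsub>R\<^esub> \<otimes>\<^bsub>fraction_field R\<^esub> x)\<rparr>"

text \<open>The tensor product \<open>M \<otimes> N\<close> over \<open>R\<close> as an abelian group (written multiplicatively): the free
  abelian group on \<open>M \<times> N\<close> modulo the bilinearity relations.\<close>

definition tensor_relations ::
    "('a, 'r) ring_scheme \<Rightarrow> ('a, 'm) module \<Rightarrow> ('a, 'n) module \<Rightarrow> ('m \<times> 'n \<Rightarrow>\<^sub>0 int) set" where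
  "tensor_relations R M N =
     {frag_of (m \<oplus>\<^bsub>M\<^esub> m', x) - frag_of (m, x) - frag_of (m', x) | m m' x.
        m \<in> carrier M \<and> m' \<in> carrier M \<and> x \<in> carrier N} \<union>
     {frag_of (m, x \<oplus>\<^bsub>N\<^esub> x') - frag_of (m, x) - frag_of (m, x') | m x x'.
        m \<in> carrier M \<and> x \<in> carrier N \<and> x' \<in> carrier N} \<union>
     {frag_of (a \<odot>\<^bsub>M\<^esub> m, x) - frag_of (m, a \<odot>\<^bsub>N\<^esub> x) | a m x.
        a \<in> carrier R \<and> m \<in> carrier M \<and> x \<in> carrier N}"

definition tensor_kernel ::
    "('a, 'r) ring_scheme \<Rightarrow> ('a, 'm) module \<Rightarrow> ('a, 'n) module \<Rightarrow> ('m \<times> 'n \<Rightarrow>\<^sub>0 int) set" where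
  "tensor_kernel R M N =
     generate (free_Abelian_group (carrier M \<times> carrier N)) (tensor_relations R M N)"

definition tensor_product ::
    "('a, 'r) ring_scheme \<Rightarrow> ('a, 'm) module \<Rightarrow> ('a, 'n) module \<Rightarrow> ('m \<times> 'n \<Rightarrow>\<^sub>0 int) set monoid" where
  "tensor_product R M N =
     free_Abelian_group (carrier M \<times> carrier N) Mod tensor_kernel R M N"

text \<open>\<open>M \<otimes> Q\<close> as a vector space over the field of quotients \<open>Q\<close>, which acts by
  \<open>q (m \<otimes> x) = m \<otimes> q x\<close>.\<close>

definition tensor_fractions :: "('a, 'r) ring_scheme \<Rightarrow> ('a, 'm) module \<Rightarrow>
    (('a \<times> 'a) set, ('m \<times> ('a \<times> 'a) set \<Rightarrow>\<^sub>0 int) set) module" where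
  "tensor_fractions R M =
     (let Q = fraction_module R; T = tensor_product R M Q
      in \<lparr>carrier = carrier T, monoid.mult = undefined, one = undefined,
          ring.zero = \<one>\<^bsub>T\<^esub>, add = monoid.mult T,
          smult = (\<lambda>q X. \<Union>t \<in> X.
            tensor_kernel R M Q #>\<^bsub>free_Abelian_group (carrier M \<times> carrier Q)\<^esub>
              frag_extend (\<lambda>(m, x). frag_of (m, q \<otimes>\<^bsub>fraction_field R\<^esub> x)) t)\<rparr>)"

definition has_finite_rank :: "('a, 'r) ring_scheme \<Rightarrow> ('a, 'm) module \<Rightarrow> bool" where
  "has_finite_rank R M \<longleftrightarrow> vectorspace.fin_dim (fraction_field R) (tensor_fractions R M)"

definition module_rank :: "('a, 'r) ring_scheme \<Rightarrow> ('a, 'm) module \<Rightarrow> nat" where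
  "module_rank R M = vectorspace.dim (fraction_field R) (tensor_fractions R M)"


section \<open>Chain complexes\<close>

record ('a, 'u) module_complex =
  Chain :: "int \<Rightarrow> ('a, 'u) module"
  diff :: "int \<Rightarrow> 'u \<Rightarrow> 'u"

definition chain_complex :: "('a, 'r) ring_scheme \<Rightarrow> ('a, 'u) module_complex \<Rightarrow> bool" where
  "chain_complex R C \<longleftrightarrow>
     (\<forall>n. module R (Chain C n)) \<and>
     (\<forall>n. diff C n \<in> module_hom R (Chain C n) (Chain C (n - 1))) \<and>
     (\<forall>n. \<forall>x \<in> carrier (Chain C n). diff C (n - 1) (diff C n x) = \<zero>\<^bsub>Chain C (n - 2)\<^esub>)"

definition positive_complex :: "('a, 'u) module_complex \<Rightarrow> bool" where
  "positive_complex C \<longleftrightarrow> (\<forall>n < 0. carrier (Chain C n) = {\<zero>\<^bsub>Chain C n\<^esub>})"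

definition quotient_module :: "('a, 'm) module \<Rightarrow> 'm set \<Rightarrow> ('a, 'm set) module" where
  "quotient_module M N =
     \<lparr>carrier = a_rcosets\<^bsub>M\<^esub> N, monoid.mult = undefined, one = undefined,
      ring.zero = N, add = set_add M,
      smult = (\<lambda>a X. \<Union>x \<in> X. N +>\<^bsub>M\<^esub> (a \<odot>\<^bsub>M\<^esub> x))\<rparr>"

definition cycles :: "('a, 'u) module_complex \<Rightarrow> int \<Rightarrow> 'u set" where
  "cycles C n = {x \<in> carrier (Chain C n). diff C n x = \<zero>\<^bsub>Chain C (n - 1)\<^esub>}"

definition boundaries :: "('a, 'u) module_complex \<Rightarrow> int \<Rightarrow> 'u set" where
  "boundaries C n = diff C (n + 1) ` carrier (Chain C (n + 1))"

definition homology :: "('a, 'u) module_complex \<Rightarrow> int \<Rightarrow> ('a, 'u set) module" where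
  "homology C n = quotient_module ((Chain C n)\<lparr>carrier := cycles C n\<rparr>) (boundaries C n)"

text \<open>A chain map is stored together with its source and target; its components are
  extensional, so that equal chain maps are equal in HOL.\<close>

type_synonym ('a, 'u) chain_map = "('a, 'u) module_complex \<times> (int \<Rightarrow> 'u \<Rightarrow> 'u) \<times> ('a, 'u) module_complex"

definition is_chain_map ::
    "('a, 'r) ring_scheme \<Rightarrow> ('a, 'u) module_complex \<Rightarrow> (int \<Rightarrow> 'u \<Rightarrow> 'u) \<Rightarrow> ('a, 'u) module_complex \<Rightarrow> bool" where
  "is_chain_map R C f D \<longleftrightarrow>
     (\<forall>n. f n \<in> module_hom R (Chain C n) (Chain D n) \<inter> extensional (carrier (Chain C n))) \<and>
     (\<forall>n. \<forall>x \<in> carrier (Chain C n). diff D n (f n x) = f (n - 1) (diff C n x))"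

definition homology_map ::
    "(int \<Rightarrow> 'u \<Rightarrow> 'u) \<Rightarrow> ('a, 'u) module_complex \<Rightarrow> int \<Rightarrow> 'u set \<Rightarrow> 'u set" where
  "homology_map f D n X = (\<Union>x \<in> X. boundaries D n +>\<^bsub>Chain D n\<^esub> f n x)"

definition quasi_isomorphism ::
    "('a, 'u) module_complex \<Rightarrow> (int \<Rightarrow> 'u \<Rightarrow> 'u) \<Rightarrow> ('a, 'u) module_complex \<Rightarrow> bool" where
  "quasi_isomorphism C f D \<longleftrightarrow>
     (\<forall>n. bij_betw (homology_map f D n) (carrier (homology C n)) (carrier (homology D n)))"

definition zero_module :: "('a, 'u) module" where
  "zero_module = \<lparr>carrier = {undefined}, monoid.mult = undefined, one = undefined,
     ring.zero = undefined, add = (\<lambda>_ _. undefined), smult = (\<lambda>_ _. undefined)\<rparr>"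

definition zero_complex :: "('a, 'u) module_complex" where
  "zero_complex = \<lparr>Chain = (\<lambda>_. zero_module), diff = (\<lambda>_ _. undefined)\<rparr>"


section \<open>Abel complexes\<close>

definition Abel_sequence :: "(nat \<Rightarrow> real) \<Rightarrow> bool" where
  "Abel_sequence a \<longleftrightarrow> conv_radius a \<ge> 1 \<and>
     (\<exists>L. ((\<lambda>x. (1 - x) * suminf (\<lambda>k. a k * x ^ k)) \<longlongrightarrow> L) (at_left 1))"

definition controlled_absolute_growth :: "(nat \<Rightarrow> real) \<Rightarrow> bool" where
  "controlled_absolute_growth a \<longleftrightarrow> conv_radius a \<ge> 1 \<and>
     ((\<lambda>x. (1 - x)\<^sup>2 * suminf (\<lambda>k. \<bar>a k\<bar> * x ^ k)) \<longlongrightarrow> 0) (at_left 1)"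

definition homology_ranks :: "('a, 'r) ring_scheme \<Rightarrow> ('a, 'u) module_complex \<Rightarrow> nat \<Rightarrow> real" where
  "homology_ranks R C n = (-1) ^ n * real (module_rank R (homology C (int n)))"

definition Abel_complexes :: "('a, 'r) ring_scheme \<Rightarrow> ('a, 'u) module_complex set" where
  "Abel_complexes R = {C. chain_complex R C \<and> positive_complex C \<and>
     (\<forall>n. has_finite_rank R (homology C n)) \<and>
     Abel_sequence (homology_ranks R C) \<and> controlled_absolute_growth (homology_ranks R C)}"

text \<open>The complexes are those whose chain modules have underlying sets contained in the
  type \<open>'u\<close>, which plays the role of a universe.\<close>

definition Abel_category ::
    "('a, 'r) ring_scheme \<Rightarrow> (('a, 'u) module_complex, ('a, 'u) chain_map) waldhausen" where
  "Abel_category R =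
     \<lparr>Ob = Abel_complexes R,
      Arr = {(C, f, D). C \<in> Abel_complexes R \<and> D \<in> Abel_complexes R \<and> is_chain_map R C f D},
      Dom = (\<lambda>(C, f, D). C),
      Cod = (\<lambda>(C, f, D). D),
      Idn = (\<lambda>C. (C, \<lambda>n. \<lambda>x \<in> carrier (Chain C n). x, C)),
      Comp = (\<lambda>(_, g, E) (C, f, _). (C, \<lambda>n. compose (carrier (Chain C n)) (g n) (f n), E)),
      Zero = zero_complex,
      Cof = {(C, f, D). C \<in> Abel_complexes R \<and> D \<in> Abel_complexes R \<and> is_chain_map R C f D \<and>
        (\<forall>n. inj_on (f n) (carrier (Chain C n)))},
      Weq = {(C, f, D). C \<in> Abel_complexes R \<and> D \<in> Abel_complexes R \<and> is_chain_map R C f D \<and>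
        quasi_isomorphism C f D}\<rparr>"


section \<open>The mapping cylinder\<close>

text \<open>Triples of elements of the universe \<open>'u\<close> are turned into elements of \<open>'u\<close> by an injection
  \<open>enc\<close>. Its existence means that the universe is closed under finite direct sums (and so, up to
  isomorphism, under pushouts); every infinite type has one.\<close>

definition direct_sum3 :: "('u \<times> 'u \<times> 'u \<Rightarrow> 'u) \<Rightarrow>
    ('a, 'u) module \<Rightarrow> ('a, 'u) module \<Rightarrow> ('a, 'u) module \<Rightarrow> ('a, 'u) module" where
  "direct_sum3 enc L M N =
     \<lparr>carrier = enc ` (carrier L \<times> carrier M \<times> carrier N),
      monoid.mult = undefined, one = undefined,
      ring.zero = enc (\<zero>\<^bsub>L\<^esub>, \<zero>\<^bsub>M\<^esub>, \<zero>\<^bsub>N\<^esub>),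
      add = (\<lambda>s t. case (inv_into UNIV enc s, inv_into UNIV enc t) of ((x, y, z), (x', y', z')) \<Rightarrow>
        enc (x \<oplus>\<^bsub>L\<^esub> x', y \<oplus>\<^bsub>M\<^esub> y', z \<oplus>\<^bsub>N\<^esub> z')),
      smult = (\<lambda>a s. case inv_into UNIV enc s of (x, y, z) \<Rightarrow> enc (a \<odot>\<^bsub>L\<^esub> x, a \<odot>\<^bsub>M\<^esub> y, a \<odot>\<^bsub>N\<^esub> z))\<rparr>"

text \<open>Degree \<open>n\<close> is the direct sum of \<open>C n\<close>, \<open>C (n - 1)\<close> and \<open>D n\<close>, and
  \<open>d (x, y, z) = (d x + y, - d y, d z - f y)\<close>.\<close>

definition cylinder_complex ::
    "('u \<times> 'u \<times> 'u \<Rightarrow> 'u) \<Rightarrow> ('a, 'u) chain_map \<Rightarrow> ('a, 'u) module_complex" where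
  "cylinder_complex enc = (\<lambda>(C, f, D).
     \<lparr>Chain = (\<lambda>n. direct_sum3 enc (Chain C n) (Chain C (n - 1)) (Chain D n)),
      diff = (\<lambda>n s. case inv_into UNIV enc s of (x, y, z) \<Rightarrow>
        enc (diff C n x \<oplus>\<^bsub>Chain C (n - 1)\<^esub> y,
             \<ominus>\<^bsub>Chain C (n - 2)\<^esub> diff C (n - 1) y,
             diff D n z \<ominus>\<^bsub>Chain D (n - 1)\<^esub> f (n - 1) y))\<rparr>)"

definition mapping_cylinder ::
    "('u \<times> 'u \<times> 'u \<Rightarrow> 'u) \<Rightarrow> (('a, 'u) module_complex, ('a, 'u) chain_map) cylinder" where
  "mapping_cylinder enc =
     \<lparr>Cyl = cylinder_complex enc,
      Cyl_map = (\<lambda>(f, (_, a, _), (_, b, _), g).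
        (cylinder_complex enc f,
         \<lambda>n. \<lambda>s \<in> carrier (Chain (cylinder_complex enc f) n).
           case inv_into UNIV enc s of (x, y, z) \<Rightarrow> enc (a n x, a (n - 1) y, b n z),
         cylinder_complex enc g)),
      front_incl = (\<lambda>(C, f, D).
        (C,
         \<lambda>n. \<lambda>x \<in> carrier (Chain C n). enc (x, \<zero>\<^bsub>Chain C (n - 1)\<^esub>, \<zero>\<^bsub>Chain D n\<^esub>),
         cylinder_complex enc (C, f, D))),
      back_incl = (\<lambda>(C, f, D).
        (D,
         \<lambda>n. \<lambda>z \<in> carrier (Chain D n). enc (\<zero>\<^bsub>Chain C n\<^esub>, \<zero>\<^bsub>Chain C (n - 1)\<^esub>, z),
         cylinder_complex enc (C, f, D))),
      proj = (\<lambda>(C, f, D).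
        (cylinder_complex enc (C, f, D),
         \<lambda>n. \<lambda>s \<in> carrier (Chain (cylinder_complex enc (C, f, D)) n).
           case inv_into UNIV enc s of (x, y, z) \<Rightarrow> f n x \<oplus>\<^bsub>Chain D n\<^esub> z,
         D))\<rparr>"

end

theory Submission
  imports Defs
begin

text \<open>The theorem has an arithmetic, an analytic and a categorical ingredient.

  \<^bold>\<open>Ranks.\<close> The functor \<open>M \<mapsto> M \<otimes> Q\<close> is exact because it is a localization. The tensor product is
  looked at only once, to see that \<open>m \<mapsto> m \<otimes> 1\<close> has the torsion of \<open>M\<close> as its kernel and that every
  vector of \<open>M \<otimes> Q\<close> is a fraction \<open>m \<otimes> 1/s\<close>. These two properties (\<open>is_localization\<close>) determine a
  vector space up to isomorphism (\<open>localization_unique\<close>) and are inherited by kernels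
  (\<open>localization_exact\<close>). So rank is additive along chains of submodules \<open>X \<subseteq> W \<subseteq> Y\<close> and takes equal
  values on isomorphic subquotients (\<open>subquotient_rank_filtration\<close>, \<open>subquotient_rank_iso\<close>). Applied to
  the long exact homology sequence of \<open>0 \<rightarrow> A \<rightarrow> B \<rightarrow> C \<rightarrow> 0\<close> this gives
  \<open>rank H\<^sub>n C + rank H\<^sub>n A = rank H\<^sub>n B + \<kappa>\<^sub>n + \<kappa>\<^sub>n\<^sub>-\<^sub>1\<close>, where \<open>\<kappa>\<^sub>n\<close> is the rank of the connecting
  homomorphism \<open>H\<^sub>n\<^sub>+\<^sub>1 C \<rightarrow> H\<^sub>n A\<close> (\<open>long_exact_ranks\<close>).

  \<^bold>\<open>Power series.\<close> Up to the error \<open>(-1)\<^sup>n (\<kappa>\<^sub>n + \<kappa>\<^sub>n\<^sub>-\<^sub>1)\<close>, the sequence of \<open>C\<close> is the difference of those of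
  \<open>B\<close> and \<open>A\<close>. The error telescopes: with \<open>v\<^sub>n = (-1)\<^sup>n \<kappa>\<^sub>n\<^sub>-\<^sub>1\<close> it is \<open>v\<^sub>n - v\<^sub>n\<^sub>+\<^sub>1\<close>, whose power series is
  that of \<open>v\<close> times \<open>-(1 - x)/x\<close>. Its Abel mean therefore contains the factor \<open>(1 - x)\<^sup>2\<close>, and it tends to
  \<open>0\<close> because \<open>\<kappa>\<^sub>n \<le> rank H\<^sub>n A\<close> and \<open>A\<close> has controlled absolute growth (\<open>Abel_telescope\<close>). Hence Abel
  complexes of controlled absolute growth are closed under cokernels of injections and under extensions
  (\<open>Abel_quotient\<close>, \<open>Abel_middle\<close>).

  \<^bold>\<open>Cofibrations and weak equivalences.\<close> A pushout \<open>P\<close> of \<open>B \<leftarrow> A \<rightarrow> C\<close> along an injection is an extension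
  of \<open>B/A\<close> by \<open>C\<close>, so it stays in the category. Since pushouts are unique up to isomorphism, every abstract
  pushout along a cofibration has the elementwise description of \<open>exact_square\<close>
  (\<open>pushout_exact_square\<close>), and the axioms become statements about elements. The gluing and the extension
  axiom follow from the two forms of the five lemma in \<open>quotient_quasi_isomorphism\<close> and
  \<open>middle_quasi_isomorphism\<close>, where a quasi-isomorphism is used in the form that its mapping cone is acyclic
  (\<open>quasi_isomorphism_iff\<close>).

  \<^bold>\<open>Cylinders.\<close> The projection \<open>T(f) \<rightarrow> D\<close> is a quasi-isomorphism, so \<open>T(f)\<close> is an Abel complex of
  controlled absolute growth because \<open>D\<close> is one. Pushouts of arrows are formed at both ends separately
  (\<open>arrow_pushout_components\<close>), and coproducts are direct sums of complexes (\<open>cop_square\<close>). Exactness of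
  \<open>f \<mapsto> (A \<or> B \<rightarrow> T(f))\<close> is then checked in the coordinates \<open>(x, y, z)\<close> of \<open>T(f)\<close>, except for weak
  equivalences, where gluing and saturation suffice. When \<open>T(* \<rightarrow> A)\<close> is replaced by \<open>A\<close>, the only change is
  that its coordinates are read off from \<open>z\<close>; so both cylinders are instances of \<open>cylinder_model\<close>, in which
  all of this is proved.\<close>

section \<open>The field of quotients\<close>

text \<open>The operations of the field of quotients are unions over representatives; this collapses such a union
  once its members are known to agree.\<close>

lemma UN_pairs_const:
  assumes "p \<in> X" "q \<in> Y" "\<And>a b c d. (a, b) \<in> X \<Longrightarrow> (c, d) \<in> Y \<Longrightarrow> F a b c d = K"
  shows "(\<Union>(a, b) \<in> X. \<Union>(c, d) \<in> Y. F a b c d) = K"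
  using assms by (cases p; cases q) (auto split: prod.splits, metis+)

context domain
begin

abbreviation fractions ("Q") where "Q \<equiv> fraction_field R"

lemma equiv_fraction_rel: "equiv (carrier R \<times> (carrier R - {\<zero>})) (fraction_rel R)"
proof (rule equivI)
  show "fraction_rel R \<subseteq> (carrier R \<times> (carrier R - {\<zero>})) \<times> (carrier R \<times> (carrier R - {\<zero>}))"
    by (auto simp: fraction_rel_def)
  show "refl_on (carrier R \<times> (carrier R - {\<zero>})) (fraction_rel R)"
    by (auto simp: refl_on_def fraction_rel_def)
  show "sym (fraction_rel R)"
    by (auto simp: sym_def fraction_rel_def)
  show "trans (fraction_rel R)"
  proof (rule transI, clarsimp simp: fraction_rel_def)
    fix a b c d e f
    assume c: "a \<in> carrier R" "b \<in> carrier R" "c \<in> carrier R" "d \<in> carrier R" "e \<in> carrier R"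
      "f \<in> carrier R" "d \<noteq> \<zero>" and 1: "a \<otimes> d = c \<otimes> b" and 2: "c \<otimes> f = e \<otimes> d"
    have "d \<otimes> (a \<otimes> f) = (a \<otimes> d) \<otimes> f" using c by (simp add: m_ac)
    also have "\<dots> = (c \<otimes> f) \<otimes> b" using c 1 by (simp add: m_ac)
    also have "\<dots> = d \<otimes> (e \<otimes> b)" using c 2 by (simp add: m_ac)
    finally show "a \<otimes> f = e \<otimes> b" using c by (simp add: m_lcancel)
  qed
qed

lemma fraction_eq_iff:
  assumes "a \<in> carrier R" "b \<in> carrier R" "b \<noteq> \<zero>" "c \<in> carrier R" "d \<in> carrier R" "d \<noteq> \<zero>"
  shows "fraction R a b = fraction R c d \<longleftrightarrow> a \<otimes> d = c \<otimes> b"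
  using eq_equiv_class_iff[OF equiv_fraction_rel, of "(a, b)" "(c, d)"] assms
  by (auto simp: fraction_def fraction_rel_def)

lemma fraction_in_carrier [simp, intro]:
  "a \<in> carrier R \<Longrightarrow> b \<in> carrier R \<Longrightarrow> b \<noteq> \<zero> \<Longrightarrow> fraction R a b \<in> carrier Q"
  by (auto simp: fraction_field_def fraction_def quotient_def)

lemma fraction_cases:
  assumes "x \<in> carrier Q"
  obtains a b where "a \<in> carrier R" "b \<in> carrier R" "b \<noteq> \<zero>" "x = fraction R a b"
  using assms by (auto simp: fraction_field_def fraction_def quotient_def)

lemma fraction_memD: "(a', b') \<in> fraction R a b \<Longrightarrow> a' \<in> carrier R \<and> b' \<in> carrier R \<and> b' \<noteq> \<zero> \<and>
    a \<otimes> b' = a' \<otimes> b"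
  by (auto simp: fraction_def fraction_rel_def)

lemma fraction_self_mem: "a \<in> carrier R \<Longrightarrow> b \<in> carrier R \<Longrightarrow> b \<noteq> \<zero> \<Longrightarrow> (a, b) \<in> fraction R a b"
  by (auto simp: fraction_def fraction_rel_def)

lemma fraction_mult:
  assumes "a \<in> carrier R" "b \<in> carrier R" "b \<noteq> \<zero>" "c \<in> carrier R" "d \<in> carrier R" "d \<noteq> \<zero>"
  shows "fraction R a b \<otimes>\<^bsub>Q\<^esub> fraction R c d = fraction R (a \<otimes> c) (b \<otimes> d)"
proof -
  have "fraction R (a' \<otimes> c') (b' \<otimes> d') = fraction R (a \<otimes> c) (b \<otimes> d)"
    if 1: "(a', b') \<in> fraction R a b" and 2: "(c', d') \<in> fraction R c d" for a' b' c' d'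
  proof -
    note D = fraction_memD[OF 1] fraction_memD[OF 2]
    from D have eq: "a' \<otimes> b = a \<otimes> b'" "c' \<otimes> d = c \<otimes> d'" by simp_all
    from D have D: "a' \<in> carrier R" "b' \<in> carrier R" "b' \<noteq> \<zero>"
      "c' \<in> carrier R" "d' \<in> carrier R" "d' \<noteq> \<zero>" by simp_all
    have "(a' \<otimes> c') \<otimes> (b \<otimes> d) = (a' \<otimes> b) \<otimes> (c' \<otimes> d)" using D assms by (simp add: m_ac)
    also have "\<dots> = (a \<otimes> b') \<otimes> (c \<otimes> d')" by (simp only: eq)
    also have "\<dots> = (a \<otimes> c) \<otimes> (b' \<otimes> d')" using D assms by (simp add: m_ac)
    finally show ?thesis
      by (rule fraction_eq_iff[THEN iffD2, rotated -1]) (use D assms in \<open>simp_all add: integral_iff\<close>)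
  qed
  then show ?thesis
    unfolding fraction_field_def
    by (simp, intro UN_pairs_const[OF fraction_self_mem[of a b] fraction_self_mem[of c d]])
      (use assms in auto)
qed

lemma fraction_add:
  assumes "a \<in> carrier R" "b \<in> carrier R" "b \<noteq> \<zero>" "c \<in> carrier R" "d \<in> carrier R" "d \<noteq> \<zero>"
  shows "fraction R a b \<oplus>\<^bsub>Q\<^esub> fraction R c d = fraction R (a \<otimes> d \<oplus> c \<otimes> b) (b \<otimes> d)"
proof -
  have "fraction R (a' \<otimes> d' \<oplus> c' \<otimes> b') (b' \<otimes> d') = fraction R (a \<otimes> d \<oplus> c \<otimes> b) (b \<otimes> d)"
    if 1: "(a', b') \<in> fraction R a b" and 2: "(c', d') \<in> fraction R c d" for a' b' c' d'
  proof -
    note D = fraction_memD[OF 1] fraction_memD[OF 2]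
    from D have eq: "a' \<otimes> b = a \<otimes> b'" "c' \<otimes> d = c \<otimes> d'" by simp_all
    from D have D: "a' \<in> carrier R" "b' \<in> carrier R" "b' \<noteq> \<zero>"
      "c' \<in> carrier R" "d' \<in> carrier R" "d' \<noteq> \<zero>" by simp_all
    have "(a' \<otimes> d' \<oplus> c' \<otimes> b') \<otimes> (b \<otimes> d) = (a' \<otimes> b) \<otimes> (d' \<otimes> d) \<oplus> (c' \<otimes> d) \<otimes> (b' \<otimes> b)"
      using D assms by (simp add: m_ac l_distr r_distr)
    also have "\<dots> = (a \<otimes> b') \<otimes> (d' \<otimes> d) \<oplus> (c \<otimes> d') \<otimes> (b' \<otimes> b)" by (simp only: eq)
    also have "\<dots> = (a \<otimes> d \<oplus> c \<otimes> b) \<otimes> (b' \<otimes> d')" using D assms by (simp add: m_ac l_distr r_distr)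
    finally show ?thesis
      by (rule fraction_eq_iff[THEN iffD2, rotated -1]) (use D assms in \<open>simp_all add: integral_iff\<close>)
  qed
  then show ?thesis
    unfolding fraction_field_def
    by (simp, intro UN_pairs_const[OF fraction_self_mem[of a b] fraction_self_mem[of c d]])
      (use assms in auto)
qed

lemma fraction_one: "\<one>\<^bsub>Q\<^esub> = fraction R \<one> \<one>"
  and fraction_zero: "\<zero>\<^bsub>Q\<^esub> = fraction R \<zero> \<one>"
  by (simp_all add: fraction_field_def)

lemmas fraction_simps = fraction_mult fraction_add fraction_one fraction_zero fraction_eq_iff integral_iff

theorem field_fractions: "field Q"
proof (rule cring.cring_fieldI2)
  show "cring Q"
  proof (rule cringI)
    show "abelian_group Q"
    proof (rule abelian_groupI)
      fix x y z assume "x \<in> carrier Q" "y \<in> carrier Q" "z \<in> carrier Q"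
      then show "(x \<oplus>\<^bsub>Q\<^esub> y) \<oplus>\<^bsub>Q\<^esub> z = x \<oplus>\<^bsub>Q\<^esub> (y \<oplus>\<^bsub>Q\<^esub> z)"
        by (elim fraction_cases) (simp add: fraction_simps m_ac l_distr r_distr a_ac)
    next
      fix x assume "x \<in> carrier Q"
      then obtain a b where ab: "a \<in> carrier R" "b \<in> carrier R" "b \<noteq> \<zero>" "x = fraction R a b"
        by (rule fraction_cases)
      then have "fraction R (\<ominus> a) b \<oplus>\<^bsub>Q\<^esub> x = \<zero>\<^bsub>Q\<^esub>"
        by (simp add: fraction_simps l_minus l_neg)
      then show "\<exists>y\<in>carrier Q. y \<oplus>\<^bsub>Q\<^esub> x = \<zero>\<^bsub>Q\<^esub>" using ab by blast
    qed (elim fraction_cases; simp add: fraction_simps m_ac a_ac; fail | simp add: fraction_zero)+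
    show "comm_monoid Q"
    proof (rule comm_monoidI)
      fix x y z assume "x \<in> carrier Q" "y \<in> carrier Q" "z \<in> carrier Q"
      then show "(x \<otimes>\<^bsub>Q\<^esub> y) \<otimes>\<^bsub>Q\<^esub> z = x \<otimes>\<^bsub>Q\<^esub> (y \<otimes>\<^bsub>Q\<^esub> z)"
        by (elim fraction_cases) (simp add: fraction_simps m_ac)
    qed (elim fraction_cases; simp add: fraction_simps m_ac; fail | simp add: fraction_one)+
    show "(x \<oplus>\<^bsub>Q\<^esub> y) \<otimes>\<^bsub>Q\<^esub> z = x \<otimes>\<^bsub>Q\<^esub> z \<oplus>\<^bsub>Q\<^esub> y \<otimes>\<^bsub>Q\<^esub> z"
      if "x \<in> carrier Q" "y \<in> carrier Q" "z \<in> carrier Q" for x y z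
      using that by (elim fraction_cases) (simp add: fraction_simps m_ac l_distr r_distr)
  qed
  show "\<zero>\<^bsub>Q\<^esub> \<noteq> \<one>\<^bsub>Q\<^esub>"
    by (simp add: fraction_simps)
  fix x assume x: "x \<in> carrier Q" and "x \<noteq> \<zero>\<^bsub>Q\<^esub>"
  from x obtain a b where ab: "a \<in> carrier R" "b \<in> carrier R" "b \<noteq> \<zero>" "x = fraction R a b"
    by (rule fraction_cases)
  with \<open>x \<noteq> \<zero>\<^bsub>Q\<^esub>\<close> have "a \<noteq> \<zero>" by (auto simp: fraction_simps)
  with ab have "x \<otimes>\<^bsub>Q\<^esub> fraction R b a = \<one>\<^bsub>Q\<^esub>" by (simp add: fraction_simps m_ac)
  then show "\<exists>y\<in>carrier Q. x \<otimes>\<^bsub>Q\<^esub> y = \<one>\<^bsub>Q\<^esub>" using ab \<open>a \<noteq> \<zero>\<close> by blast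
qed

end

section \<open>The base change to the field of quotients as a localization\<close>

text \<open>\<open>V\<close> is \<open>Y/X \<otimes> Q\<close>, with \<open>\<phi>\<close> induced by \<open>y \<mapsto> [y] \<otimes> 1\<close>. Speaking of \<open>X \<subseteq> Y \<subseteq> M\<close> in place of the module
  \<open>Y/X\<close> keeps cosets out of the arguments, so that iterated subquotients live in one module \<open>M\<close>.\<close>

definition is_localization ::
    "('a, 'r) ring_scheme \<Rightarrow> ('a, 'm) module \<Rightarrow> 'm set \<Rightarrow> 'm set \<Rightarrow>
     (('a \<times> 'a) set, 'v) module \<Rightarrow> ('m \<Rightarrow> 'v) \<Rightarrow> bool" where
  "is_localization R M Y X V \<phi> \<longleftrightarrow>
     vectorspace (fraction_field R) V \<and>
     \<phi> \<in> Y \<rightarrow> carrier V \<and>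
     (\<forall>y\<in>Y. \<forall>y'\<in>Y. \<phi> (y \<oplus>\<^bsub>M\<^esub> y') = \<phi> y \<oplus>\<^bsub>V\<^esub> \<phi> y') \<and>
     (\<forall>r\<in>carrier R. \<forall>y\<in>Y. \<phi> (r \<odot>\<^bsub>M\<^esub> y) = fraction R r \<one>\<^bsub>R\<^esub> \<odot>\<^bsub>V\<^esub> \<phi> y) \<and>
     (\<forall>v\<in>carrier V. \<exists>s\<in>carrier R - {\<zero>\<^bsub>R\<^esub>}. \<exists>y\<in>Y. v = fraction R \<one>\<^bsub>R\<^esub> s \<odot>\<^bsub>V\<^esub> \<phi> y) \<and>
     (\<forall>y\<in>Y. \<phi> y = \<zero>\<^bsub>V\<^esub> \<longleftrightarrow> (\<exists>r\<in>carrier R - {\<zero>\<^bsub>R\<^esub>}. r \<odot>\<^bsub>M\<^esub> y \<in> X))"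

lemma (in abelian_group) add_diff_diff_self:
  "x \<in> carrier G \<Longrightarrow> y \<in> carrier G \<Longrightarrow> x \<oplus> y \<ominus> x \<ominus> y = \<zero>"
  using r_neg[of "x \<oplus> y"] by (simp add: minus_eq minus_add a_assoc)

locale domain_module = domain R + M: module R M
  for R :: "('a, 'r) ring_scheme" (structure) and M :: "('a, 'm) module"
begin

abbreviation gens where "gens \<equiv> carrier M \<times> carrier Q"
abbreviation F where "F \<equiv> free_Abelian_group gens"
abbreviation K where "K \<equiv> tensor_kernel R M (fraction_module R)"
abbreviation V where "V \<equiv> tensor_fractions R M"

text \<open>Tensors are handled through representatives in the free group: classes add as their representatives do,
  and multiplying a class by \<open>q\<close> multiplies the second entry of each generator by \<open>q\<close>.\<close>

definition cl where "cl t = K #>\<^bsub>F\<^esub> t"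
definition ext where "ext q = frag_extend (\<lambda>(m, x). frag_of (m, q \<otimes>\<^bsub>Q\<^esub> x))"

interpretation Q: field Q by (rule field_fractions)

lemma fraction_module_simps [simp]:
  "carrier (fraction_module R) = carrier Q" "add (fraction_module R) = add Q"
  "a \<odot>\<^bsub>fraction_module R\<^esub> x = fraction R a \<one> \<otimes>\<^bsub>Q\<^esub> x"
  by (simp_all add: fraction_module_def)

lemma tensor_relations_in_carrier: "tensor_relations R M (fraction_module R) \<subseteq> carrier F"
proof -
  have 2: "Poly_Mapping.keys (frag_of a - frag_of b) \<subseteq> gens" if "a \<in> gens" "b \<in> gens" for a b
    using keys_diff[of "frag_of a" "frag_of b"] that by auto
  have 3: "Poly_Mapping.keys (frag_of a - frag_of b - frag_of c) \<subseteq> gens"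
    if "a \<in> gens" "b \<in> gens" "c \<in> gens" for a b c
    using keys_diff[of "frag_of a - frag_of b" "frag_of c"] 2[of a b] that by auto
  show ?thesis
  proof
    fix t assume "t \<in> tensor_relations R M (fraction_module R)"
    then show "t \<in> carrier F"
      unfolding tensor_relations_def fraction_module_simps carrier_free_Abelian_group_iff
      by (elim UnE CollectE exE conjE) (auto intro!: 2 3 del: subsetI)
  qed
qed

lemma subgroup_K: "subgroup K F"
  unfolding tensor_kernel_def fraction_module_simps
  by (intro group.generate_is_subgroup tensor_relations_in_carrier group_free_Abelian_group)

lemma K_carrier: "t \<in> K \<Longrightarrow> Poly_Mapping.keys t \<subseteq> gens"
  using subgroup.mem_carrier[OF subgroup_K] by auto

lemma K_zero [simp]: "0 \<in> K"
  using subgroup.one_closed[OF subgroup_K] by simp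

lemma K_add [intro]: "s \<in> K \<Longrightarrow> t \<in> K \<Longrightarrow> s + t \<in> K"
  using subgroup.m_closed[OF subgroup_K] by simp

lemma K_minus: "t \<in> K \<Longrightarrow> - t \<in> K"
  using subgroup.m_inv_closed[OF subgroup_K, of t] K_carrier[of t] by simp

lemma K_diff [intro]: "s \<in> K \<Longrightarrow> t \<in> K \<Longrightarrow> s - t \<in> K"
  using K_add[OF _ K_minus] by simp

lemma relation_in_K: "t \<in> tensor_relations R M (fraction_module R) \<Longrightarrow> t \<in> K"
  unfolding tensor_kernel_def by (rule generate.incl)

lemma K_add_left: "m \<in> carrier M \<Longrightarrow> m' \<in> carrier M \<Longrightarrow> x \<in> carrier Q \<Longrightarrow>
    frag_of (m \<oplus>\<^bsub>M\<^esub> m', x) - frag_of (m, x) - frag_of (m', x) \<in> K"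
  by (rule relation_in_K) (auto simp: tensor_relations_def)

lemma K_add_right: "m \<in> carrier M \<Longrightarrow> x \<in> carrier Q \<Longrightarrow> x' \<in> carrier Q \<Longrightarrow>
    frag_of (m, x \<oplus>\<^bsub>Q\<^esub> x') - frag_of (m, x) - frag_of (m, x') \<in> K"
  by (rule relation_in_K) (auto simp: tensor_relations_def)

lemma K_smult: "a \<in> carrier R \<Longrightarrow> m \<in> carrier M \<Longrightarrow> x \<in> carrier Q \<Longrightarrow>
    frag_of (a \<odot>\<^bsub>M\<^esub> m, x) - frag_of (m, fraction R a \<one> \<otimes>\<^bsub>Q\<^esub> x) \<in> K"
  by (rule relation_in_K) (auto simp: tensor_relations_def)

lemma mem_cl: "s \<in> cl t \<longleftrightarrow> s - t \<in> K"
  by (auto simp: cl_def r_coset_def intro: bexI[of _ "s - t"])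

lemma cl_eq_iff: "cl s = cl t \<longleftrightarrow> s - t \<in> K"
proof
  assume "cl s = cl t"
  then have "s \<in> cl t" using mem_cl[of s s] by simp
  then show "s - t \<in> K" by (simp add: mem_cl)
next
  assume *: "s - t \<in> K"
  show "cl s = cl t"
    using K_add[OF _ *] K_diff[OF _ *] by (fastforce simp: mem_cl algebra_simps)
qed

lemma V_quotient:
  "carrier V = carrier (F Mod K)" "add V = monoid.mult (F Mod K)" "\<zero>\<^bsub>V\<^esub> = \<one>\<^bsub>F Mod K\<^esub>"
  unfolding tensor_fractions_def tensor_product_def Let_def fraction_module_simps by simp_all

lemma V_carrier: "X \<in> carrier V \<longleftrightarrow> (\<exists>t. Poly_Mapping.keys t \<subseteq> gens \<and> X = cl t)"
  unfolding V_quotient by (simp add: FactGroup_def RCOSETS_def cl_def Bex_def)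

lemma cl_in_V [simp, intro]: "Poly_Mapping.keys t \<subseteq> gens \<Longrightarrow> cl t \<in> carrier V"
  by (auto simp: V_carrier)

lemma V_cases:
  assumes "X \<in> carrier V" obtains t where "Poly_Mapping.keys t \<subseteq> gens" "X = cl t"
  using assms by (auto simp: V_carrier)

lemma abelian_group_V: "abelian_group V"
proof -
  interpret G: comm_group "F Mod K"
    by (rule comm_group.abelian_FactGroup[OF abelian_free_Abelian_group subgroup_K])
  show ?thesis
  proof (rule abelian_groupI, unfold V_quotient)
    fix x y z assume "x \<in> carrier (F Mod K)" "y \<in> carrier (F Mod K)" "z \<in> carrier (F Mod K)"
    then show "(x \<otimes>\<^bsub>F Mod K\<^esub> y) \<otimes>\<^bsub>F Mod K\<^esub> z = x \<otimes>\<^bsub>F Mod K\<^esub> (y \<otimes>\<^bsub>F Mod K\<^esub> z)" by (rule G.m_assoc)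
  next
    fix x y assume "x \<in> carrier (F Mod K)" "y \<in> carrier (F Mod K)"
    then show "x \<otimes>\<^bsub>F Mod K\<^esub> y = y \<otimes>\<^bsub>F Mod K\<^esub> x" by (rule G.m_comm)
  next
    fix x assume "x \<in> carrier (F Mod K)"
    then show "\<exists>y\<in>carrier (F Mod K). y \<otimes>\<^bsub>F Mod K\<^esub> x = \<one>\<^bsub>F Mod K\<^esub>"
      by (intro bexI[of _ "inv\<^bsub>F Mod K\<^esub> x"]) (rule G.l_inv G.inv_closed, assumption)+
  qed (rule G.m_closed G.one_closed G.l_one; assumption?)+
qed

lemma V_zero: "\<zero>\<^bsub>V\<^esub> = cl 0"
  by (auto simp: mem_cl V_quotient FactGroup_def)

lemma V_add: assumes "Poly_Mapping.keys s \<subseteq> gens" "Poly_Mapping.keys t \<subseteq> gens" shows "cl s \<oplus>\<^bsub>V\<^esub> cl t = cl (s + t)"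
proof -
  have "K \<lhd> F" by (rule comm_group.subgroup_imp_normal[OF abelian_free_Abelian_group subgroup_K])
  from normal.rcos_sum[OF this, of s t] show ?thesis
    using assms unfolding V_quotient FactGroup_def cl_def by simp
qed

lemma ext_0 [simp]: "ext q 0 = 0" and ext_diff: "ext q (s - t) = ext q s - ext q t"
  and ext_add: "ext q (s + t) = ext q s + ext q t"
  and ext_of [simp]: "ext q (frag_of (m, x)) = frag_of (m, q \<otimes>\<^bsub>Q\<^esub> x)"
  by (simp_all add: ext_def frag_extend_diff frag_extend_add)

lemma keys_ext: assumes "q \<in> carrier Q" "Poly_Mapping.keys t \<subseteq> gens" shows "Poly_Mapping.keys (ext q t) \<subseteq> gens"
proof -
  have "Poly_Mapping.keys (ext q t) \<subseteq> (\<Union>(m, x)\<in>Poly_Mapping.keys t. {(m, q \<otimes>\<^bsub>Q\<^esub> x)})"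
    unfolding ext_def using keys_frag_extend[of "\<lambda>(m, x). frag_of (m, q \<otimes>\<^bsub>Q\<^esub> x)" t] by force
  with assms show ?thesis by fastforce
qed

text \<open>The action of \<open>q\<close> is well defined: it preserves each of the bilinearity relations, hence
  the subgroup that they generate.\<close>

lemma ext_K: assumes q: "q \<in> carrier Q" and t: "t \<in> K" shows "ext q t \<in> K"
proof -
  have "tensor_relations R M (fraction_module R) \<subseteq> {t \<in> carrier F. ext q t \<in> K}"
  proof
    fix t assume t: "t \<in> tensor_relations R M (fraction_module R)"
    then have "ext q t \<in> K"
      unfolding tensor_relations_def fraction_module_simps
    proof (elim UnE CollectE exE conjE)
      fix m m' x assume "t = frag_of (m \<oplus>\<^bsub>M\<^esub> m', x) - frag_of (m, x) - frag_of (m', x)"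
        "m \<in> carrier M" "m' \<in> carrier M" "x \<in> carrier Q"
      then show ?thesis using q by (simp add: ext_diff K_add_left)
    next
      fix m x x' assume "t = frag_of (m, x \<oplus>\<^bsub>Q\<^esub> x') - frag_of (m, x) - frag_of (m, x')"
        "m \<in> carrier M" "x \<in> carrier Q" "x' \<in> carrier Q"
      then show ?thesis using q by (simp add: ext_diff K_add_right Q.r_distr)
    next
      fix a m x assume "t = frag_of (a \<odot>\<^bsub>M\<^esub> m, x) - frag_of (m, fraction R a \<one> \<otimes>\<^bsub>Q\<^esub> x)"
        "a \<in> carrier R" "m \<in> carrier M" "x \<in> carrier Q"
      then show ?thesis using q K_smult[of a m "q \<otimes>\<^bsub>Q\<^esub> x"]
        by (simp add: ext_diff Q.m_lcomm[of q])
    qed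
    with t tensor_relations_in_carrier show "t \<in> {t \<in> carrier F. ext q t \<in> K}" by blast
  qed
  moreover have "subgroup {t \<in> carrier F. ext q t \<in> K} F"
  proof (rule group.subgroupI[OF group_free_Abelian_group])
    fix s t assume "s \<in> {t \<in> carrier F. ext q t \<in> K}" "t \<in> {t \<in> carrier F. ext q t \<in> K}"
    then show "s \<otimes>\<^bsub>F\<^esub> t \<in> {t \<in> carrier F. ext q t \<in> K}"
      using keys_add[of s t] by (auto simp: ext_add)
  next
    fix t assume "t \<in> {t \<in> carrier F. ext q t \<in> K}"
    then show "inv\<^bsub>F\<^esub> t \<in> {t \<in> carrier F. ext q t \<in> K}"
      using ext_diff[of q 0 t] by (auto simp: K_minus)
  next
    have "0 \<in> {t \<in> carrier F. ext q t \<in> K}" by simp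
    then show "{t \<in> carrier F. ext q t \<in> K} \<noteq> {}" by blast
  qed auto
  ultimately have "K \<subseteq> {t \<in> carrier F. ext q t \<in> K}"
    unfolding tensor_kernel_def[of R M "fraction_module R"] fraction_module_simps
    using group.generate_subgroup_incl[OF group_free_Abelian_group] by blast
  with t show ?thesis by blast
qed

lemma V_smult: assumes "q \<in> carrier Q" "Poly_Mapping.keys t \<subseteq> gens" shows "q \<odot>\<^bsub>V\<^esub> cl t = cl (ext q t)"
proof -
  have "q \<odot>\<^bsub>V\<^esub> cl t = (\<Union>s\<in>cl t. cl (ext q s))"
    by (simp add: tensor_fractions_def Let_def cl_def ext_def)
  also have "\<dots> = cl (ext q t)"
  proof -
    have "cl (ext q s) = cl (ext q t)" if "s \<in> cl t" for s
      using that ext_K[OF assms(1), of "s - t"] by (simp add: mem_cl cl_eq_iff ext_diff)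
    moreover have "t \<in> cl t" by (simp add: mem_cl)
    ultimately show ?thesis by blast
  qed
  finally show ?thesis .
qed

text \<open>Two additive maps that agree on generators modulo \<open>K\<close> agree modulo \<open>K\<close>; with their difference as \<open>f\<close>,
  this verifies the vector space axioms on generators.\<close>

lemma K_induct:
  assumes "Poly_Mapping.keys t \<subseteq> gens" "\<And>m x. m \<in> carrier M \<Longrightarrow> x \<in> carrier Q \<Longrightarrow> f (frag_of (m, x)) \<in> K"
    "f 0 = 0" "\<And>s t. f (s - t) = f s - f t"
  shows "f t \<in> K"
  using assms(1)
  by (induction t rule: free_Abelian_group_induct[consumes 1]) (auto simp: assms(3,4) intro: assms(2))

lemma vectorspace_V: "vectorspace Q V"
proof -
  have "module Q V"
  proof (rule moduleI)
    show "cring Q" by (rule Q.is_cring)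
    show "abelian_group V" by (rule abelian_group_V)
    show "a \<odot>\<^bsub>V\<^esub> x \<in> carrier V" if "a \<in> carrier Q" "x \<in> carrier V" for a x
      using that by (auto elim!: V_cases simp: V_smult keys_ext)
    show "(a \<oplus>\<^bsub>Q\<^esub> b) \<odot>\<^bsub>V\<^esub> x = a \<odot>\<^bsub>V\<^esub> x \<oplus>\<^bsub>V\<^esub> b \<odot>\<^bsub>V\<^esub> x"
      if ab: "a \<in> carrier Q" "b \<in> carrier Q" and "x \<in> carrier V" for a b x
    proof -
      from \<open>x \<in> carrier V\<close> obtain t where t: "Poly_Mapping.keys t \<subseteq> gens" "x = cl t" by (rule V_cases)
      have "ext (a \<oplus>\<^bsub>Q\<^esub> b) t - (ext a t + ext b t) \<in> K"
        using K_induct[OF t(1), of "\<lambda>t. ext (a \<oplus>\<^bsub>Q\<^esub> b) t - (ext a t + ext b t)"] ab K_add_right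
        by (simp add: ext_diff Q.l_distr algebra_simps)
      with t ab show ?thesis by (simp add: V_smult V_add keys_ext cl_eq_iff)
    qed
    show "a \<odot>\<^bsub>V\<^esub> (x \<oplus>\<^bsub>V\<^esub> y) = a \<odot>\<^bsub>V\<^esub> x \<oplus>\<^bsub>V\<^esub> a \<odot>\<^bsub>V\<^esub> y"
      if a: "a \<in> carrier Q" and "x \<in> carrier V" and "y \<in> carrier V" for a x y
    proof -
      from \<open>x \<in> carrier V\<close> obtain s where s: "Poly_Mapping.keys s \<subseteq> gens" "x = cl s" by (rule V_cases)
      from \<open>y \<in> carrier V\<close> obtain t where t: "Poly_Mapping.keys t \<subseteq> gens" "y = cl t" by (rule V_cases)
      have "Poly_Mapping.keys (s + t) \<subseteq> gens" using s t keys_add[of s t] by blast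
      with s t a show ?thesis by (simp add: V_smult V_add keys_ext ext_add)
    qed
    show "(a \<otimes>\<^bsub>Q\<^esub> b) \<odot>\<^bsub>V\<^esub> x = a \<odot>\<^bsub>V\<^esub> (b \<odot>\<^bsub>V\<^esub> x)"
      if ab: "a \<in> carrier Q" "b \<in> carrier Q" and "x \<in> carrier V" for a b x
    proof -
      from \<open>x \<in> carrier V\<close> obtain t where t: "Poly_Mapping.keys t \<subseteq> gens" "x = cl t" by (rule V_cases)
      have "ext (a \<otimes>\<^bsub>Q\<^esub> b) t - ext a (ext b t) \<in> K"
        by (rule K_induct[OF t(1), of "\<lambda>t. ext (a \<otimes>\<^bsub>Q\<^esub> b) t - ext a (ext b t)"])
          (use ab in \<open>simp_all add: ext_diff Q.m_assoc\<close>)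
      with t ab show ?thesis by (simp add: V_smult keys_ext cl_eq_iff)
    qed
    show "\<one>\<^bsub>Q\<^esub> \<odot>\<^bsub>V\<^esub> x = x" if "x \<in> carrier V" for x
    proof -
      from \<open>x \<in> carrier V\<close> obtain t where t: "Poly_Mapping.keys t \<subseteq> gens" "x = cl t" by (rule V_cases)
      have "ext \<one>\<^bsub>Q\<^esub> t - t \<in> K"
        by (rule K_induct[OF t(1), of "\<lambda>t. ext \<one>\<^bsub>Q\<^esub> t - t"]) (simp_all add: ext_diff)
      with t show ?thesis by (simp add: V_smult cl_eq_iff)
    qed
  qed
  then show ?thesis by (intro vectorspace.intro field_fractions)
qed

definition tens where "tens m q = cl (frag_of (m, q))"

lemma tens_in [simp]: "m \<in> carrier M \<Longrightarrow> q \<in> carrier Q \<Longrightarrow> tens m q \<in> carrier V"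
  unfolding tens_def by (rule cl_in_V) simp

lemma tens_smult: "m \<in> carrier M \<Longrightarrow> q \<in> carrier Q \<Longrightarrow> p \<in> carrier Q \<Longrightarrow>
    p \<odot>\<^bsub>V\<^esub> tens m q = tens m (p \<otimes>\<^bsub>Q\<^esub> q)"
  by (simp add: tens_def V_smult)

lemma tens_add_left: "m \<in> carrier M \<Longrightarrow> m' \<in> carrier M \<Longrightarrow> q \<in> carrier Q \<Longrightarrow>
    tens (m \<oplus>\<^bsub>M\<^esub> m') q = tens m q \<oplus>\<^bsub>V\<^esub> tens m' q"
  using K_add_left[of m m' q] by (simp add: tens_def V_add cl_eq_iff algebra_simps)

lemma tens_move: "a \<in> carrier R \<Longrightarrow> m \<in> carrier M \<Longrightarrow> q \<in> carrier Q \<Longrightarrow>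
    tens (a \<odot>\<^bsub>M\<^esub> m) q = tens m (fraction R a \<one> \<otimes>\<^bsub>Q\<^esub> q)"
  using K_smult[of a m q] by (simp add: tens_def cl_eq_iff)

lemma fraction_split:
  assumes "a \<in> carrier R" "b \<in> carrier R" "b \<noteq> \<zero>"
  shows "fraction R a b = fraction R a \<one> \<otimes>\<^bsub>Q\<^esub> fraction R \<one> b"
  using assms by (simp add: fraction_simps)

text \<open>A common denominator turns every tensor into a pure one.\<close>

lemma V_pure:
  assumes "v \<in> carrier V"
  obtains m s where "m \<in> carrier M" "s \<in> carrier R" "s \<noteq> \<zero>" "v = tens m (fraction R \<one> s)"
proof -
  interpret V: vectorspace Q V by (rule vectorspace_V)
  from assms obtain t where "Poly_Mapping.keys t \<subseteq> gens" "v = cl t" by (rule V_cases)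
  from this(1) have "\<exists>m\<in>carrier M. \<exists>s\<in>carrier R - {\<zero>}. cl t = tens m (fraction R \<one> s)"
  proof (induction t rule: free_Abelian_group_induct[consumes 1, case_names zero diff gen])
    case zero
    have "cl 0 = tens \<zero>\<^bsub>M\<^esub> (fraction R \<one> \<one>)"
      using tens_add_left[of "\<zero>\<^bsub>M\<^esub>" "\<zero>\<^bsub>M\<^esub>" "fraction R \<one> \<one>"] V.add.l_cancel_one'[of "tens \<zero>\<^bsub>M\<^esub> (fraction R \<one> \<one>)"]
      by (simp flip: V_zero)
    then show ?case by (intro bexI[of _ "\<zero>\<^bsub>M\<^esub>"] bexI[of _ \<one>]) auto
  next
    case (diff x y)
    then obtain m s n t where ms: "m \<in> carrier M" "s \<in> carrier R" "s \<noteq> \<zero>" "cl x = tens m (fraction R \<one> s)"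
      and nt: "n \<in> carrier M" "t \<in> carrier R" "t \<noteq> \<zero>" "cl y = tens n (fraction R \<one> t)" by auto
    let ?q = "fraction R \<one> (s \<otimes> t)"
    have q: "?q \<in> carrier Q" using ms nt by (simp add: integral_iff)
    have c: "fraction R t \<one> \<otimes>\<^bsub>Q\<^esub> ?q = fraction R \<one> s" "fraction R s \<one> \<otimes>\<^bsub>Q\<^esub> ?q = fraction R \<one> t"
      using ms nt by (simp_all add: fraction_simps) (simp_all add: m_ac)
    have "cl (x - y) \<oplus>\<^bsub>V\<^esub> cl y = cl x"
      using diff keys_diff[of x y] by (subst V_add) auto
    also have "\<dots> = tens (t \<odot>\<^bsub>M\<^esub> m) ?q"
      using ms nt q by (simp add: tens_move c)
    also have "\<dots> = tens ((t \<odot>\<^bsub>M\<^esub> m \<ominus>\<^bsub>M\<^esub> s \<odot>\<^bsub>M\<^esub> n) \<oplus>\<^bsub>M\<^esub> s \<odot>\<^bsub>M\<^esub> n) ?q"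
      using ms nt by (simp add: M.minus_eq M.a_assoc M.l_neg)
    also have "\<dots> = tens (t \<odot>\<^bsub>M\<^esub> m \<ominus>\<^bsub>M\<^esub> s \<odot>\<^bsub>M\<^esub> n) ?q \<oplus>\<^bsub>V\<^esub> tens (s \<odot>\<^bsub>M\<^esub> n) ?q"
      using ms nt q by (subst tens_add_left) auto
    also have "tens (s \<odot>\<^bsub>M\<^esub> n) ?q = cl y"
      using ms nt q by (simp add: tens_move c)
    finally have "cl (x - y) \<oplus>\<^bsub>V\<^esub> cl y = tens (t \<odot>\<^bsub>M\<^esub> m \<ominus>\<^bsub>M\<^esub> s \<odot>\<^bsub>M\<^esub> n) ?q \<oplus>\<^bsub>V\<^esub> cl y" .
    moreover have "Poly_Mapping.keys (x - y) \<subseteq> gens" using diff keys_diff[of x y] by blast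
    ultimately have "cl (x - y) = tens (t \<odot>\<^bsub>M\<^esub> m \<ominus>\<^bsub>M\<^esub> s \<odot>\<^bsub>M\<^esub> n) ?q"
      using diff.hyps ms nt q by (simp add: V.add.right_cancel)
    then show ?case using ms nt
      by (intro bexI[of _ "t \<odot>\<^bsub>M\<^esub> m \<ominus>\<^bsub>M\<^esub> s \<odot>\<^bsub>M\<^esub> n"] bexI[of _ "s \<otimes> t"]) (auto simp: integral_iff)
  next
    case (gen a)
    then obtain m q where a: "a = (m, q)" "m \<in> carrier M" "q \<in> carrier Q" by auto
    from a(3) obtain c d where q: "c \<in> carrier R" "d \<in> carrier R" "d \<noteq> \<zero>" "q = fraction R c d"
      by (rule fraction_cases)
    have "cl (frag_of a) = tens (c \<odot>\<^bsub>M\<^esub> m) (fraction R \<one> d)"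
      using a q by (simp add: tens_move flip: fraction_split) (simp add: tens_def)
    then show ?case using a q by (intro bexI[of _ "c \<odot>\<^bsub>M\<^esub> m"] bexI[of _ d]) auto
  qed
  with \<open>v = cl t\<close> show thesis using that by blast
qed

text \<open>The numerator of \<open>q\<close> with respect to a denominator \<open>b\<close> of \<open>q\<close>. In general \<open>b\<close> is not a denominator of all \<open>q\<close>; the
  value \<open>0\<close> elsewhere lets clearing denominators by \<open>b\<close> be defined on every generator.\<close>

definition num where
  "num b q = (if \<exists>c\<in>carrier R. fraction R b \<one> \<otimes>\<^bsub>Q\<^esub> q = fraction R c \<one>
     then THE c. c \<in> carrier R \<and> fraction R b \<one> \<otimes>\<^bsub>Q\<^esub> q = fraction R c \<one> else \<zero>)"

lemma num_eq: "c \<in> carrier R \<Longrightarrow> fraction R b \<one> \<otimes>\<^bsub>Q\<^esub> q = fraction R c \<one> \<Longrightarrow> num b q = c"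
  unfolding num_def by (auto simp: fraction_eq_iff intro!: the_equality)

lemma num_closed [simp]: "num b q \<in> carrier R"
  using num_eq by (cases "\<exists>c\<in>carrier R. fraction R b \<one> \<otimes>\<^bsub>Q\<^esub> q = fraction R c \<one>") (metis, simp add: num_def)

lemma num_fraction:
  "a \<in> carrier R \<Longrightarrow> d \<in> carrier R \<Longrightarrow> d \<noteq> \<zero> \<Longrightarrow> c \<in> carrier R \<Longrightarrow> num (d \<otimes> c) (fraction R a d) = a \<otimes> c"
  by (rule num_eq) (simp_all add: fraction_simps m_ac)

text \<open>Clearing denominators by \<open>b\<close> is a homomorphism \<open>h\<close> from the free group to \<open>M\<close> which kills a
  given element of the kernel as soon as \<open>b\<close> is divisible enough.\<close>

definition killed where
  "killed t \<longleftrightarrow> (\<exists>b0\<in>carrier R - {\<zero>}. \<forall>c\<in>carrier R. \<forall>h\<in>hom F (add_monoid M).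
     (\<forall>(m, x)\<in>gens. h (frag_of (m, x)) = num (b0 \<otimes> c) x \<odot>\<^bsub>M\<^esub> m) \<longrightarrow> h t = \<zero>\<^bsub>M\<^esub>)"

lemma hom_F_add: "h \<in> hom F (add_monoid M) \<Longrightarrow> Poly_Mapping.keys s \<subseteq> gens \<Longrightarrow> Poly_Mapping.keys t \<subseteq> gens \<Longrightarrow>
    h (s + t) = h s \<oplus>\<^bsub>M\<^esub> h t"
  by (auto simp: hom_def)

lemma hom_F_closed: "h \<in> hom F (add_monoid M) \<Longrightarrow> Poly_Mapping.keys s \<subseteq> gens \<Longrightarrow> h s \<in> carrier M"
  by (auto simp: hom_def Pi_def)

lemma hom_F_diff:
  assumes "h \<in> hom F (add_monoid M)" "Poly_Mapping.keys s \<subseteq> gens" "Poly_Mapping.keys t \<subseteq> gens"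
  shows "h (s - t) = h s \<ominus>\<^bsub>M\<^esub> h t"
proof -
  have k: "Poly_Mapping.keys (s - t) \<subseteq> gens" using keys_diff[of s t] assms by blast
  have "h (s - t) \<oplus>\<^bsub>M\<^esub> h t = h s" using hom_F_add[OF assms(1) k assms(3)] by simp
  then show ?thesis
    using hom_F_closed[OF assms(1)] k assms by (simp add: M.minus_eq M.add.inv_solve_right)
qed

lemma killed_diff:
  assumes "Poly_Mapping.keys s \<subseteq> gens" "Poly_Mapping.keys t \<subseteq> gens" "killed s" "killed t" shows "killed (s - t)"
proof -
  from assms(3) obtain b where b: "b \<in> carrier R" "b \<noteq> \<zero>" and
    hs: "\<And>c h. \<lbrakk>c \<in> carrier R; h \<in> hom F (add_monoid M); \<forall>(m, x)\<in>gens. h (frag_of (m, x)) = num (b \<otimes> c) x \<odot>\<^bsub>M\<^esub> m\<rbrakk>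
      \<Longrightarrow> h s = \<zero>\<^bsub>M\<^esub>"
    unfolding killed_def by blast
  from assms(4) obtain d where d: "d \<in> carrier R" "d \<noteq> \<zero>" and
    ht: "\<And>c h. \<lbrakk>c \<in> carrier R; h \<in> hom F (add_monoid M); \<forall>(m, x)\<in>gens. h (frag_of (m, x)) = num (d \<otimes> c) x \<odot>\<^bsub>M\<^esub> m\<rbrakk>
      \<Longrightarrow> h t = \<zero>\<^bsub>M\<^esub>"
    unfolding killed_def by blast
  have "h (s - t) = \<zero>\<^bsub>M\<^esub>" if "c \<in> carrier R" "h \<in> hom F (add_monoid M)"
    "\<forall>(m, x)\<in>gens. h (frag_of (m, x)) = num ((b \<otimes> d) \<otimes> c) x \<odot>\<^bsub>M\<^esub> m" for c h
  proof -
    have "(b \<otimes> d) \<otimes> c = b \<otimes> (d \<otimes> c)" "(b \<otimes> d) \<otimes> c = d \<otimes> (b \<otimes> c)"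
      using b d that by (simp_all add: m_ac)
    then have "h s = \<zero>\<^bsub>M\<^esub>" "h t = \<zero>\<^bsub>M\<^esub>"
      using hs[of "d \<otimes> c" h] ht[of "b \<otimes> c" h] b d that by auto
    then show ?thesis using that assms by (simp add: hom_F_diff M.minus_eq)
  qed
  moreover have "b \<otimes> d \<in> carrier R - {\<zero>}" using b d by (simp add: integral_iff)
  ultimately show ?thesis unfolding killed_def by blast
qed

text \<open>The number \<open>b0\<close> is \<open>1\<close> for additivity in the first factor, a common denominator for additivity in the
  second, and the denominator of the fraction for the balancing relation.\<close>

lemma killed_relation:
  assumes "t \<in> tensor_relations R M (fraction_module R)" shows "killed t"
  using assms unfolding tensor_relations_def fraction_module_simps
proof (elim UnE CollectE exE conjE)
  fix m m' x assume *: "t = frag_of (m \<oplus>\<^bsub>M\<^esub> m', x) - frag_of (m, x) - frag_of (m', x)"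
    "m \<in> carrier M" "m' \<in> carrier M" "x \<in> carrier Q"
  have "h t = \<zero>\<^bsub>M\<^esub>" if "c \<in> carrier R" "h \<in> hom F (add_monoid M)"
    "\<forall>(m, x)\<in>gens. h (frag_of (m, x)) = num (\<one> \<otimes> c) x \<odot>\<^bsub>M\<^esub> m" for c h
    using that *(2-) keys_diff[of "frag_of (m \<oplus>\<^bsub>M\<^esub> m', x)" "frag_of (m, x)"] unfolding *(1)
    by (subst hom_F_diff) (auto simp: hom_F_diff M.smult_r_distr M.add_diff_diff_self)
  then show ?thesis unfolding killed_def by (intro bexI[of _ \<one>]) auto
next
  fix m x x' assume *: "t = frag_of (m, x \<oplus>\<^bsub>Q\<^esub> x') - frag_of (m, x) - frag_of (m, x')"
    "m \<in> carrier M" "x \<in> carrier Q" "x' \<in> carrier Q"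
  from *(3) obtain a b where x: "a \<in> carrier R" "b \<in> carrier R" "b \<noteq> \<zero>" "x = fraction R a b"
    by (rule fraction_cases)
  from *(4) obtain a' b' where x': "a' \<in> carrier R" "b' \<in> carrier R" "b' \<noteq> \<zero>" "x' = fraction R a' b'"
    by (rule fraction_cases)
  have "h t = \<zero>\<^bsub>M\<^esub>" if "c \<in> carrier R" "h \<in> hom F (add_monoid M)"
    and h: "\<forall>(m, x)\<in>gens. h (frag_of (m, x)) = num ((b \<otimes> b') \<otimes> c) x \<odot>\<^bsub>M\<^esub> m" for c h
  proof -
    have "num ((b \<otimes> b') \<otimes> c) x = a \<otimes> (b' \<otimes> c)" "num ((b \<otimes> b') \<otimes> c) x' = a' \<otimes> (b \<otimes> c)"
      using num_fraction[of a b "b' \<otimes> c"] num_fraction[of a' b' "b \<otimes> c"] x x' that by (simp_all add: m_ac)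
    moreover have "num ((b \<otimes> b') \<otimes> c) (x \<oplus>\<^bsub>Q\<^esub> x') = (a \<otimes> b' \<oplus> a' \<otimes> b) \<otimes> c"
      using num_fraction[of "a \<otimes> b' \<oplus> a' \<otimes> b" "b \<otimes> b'" c] x x' that
      by (simp add: fraction_simps)
    ultimately have "num ((b \<otimes> b') \<otimes> c) (x \<oplus>\<^bsub>Q\<^esub> x') = num ((b \<otimes> b') \<otimes> c) x \<oplus> num ((b \<otimes> b') \<otimes> c) x'"
      using x x' that by (simp add: l_distr r_distr m_ac)
    with *(2-) that keys_diff[of "frag_of (m, x \<oplus>\<^bsub>Q\<^esub> x')" "frag_of (m, x)"] show ?thesis
      unfolding *(1) by (subst hom_F_diff) (auto simp: hom_F_diff M.smult_l_distr M.add_diff_diff_self)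
  qed
  then show ?thesis unfolding killed_def using x x' by (intro bexI[of _ "b \<otimes> b'"]) (auto simp: integral_iff)
next
  fix a m x assume *: "t = frag_of (a \<odot>\<^bsub>M\<^esub> m, x) - frag_of (m, fraction R a \<one> \<otimes>\<^bsub>Q\<^esub> x)"
    "a \<in> carrier R" "m \<in> carrier M" "x \<in> carrier Q"
  from *(4) obtain a' b where x: "a' \<in> carrier R" "b \<in> carrier R" "b \<noteq> \<zero>" "x = fraction R a' b"
    by (rule fraction_cases)
  have "h t = \<zero>\<^bsub>M\<^esub>" if "c \<in> carrier R" "h \<in> hom F (add_monoid M)"
    and h: "\<forall>(m, x)\<in>gens. h (frag_of (m, x)) = num (b \<otimes> c) x \<odot>\<^bsub>M\<^esub> m" for c h
  proof -
    have "num (b \<otimes> c) x = a' \<otimes> c" "num (b \<otimes> c) (fraction R a \<one> \<otimes>\<^bsub>Q\<^esub> x) = (a' \<otimes> c) \<otimes> a"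
      using num_fraction[of a' b c] num_fraction[of "a \<otimes> a'" b c] x * that by (simp_all add: fraction_mult m_ac)
    with * that x(1) show ?thesis
      by (simp add: hom_F_diff M.smult_assoc1 M.minus_eq M.r_neg)
  qed
  then show ?thesis unfolding killed_def using x by (intro bexI[of _ b]) auto
qed

lemma killed_K: assumes "t \<in> K" shows "killed t"
proof -
  have 0: "killed 0"
    unfolding killed_def using hom_F_diff[of _ 0 0] hom_F_closed[of _ 0]
    by (intro bexI[of _ \<one>]) (auto simp: M.minus_eq M.r_neg)
  have "subgroup {t \<in> carrier F. killed t} F"
  proof (rule group.subgroupI[OF group_free_Abelian_group])
    fix s t assume "s \<in> {t \<in> carrier F. killed t}" "t \<in> {t \<in> carrier F. killed t}"
    then show "s \<otimes>\<^bsub>F\<^esub> t \<in> {t \<in> carrier F. killed t}"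
      using keys_add[of s t] killed_diff[of s "0 - t"] killed_diff[OF _ _ 0, of t] by auto
  next
    fix t assume "t \<in> {t \<in> carrier F. killed t}"
    then show "inv\<^bsub>F\<^esub> t \<in> {t \<in> carrier F. killed t}"
      using killed_diff[OF _ _ 0, of t] by auto
  next
    have "0 \<in> {t \<in> carrier F. killed t}" using 0 by simp
    then show "{t \<in> carrier F. killed t} \<noteq> {}" by blast
  qed auto
  moreover have "tensor_relations R M (fraction_module R) \<subseteq> {t \<in> carrier F. killed t}"
    using killed_relation tensor_relations_in_carrier by blast
  ultimately have "K \<subseteq> {t \<in> carrier F. killed t}"
    unfolding tensor_kernel_def[of R M "fraction_module R"] fraction_module_simps
    using group.generate_subgroup_incl[OF group_free_Abelian_group] by blast
  with assms show ?thesis by blast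
qed

text \<open>Only torsion dies in \<open>M \<otimes> Q\<close>: if \<open>m \<otimes> 1\<close> vanishes, then clearing denominators by a suitable \<open>b \<noteq> 0\<close>
  sends it to \<open>b m = 0\<close>.\<close>

lemma tens_one_zero_iff:
  assumes m: "m \<in> carrier M"
  shows "tens m \<one>\<^bsub>Q\<^esub> = \<zero>\<^bsub>V\<^esub> \<longleftrightarrow> (\<exists>r\<in>carrier R - {\<zero>}. r \<odot>\<^bsub>M\<^esub> m = \<zero>\<^bsub>M\<^esub>)"
proof
  assume "tens m \<one>\<^bsub>Q\<^esub> = \<zero>\<^bsub>V\<^esub>"
  then have "frag_of (m, \<one>\<^bsub>Q\<^esub>) \<in> K" by (simp add: tens_def V_zero cl_eq_iff)
  then have "killed (frag_of (m, \<one>\<^bsub>Q\<^esub>))" by (rule killed_K)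
  then obtain b where b: "b \<in> carrier R" "b \<noteq> \<zero>" and
    kill: "\<And>c h. \<lbrakk>c \<in> carrier R; h \<in> hom F (add_monoid M); \<forall>(m, x)\<in>gens. h (frag_of (m, x)) = num (b \<otimes> c) x \<odot>\<^bsub>M\<^esub> m\<rbrakk>
      \<Longrightarrow> h (frag_of (m, \<one>\<^bsub>Q\<^esub>)) = \<zero>\<^bsub>M\<^esub>"
    unfolding killed_def by blast
  have "comm_group (add_monoid M)" by (rule M.a_comm_group)
  moreover have "(\<lambda>(m, x). num b x \<odot>\<^bsub>M\<^esub> m) ` gens \<subseteq> carrier (add_monoid M)" by auto
  ultimately obtain h where "h \<in> hom F (add_monoid M)"
    "\<And>p. p \<in> gens \<Longrightarrow> h (frag_of p) = (case p of (m, x) \<Rightarrow> num b x \<odot>\<^bsub>M\<^esub> m)"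
    by (rule comm_group.free_Abelian_group_universal) (rule that)
  moreover from this have "h (frag_of (m, \<one>\<^bsub>Q\<^esub>)) = \<zero>\<^bsub>M\<^esub>" using kill[of \<one> h] b by auto
  ultimately have "num b \<one>\<^bsub>Q\<^esub> \<odot>\<^bsub>M\<^esub> m = \<zero>\<^bsub>M\<^esub>" using m by simp
  moreover have "num b \<one>\<^bsub>Q\<^esub> = b" using b by (intro num_eq) auto
  ultimately show "\<exists>r\<in>carrier R - {\<zero>}. r \<odot>\<^bsub>M\<^esub> m = \<zero>\<^bsub>M\<^esub>" using b by auto
next
  interpret V: vectorspace Q V by (rule vectorspace_V)
  assume "\<exists>r\<in>carrier R - {\<zero>}. r \<odot>\<^bsub>M\<^esub> m = \<zero>\<^bsub>M\<^esub>"
  then obtain r where r: "r \<in> carrier R" "r \<noteq> \<zero>" "r \<odot>\<^bsub>M\<^esub> m = \<zero>\<^bsub>M\<^esub>" by blast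
  then have q: "fraction R \<one> r \<in> carrier Q" by simp
  have "fraction R r \<one> \<otimes>\<^bsub>Q\<^esub> fraction R \<one> r = \<one>\<^bsub>Q\<^esub>"
    using r by (simp add: fraction_simps)
  then have "tens m \<one>\<^bsub>Q\<^esub> = tens m (fraction R r \<one> \<otimes>\<^bsub>Q\<^esub> fraction R \<one> r)" by simp
  also have "\<dots> = tens \<zero>\<^bsub>M\<^esub> (fraction R \<one> r)" using m r q by (simp flip: tens_move)
  also have "\<dots> = \<zero>\<^bsub>V\<^esub>"
    using tens_add_left[of "\<zero>\<^bsub>M\<^esub>" "\<zero>\<^bsub>M\<^esub>" "fraction R \<one> r"] q
      V.add.l_cancel_one'[of "tens \<zero>\<^bsub>M\<^esub> (fraction R \<one> r)"] by simp
  finally show "tens m \<one>\<^bsub>Q\<^esub> = \<zero>\<^bsub>V\<^esub>" .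
qed

theorem tensor_fractions_localization:
  "is_localization R M (carrier M) {\<zero>\<^bsub>M\<^esub>} V (\<lambda>m. tens m \<one>\<^bsub>Q\<^esub>)"
  unfolding is_localization_def
proof (intro conjI ballI)
  fix v assume "v \<in> carrier V"
  then obtain m s where "m \<in> carrier M" "s \<in> carrier R" "s \<noteq> \<zero>" "v = tens m (fraction R \<one> s)"
    by (rule V_pure)
  then show "\<exists>s\<in>carrier R - {\<zero>}. \<exists>y\<in>carrier M. v = fraction R \<one> s \<odot>\<^bsub>V\<^esub> tens y \<one>\<^bsub>Q\<^esub>"
    by (intro bexI[of _ s] bexI[of _ m]) (auto simp: tens_smult)
qed (auto simp: vectorspace_V tens_add_left tens_move tens_smult tens_one_zero_iff)

end

section \<open>Exactness and uniqueness of localizations\<close>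

lemma (in abelian_group) minus_add_cancel:
  "x \<in> carrier G \<Longrightarrow> y \<in> carrier G \<Longrightarrow> (x \<ominus> y) \<oplus> y = x"
  by (simp add: minus_eq a_assoc l_neg)

text \<open>The dimension of \<open>V\<close> bounds the size of independent sets, so the kernel contains a maximal one.\<close>

lemma (in linear_map) fin_dim_kernel:
  assumes fd: "V.fin_dim"
  shows "vectorspace.fin_dim K (V\<lparr>carrier := kerT\<rparr>)"
proof -
  have sub: "subspace K kerT V" by (rule kerT_is_subspace)
  then have subm: "submodule K kerT V" by (simp add: subspace_def)
  interpret ker: vectorspace K "V\<lparr>carrier := kerT\<rparr>" by (rule V.subspace_is_vs[OF sub])
  have "finite A \<and> card A \<le> V.dim" if "A \<subseteq> kerT" "ker.lin_indpt A" for A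
    using that fd V.li_le_dim[of A] V.module.span_li_not_depend(2)[OF that(1) subm]
    by (auto simp: ker_def)
  then have "\<exists>A. finite A \<and> maximal A (\<lambda>S. S \<subseteq> carrier (V\<lparr>carrier := kerT\<rparr>) \<and> ker.lin_indpt S)"
    by (intro maximal_exists[where N = "V.dim" and B = "{}"]) (auto simp: ker.lin_dep_def)
  then obtain A where "finite A" and
    *: "maximal A (\<lambda>S. S \<subseteq> carrier (V\<lparr>carrier := kerT\<rparr>) \<and> ker.lin_indpt S)" by blast
  moreover from * have "A \<subseteq> carrier (V\<lparr>carrier := kerT\<rparr>)" by (simp add: maximal_def)
  moreover have "ker.gen_set A" using * by (rule ker.max_li_is_gen)
  ultimately show ?thesis unfolding ker.fin_dim_def by blast
qed

text \<open>Generators of the kernel together with preimages of generators of the image generate \<open>V\<close>.\<close>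

lemma (in linear_map) fin_dim_from_kernel_and_image:
  assumes surj: "T ` carrier V = carrier W" and fdW: "W.fin_dim"
    and fdK: "vectorspace.fin_dim K (V\<lparr>carrier := kerT\<rparr>)"
  shows "V.fin_dim"
proof -
  have sub: "subspace K kerT V" by (rule kerT_is_subspace)
  then have subm: "submodule K kerT V" by (simp add: subspace_def)
  interpret ker: vectorspace K "V\<lparr>carrier := kerT\<rparr>" by (rule V.subspace_is_vs[OF sub])
  from fdK obtain A where A: "finite A" "A \<subseteq> kerT" "ker.module.span A = kerT"
    unfolding ker.fin_dim_def by auto
  from fdW obtain B where B: "finite B" "B \<subseteq> carrier W" "W.module.span B = carrier W"
    unfolding W.fin_dim_def by auto
  from B(1,2) surj obtain B' where B': "finite B'" "B' \<subseteq> carrier V" "B = T ` B'"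
    by (metis finite_subset_image)
  let ?S = "V.module.span (A \<union> B')"
  have AB: "A \<union> B' \<subseteq> carrier V" using A B' by (auto simp: ker_def)
  have S: "submodule K ?S V" by (rule V.module.span_is_submodule[OF AB])
  then interpret S: submodule K ?S V .
  have "submodule K (T ` ?S) W"
  proof (rule submodule.intro)
    show "T ` ?S \<subseteq> carrier W" using S.subset surj by blast
    show "\<zero>\<^bsub>W\<^esub> \<in> T ` ?S" using S.zero_closed T0_is_0 by (metis imageI)
    show "v \<oplus>\<^bsub>W\<^esub> w \<in> T ` ?S" if vw: "v \<in> T ` ?S" "w \<in> T ` ?S" for v w
    proof -
      from vw obtain x y where "x \<in> ?S" "y \<in> ?S" "v = T x" "w = T y" by blast
      moreover from this have "T (x \<oplus>\<^bsub>V\<^esub> y) = T x \<oplus>\<^bsub>W\<^esub> T y" using S.subset by (intro T_add) auto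
      ultimately show ?thesis using S.m_closed by (metis imageI)
    qed
    show "c \<odot>\<^bsub>W\<^esub> v \<in> T ` ?S" if c: "c \<in> carrier K" and v: "v \<in> T ` ?S" for c v
    proof -
      from v obtain x where "x \<in> ?S" "v = T x" by blast
      moreover from this c have "T (c \<odot>\<^bsub>V\<^esub> x) = c \<odot>\<^bsub>W\<^esub> T x" using S.subset by (intro T_smult) auto
      ultimately show ?thesis using S.smult_closed[OF c] by (metis imageI)
    qed
  qed (rule W.module.module_axioms)
  moreover have "B \<subseteq> T ` ?S" using B' V.module.in_own_span[OF AB] by auto
  ultimately have TS: "carrier W \<subseteq> T ` ?S" using W.module.span_is_subset B(3) by metis
  have "v \<in> ?S" if v: "v \<in> carrier V" for v
  proof -
    have "T v \<in> carrier W" using v surj by blast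
    with TS obtain s where s: "s \<in> ?S" "T v = T s" by blast
    have sV: "s \<in> carrier V" using s S.subset by blast
    have "T (v \<ominus>\<^bsub>V\<^esub> s) = T v \<ominus>\<^bsub>W\<^esub> T s" using v sV by (rule T_minus)
    also have "\<dots> = \<zero>\<^bsub>W\<^esub>" using s(2) v sV surj by (auto simp: image_subset_iff set_eq_iff)
    finally have "v \<ominus>\<^bsub>V\<^esub> s \<in> kerT" using v sV by (simp add: ker_def)
    also have "kerT = V.module.span A"
      using V.module.span_li_not_depend(1)[OF A(2) subm] A(3) by simp
    also have "\<dots> \<subseteq> ?S" by (rule V.module.span_is_monotone) simp
    finally have "(v \<ominus>\<^bsub>V\<^esub> s) \<oplus>\<^bsub>V\<^esub> s \<in> ?S" using s by (intro S.m_closed)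
    moreover have "abelian_group V" by unfold_locales
    ultimately show ?thesis using abelian_group.minus_add_cancel v sV by metis
  qed
  then have "?S = carrier V" using S.subset by blast
  then show ?thesis unfolding V.fin_dim_def using A(1) B'(1) AB by blast
qed

lemma (in linear_map) dim_kernel_and_image:
  assumes surj: "T ` carrier V = carrier W" and fd: "V.fin_dim"
  shows "V.dim = W.dim + vectorspace.dim K (V\<lparr>carrier := kerT\<rparr>)"
  using rank_nullity[OF fd] surj by (simp add: im_def)

locale localization = domain R + M: module R M
  for R :: "('a, 'r) ring_scheme" (structure) and M :: "('a, 'm) module" +
  fixes Y X :: "'m set" and V :: "(('a \<times> 'a) set, 'v) module" and \<phi> :: "'m \<Rightarrow> 'v"
  assumes sub: "submodule R Y M" and loc: "is_localization R M Y X V \<phi>"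

sublocale localization \<subseteq> V: vectorspace "fraction_field R" V
  using loc by (simp add: is_localization_def)

sublocale localization \<subseteq> Y: submodule R Y M
  by (rule sub)

context localization
begin

lemma Y_in: "y \<in> Y \<Longrightarrow> y \<in> carrier M" using Y.subset by blast

lemma Y_neg: "y \<in> Y \<Longrightarrow> \<ominus>\<^bsub>M\<^esub> y \<in> Y"
  using Y.smult_closed[of "\<ominus> \<one>" y] Y_in[of y] by (simp add: M.smult_l_minus)

lemma Y_minus: "y \<in> Y \<Longrightarrow> y' \<in> Y \<Longrightarrow> y \<ominus>\<^bsub>M\<^esub> y' \<in> Y"
  by (simp add: M.minus_eq Y_neg)

lemma phi_closed [simp]: "y \<in> Y \<Longrightarrow> \<phi> y \<in> carrier V"
  and phi_add: "y \<in> Y \<Longrightarrow> y' \<in> Y \<Longrightarrow> \<phi> (y \<oplus>\<^bsub>M\<^esub> y') = \<phi> y \<oplus>\<^bsub>V\<^esub> \<phi> y'"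
  and phi_smult: "r \<in> carrier R \<Longrightarrow> y \<in> Y \<Longrightarrow> \<phi> (r \<odot>\<^bsub>M\<^esub> y) = fraction R r \<one> \<odot>\<^bsub>V\<^esub> \<phi> y"
  and phi_zero_iff: "y \<in> Y \<Longrightarrow> \<phi> y = \<zero>\<^bsub>V\<^esub> \<longleftrightarrow> (\<exists>r\<in>carrier R - {\<zero>}. r \<odot>\<^bsub>M\<^esub> y \<in> X)"
  using loc by (auto simp: is_localization_def Pi_def)

lemma phi_cases:
  assumes "v \<in> carrier V"
  obtains s y where "s \<in> carrier R" "s \<noteq> \<zero>" "y \<in> Y" "v = fraction R \<one> s \<odot>\<^bsub>V\<^esub> \<phi> y"
  using assms loc unfolding is_localization_def by (metis DiffE singletonI)

lemma phi_minus: assumes "y \<in> Y" "y' \<in> Y" shows "\<phi> (y \<ominus>\<^bsub>M\<^esub> y') = \<phi> y \<ominus>\<^bsub>V\<^esub> \<phi> y'"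
proof -
  have "\<phi> (y \<ominus>\<^bsub>M\<^esub> y') \<oplus>\<^bsub>V\<^esub> \<phi> y' = \<phi> y"
    using assms Y_in by (simp add: Y_minus flip: phi_add) (simp add: M.minus_eq M.a_assoc M.l_neg)
  then show ?thesis using assms Y_minus by (simp add: V.M.minus_eq V.M.add.inv_solve_right)
qed

lemma smult_fraction_assoc: "a \<in> carrier R \<Longrightarrow> b \<in> carrier R \<Longrightarrow> b \<noteq> \<zero> \<Longrightarrow> c \<in> carrier R \<Longrightarrow> d \<in> carrier R \<Longrightarrow> d \<noteq> \<zero>
    \<Longrightarrow> v \<in> carrier V \<Longrightarrow>
    fraction R a b \<odot>\<^bsub>V\<^esub> (fraction R c d \<odot>\<^bsub>V\<^esub> v) = fraction R (a \<otimes> c) (b \<otimes> d) \<odot>\<^bsub>V\<^esub> v"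
  by (simp add: fraction_mult flip: V.smult_assoc1)

lemma phi_expand:
  assumes "s \<in> carrier R" "s \<noteq> \<zero>" "t \<in> carrier R" "t \<noteq> \<zero>" "y \<in> Y"
  shows "fraction R \<one> s \<odot>\<^bsub>V\<^esub> \<phi> y = fraction R \<one> (s \<otimes> t) \<odot>\<^bsub>V\<^esub> \<phi> (t \<odot>\<^bsub>M\<^esub> y)"
proof -
  have "fraction R t (s \<otimes> t) = fraction R \<one> s"
    using assms by (subst fraction_eq_iff) (simp_all add: integral_iff m_ac)
  then show ?thesis using assms by (simp add: phi_smult smult_fraction_assoc integral_iff)
qed

lemma smult_fraction_cancel:
  assumes "s \<in> carrier R" "s \<noteq> \<zero>" "v \<in> carrier V" "w \<in> carrier V"
  shows "fraction R \<one> s \<odot>\<^bsub>V\<^esub> v = fraction R \<one> s \<odot>\<^bsub>V\<^esub> w \<longleftrightarrow> v = w"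
proof -
  have 1: "fraction R s s = \<one>\<^bsub>Q\<^esub>" using assms by (simp add: fraction_simps)
  have "fraction R s \<one> \<odot>\<^bsub>V\<^esub> (fraction R \<one> s \<odot>\<^bsub>V\<^esub> v) = v" if "v \<in> carrier V" for v
    using that assms by (simp add: smult_fraction_assoc 1)
  then show ?thesis using assms by metis
qed

text \<open>Equality of fractions: cross-multiply, modulo torsion of \<open>Y/X\<close>.\<close>

lemma phi_eq_iff:
  assumes "s \<in> carrier R" "s \<noteq> \<zero>" "y \<in> Y" "t \<in> carrier R" "t \<noteq> \<zero>" "y' \<in> Y"
  shows "fraction R \<one> s \<odot>\<^bsub>V\<^esub> \<phi> y = fraction R \<one> t \<odot>\<^bsub>V\<^esub> \<phi> y' \<longleftrightarrow>
    (\<exists>r\<in>carrier R - {\<zero>}. r \<odot>\<^bsub>M\<^esub> (t \<odot>\<^bsub>M\<^esub> y \<ominus>\<^bsub>M\<^esub> s \<odot>\<^bsub>M\<^esub> y') \<in> X)"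
proof -
  have "fraction R \<one> s \<odot>\<^bsub>V\<^esub> \<phi> y = fraction R \<one> t \<odot>\<^bsub>V\<^esub> \<phi> y' \<longleftrightarrow>
    fraction R \<one> (s \<otimes> t) \<odot>\<^bsub>V\<^esub> \<phi> (t \<odot>\<^bsub>M\<^esub> y) = fraction R \<one> (s \<otimes> t) \<odot>\<^bsub>V\<^esub> \<phi> (s \<odot>\<^bsub>M\<^esub> y')"
    using assms phi_expand[of s t y] phi_expand[of t s y'] by (simp add: m_comm)
  also have "\<dots> \<longleftrightarrow> \<phi> (t \<odot>\<^bsub>M\<^esub> y) = \<phi> (s \<odot>\<^bsub>M\<^esub> y')"
    using assms by (intro smult_fraction_cancel) (auto simp: integral_iff)
  also have "\<dots> \<longleftrightarrow> \<phi> (t \<odot>\<^bsub>M\<^esub> y \<ominus>\<^bsub>M\<^esub> s \<odot>\<^bsub>M\<^esub> y') = \<zero>\<^bsub>V\<^esub>"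
    using assms by (simp add: phi_minus)
  also have "\<dots> \<longleftrightarrow> (\<exists>r\<in>carrier R - {\<zero>}. r \<odot>\<^bsub>M\<^esub> (t \<odot>\<^bsub>M\<^esub> y \<ominus>\<^bsub>M\<^esub> s \<odot>\<^bsub>M\<^esub> y') \<in> X)"
    using assms by (intro phi_zero_iff Y_minus Y.smult_closed)
  finally show ?thesis .
qed

lemma phi_frac_add:
  assumes "s \<in> carrier R" "s \<noteq> \<zero>" "y \<in> Y" "t \<in> carrier R" "t \<noteq> \<zero>" "y' \<in> Y"
  shows "fraction R \<one> s \<odot>\<^bsub>V\<^esub> \<phi> y \<oplus>\<^bsub>V\<^esub> fraction R \<one> t \<odot>\<^bsub>V\<^esub> \<phi> y' =
    fraction R \<one> (s \<otimes> t) \<odot>\<^bsub>V\<^esub> \<phi> (t \<odot>\<^bsub>M\<^esub> y \<oplus>\<^bsub>M\<^esub> s \<odot>\<^bsub>M\<^esub> y')"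
  using assms phi_expand[of s t y] phi_expand[of t s y']
  by (simp add: m_comm[of t s] phi_add V.smult_r_distr integral_iff)

lemma phi_frac_smult:
  assumes "a \<in> carrier R" "b \<in> carrier R" "b \<noteq> \<zero>" "s \<in> carrier R" "s \<noteq> \<zero>" "y \<in> Y"
  shows "fraction R a b \<odot>\<^bsub>V\<^esub> (fraction R \<one> s \<odot>\<^bsub>V\<^esub> \<phi> y) = fraction R \<one> (b \<otimes> s) \<odot>\<^bsub>V\<^esub> \<phi> (a \<odot>\<^bsub>M\<^esub> y)"
  using assms by (simp add: phi_smult smult_fraction_assoc integral_iff)

end

text \<open>Localization turns \<open>0 \<rightarrow> W/X \<rightarrow> Y/X \<rightarrow> Y/W \<rightarrow> 0\<close> into an exact sequence of vector spaces.\<close>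

lemma localization_exact:
  fixes V :: "(('a \<times> 'a) set, 'v) module" and U :: "(('a \<times> 'a) set, 'u) module"
  assumes V: "localization R M Y X V \<phi>" and U: "localization R M Y W U \<psi>"
    and W: "submodule R W M" and XW: "X \<subseteq> W" and WY: "W \<subseteq> Y"
  obtains T where "linear_map (fraction_field R) V U T" "T ` carrier V = carrier U"
    "localization R M W X (V\<lparr>carrier := mod_hom.ker V U T\<rparr>) \<phi>"
proof -
  interpret V: localization R M Y X V \<phi> by (rule V)
  interpret U: localization R M Y W U \<psi> by (rule U)
  interpret W: submodule R W M by (rule W)
  let ?Q = "fraction_field R"
  \<comment> \<open>The map sends \<open>\<phi> y / s\<close> to \<open>\<psi> y / s\<close>; \<open>phi_eq_iff\<close> and \<open>X \<subseteq> W\<close> make it well defined.\<close>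
  define T where "T v = (SOME u. \<exists>s y. s \<in> carrier R \<and> s \<noteq> \<zero>\<^bsub>R\<^esub> \<and> y \<in> Y \<and>
    v = fraction R \<one>\<^bsub>R\<^esub> s \<odot>\<^bsub>V\<^esub> \<phi> y \<and> u = fraction R \<one>\<^bsub>R\<^esub> s \<odot>\<^bsub>U\<^esub> \<psi> y)" for v
  have T: "T (fraction R \<one>\<^bsub>R\<^esub> s \<odot>\<^bsub>V\<^esub> \<phi> y) = fraction R \<one>\<^bsub>R\<^esub> s \<odot>\<^bsub>U\<^esub> \<psi> y"
    if sy: "s \<in> carrier R" "s \<noteq> \<zero>\<^bsub>R\<^esub>" "y \<in> Y" for s y
    unfolding T_def
  proof (rule someI2)
    show "\<exists>s' y'. s' \<in> carrier R \<and> s' \<noteq> \<zero>\<^bsub>R\<^esub> \<and> y' \<in> Y \<and>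
      fraction R \<one>\<^bsub>R\<^esub> s \<odot>\<^bsub>V\<^esub> \<phi> y = fraction R \<one>\<^bsub>R\<^esub> s' \<odot>\<^bsub>V\<^esub> \<phi> y' \<and>
      fraction R \<one>\<^bsub>R\<^esub> s \<odot>\<^bsub>U\<^esub> \<psi> y = fraction R \<one>\<^bsub>R\<^esub> s' \<odot>\<^bsub>U\<^esub> \<psi> y'"
      using sy by blast
    fix u assume "\<exists>s' y'. s' \<in> carrier R \<and> s' \<noteq> \<zero>\<^bsub>R\<^esub> \<and> y' \<in> Y \<and>
      fraction R \<one>\<^bsub>R\<^esub> s \<odot>\<^bsub>V\<^esub> \<phi> y = fraction R \<one>\<^bsub>R\<^esub> s' \<odot>\<^bsub>V\<^esub> \<phi> y' \<and> u = fraction R \<one>\<^bsub>R\<^esub> s' \<odot>\<^bsub>U\<^esub> \<psi> y'"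
    then obtain s' y' where s': "s' \<in> carrier R" "s' \<noteq> \<zero>\<^bsub>R\<^esub>" "y' \<in> Y"
      and eq: "fraction R \<one>\<^bsub>R\<^esub> s \<odot>\<^bsub>V\<^esub> \<phi> y = fraction R \<one>\<^bsub>R\<^esub> s' \<odot>\<^bsub>V\<^esub> \<phi> y'"
      and u: "u = fraction R \<one>\<^bsub>R\<^esub> s' \<odot>\<^bsub>U\<^esub> \<psi> y'" by blast
    from eq have "\<exists>r\<in>carrier R - {\<zero>\<^bsub>R\<^esub>}. r \<odot>\<^bsub>M\<^esub> (s' \<odot>\<^bsub>M\<^esub> y \<ominus>\<^bsub>M\<^esub> s \<odot>\<^bsub>M\<^esub> y') \<in> X"
      by (rule V.phi_eq_iff[OF sy s', THEN iffD1])
    then have "\<exists>r\<in>carrier R - {\<zero>\<^bsub>R\<^esub>}. r \<odot>\<^bsub>M\<^esub> (s' \<odot>\<^bsub>M\<^esub> y \<ominus>\<^bsub>M\<^esub> s \<odot>\<^bsub>M\<^esub> y') \<in> W"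
      using XW by blast
    then have "fraction R \<one>\<^bsub>R\<^esub> s \<odot>\<^bsub>U\<^esub> \<psi> y = fraction R \<one>\<^bsub>R\<^esub> s' \<odot>\<^bsub>U\<^esub> \<psi> y'"
      by (rule U.phi_eq_iff[OF sy s', THEN iffD2])
    then show "u = fraction R \<one>\<^bsub>R\<^esub> s \<odot>\<^bsub>U\<^esub> \<psi> y" by (simp add: u)
  qed
  have one: "fraction R \<one>\<^bsub>R\<^esub> \<one>\<^bsub>R\<^esub> = \<one>\<^bsub>?Q\<^esub>" by (simp add: V.fraction_one)
  have T_phi: "T (\<phi> y) = \<psi> y" if "y \<in> Y" for y
    using T[of "\<one>\<^bsub>R\<^esub>" y] that by (simp add: one)
  have lin: "linear_map ?Q V U T"
  proof (intro linear_map.intro mod_hom.intro mod_hom_axioms.intro)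
    show "T \<in> module_hom ?Q V U"
      unfolding module_hom_def
    proof (intro CollectI conjI allI impI)
      show "T \<in> carrier V \<rightarrow> carrier U"
        by (auto elim!: V.phi_cases simp: T)
      fix v w assume "v \<in> carrier V \<and> w \<in> carrier V"
      then obtain s y t z where sy: "s \<in> carrier R" "s \<noteq> \<zero>\<^bsub>R\<^esub>" "y \<in> Y" "v = fraction R \<one>\<^bsub>R\<^esub> s \<odot>\<^bsub>V\<^esub> \<phi> y"
        and tz: "t \<in> carrier R" "t \<noteq> \<zero>\<^bsub>R\<^esub>" "z \<in> Y" "w = fraction R \<one>\<^bsub>R\<^esub> t \<odot>\<^bsub>V\<^esub> \<phi> z"
        by (metis V.phi_cases)
      then show "T (v \<oplus>\<^bsub>V\<^esub> w) = T v \<oplus>\<^bsub>U\<^esub> T w"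
        by (simp add: V.phi_frac_add U.phi_frac_add T V.integral_iff)
    next
      fix q v assume "q \<in> carrier ?Q \<and> v \<in> carrier V"
      moreover then obtain a b where "a \<in> carrier R" "b \<in> carrier R" "b \<noteq> \<zero>\<^bsub>R\<^esub>" "q = fraction R a b"
        using V.fraction_cases by blast
      moreover from calculation obtain s y where "s \<in> carrier R" "s \<noteq> \<zero>\<^bsub>R\<^esub>" "y \<in> Y"
        "v = fraction R \<one>\<^bsub>R\<^esub> s \<odot>\<^bsub>V\<^esub> \<phi> y"
        using V.phi_cases by blast
      ultimately show "T (q \<odot>\<^bsub>V\<^esub> v) = q \<odot>\<^bsub>U\<^esub> T v"
        by (simp add: V.phi_frac_smult U.phi_frac_smult T V.integral_iff)
    qed
  qed unfold_locales
  then interpret T: linear_map ?Q V U T .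
  have surj: "T ` carrier V = carrier U"
  proof
    show "T ` carrier V \<subseteq> carrier U" by auto
    show "carrier U \<subseteq> T ` carrier V"
    proof
      fix u assume "u \<in> carrier U"
      then obtain s y where "s \<in> carrier R" "s \<noteq> \<zero>\<^bsub>R\<^esub>" "y \<in> Y" "u = fraction R \<one>\<^bsub>R\<^esub> s \<odot>\<^bsub>U\<^esub> \<psi> y"
        by (rule U.phi_cases)
      then show "u \<in> T ` carrier V"
        by (intro image_eqI[of _ _ "fraction R \<one>\<^bsub>R\<^esub> s \<odot>\<^bsub>V\<^esub> \<phi> y"]) (auto simp: T_phi)
    qed
  qed
  have "localization R M W X (V\<lparr>carrier := T.ker\<rparr>) \<phi>"
  proof (intro localization.intro localization_axioms.intro W)
    show "is_localization R M W X (V\<lparr>carrier := T.ker\<rparr>) \<phi>"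
      unfolding is_localization_def
    proof (intro conjI ballI)
      show "vectorspace ?Q (V\<lparr>carrier := T.ker\<rparr>)"
        by (rule V.V.subspace_is_vs[OF T.kerT_is_subspace])
      have ker: "\<phi> w \<in> T.ker" if "w \<in> W" for w
      proof -
        have "\<psi> w = \<zero>\<^bsub>U\<^esub>"
          using that WY by (subst U.phi_zero_iff) (auto intro!: bexI[of _ "\<one>\<^bsub>R\<^esub>"] simp: U.Y_in subset_iff)
        then show ?thesis using that WY by (auto simp: T.ker_def T_phi subset_iff)
      qed
      then show "\<phi> \<in> W \<rightarrow> carrier (V\<lparr>carrier := T.ker\<rparr>)" by simp
      show "\<phi> (y \<oplus>\<^bsub>M\<^esub> y') = \<phi> y \<oplus>\<^bsub>V\<lparr>carrier := T.ker\<rparr>\<^esub> \<phi> y'" if "y \<in> W" "y' \<in> W" for y y'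
        using that WY by (simp add: V.phi_add subset_iff)
      show "\<phi> (r \<odot>\<^bsub>M\<^esub> y) = fraction R r \<one>\<^bsub>R\<^esub> \<odot>\<^bsub>V\<lparr>carrier := T.ker\<rparr>\<^esub> \<phi> y"
        if "r \<in> carrier R" "y \<in> W" for r y
        using that WY by (simp add: V.phi_smult subset_iff)
      show "(\<phi> y = \<zero>\<^bsub>V\<lparr>carrier := T.ker\<rparr>\<^esub>) = (\<exists>r\<in>carrier R - {\<zero>\<^bsub>R\<^esub>}. r \<odot>\<^bsub>M\<^esub> y \<in> X)" if "y \<in> W" for y
        using that WY by (simp add: V.phi_zero_iff subset_iff)
      fix v assume "v \<in> carrier (V\<lparr>carrier := T.ker\<rparr>)"
      then have v: "v \<in> carrier V" "T v = \<zero>\<^bsub>U\<^esub>" by (auto simp: T.ker_def)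
      from v(1) obtain s y where sy: "s \<in> carrier R" "s \<noteq> \<zero>\<^bsub>R\<^esub>" "y \<in> Y" "v = fraction R \<one>\<^bsub>R\<^esub> s \<odot>\<^bsub>V\<^esub> \<phi> y"
        by (rule V.phi_cases)
      from v(2) sy have "fraction R \<one>\<^bsub>R\<^esub> s \<odot>\<^bsub>U\<^esub> \<psi> y = fraction R \<one>\<^bsub>R\<^esub> s \<odot>\<^bsub>U\<^esub> \<zero>\<^bsub>U\<^esub>"
        by (simp add: T_phi)
      then have "\<psi> y = \<zero>\<^bsub>U\<^esub>"
        by (rule iffD1[OF U.smult_fraction_cancel, rotated -1]) (use sy in auto)
      then obtain r where r: "r \<in> carrier R" "r \<noteq> \<zero>\<^bsub>R\<^esub>" "r \<odot>\<^bsub>M\<^esub> y \<in> W"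
        using sy(3) U.phi_zero_iff by blast
      have "v = fraction R \<one>\<^bsub>R\<^esub> (s \<otimes>\<^bsub>R\<^esub> r) \<odot>\<^bsub>V\<^esub> \<phi> (r \<odot>\<^bsub>M\<^esub> y)"
        using sy r by (simp add: V.phi_expand[of s r])
      then show "\<exists>s\<in>carrier R - {\<zero>\<^bsub>R\<^esub>}. \<exists>y\<in>W. v = fraction R \<one>\<^bsub>R\<^esub> s \<odot>\<^bsub>V\<lparr>carrier := T.ker\<rparr>\<^esub> \<phi> y"
        using sy r by (intro bexI[of _ "s \<otimes>\<^bsub>R\<^esub> r"] bexI[of _ "r \<odot>\<^bsub>M\<^esub> y"]) (auto simp: V.integral_iff)
    qed
  qed unfold_locales
  with lin surj show thesis by (rule that)
qed

text \<open>The comparison map of \<open>localization_exact\<close> for \<open>W = X\<close> has a kernel that localizes \<open>X/X\<close>, so it is an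
  isomorphism.\<close>

lemma localization_unique:
  fixes V :: "(('a \<times> 'a) set, 'v) module" and U :: "(('a \<times> 'a) set, 'u) module"
  assumes V: "localization R M Y X V \<phi>" and U: "localization R M Y X U \<psi>" and X: "submodule R X M" "X \<subseteq> Y"
    and fd: "vectorspace.fin_dim (fraction_field R) V"
  shows "vectorspace.fin_dim (fraction_field R) U"
    and "vectorspace.dim (fraction_field R) U = vectorspace.dim (fraction_field R) V"
proof -
  from localization_exact[OF V U X(1) subset_refl X(2)] obtain T where
    T: "linear_map (fraction_field R) V U T" "T ` carrier V = carrier U"
      "localization R M X X (V\<lparr>carrier := mod_hom.ker V U T\<rparr>) \<phi>" .
  interpret T: linear_map "fraction_field R" V U T by (rule T(1))
  interpret K: localization R M X X "V\<lparr>carrier := T.ker\<rparr>" \<phi> by (rule T(3))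
  have "T.ker \<subseteq> {\<zero>\<^bsub>V\<^esub>}"
  proof
    fix v assume "v \<in> T.ker"
    then have "v \<in> carrier (V\<lparr>carrier := T.ker\<rparr>)" by simp
    then obtain s y where sy: "s \<in> carrier R" "s \<noteq> \<zero>\<^bsub>R\<^esub>" "y \<in> X" "v = fraction R \<one>\<^bsub>R\<^esub> s \<odot>\<^bsub>V\<lparr>carrier := T.ker\<rparr>\<^esub> \<phi> y"
      by (rule K.phi_cases)
    have "\<phi> y = \<zero>\<^bsub>V\<lparr>carrier := T.ker\<rparr>\<^esub>"
      using sy by (subst K.phi_zero_iff) (auto intro!: bexI[of _ "\<one>\<^bsub>R\<^esub>"] simp: K.Y_in)
    with sy show "v \<in> {\<zero>\<^bsub>V\<^esub>}" by simp
  qed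
  then have ker: "T.ker = {\<zero>\<^bsub>V\<^esub>}" by (auto simp: T.ker_def)
  have inj: "inj_on T (carrier V)"
  proof (rule inj_onI)
    fix v w assume vw: "v \<in> carrier V" "w \<in> carrier V" "T v = T w"
    have "T (v \<ominus>\<^bsub>V\<^esub> w) = \<zero>\<^bsub>U\<^esub>" using vw by (simp add: T.T_minus)
    then have "v \<ominus>\<^bsub>V\<^esub> w \<in> T.ker" using vw by (simp add: T.ker_def)
    then show "v = w" using vw by (simp add: ker)
  qed
  show "vectorspace.fin_dim (fraction_field R) U" using T.surj_fin_dim[OF fd T(2)] .
  show "vectorspace.dim (fraction_field R) U = vectorspace.dim (fraction_field R) V"
    using T.dim_eq[OF fd inj T(2)] by simp
qed


section \<open>Ranks of subquotients\<close>

definition subquotient :: "('a, 'm) module \<Rightarrow> 'm set \<Rightarrow> 'm set \<Rightarrow> ('a, 'm set) module" where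
  "subquotient M Y X = quotient_module (M\<lparr>carrier := Y\<rparr>) X"

locale submodule_pair = domain R + M: module R M
  for R :: "('a, 'r) ring_scheme" (structure) and M :: "('a, 'm) module" +
  fixes Y X :: "'m set"
  assumes sub_Y: "submodule R Y M" and sub_X: "submodule R X M" and X_Y: "X \<subseteq> Y"
begin

sublocale Y: submodule R Y M by (rule sub_Y)
sublocale X: submodule R X M by (rule sub_X)

abbreviation SQ where "SQ \<equiv> subquotient M Y X"
definition cls where "cls y = X +>\<^bsub>M\<^esub> y"

lemma Y_in: "y \<in> Y \<Longrightarrow> y \<in> carrier M" using Y.subset by blast

lemma Y_neg: "y \<in> Y \<Longrightarrow> \<ominus>\<^bsub>M\<^esub> y \<in> Y"
  using Y.smult_closed[of "\<ominus> \<one>" y] Y_in[of y] by (simp add: M.smult_l_minus)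

lemma Y_minus: "y \<in> Y \<Longrightarrow> y' \<in> Y \<Longrightarrow> y \<ominus>\<^bsub>M\<^esub> y' \<in> Y"
  by (simp add: M.minus_eq Y_neg)

lemma X_in: "x \<in> X \<Longrightarrow> x \<in> carrier M" using X.subset by blast

lemma X_neg: "x \<in> X \<Longrightarrow> \<ominus>\<^bsub>M\<^esub> x \<in> X"
  using X.smult_closed[of "\<ominus> \<one>" x] X_in[of x] by (simp add: M.smult_l_minus)

lemma abelian_subgroup_X: "abelian_subgroup X M"
proof (rule abelian_subgroupI3)
  show "additive_subgroup X M"
    by (rule additive_subgroup.intro, rule group.subgroupI)
      (use M.a_group X.subset X_neg X.zero_closed in \<open>auto simp: a_inv_def[symmetric] simp del: X.zero_closed\<close>)
  show "abelian_group M" by (rule M.abelian_group_axioms)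
qed

lemma cls_eq_iff: "x \<in> carrier M \<Longrightarrow> y \<in> carrier M \<Longrightarrow> cls x = cls y \<longleftrightarrow> x \<ominus>\<^bsub>M\<^esub> y \<in> X"
  unfolding cls_def
  by (metis M.minus_eq abelian_subgroup.a_rcos_module abelian_subgroup.a_repr_independence'
      abelian_subgroup.a_rcos_self abelian_subgroup_X)

lemma mem_cls: "z \<in> cls x \<longleftrightarrow> (\<exists>h\<in>X. z = h \<oplus>\<^bsub>M\<^esub> x)"
  by (auto simp: cls_def a_r_coset_def')

lemma SQ_carrier: "carrier SQ = cls ` Y"
  by (auto simp: subquotient_def quotient_module_def A_RCOSETS_def' cls_def a_r_coset_def')

lemma SQ_zero: "\<zero>\<^bsub>SQ\<^esub> = cls \<zero>\<^bsub>M\<^esub>"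
  using X_in by (auto simp: subquotient_def quotient_module_def mem_cls)

lemma SQ_add: assumes "x \<in> Y" "y \<in> Y" shows "cls x \<oplus>\<^bsub>SQ\<^esub> cls y = cls (x \<oplus>\<^bsub>M\<^esub> y)"
proof -
  have "cls x \<oplus>\<^bsub>SQ\<^esub> cls y = cls x <+>\<^bsub>M\<^esub> cls y"
    by (simp add: subquotient_def quotient_module_def set_add_def' )
  also have "\<dots> = cls (x \<oplus>\<^bsub>M\<^esub> y)"
    unfolding cls_def using assms Y_in
    by (intro abelian_subgroup.a_rcos_sum[OF abelian_subgroup_X]) auto
  finally show ?thesis .
qed

lemma SQ_smult: assumes "a \<in> carrier R" "x \<in> Y" shows "a \<odot>\<^bsub>SQ\<^esub> cls x = cls (a \<odot>\<^bsub>M\<^esub> x)"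
proof -
  have "a \<odot>\<^bsub>SQ\<^esub> cls x = (\<Union>z\<in>cls x. cls (a \<odot>\<^bsub>M\<^esub> z))"
    by (simp add: subquotient_def quotient_module_def cls_def a_r_coset_def')
  also have "\<dots> = cls (a \<odot>\<^bsub>M\<^esub> x)"
  proof -
    have "cls (a \<odot>\<^bsub>M\<^esub> z) = cls (a \<odot>\<^bsub>M\<^esub> x)" if "z \<in> cls x" for z
    proof -
      from that obtain h where h: "h \<in> X" "z = h \<oplus>\<^bsub>M\<^esub> x" by (auto simp: mem_cls)
      have "a \<odot>\<^bsub>M\<^esub> z \<ominus>\<^bsub>M\<^esub> a \<odot>\<^bsub>M\<^esub> x = a \<odot>\<^bsub>M\<^esub> h"
        using h assms X_in Y_in by (simp add: M.smult_r_distr M.minus_eq M.a_assoc M.r_neg)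
      then show ?thesis using h assms X_in Y_in by (subst cls_eq_iff) auto
    qed
    moreover have "x \<in> cls x" using assms Y_in X.zero_closed by (metis M.l_zero mem_cls)
    ultimately show ?thesis by blast
  qed
  finally show ?thesis .
qed

lemma module_SQ: "module R SQ"
proof (rule moduleI)
  show "cring R" ..
  show "abelian_group SQ"
  proof (rule abelian_groupI)
    fix x assume "x \<in> carrier SQ"
    then obtain y where y: "y \<in> Y" "x = cls y" by (auto simp: SQ_carrier)
    then show "\<exists>y\<in>carrier SQ. y \<oplus>\<^bsub>SQ\<^esub> x = \<zero>\<^bsub>SQ\<^esub>"
      using Y_in by (intro bexI[of _ "cls (\<ominus>\<^bsub>M\<^esub> y)"]) (auto simp: SQ_add Y_neg SQ_zero SQ_carrier M.l_neg)
  next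
    fix x y z assume "x \<in> carrier SQ" "y \<in> carrier SQ" "z \<in> carrier SQ"
    then obtain a b c where "a \<in> Y" "b \<in> Y" "c \<in> Y" "x = cls a" "y = cls b" "z = cls c"
      unfolding SQ_carrier by blast
    then show "(x \<oplus>\<^bsub>SQ\<^esub> y) \<oplus>\<^bsub>SQ\<^esub> z = x \<oplus>\<^bsub>SQ\<^esub> (y \<oplus>\<^bsub>SQ\<^esub> z)"
      by (simp add: SQ_add M.a_assoc Y_in)
  next
    fix x y assume "x \<in> carrier SQ" "y \<in> carrier SQ"
    then obtain a b where ab: "a \<in> Y" "b \<in> Y" "x = cls a" "y = cls b"
      unfolding SQ_carrier by blast
    then show "x \<oplus>\<^bsub>SQ\<^esub> y = y \<oplus>\<^bsub>SQ\<^esub> x"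
      by (simp add: SQ_add M.a_comm[of a b] Y_in)
    from ab show "x \<oplus>\<^bsub>SQ\<^esub> y \<in> carrier SQ" by (simp add: SQ_add SQ_carrier)
  next
    fix x assume "x \<in> carrier SQ"
    then obtain a where "a \<in> Y" "x = cls a" unfolding SQ_carrier by blast
    then show "\<zero>\<^bsub>SQ\<^esub> \<oplus>\<^bsub>SQ\<^esub> x = x" by (simp add: SQ_zero SQ_add Y_in)
  qed (simp add: SQ_zero SQ_carrier)
next
  fix a b x y assume ab: "a \<in> carrier R" "b \<in> carrier R" and "x \<in> carrier SQ" "y \<in> carrier SQ"
  then obtain u v where uv: "u \<in> Y" "x = cls u" "v \<in> Y" "y = cls v"
    unfolding SQ_carrier by blast
  with ab show "(a \<oplus> b) \<odot>\<^bsub>SQ\<^esub> x = a \<odot>\<^bsub>SQ\<^esub> x \<oplus>\<^bsub>SQ\<^esub> b \<odot>\<^bsub>SQ\<^esub> x"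
    by (simp add: SQ_smult SQ_add M.smult_l_distr Y_in)
  from ab uv show "a \<odot>\<^bsub>SQ\<^esub> (x \<oplus>\<^bsub>SQ\<^esub> y) = a \<odot>\<^bsub>SQ\<^esub> x \<oplus>\<^bsub>SQ\<^esub> a \<odot>\<^bsub>SQ\<^esub> y"
    by (simp add: SQ_smult SQ_add M.smult_r_distr Y_in)
  from ab uv show "(a \<otimes> b) \<odot>\<^bsub>SQ\<^esub> x = a \<odot>\<^bsub>SQ\<^esub> (b \<odot>\<^bsub>SQ\<^esub> x)"
    by (simp add: SQ_smult M.smult_assoc1 Y_in)
  from ab uv show "a \<odot>\<^bsub>SQ\<^esub> x \<in> carrier SQ" by (simp add: SQ_smult SQ_carrier)
next
  fix x assume "x \<in> carrier SQ"
  then show "\<one> \<odot>\<^bsub>SQ\<^esub> x = x" by (auto simp: SQ_carrier SQ_smult Y_in)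
qed

text \<open>The localization \<open>c \<mapsto> c \<otimes> 1\<close> of the module \<open>Y/X\<close> is composed with the quotient map.\<close>

lemma localization_tensor:
  obtains \<phi> where "localization R M Y X (tensor_fractions R SQ) \<phi>"
proof -
  interpret SQ: module R SQ by (rule module_SQ)
  interpret S: domain_module R SQ by unfold_locales
  interpret V: vectorspace "fraction_field R" S.V by (rule S.vectorspace_V)
  define \<phi> where "\<phi> = (\<lambda>y. S.tens (cls y) \<one>\<^bsub>fraction_field R\<^esub>)"
  note l = S.tensor_fractions_localization[unfolded is_localization_def]
  have "cls y = \<zero>\<^bsub>SQ\<^esub> \<longleftrightarrow> y \<in> X" if "y \<in> Y" for y
    using that Y_in M.minus_add_cancel[of y "\<zero>\<^bsub>M\<^esub>"] by (simp add: SQ_zero cls_eq_iff)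
  then have "is_localization R M Y X S.V \<phi>"
    unfolding is_localization_def \<phi>_def
    using l by (simp add: SQ_carrier SQ_add[symmetric] SQ_smult[symmetric]) (auto simp: SQ_smult Pi_def)
  then show thesis
    by (intro that[of \<phi>] localization.intro localization_axioms.intro sub_Y) unfold_locales
qed

end

definition sq_fin where "sq_fin R M Y X \<longleftrightarrow> has_finite_rank R (subquotient M Y X)"
definition sq_rank where "sq_rank R M Y X = module_rank R (subquotient M Y X)"

theorem subquotient_rank_filtration:
  assumes "submodule_pair R M Y W" "submodule_pair R M W X"
  shows "sq_fin R M Y X \<longleftrightarrow> sq_fin R M Y W \<and> sq_fin R M W X"
    and "sq_fin R M Y X \<Longrightarrow> sq_rank R M Y X = sq_rank R M Y W + sq_rank R M W X"
proof -
  interpret YW: submodule_pair R M Y W by fact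
  interpret WX: submodule_pair R M W X by fact
  interpret YX: submodule_pair R M Y X
    using YW.X_Y WX.X_Y YW.sub_Y WX.sub_X by unfold_locales auto
  let ?Q = "fraction_field R"
  obtain \<phi> where V: "localization R M Y X (tensor_fractions R (subquotient M Y X)) \<phi>"
    by (rule YX.localization_tensor)
  obtain \<psi> where U: "localization R M Y W (tensor_fractions R (subquotient M Y W)) \<psi>"
    by (rule YW.localization_tensor)
  obtain \<theta> where K: "localization R M W X (tensor_fractions R (subquotient M W X)) \<theta>"
    by (rule WX.localization_tensor)
  from localization_exact[OF V U WX.sub_Y WX.X_Y YW.X_Y] obtain T where
    T: "linear_map ?Q (tensor_fractions R (subquotient M Y X)) (tensor_fractions R (subquotient M Y W)) T"
      "T ` carrier (tensor_fractions R (subquotient M Y X)) = carrier (tensor_fractions R (subquotient M Y W))"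
      "localization R M W X ((tensor_fractions R (subquotient M Y X))
         \<lparr>carrier := mod_hom.ker (tensor_fractions R (subquotient M Y X)) (tensor_fractions R (subquotient M Y W)) T\<rparr>) \<phi>" .
  interpret T: linear_map ?Q "tensor_fractions R (subquotient M Y X)" "tensor_fractions R (subquotient M Y W)" T
    by (rule T(1))
  note fwd = localization_unique[OF T(3) K WX.sub_X WX.X_Y]
  note bwd = localization_unique[OF K T(3) WX.sub_X WX.X_Y]
  show "sq_fin R M Y X \<longleftrightarrow> sq_fin R M Y W \<and> sq_fin R M W X"
    unfolding sq_fin_def has_finite_rank_def
    using T.surj_fin_dim[OF _ T(2)] fwd(1)[OF T.fin_dim_kernel] T.fin_dim_from_kernel_and_image[OF T(2) _ bwd(1)]
    by blast
  show "sq_fin R M Y X \<Longrightarrow> sq_rank R M Y X = sq_rank R M Y W + sq_rank R M W X"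
    unfolding sq_fin_def has_finite_rank_def sq_rank_def module_rank_def
    using T.dim_kernel_and_image[OF T(2)] fwd(2)[OF T.fin_dim_kernel] by simp
qed

text \<open>The hypotheses say that \<open>f\<close> induces an isomorphism \<open>Y/X \<rightarrow> Y'/X'\<close>. A localization of \<open>Y'/X'\<close> composed with \<open>f\<close>
  is one of \<open>Y/X\<close>.\<close>

theorem subquotient_rank_iso:
  assumes "submodule_pair R M Y X" "submodule_pair R N Y' X'"
    and f: "\<And>y. y \<in> Y \<Longrightarrow> f y \<in> Y'"
      "\<And>x y. x \<in> Y \<Longrightarrow> y \<in> Y \<Longrightarrow> f (x \<oplus>\<^bsub>M\<^esub> y) = f x \<oplus>\<^bsub>N\<^esub> f y"
      "\<And>a y. a \<in> carrier R \<Longrightarrow> y \<in> Y \<Longrightarrow> f (a \<odot>\<^bsub>M\<^esub> y) = a \<odot>\<^bsub>N\<^esub> f y"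
    and surj: "\<And>y'. y' \<in> Y' \<Longrightarrow> \<exists>y\<in>Y. y' \<ominus>\<^bsub>N\<^esub> f y \<in> X'"
    and inj: "\<And>y. y \<in> Y \<Longrightarrow> f y \<in> X' \<longleftrightarrow> y \<in> X"
  shows "sq_fin R M Y X \<longleftrightarrow> sq_fin R N Y' X'"
    and "sq_fin R M Y X \<Longrightarrow> sq_rank R M Y X = sq_rank R N Y' X'"
proof -
  interpret M: submodule_pair R M Y X by fact
  interpret N: submodule_pair R N Y' X' by fact
  obtain \<phi> where V: "localization R M Y X (tensor_fractions R (subquotient M Y X)) \<phi>"
    by (rule M.localization_tensor)
  obtain \<psi> where U: "localization R N Y' X' (tensor_fractions R (subquotient N Y' X')) \<psi>"
    by (rule N.localization_tensor)
  interpret U: localization R N Y' X' "tensor_fractions R (subquotient N Y' X')" \<psi> by (rule U)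
  have "is_localization R M Y X (tensor_fractions R (subquotient N Y' X')) (\<lambda>y. \<psi> (f y))"
    unfolding is_localization_def
  proof (intro conjI ballI)
    fix v assume "v \<in> carrier (tensor_fractions R (subquotient N Y' X'))"
    then obtain s y' where sy: "s \<in> carrier R" "s \<noteq> \<zero>\<^bsub>R\<^esub>" "y' \<in> Y'"
      "v = fraction R \<one>\<^bsub>R\<^esub> s \<odot>\<^bsub>tensor_fractions R (subquotient N Y' X')\<^esub> \<psi> y'"
      by (rule U.phi_cases)
    from surj[OF sy(3)] obtain y where y: "y \<in> Y" "y' \<ominus>\<^bsub>N\<^esub> f y \<in> X'" by blast
    have "\<psi> (y' \<ominus>\<^bsub>N\<^esub> f y) = \<zero>\<^bsub>tensor_fractions R (subquotient N Y' X')\<^esub>"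
      using y sy(3) f(1) N.X_in by (subst U.phi_zero_iff) (auto intro!: bexI[of _ "\<one>\<^bsub>R\<^esub>"] U.Y_minus)
    then have "\<psi> y' = \<psi> (f y)" using y sy(3) f(1) by (simp add: U.phi_minus)
    then show "\<exists>s\<in>carrier R - {\<zero>\<^bsub>R\<^esub>}. \<exists>y\<in>Y.
        v = fraction R \<one>\<^bsub>R\<^esub> s \<odot>\<^bsub>tensor_fractions R (subquotient N Y' X')\<^esub> \<psi> (f y)"
      using sy y by auto
  next
    fix y assume y: "y \<in> Y"
    show "\<psi> (f y) = \<zero>\<^bsub>tensor_fractions R (subquotient N Y' X')\<^esub> \<longleftrightarrow> (\<exists>r\<in>carrier R - {\<zero>\<^bsub>R\<^esub>}. r \<odot>\<^bsub>M\<^esub> y \<in> X)"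
      using y f(1) by (subst U.phi_zero_iff) (auto simp: f(3)[symmetric] inj)
  qed (auto simp: f U.phi_add U.phi_smult U.V.vectorspace_axioms)
  then have U': "localization R M Y X (tensor_fractions R (subquotient N Y' X')) (\<lambda>y. \<psi> (f y))"
    by (intro localization.intro localization_axioms.intro M.sub_Y) unfold_locales
  note fwd = localization_unique[OF V U' M.sub_X M.X_Y]
  note bwd = localization_unique[OF U' V M.sub_X M.X_Y]
  show "sq_fin R M Y X \<longleftrightarrow> sq_fin R N Y' X'"
    unfolding sq_fin_def has_finite_rank_def using fwd(1) bwd(1) by blast
  show "sq_fin R M Y X \<Longrightarrow> sq_rank R M Y X = sq_rank R N Y' X'"
    unfolding sq_fin_def has_finite_rank_def sq_rank_def module_rank_def using fwd(2) by simp
qed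

section \<open>Abel sequences of controlled absolute growth\<close>

lemma eventually_at_left_1: "(\<And>x::real. 0 < x \<Longrightarrow> x < 1 \<Longrightarrow> P x) \<Longrightarrow> eventually P (at_left 1)"
  by (rule eventually_at_leftI[of 0]) auto

lemma abs_summable_if_conv_radius:
  fixes a :: "nat \<Rightarrow> real"
  assumes "conv_radius a \<ge> 1" "0 \<le> x" "x < 1"
  shows "summable (\<lambda>k. \<bar>a k\<bar> * x ^ k)"
proof -
  have "ereal (norm x) < conv_radius a"
    using assms by (intro less_le_trans[OF _ assms(1)]) (simp add: one_ereal_def)
  from abs_summable_in_conv_radius[OF this] show ?thesis
    using assms by (simp add: abs_mult power_abs)
qed

lemma summable_from_abs:
  fixes a :: "nat \<Rightarrow> real"
  assumes "summable (\<lambda>k. \<bar>a k\<bar> * x ^ k)" "0 \<le> x" shows "summable (\<lambda>k. a k * x ^ k)"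
proof (rule summable_rabs_cancel)
  have "(\<lambda>k. \<bar>a k * x ^ k\<bar>) = (\<lambda>k. \<bar>a k\<bar> * x ^ k)"
    using assms(2) by (simp only: abs_mult power_abs abs_of_nonneg)
  with assms(1) show "summable (\<lambda>k. \<bar>a k * x ^ k\<bar>)" by (simp only:)
qed

lemma summable_if_conv_radius:
  fixes a :: "nat \<Rightarrow> real"
  assumes "conv_radius a \<ge> 1" "0 \<le> x" "x < 1"
  shows "summable (\<lambda>k. a k * x ^ k)"
  by (rule summable_from_abs[OF abs_summable_if_conv_radius[OF assms] assms(2)])

lemma conv_radius_ge_1I:
  fixes a :: "nat \<Rightarrow> real"
  assumes "\<And>x. 0 < x \<Longrightarrow> x < 1 \<Longrightarrow> summable (\<lambda>k. a k * x ^ k)"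
  shows "conv_radius a \<ge> 1"
proof (rule conv_radius_geI_ex)
  fix r :: real assume "0 < r" "ereal r < 1"
  then show "\<exists>z::real. norm z = r \<and> summable (\<lambda>n. a n * z ^ n)"
    using assms[of r] by (intro exI[of _ r]) (simp add: one_ereal_def)
qed

lemma controlled_mono:
  assumes b: "controlled_absolute_growth b" and le: "\<And>n. \<bar>a n\<bar> \<le> \<bar>b n\<bar>"
  shows "controlled_absolute_growth a"
  unfolding controlled_absolute_growth_def
proof
  have rb: "conv_radius b \<ge> 1" using b by (simp add: controlled_absolute_growth_def)
  have sa: "summable (\<lambda>k. \<bar>a k\<bar> * x ^ k)" if "0 < x" "x < 1" for x
    by (rule summable_comparison_test'[OF abs_summable_if_conv_radius[OF rb, of x]])
      (use that le in \<open>auto simp: abs_mult intro: mult_right_mono\<close>)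
  show "conv_radius a \<ge> 1"
    by (rule conv_radius_ge_1I) (rule summable_from_abs[OF sa]; simp)
  show "((\<lambda>x. (1 - x)\<^sup>2 * suminf (\<lambda>k. \<bar>a k\<bar> * x ^ k)) \<longlongrightarrow> 0) (at_left 1)"
  proof (rule tendsto_sandwich)
    show "\<forall>\<^sub>F x in at_left 1. (1 - x)\<^sup>2 * suminf (\<lambda>k. \<bar>a k\<bar> * x ^ k) \<le> (1 - x)\<^sup>2 * suminf (\<lambda>k. \<bar>b k\<bar> * x ^ k)"
      using le
      by (intro eventually_at_left_1 mult_left_mono suminf_le mult_right_mono sa
          abs_summable_if_conv_radius[OF rb]) auto
    show "\<forall>\<^sub>F x in at_left 1. 0 \<le> (1 - x)\<^sup>2 * suminf (\<lambda>k. \<bar>a k\<bar> * x ^ k)"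
      using sa by (intro eventually_at_left_1 mult_nonneg_nonneg suminf_nonneg) auto
    show "((\<lambda>x. (1 - x)\<^sup>2 * suminf (\<lambda>k. \<bar>b k\<bar> * x ^ k)) \<longlongrightarrow> 0) (at_left 1)"
      using b by (simp add: controlled_absolute_growth_def)
  qed auto
qed

lemma controlled_add_abs:
  assumes "controlled_absolute_growth a" "controlled_absolute_growth b"
  shows "controlled_absolute_growth (\<lambda>n. \<bar>a n\<bar> + \<bar>b n\<bar>)"
  unfolding controlled_absolute_growth_def
proof
  have r: "conv_radius a \<ge> 1" "conv_radius b \<ge> 1"
    using assms by (simp_all add: controlled_absolute_growth_def)
  have s: "(\<lambda>k. (\<bar>a k\<bar> + \<bar>b k\<bar>) * x ^ k) sums (suminf (\<lambda>k. \<bar>a k\<bar> * x ^ k) + suminf (\<lambda>k. \<bar>b k\<bar> * x ^ k))"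
    if "0 < x" "x < 1" for x
    unfolding distrib_right using that r
    by (intro sums_add summable_sums abs_summable_if_conv_radius) auto
  show "conv_radius (\<lambda>n. \<bar>a n\<bar> + \<bar>b n\<bar>) \<ge> 1"
    using s by (intro conv_radius_ge_1I) (auto dest: sums_summable)
  have "((\<lambda>x. (1 - x)\<^sup>2 * suminf (\<lambda>k. \<bar>a k\<bar> * x ^ k) + (1 - x)\<^sup>2 * suminf (\<lambda>k. \<bar>b k\<bar> * x ^ k)) \<longlongrightarrow> 0 + 0) (at_left 1)"
    using assms by (intro tendsto_add) (simp_all add: controlled_absolute_growth_def)
  moreover have "\<forall>\<^sub>F x in at_left 1.
      (1 - x)\<^sup>2 * suminf (\<lambda>k. \<bar>a k\<bar> * x ^ k) + (1 - x)\<^sup>2 * suminf (\<lambda>k. \<bar>b k\<bar> * x ^ k) =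
      (1 - x)\<^sup>2 * suminf (\<lambda>k. \<bar>\<bar>a k\<bar> + \<bar>b k\<bar>\<bar> * x ^ k)"
    by (intro eventually_at_left_1) (simp add: s[THEN sums_unique, symmetric] distrib_left)
  ultimately show "((\<lambda>x. (1 - x)\<^sup>2 * suminf (\<lambda>k. \<bar>\<bar>a k\<bar> + \<bar>b k\<bar>\<bar> * x ^ k)) \<longlongrightarrow> 0) (at_left 1)"
    by (auto intro: Lim_transform_eventually)
qed

lemma sums_shift:
  fixes x :: real
  assumes "summable (\<lambda>k. c k * x ^ k)"
  shows "(\<lambda>k. (case k of 0 \<Rightarrow> 0 | Suc m \<Rightarrow> c m) * x ^ k) sums (x * suminf (\<lambda>k. c k * x ^ k))"
proof -
  have "(\<lambda>m. x * (c m * x ^ m)) sums (x * suminf (\<lambda>k. c k * x ^ k))"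
    by (intro sums_mult summable_sums assms)
  then have "(\<lambda>m. (case Suc m of 0 \<Rightarrow> 0 | Suc m \<Rightarrow> c m) * x ^ Suc m) sums (x * suminf (\<lambda>k. c k * x ^ k))"
    by (simp add: mult_ac)
  from sums_Suc[OF this] show ?thesis by simp
qed

lemma controlled_shift:
  assumes "controlled_absolute_growth a"
  shows "controlled_absolute_growth (\<lambda>n. case n of 0 \<Rightarrow> 0 | Suc m \<Rightarrow> a m)"
  unfolding controlled_absolute_growth_def
proof
  have r: "conv_radius a \<ge> 1" using assms by (simp add: controlled_absolute_growth_def)
  show "conv_radius (\<lambda>n. case n of 0 \<Rightarrow> 0 | Suc m \<Rightarrow> a m) \<ge> 1"
    by (rule conv_radius_ge_1I) (rule sums_summable[OF sums_shift[OF summable_if_conv_radius[OF r]]]; simp)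
  have abs: "\<bar>case k of 0 \<Rightarrow> 0 | Suc m \<Rightarrow> a m\<bar> = (case k of 0 \<Rightarrow> 0 | Suc m \<Rightarrow> \<bar>a m\<bar>)" for k
    by (cases k) auto
  have "suminf (\<lambda>k. \<bar>case k of 0 \<Rightarrow> 0 | Suc m \<Rightarrow> a m\<bar> * x ^ k) = x * suminf (\<lambda>k. \<bar>a k\<bar> * x ^ k)"
    if "0 < x" "x < 1" for x
    unfolding abs using that r
    by (intro sums_unique[symmetric] sums_shift abs_summable_if_conv_radius) auto
  then have "\<forall>\<^sub>F x in at_left 1. x * ((1 - x)\<^sup>2 * suminf (\<lambda>k. \<bar>a k\<bar> * x ^ k)) =
      (1 - x)\<^sup>2 * suminf (\<lambda>k. \<bar>case k of 0 \<Rightarrow> 0 | Suc m \<Rightarrow> a m\<bar> * x ^ k)"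
    by (intro eventually_at_left_1) simp
  moreover have "((\<lambda>x. x * ((1 - x)\<^sup>2 * suminf (\<lambda>k. \<bar>a k\<bar> * x ^ k))) \<longlongrightarrow> 1 * 0) (at_left 1)"
    using assms by (intro tendsto_mult tendsto_ident_at) (simp add: controlled_absolute_growth_def)
  ultimately show "((\<lambda>x. (1 - x)\<^sup>2 * suminf (\<lambda>k. \<bar>case k of 0 \<Rightarrow> 0 | Suc m \<Rightarrow> a m\<bar> * x ^ k)) \<longlongrightarrow> 0) (at_left 1)"
    by (auto intro: Lim_transform_eventually)
qed

lemma Abel_add:
  assumes "Abel_sequence a" "Abel_sequence b"
  shows "Abel_sequence (\<lambda>n. a n + b n)"
proof -
  from assms obtain L M where r: "conv_radius a \<ge> 1" "conv_radius b \<ge> 1" and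
    L: "((\<lambda>x. (1 - x) * suminf (\<lambda>k. a k * x ^ k)) \<longlongrightarrow> L) (at_left 1)" and
    M: "((\<lambda>x. (1 - x) * suminf (\<lambda>k. b k * x ^ k)) \<longlongrightarrow> M) (at_left 1)"
    by (auto simp: Abel_sequence_def)
  have s: "(\<lambda>k. (a k + b k) * x ^ k) sums (suminf (\<lambda>k. a k * x ^ k) + suminf (\<lambda>k. b k * x ^ k))"
    if "0 < x" "x < 1" for x
    unfolding distrib_right using that r
    by (intro sums_add summable_sums summable_if_conv_radius) auto
  have "conv_radius (\<lambda>n. a n + b n) \<ge> 1"
    using s by (intro conv_radius_ge_1I) (auto dest: sums_summable)
  moreover have "((\<lambda>x. (1 - x) * suminf (\<lambda>k. (a k + b k) * x ^ k)) \<longlongrightarrow> L + M) (at_left 1)"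
    by (rule Lim_transform_eventually[OF tendsto_add[OF L M]])
      (auto intro!: eventually_at_left_1 simp: s[THEN sums_unique, symmetric] distrib_left)
  ultimately show ?thesis by (auto simp: Abel_sequence_def)
qed

lemma Abel_uminus:
  assumes "Abel_sequence a" shows "Abel_sequence (\<lambda>n. - a n)"
proof -
  from assms obtain L where r: "conv_radius a \<ge> 1" and
    L: "((\<lambda>x. (1 - x) * suminf (\<lambda>k. a k * x ^ k)) \<longlongrightarrow> L) (at_left 1)"
    by (auto simp: Abel_sequence_def)
  have s: "(\<lambda>k. - a k * x ^ k) sums - suminf (\<lambda>k. a k * x ^ k)" if "0 < x" "x < 1" for x
    using sums_minus[OF summable_sums[OF summable_if_conv_radius[OF r]]] that by auto
  have "conv_radius (\<lambda>n. - a n) \<ge> 1"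
    using s by (intro conv_radius_ge_1I) (auto dest: sums_summable)
  moreover have "((\<lambda>x. (1 - x) * suminf (\<lambda>k. - a k * x ^ k)) \<longlongrightarrow> - L) (at_left 1)"
    by (rule Lim_transform_eventually[OF tendsto_minus[OF L]])
      (rule eventually_at_left_1, subst s[THEN sums_unique, symmetric], auto)
  ultimately show ?thesis by (auto simp: Abel_sequence_def)
qed

text \<open>The power series of the differences is \<open>-(1 - x)/x\<close> times that of \<open>v\<close>, so the Abel mean is bounded by
  \<open>(1 - x)\<^sup>2 / x\<close> times the series of \<open>\<bar>v\<bar>\<close>. It tends to \<open>0\<close>: the growth condition is about exactly
  this factor.\<close>

lemma Abel_telescope:
  assumes v: "controlled_absolute_growth v" and "v 0 = 0"
  shows "Abel_sequence (\<lambda>n. v n - v (Suc n))"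
proof -
  have r: "conv_radius v \<ge> 1" using v by (simp add: controlled_absolute_growth_def)
  have s: "(\<lambda>k. (v k - v (Suc k)) * x ^ k) sums (- (1 - x) * suminf (\<lambda>k. v k * x ^ k) / x)"
    if x: "0 < x" "x < 1" for x
  proof -
    have sv: "(\<lambda>k. v k * x ^ k) sums (suminf (\<lambda>k. v k * x ^ k))"
      using x by (intro summable_sums summable_if_conv_radius r) auto
    then have "(\<lambda>k. v (Suc k) * x ^ Suc k) sums (suminf (\<lambda>k. v k * x ^ k))"
      using \<open>v 0 = 0\<close> by (subst sums_Suc_iff) simp
    then have "(\<lambda>k. v (Suc k) * x ^ Suc k / x) sums (suminf (\<lambda>k. v k * x ^ k) / x)"
      by (rule sums_divide)
    then have "(\<lambda>k. v (Suc k) * x ^ k) sums (suminf (\<lambda>k. v k * x ^ k) / x)" using x by simp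
    from sums_diff[OF sv this] show ?thesis using x by (simp add: field_simps)
  qed
  have "conv_radius (\<lambda>n. v n - v (Suc n)) \<ge> 1"
    using s by (intro conv_radius_ge_1I) (auto dest: sums_summable)
  moreover have "((\<lambda>x. (1 - x) * suminf (\<lambda>k. (v k - v (Suc k)) * x ^ k)) \<longlongrightarrow> 0) (at_left 1)"
  proof (rule Lim_null_comparison)
    have "\<bar>suminf (\<lambda>k. v k * x ^ k)\<bar> \<le> suminf (\<lambda>k. \<bar>v k\<bar> * x ^ k)" if "0 < x" "x < 1" for x
      using summable_rabs[of "\<lambda>k. v k * x ^ k"] abs_summable_if_conv_radius[OF r, of x] that
      by (simp add: abs_mult power_abs)
    then show "\<forall>\<^sub>F x in at_left 1. norm ((1 - x) * suminf (\<lambda>k. (v k - v (Suc k)) * x ^ k)) \<le>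
        (1 - x)\<^sup>2 * suminf (\<lambda>k. \<bar>v k\<bar> * x ^ k) / x"
      by (intro eventually_at_left_1)
        (simp add: s[THEN sums_unique, symmetric] abs_mult power2_eq_square mult.assoc
          divide_right_mono mult_left_mono)
    have "((\<lambda>x. (1 - x)\<^sup>2 * suminf (\<lambda>k. \<bar>v k\<bar> * x ^ k) / x) \<longlongrightarrow> 0 / 1) (at_left 1)"
      using v by (intro tendsto_divide tendsto_ident_at) (auto simp: controlled_absolute_growth_def)
    then show "((\<lambda>x. (1 - x)\<^sup>2 * suminf (\<lambda>k. \<bar>v k\<bar> * x ^ k) / x) \<longlongrightarrow> 0) (at_left 1)" by simp
  qed
  ultimately show ?thesis by (auto simp: Abel_sequence_def)
qed

text \<open>Here \<open>h\<close> is the unsigned sequence of ranks.\<close>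

definition Abel_controlled :: "(nat \<Rightarrow> real) \<Rightarrow> bool" where
  "Abel_controlled h \<longleftrightarrow>
     Abel_sequence (\<lambda>n. (- 1) ^ n * h n) \<and> controlled_absolute_growth (\<lambda>n. (- 1) ^ n * h n)"

text \<open>What the long exact homology sequence says about ranks. The term \<open>u (n + 1)\<close> is the rank of the connecting
  homomorphism \<open>H\<^sub>n\<^sub>+\<^sub>1 C \<rightarrow> H\<^sub>n A\<close>; the shift makes \<open>u 0\<close> the rank of \<open>H\<^sub>0 C \<rightarrow> H\<^sub>-\<^sub>1 A = 0\<close>.\<close>

locale rank_exact_sequence =
  fixes hA hB hC u :: "nat \<Rightarrow> real"
  assumes nonneg: "0 \<le> hA n" "0 \<le> hB n" "0 \<le> hC n" "0 \<le> u n"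
    and u_0: "u 0 = 0" and u_Suc: "u (Suc n) \<le> hA n"
    and hC: "hC n = hB n - hA n + u (Suc n) + u n"
begin

lemma u_le: "u n \<le> (case n of 0 \<Rightarrow> 0 | Suc m \<Rightarrow> hA m)"
  using u_0 u_Suc by (cases n) auto

lemma controlled_u:
  assumes "Abel_controlled hA" shows "controlled_absolute_growth (\<lambda>n. (- 1) ^ n * u n)"
proof (rule controlled_mono)
  show "controlled_absolute_growth (\<lambda>n. case n of 0 \<Rightarrow> 0 | Suc m \<Rightarrow> (- 1) ^ m * hA m)"
    using assms by (intro controlled_shift) (simp add: Abel_controlled_def)
  show "\<bar>(- 1) ^ n * u n\<bar> \<le> \<bar>case n of 0 \<Rightarrow> 0 | Suc m \<Rightarrow> (- 1) ^ m * hA m\<bar>" for n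
    using u_le[of n] nonneg by (cases n) (auto simp: abs_mult)
qed

lemma Abel_u:
  assumes "Abel_controlled hA" shows "Abel_sequence (\<lambda>n. (- 1) ^ n * u n - (- 1) ^ Suc n * u (Suc n))"
  using Abel_telescope[OF controlled_u[OF assms]] u_0 by simp

lemma Abel_controlled_C:
  assumes A: "Abel_controlled hA" and B: "Abel_controlled hB" shows "Abel_controlled hC"
  unfolding Abel_controlled_def
proof
  have eq: "(- 1) ^ n * hC n = (- 1) ^ n * hB n + - ((- 1) ^ n * hA n) +
      ((- 1) ^ n * u n - (- 1) ^ Suc n * u (Suc n))" for n
    by (simp add: hC algebra_simps)
  show "Abel_sequence (\<lambda>n. (- 1) ^ n * hC n)"
    unfolding eq using A B by (intro Abel_add Abel_uminus Abel_u) (auto simp: Abel_controlled_def)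
  show "controlled_absolute_growth (\<lambda>n. (- 1) ^ n * hC n)"
  proof (rule controlled_mono)
    show "controlled_absolute_growth (\<lambda>n. \<bar>(- 1) ^ n * hB n\<bar> + \<bar>(- 1) ^ n * u n\<bar>)"
      using B controlled_u[OF A] by (intro controlled_add_abs) (auto simp: Abel_controlled_def)
    show "\<bar>(- 1) ^ n * hC n\<bar> \<le> \<bar>\<bar>(- 1) ^ n * hB n\<bar> + \<bar>(- 1) ^ n * u n\<bar>\<bar>" for n
    proof -
      have "hC n \<le> hB n + u n" using hC[of n] u_Suc[of n] by linarith
      then show ?thesis by (simp add: abs_mult nonneg)
    qed
  qed
qed

lemma Abel_controlled_B:
  assumes A: "Abel_controlled hA" and C: "Abel_controlled hC" shows "Abel_controlled hB"
  unfolding Abel_controlled_def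
proof
  have eq: "(- 1) ^ n * hB n = (- 1) ^ n * hC n + (- 1) ^ n * hA n +
      - ((- 1) ^ n * u n - (- 1) ^ Suc n * u (Suc n))" for n
    by (simp add: hC algebra_simps)
  show "Abel_sequence (\<lambda>n. (- 1) ^ n * hB n)"
    unfolding eq using A C by (intro Abel_add Abel_uminus Abel_u) (auto simp: Abel_controlled_def)
  show "controlled_absolute_growth (\<lambda>n. (- 1) ^ n * hB n)"
  proof (rule controlled_mono)
    show "controlled_absolute_growth (\<lambda>n. \<bar>(- 1) ^ n * hC n\<bar> + \<bar>(- 1) ^ n * hA n\<bar>)"
      using A C by (intro controlled_add_abs) (auto simp: Abel_controlled_def)
    show "\<bar>(- 1) ^ n * hB n\<bar> \<le> \<bar>\<bar>(- 1) ^ n * hC n\<bar> + \<bar>(- 1) ^ n * hA n\<bar>\<bar>" for n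
    proof -
      have "hB n \<le> hC n + hA n" using hC[of n] nonneg(4)[of n] nonneg(4)[of "Suc n"] by linarith
      then show ?thesis by (simp add: abs_mult nonneg)
    qed
  qed
qed

end

section \<open>Quasi-isomorphisms\<close>

lemma (in abelian_group) add3_minus:
  "u \<in> carrier G \<Longrightarrow> v \<in> carrier G \<Longrightarrow> w \<in> carrier G \<Longrightarrow> (u \<oplus> v \<oplus> w) \<ominus> u = v \<oplus> w"
  using minus_add_cancel[of "v \<oplus> w" u] add.inv_solve_right[of "v \<oplus> w" "u \<oplus> v \<oplus> w" u]
  by (simp add: minus_eq a_ac)

locale complex_over = domain R for R :: "('a, 'r) ring_scheme" (structure) +
  fixes C :: "('a, 'u) module_complex"
  assumes cx: "chain_complex R C"
begin

sublocale M: module R "Chain C n" for n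
  using cx by (simp add: chain_complex_def)

lemma d_hom: "diff C n \<in> module_hom R (Chain C n) (Chain C (n - 1))"
  using cx by (simp add: chain_complex_def)

sublocale d: mod_hom R "Chain C n" "Chain C (n - 1)" "diff C n" for n
  by unfold_locales (rule d_hom)

lemma d_closed [simp, intro]: "x \<in> carrier (Chain C n) \<Longrightarrow> diff C n x \<in> carrier (Chain C (n - 1))"
  using d_hom by (auto simp: module_hom_def)

text \<open>Rules with suffix \<open>_1\<close> or \<open>_2\<close> are shifted by so many degrees, with \<open>n + 1 - 1\<close> and its like evaluated.\<close>

lemma d_closed_1 [simp, intro]: "x \<in> carrier (Chain C (n + 1)) \<Longrightarrow> diff C (n + 1) x \<in> carrier (Chain C n)"
  using d_closed[of x "n + 1"] by simp

lemma d_closed_2 [simp, intro]: "x \<in> carrier (Chain C (n + 2)) \<Longrightarrow> diff C (n + 2) x \<in> carrier (Chain C (n + 1))"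
  using d_closed[of x "n + 2"] by (simp add: algebra_simps)

lemma d_add: "x \<in> carrier (Chain C n) \<Longrightarrow> y \<in> carrier (Chain C n) \<Longrightarrow>
    diff C n (x \<oplus>\<^bsub>Chain C n\<^esub> y) = diff C n x \<oplus>\<^bsub>Chain C (n - 1)\<^esub> diff C n y"
  using d_hom by (auto simp: module_hom_def)

lemma d_add_2: "x \<in> carrier (Chain C (n + 2)) \<Longrightarrow> y \<in> carrier (Chain C (n + 2)) \<Longrightarrow>
    diff C (n + 2) (x \<oplus>\<^bsub>Chain C (n + 2)\<^esub> y) = diff C (n + 2) x \<oplus>\<^bsub>Chain C (n + 1)\<^esub> diff C (n + 2) y"
  using d_add[of x "n + 2" y] by (simp add: algebra_simps)

lemma d_smult: "a \<in> carrier R \<Longrightarrow> x \<in> carrier (Chain C n) \<Longrightarrow>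
    diff C n (a \<odot>\<^bsub>Chain C n\<^esub> x) = a \<odot>\<^bsub>Chain C (n - 1)\<^esub> diff C n x"
  using d_hom by (auto simp: module_hom_def)

lemma d_zero: "diff C n \<zero>\<^bsub>Chain C n\<^esub> = \<zero>\<^bsub>Chain C (n - 1)\<^esub>"
  by simp

lemma d_minus: "x \<in> carrier (Chain C n) \<Longrightarrow> y \<in> carrier (Chain C n) \<Longrightarrow>
    diff C n (x \<ominus>\<^bsub>Chain C n\<^esub> y) = diff C n x \<ominus>\<^bsub>Chain C (n - 1)\<^esub> diff C n y"
  by (rule d.f_minus)

lemma d_neg: "x \<in> carrier (Chain C n) \<Longrightarrow>
    diff C n (\<ominus>\<^bsub>Chain C n\<^esub> x) = \<ominus>\<^bsub>Chain C (n - 1)\<^esub> diff C n x"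
  by (rule d.f_neg)

lemma dd: "x \<in> carrier (Chain C n) \<Longrightarrow> diff C (n - 1) (diff C n x) = \<zero>\<^bsub>Chain C (n - 2)\<^esub>"
  using cx by (simp add: chain_complex_def)

lemma dd_1: "x \<in> carrier (Chain C (n + 1)) \<Longrightarrow> diff C n (diff C (n + 1) x) = \<zero>\<^bsub>Chain C (n - 1)\<^esub>"
  using dd[of x "n + 1"] by simp

lemma dd_2: "x \<in> carrier (Chain C (n + 2)) \<Longrightarrow> diff C (n + 1) (diff C (n + 2) x) = \<zero>\<^bsub>Chain C n\<^esub>"
  using dd[of x "n + 2"] by (simp add: algebra_simps)

lemma submodule_cycles: "submodule R (cycles C n) (Chain C n)"
  by (rule submodule.intro[OF M.module_axioms])
    (auto simp: cycles_def d_add d_smult)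

lemma submodule_boundaries: "submodule R (boundaries C n) (Chain C n)"
proof (rule submodule.intro[OF M.module_axioms])
  fix v w assume "v \<in> boundaries C n" "w \<in> boundaries C n"
  then obtain x y where xy: "x \<in> carrier (Chain C (n + 1))" "y \<in> carrier (Chain C (n + 1))"
    "v = diff C (n + 1) x" "w = diff C (n + 1) y" by (auto simp: boundaries_def)
  then show "v \<oplus>\<^bsub>Chain C n\<^esub> w \<in> boundaries C n"
    unfolding boundaries_def by (intro image_eqI[of _ _ "x \<oplus>\<^bsub>Chain C (n + 1)\<^esub> y"]) (auto simp: d_add)
next
  fix a v assume "a \<in> carrier R" "v \<in> boundaries C n"
  then obtain x where "a \<in> carrier R" "x \<in> carrier (Chain C (n + 1))" "v = diff C (n + 1) x"
    by (auto simp: boundaries_def)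
  then show "a \<odot>\<^bsub>Chain C n\<^esub> v \<in> boundaries C n"
    unfolding boundaries_def by (intro image_eqI[of _ _ "a \<odot>\<^bsub>Chain C (n + 1)\<^esub> x"]) (auto simp: d_smult)
next
  show "\<zero>\<^bsub>Chain C n\<^esub> \<in> boundaries C n"
    unfolding boundaries_def using d_zero[of "n + 1"] by (intro image_eqI[of _ _ "\<zero>\<^bsub>Chain C (n + 1)\<^esub>"]) auto
qed (auto simp: boundaries_def)

lemma boundaries_subset: "boundaries C n \<subseteq> cycles C n"
proof
  fix z assume "z \<in> boundaries C n"
  then obtain x where "x \<in> carrier (Chain C (n + 1))" "z = diff C (n + 1) x"
    unfolding boundaries_def by blast
  then show "z \<in> cycles C n" by (simp add: cycles_def dd_1)
qed

sublocale H: submodule_pair R "Chain C n" "cycles C n" "boundaries C n" for n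
  by (rule submodule_pair.intro[OF domain_axioms M.module_axioms],
      rule submodule_pair_axioms.intro[OF submodule_cycles submodule_boundaries boundaries_subset])

lemma homology_eq: "homology C n = subquotient (Chain C n) (cycles C n) (boundaries C n)"
  by (simp add: homology_def subquotient_def)

end

locale cmap = C: complex_over R C + D: complex_over R D
  for R :: "('a, 'r) ring_scheme" (structure) and C :: "('a, 'u) module_complex"
    and f :: "int \<Rightarrow> 'u \<Rightarrow> 'u" and D :: "('a, 'u) module_complex" +
  assumes chain_map: "is_chain_map R C f D"
begin

lemma f_hom: "f n \<in> module_hom R (Chain C n) (Chain D n)"
  using chain_map by (auto simp: is_chain_map_def)

sublocale f: mod_hom R "Chain C n" "Chain D n" "f n" for n
  by unfold_locales (rule f_hom)

lemma f_closed [simp, intro]: "x \<in> carrier (Chain C n) \<Longrightarrow> f n x \<in> carrier (Chain D n)"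
  using f_hom by (auto simp: module_hom_def)

lemma f_add: "x \<in> carrier (Chain C n) \<Longrightarrow> y \<in> carrier (Chain C n) \<Longrightarrow>
    f n (x \<oplus>\<^bsub>Chain C n\<^esub> y) = f n x \<oplus>\<^bsub>Chain D n\<^esub> f n y"
  using f_hom by (auto simp: module_hom_def)

lemma f_smult: "a \<in> carrier R \<Longrightarrow> x \<in> carrier (Chain C n) \<Longrightarrow>
    f n (a \<odot>\<^bsub>Chain C n\<^esub> x) = a \<odot>\<^bsub>Chain D n\<^esub> f n x"
  using f_hom by (auto simp: module_hom_def)

lemma f_zero: "f n \<zero>\<^bsub>Chain C n\<^esub> = \<zero>\<^bsub>Chain D n\<^esub>"
  by simp

lemma f_minus: "x \<in> carrier (Chain C n) \<Longrightarrow> y \<in> carrier (Chain C n) \<Longrightarrow>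
    f n (x \<ominus>\<^bsub>Chain C n\<^esub> y) = f n x \<ominus>\<^bsub>Chain D n\<^esub> f n y"
  by (rule f.f_minus)

lemma f_neg: "x \<in> carrier (Chain C n) \<Longrightarrow>
    f n (\<ominus>\<^bsub>Chain C n\<^esub> x) = \<ominus>\<^bsub>Chain D n\<^esub> f n x"
  by (rule f.f_neg)

lemma d_f: "x \<in> carrier (Chain C n) \<Longrightarrow> diff D n (f n x) = f (n - 1) (diff C n x)"
  using chain_map by (auto simp: is_chain_map_def)

lemma d_f_1: "x \<in> carrier (Chain C (n + 1)) \<Longrightarrow> diff D (n + 1) (f (n + 1) x) = f n (diff C (n + 1) x)"
  using d_f[of x "n + 1"] by simp

lemma d_f_2: "x \<in> carrier (Chain C (n + 2)) \<Longrightarrow>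
    diff D (n + 2) (f (n + 2) x) = f (n + 1) (diff C (n + 2) x)"
  using d_f[of x "n + 2"] by (simp add: algebra_simps)

lemma f_cycles: "x \<in> cycles C n \<Longrightarrow> f n x \<in> cycles D n"
  by (auto simp: cycles_def d_f)

lemma f_boundaries: "x \<in> boundaries C n \<Longrightarrow> f n x \<in> boundaries D n"
  unfolding boundaries_def using d_f_1[of _ n] by force

lemma homology_map_cls:
  assumes "x \<in> cycles C n"
  shows "homology_map f D n (C.H.cls n x) = D.H.cls n (f n x)"
proof -
  have "homology_map f D n (C.H.cls n x) = (\<Union>z\<in>C.H.cls n x. D.H.cls n (f n z))"
    by (simp add: homology_map_def D.H.cls_def)
  also have "\<dots> = D.H.cls n (f n x)"
  proof -
    have x: "x \<in> carrier (Chain C n)" using assms by (simp add: cycles_def)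
    have "D.H.cls n (f n z) = D.H.cls n (f n x)" if z: "z \<in> C.H.cls n x" for z
    proof -
      from z obtain h where h: "h \<in> boundaries C n" "z = h \<oplus>\<^bsub>Chain C n\<^esub> x"
        by (auto simp: C.H.mem_cls)
      then have hc: "h \<in> carrier (Chain C n)" using C.H.X_in by blast
      have "f n z \<ominus>\<^bsub>Chain D n\<^esub> f n x = f n h"
        using h hc x by (simp add: f_add D.M.minus_eq D.M.a_assoc D.M.r_neg)
      then show ?thesis using h hc x f_boundaries by (subst D.H.cls_eq_iff) auto
    qed
    moreover have "x \<in> C.H.cls n x"
      using x C.H.X.zero_closed[of n] by (metis C.M.l_zero C.H.mem_cls)
    ultimately show ?thesis by blast
  qed
  finally show ?thesis .
qed

lemma homology_map_inj_iff:
  "inj_on (homology_map f D n) (carrier (homology C n)) \<longleftrightarrow>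
     (\<forall>x\<in>cycles C n. f n x \<in> boundaries D n \<longrightarrow> x \<in> boundaries C n)"
proof
  assume inj: "inj_on (homology_map f D n) (carrier (homology C n))"
  show "\<forall>x\<in>cycles C n. f n x \<in> boundaries D n \<longrightarrow> x \<in> boundaries C n"
  proof (intro ballI impI)
    fix x assume x: "x \<in> cycles C n" "f n x \<in> boundaries D n"
    have z: "\<zero>\<^bsub>Chain C n\<^esub> \<in> cycles C n" by (rule C.H.Y.zero_closed)
    have xc: "x \<in> carrier (Chain C n)" using x(1) by (rule C.H.Y_in)
    have "homology_map f D n (C.H.cls n x) = homology_map f D n (C.H.cls n \<zero>\<^bsub>Chain C n\<^esub>)"
      unfolding homology_map_cls[OF x(1)] homology_map_cls[OF z]
      using x(2) xc D.M.minus_add_cancel[of "f n x" n "\<zero>\<^bsub>Chain D n\<^esub>"] by (subst D.H.cls_eq_iff) auto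
    then have "C.H.cls n x = C.H.cls n \<zero>\<^bsub>Chain C n\<^esub>"
      using inj x(1) z by (auto simp: inj_on_def C.homology_eq C.H.SQ_carrier)
    then have "x \<ominus>\<^bsub>Chain C n\<^esub> \<zero>\<^bsub>Chain C n\<^esub> \<in> boundaries C n"
      using xc by (subst (asm) C.H.cls_eq_iff) auto
    then show "x \<in> boundaries C n"
      using xc C.M.minus_add_cancel[of x n "\<zero>\<^bsub>Chain C n\<^esub>"] by simp
  qed
next
  assume *: "\<forall>x\<in>cycles C n. f n x \<in> boundaries D n \<longrightarrow> x \<in> boundaries C n"
  show "inj_on (homology_map f D n) (carrier (homology C n))"
  proof (rule inj_onI, unfold C.homology_eq C.H.SQ_carrier, elim imageE)
    fix X X' x x' assume X: "X = C.H.cls n x" "x \<in> cycles C n" and X': "X' = C.H.cls n x'" "x' \<in> cycles C n"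
      and eq: "homology_map f D n X = homology_map f D n X'"
    have xc: "x \<in> carrier (Chain C n)" "x' \<in> carrier (Chain C n)" using X X' C.H.Y_in by auto
    from eq X X' have "D.H.cls n (f n x) = D.H.cls n (f n x')" by (simp add: homology_map_cls)
    then have "f n (x \<ominus>\<^bsub>Chain C n\<^esub> x') \<in> boundaries D n"
      using xc by (subst (asm) D.H.cls_eq_iff) (auto simp: f_minus)
    then have "x \<ominus>\<^bsub>Chain C n\<^esub> x' \<in> boundaries C n"
      using * X X' C.H.Y_minus by blast
    then show "X = X'" using X X' xc by (simp add: C.H.cls_eq_iff)
  qed
qed

lemma homology_map_surj_iff:
  "homology_map f D n ` carrier (homology C n) = carrier (homology D n) \<longleftrightarrow>
     (\<forall>z\<in>cycles D n. \<exists>x\<in>cycles C n. z \<ominus>\<^bsub>Chain D n\<^esub> f n x \<in> boundaries D n)"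
proof -
  have 1: "homology_map f D n ` carrier (homology C n) = (\<lambda>x. D.H.cls n (f n x)) ` cycles C n"
    unfolding C.homology_eq C.H.SQ_carrier image_image by (rule image_cong) (auto simp: homology_map_cls)
  have 2: "(D.H.cls n z = D.H.cls n (f n x)) = (z \<ominus>\<^bsub>Chain D n\<^esub> f n x \<in> boundaries D n)"
    if "z \<in> cycles D n" "x \<in> cycles C n" for x z
    using that D.H.Y_in C.H.Y_in by (intro D.H.cls_eq_iff) auto
  have 3: "(\<lambda>x. D.H.cls n (f n x)) ` cycles C n \<subseteq> carrier (homology D n)"
    unfolding D.homology_eq D.H.SQ_carrier using f_cycles by blast
  have "carrier (homology D n) \<subseteq> (\<lambda>x. D.H.cls n (f n x)) ` cycles C n \<longleftrightarrow>
     (\<forall>z\<in>cycles D n. \<exists>x\<in>cycles C n. z \<ominus>\<^bsub>Chain D n\<^esub> f n x \<in> boundaries D n)"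
    unfolding D.homology_eq D.H.SQ_carrier
    by (simp add: image_subset_iff image_iff 2 cong: ball_cong bex_cong)
  with 1 3 show ?thesis by auto
qed

text \<open>A pair \<open>(x, w)\<close> as below is a cycle of the mapping cone of \<open>f\<close> up to sign, and \<open>(y, v)\<close> bounds it. In
  contrast to bijectivity on homology, this form combines the two halves of a quasi-isomorphism in one
  lifting property, and diagram chases with it need no choice of homology classes.\<close>

definition cone_acyclic where
  "cone_acyclic \<longleftrightarrow> (\<forall>n. \<forall>x\<in>carrier (Chain C n). \<forall>w\<in>carrier (Chain D (n + 1)).
     diff C n x = \<zero>\<^bsub>Chain C (n - 1)\<^esub> \<longrightarrow> f n x = diff D (n + 1) w \<longrightarrow>
     (\<exists>y\<in>carrier (Chain C (n + 1)). \<exists>v\<in>carrier (Chain D (n + 2)).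
        x = diff C (n + 1) y \<and> w = f (n + 1) y \<oplus>\<^bsub>Chain D (n + 1)\<^esub> diff D (n + 2) v))"

lemma cone_acyclicD:
  assumes "cone_acyclic" "x \<in> carrier (Chain C n)" "w \<in> carrier (Chain D (n + 1))"
    "diff C n x = \<zero>\<^bsub>Chain C (n - 1)\<^esub>" "f n x = diff D (n + 1) w"
  obtains y v where "y \<in> carrier (Chain C (n + 1))" "v \<in> carrier (Chain D (n + 2))"
    "x = diff C (n + 1) y" "w = f (n + 1) y \<oplus>\<^bsub>Chain D (n + 1)\<^esub> diff D (n + 2) v"
  using assms unfolding cone_acyclic_def by meson

lemma cone_acyclicD':
  assumes "cone_acyclic" "x \<in> carrier (Chain C (n - 1))" "w \<in> carrier (Chain D n)"
    "diff C (n - 1) x = \<zero>\<^bsub>Chain C (n - 2)\<^esub>" "f (n - 1) x = diff D n w"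
  obtains y v where "y \<in> carrier (Chain C n)" "v \<in> carrier (Chain D (n + 1))"
    "x = diff C n y" "w = f n y \<oplus>\<^bsub>Chain D n\<^esub> diff D (n + 1) v"
proof -
  have e: "n - 1 + 1 = n" "n - 1 - 1 = n - 2" "n - 1 + 2 = n + 1" by simp_all
  show thesis
    by (rule cone_acyclicD[of x "n - 1" w, unfolded e, OF assms]) (rule that)
qed

text \<open>Injectivity on homology makes \<open>x\<close> a boundary, and surjectivity corrects \<open>y\<close> so that
  \<open>f y\<close> agrees with \<open>w\<close> up to a boundary.
  Conversely, injectivity is the case of a boundary \<open>f x = d w\<close>, and surjectivity the case \<open>x = 0\<close>.\<close>

theorem quasi_isomorphism_iff: "quasi_isomorphism C f D \<longleftrightarrow> cone_acyclic"
proof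
  assume "quasi_isomorphism C f D"
  then have qi: "(\<forall>x\<in>cycles C n. f n x \<in> boundaries D n \<longrightarrow> x \<in> boundaries C n) \<and>
      (\<forall>z\<in>cycles D n. \<exists>x\<in>cycles C n. z \<ominus>\<^bsub>Chain D n\<^esub> f n x \<in> boundaries D n)" for n
    unfolding quasi_isomorphism_def bij_betw_def homology_map_inj_iff homology_map_surj_iff by (rule spec)
  have inj: "x \<in> boundaries C n" if "x \<in> cycles C n" "f n x \<in> boundaries D n" for n x
    using qi[of n] that by simp
  have surj: "\<exists>x\<in>cycles C n. z \<ominus>\<^bsub>Chain D n\<^esub> f n x \<in> boundaries D n" if "z \<in> cycles D n" for n z
    using qi[of n] that by simp
  show cone_acyclic
    unfolding cone_acyclic_def
  proof (intro allI ballI impI)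
    fix n x w assume x: "x \<in> carrier (Chain C n)" and w: "w \<in> carrier (Chain D (n + 1))"
      and dx: "diff C n x = \<zero>\<^bsub>Chain C (n - 1)\<^esub>" and fx: "f n x = diff D (n + 1) w"
    have "x \<in> boundaries C n"
      using x dx w fx by (intro inj) (auto simp: cycles_def boundaries_def)
    then obtain y where y: "y \<in> carrier (Chain C (n + 1))" "x = diff C (n + 1) y"
      by (auto simp: boundaries_def)
    have "w \<ominus>\<^bsub>Chain D (n + 1)\<^esub> f (n + 1) y \<in> cycles D (n + 1)"
      using w y fx by (simp add: cycles_def D.d_minus d_f)
    from surj[OF this] obtain y' v where y': "y' \<in> cycles C (n + 1)" and v: "v \<in> carrier (Chain D (n + 2))"
      "(w \<ominus>\<^bsub>Chain D (n + 1)\<^esub> f (n + 1) y) \<ominus>\<^bsub>Chain D (n + 1)\<^esub> f (n + 1) y' = diff D (n + 2) v"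
      by (auto simp: boundaries_def add.assoc)
    have y'c: "y' \<in> carrier (Chain C (n + 1))" "diff C (n + 1) y' = \<zero>\<^bsub>Chain C n\<^esub>"
      using y' by (auto simp: cycles_def)
    have "w = (w \<ominus>\<^bsub>Chain D (n + 1)\<^esub> f (n + 1) y) \<oplus>\<^bsub>Chain D (n + 1)\<^esub> f (n + 1) y"
      using w y by (simp add: D.M.minus_add_cancel)
    also have "w \<ominus>\<^bsub>Chain D (n + 1)\<^esub> f (n + 1) y = diff D (n + 2) v \<oplus>\<^bsub>Chain D (n + 1)\<^esub> f (n + 1) y'"
      unfolding v(2)[symmetric] using w y y'c by (simp add: D.M.minus_add_cancel)
    finally have "w = f (n + 1) (y \<oplus>\<^bsub>Chain C (n + 1)\<^esub> y') \<oplus>\<^bsub>Chain D (n + 1)\<^esub> diff D (n + 2) v"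
      using v(1) y y'c by (simp add: f_add D.M.a_ac)
    moreover have "x = diff C (n + 1) (y \<oplus>\<^bsub>Chain C (n + 1)\<^esub> y')"
      using y y'c by (simp add: C.d_add)
    ultimately show "\<exists>y\<in>carrier (Chain C (n + 1)). \<exists>v\<in>carrier (Chain D (n + 2)).
        x = diff C (n + 1) y \<and> w = f (n + 1) y \<oplus>\<^bsub>Chain D (n + 1)\<^esub> diff D (n + 2) v"
      using y y'c v(1) by (intro bexI[of _ "y \<oplus>\<^bsub>Chain C (n + 1)\<^esub> y'"] bexI[of _ v]) auto
  qed
next
  assume *: cone_acyclic
  show "quasi_isomorphism C f D"
    unfolding quasi_isomorphism_def bij_betw_def homology_map_inj_iff homology_map_surj_iff
  proof (intro allI conjI ballI impI)
    fix n x assume "x \<in> cycles C n" "f n x \<in> boundaries D n"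
    then obtain w where "x \<in> carrier (Chain C n)" "diff C n x = \<zero>\<^bsub>Chain C (n - 1)\<^esub>"
      "w \<in> carrier (Chain D (n + 1))" "f n x = diff D (n + 1) w"
      by (auto simp: cycles_def boundaries_def)
    with * show "x \<in> boundaries C n"
      unfolding boundaries_def by (metis cone_acyclicD imageI)
  next
    fix n z assume z: "z \<in> cycles D n"
    from z have zc: "z \<in> carrier (Chain D n)"
      and fz: "f (n - 1) \<zero>\<^bsub>Chain C (n - 1)\<^esub> = diff D n z"
      by (simp_all add: cycles_def)
    have d0: "diff C (n - 1) \<zero>\<^bsub>Chain C (n - 1)\<^esub> = \<zero>\<^bsub>Chain C (n - 2)\<^esub>"
      using C.d_zero[of "n - 1"] by simp
    obtain y v where "y \<in> carrier (Chain C n)" "v \<in> carrier (Chain D (n + 1))"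
      "\<zero>\<^bsub>Chain C (n - 1)\<^esub> = diff C n y" "z = f n y \<oplus>\<^bsub>Chain D n\<^esub> diff D (n + 1) v"
      by (rule cone_acyclicD'[OF * C.M.zero_closed zc d0 fz])
    moreover from this have "z \<ominus>\<^bsub>Chain D n\<^esub> f n y = diff D (n + 1) v"
      using D.M.add3_minus[of "f n y" n "\<zero>\<^bsub>Chain D n\<^esub>" "diff D (n + 1) v"] by simp
    ultimately show "\<exists>x\<in>cycles C n. z \<ominus>\<^bsub>Chain D n\<^esub> f n x \<in> boundaries D n"
      by (intro bexI[of _ y]) (auto simp: cycles_def boundaries_def)
  qed
qed

end

section \<open>Short exact sequences of complexes\<close>

locale short_exact = A: complex_over R A + B: complex_over R B + C: complex_over R C +
    i: cmap R A i B + p: cmap R B p C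
  for R :: "('a, 'r) ring_scheme" (structure) 
    and A :: "('a, 'u) module_complex" and i and B :: "('a, 'u) module_complex" and p
    and C :: "('a, 'u) module_complex" +
  assumes i_inj: "x \<in> carrier (Chain A n) \<Longrightarrow> i n x = \<zero>\<^bsub>Chain B n\<^esub> \<Longrightarrow> x = \<zero>\<^bsub>Chain A n\<^esub>"
    and p_surj: "z \<in> carrier (Chain C n) \<Longrightarrow> \<exists>y\<in>carrier (Chain B n). z = p n y"
    and p_i: "x \<in> carrier (Chain A n) \<Longrightarrow> p n (i n x) = \<zero>\<^bsub>Chain C n\<^esub>"
    and ker_p: "y \<in> carrier (Chain B n) \<Longrightarrow> p n y = \<zero>\<^bsub>Chain C n\<^esub> \<Longrightarrow> \<exists>x\<in>carrier (Chain A n). y = i n x"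
begin

lemma i_eq: "x \<in> carrier (Chain A n) \<Longrightarrow> y \<in> carrier (Chain A n) \<Longrightarrow> i n x = i n y \<Longrightarrow> x = y"
  using i_inj[of "x \<ominus>\<^bsub>Chain A n\<^esub> y" n] by (simp add: i.f_minus)

end

locale short_exact_map = S: short_exact R A i B p C + S': short_exact R A' i' B' p' C' +
    a: cmap R A a A' + b: cmap R B b B' + c: cmap R C c C'
  for R :: "('a, 'r) ring_scheme" (structure)
    and A :: "('a, 'u) module_complex" and i and B :: "('a, 'u) module_complex" and p
    and C :: "('a, 'u) module_complex"
    and A' :: "('a, 'u) module_complex" and i' and B' :: "('a, 'u) module_complex" and p'
    and C' :: "('a, 'u) module_complex" and a b c +
  assumes b_i: "x \<in> carrier (Chain A n) \<Longrightarrow> b n (i n x) = i' n (a n x)"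
    and c_p: "y \<in> carrier (Chain B n) \<Longrightarrow> c n (p n y) = p' n (b n y)"
begin

text \<open>A chase in the mapping cones. The cone cycle \<open>(z, z')\<close> lifts to \<open>(y, y')\<close>, whose boundary comes from a cone
  cycle \<open>(x, x')\<close> of \<open>a\<close>. That cycle is bounded by \<open>(s, s')\<close>, and after subtracting the latter \<open>(y, y')\<close> is a cycle
  of the cone of \<open>b\<close>, bounded by \<open>(t, t')\<close>.\<close>

lemma quotient_quasi_isomorphism:
  assumes a: "quasi_isomorphism A a A'" and b: "quasi_isomorphism B b B'"
  shows "quasi_isomorphism C c C'"
  unfolding c.quasi_isomorphism_iff c.cone_acyclic_def
proof (intro allI ballI impI)
  fix n z z' assume z: "z \<in> carrier (Chain C n)" and z': "z' \<in> carrier (Chain C' (n + 1))"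
    and dz: "diff C n z = \<zero>\<^bsub>Chain C (n - 1)\<^esub>" and cz: "c n z = diff C' (n + 1) z'"
  from S.p_surj[OF z] obtain y where y: "y \<in> carrier (Chain B n)" "z = p n y" by blast
  from S'.p_surj[OF z'] obtain y' where y': "y' \<in> carrier (Chain B' (n + 1))" "z' = p' (n + 1) y'" by blast
  have "p (n - 1) (diff B n y) = \<zero>\<^bsub>Chain C (n - 1)\<^esub>" using y dz by (simp flip: S.p.d_f)
  then obtain x where x: "x \<in> carrier (Chain A (n - 1))" "diff B n y = i (n - 1) x"
    using S.ker_p y by blast
  have "p' n (b n y \<ominus>\<^bsub>Chain B' n\<^esub> diff B' (n + 1) y') = \<zero>\<^bsub>Chain C' n\<^esub>"
    using y y' cz c_p[of y n] S'.p.d_f_1[of y' n] by (simp add: S'.p.f_minus)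
  then obtain x' where x': "x' \<in> carrier (Chain A' n)"
    "b n y \<ominus>\<^bsub>Chain B' n\<^esub> diff B' (n + 1) y' = i' n x'"
    using S'.ker_p[of "b n y \<ominus>\<^bsub>Chain B' n\<^esub> diff B' (n + 1) y'" n] y y' by auto
  have by_eq: "b n y = i' n x' \<oplus>\<^bsub>Chain B' n\<^esub> diff B' (n + 1) y'"
    unfolding x'(2)[symmetric] using y y' by (simp add: S'.B.M.minus_add_cancel)
  have dx: "diff A (n - 1) x = \<zero>\<^bsub>Chain A (n - 2)\<^esub>"
  proof (rule S.i_inj)
    show "i (n - 2) (diff A (n - 1) x) = \<zero>\<^bsub>Chain B (n - 2)\<^esub>"
      using x y S.i.d_f[of x "n - 1"] S.B.dd[of y n] by simp
  qed (use x S.A.d_closed[of x "n - 1"] in simp)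
  have ax: "a (n - 1) x = diff A' n x'"
  proof (rule S'.i_eq)
    have "i' (n - 1) (a (n - 1) x) = b (n - 1) (diff B n y)" using x by (simp add: b_i)
    also have "\<dots> = diff B' n (b n y)" using y by (simp add: b.d_f)
    also have "\<dots> = i' (n - 1) (diff A' n x')"
      unfolding by_eq using x' y' by (simp add: S'.B.d_add S'.B.dd_1 S'.i.d_f)
    finally show "i' (n - 1) (a (n - 1) x) = i' (n - 1) (diff A' n x')" .
  qed (use x x' in auto)
  obtain s s' where s: "s \<in> carrier (Chain A n)" "s' \<in> carrier (Chain A' (n + 1))"
    "x = diff A n s" "x' = a n s \<oplus>\<^bsub>Chain A' n\<^esub> diff A' (n + 1) s'"
    by (rule a.cone_acyclicD'[OF a[unfolded a.quasi_isomorphism_iff] x(1) x'(1) dx ax])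
  let ?y = "y \<ominus>\<^bsub>Chain B n\<^esub> i n s" and ?y' = "i' (n + 1) s' \<oplus>\<^bsub>Chain B' (n + 1)\<^esub> y'"
  have "b n ?y = (i' n (a n s) \<oplus>\<^bsub>Chain B' n\<^esub> i' n (diff A' (n + 1) s') \<oplus>\<^bsub>Chain B' n\<^esub> diff B' (n + 1) y')
      \<ominus>\<^bsub>Chain B' n\<^esub> i' n (a n s)"
    using s y y' by (simp add: b.f_minus b_i by_eq S'.i.f_add)
  also have "\<dots> = diff B' (n + 1) ?y'"
    using s y' S'.i.d_f_1[of s' n] by (simp add: S'.B.M.add3_minus S'.B.d_add)
  finally have by': "b n ?y = diff B' (n + 1) ?y'" .
  have dy: "diff B n ?y = \<zero>\<^bsub>Chain B (n - 1)\<^esub>"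
    using y s x by (simp add: S.B.d_minus S.i.d_f)
  obtain t t' where t: "t \<in> carrier (Chain B (n + 1))" "t' \<in> carrier (Chain B' (n + 2))"
    "?y = diff B (n + 1) t" "?y' = b (n + 1) t \<oplus>\<^bsub>Chain B' (n + 1)\<^esub> diff B' (n + 2) t'"
    using b.cone_acyclicD[OF b[unfolded b.quasi_isomorphism_iff], of ?y n ?y'] y y' s dy by' by auto
  have "z = p n (?y \<oplus>\<^bsub>Chain B n\<^esub> i n s)" using y s by (simp add: S.B.M.minus_add_cancel)
  also have "\<dots> = p n (diff B (n + 1) t)" using t s by (simp add: S.p.f_add S.p_i)
  also have "\<dots> = diff C (n + 1) (p (n + 1) t)" using t S.p.d_f_1[of t n] by simp
  finally have 1: "z = diff C (n + 1) (p (n + 1) t)" .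
  have "z' = p' (n + 1) ?y'" using y' s by (simp add: S'.p.f_add S'.p_i)
  also have "\<dots> = c (n + 1) (p (n + 1) t) \<oplus>\<^bsub>Chain C' (n + 1)\<^esub> diff C' (n + 2) (p' (n + 2) t')"
    unfolding t(4) using t S'.p.d_f_2[of t' n] by (simp add: S'.p.f_add c_p)
  finally show "\<exists>y\<in>carrier (Chain C (n + 1)). \<exists>v\<in>carrier (Chain C' (n + 2)).
      z = diff C (n + 1) y \<and> z' = c (n + 1) y \<oplus>\<^bsub>Chain C' (n + 1)\<^esub> diff C' (n + 2) v"
    using 1 t by (intro bexI[of _ "p (n + 1) t"] bexI[of _ "p' (n + 2) t'"]) auto
qed

text \<open>The image \<open>(z, z')\<close> bounds the image of \<open>(y, y')\<close> in the cone of \<open>c\<close>. Subtracting the boundary of a lift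
  \<open>(t, t')\<close> leaves a cycle \<open>(x, x')\<close> of the cone of \<open>a\<close>, which is bounded by \<open>(s, s')\<close>.\<close>

lemma middle_quasi_isomorphism:
  assumes a: "quasi_isomorphism A a A'" and c: "quasi_isomorphism C c C'"
  shows "quasi_isomorphism B b B'"
  unfolding b.quasi_isomorphism_iff b.cone_acyclic_def
proof (intro allI ballI impI)
  fix n y y' assume y: "y \<in> carrier (Chain B n)" and y': "y' \<in> carrier (Chain B' (n + 1))"
    and dy: "diff B n y = \<zero>\<^bsub>Chain B (n - 1)\<^esub>" and by_eq: "b n y = diff B' (n + 1) y'"
  have dz: "diff C n (p n y) = \<zero>\<^bsub>Chain C (n - 1)\<^esub>" using y dy by (simp add: S.p.d_f)
  have cz: "c n (p n y) = diff C' (n + 1) (p' (n + 1) y')"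
    using y y' by_eq S'.p.d_f_1[of y' n] by (simp add: c_p)
  obtain z z' where z: "z \<in> carrier (Chain C (n + 1))" "z' \<in> carrier (Chain C' (n + 2))"
    "p n y = diff C (n + 1) z" "p' (n + 1) y' = c (n + 1) z \<oplus>\<^bsub>Chain C' (n + 1)\<^esub> diff C' (n + 2) z'"
    using c.cone_acyclicD[OF c[unfolded c.quasi_isomorphism_iff] _ _ dz cz] y y' by auto
  from S.p_surj[OF z(1)] obtain t where t: "t \<in> carrier (Chain B (n + 1))" "z = p (n + 1) t" by blast
  from S'.p_surj[OF z(2)] obtain t' where t': "t' \<in> carrier (Chain B' (n + 2))" "z' = p' (n + 2) t'" by blast
  let ?u = "b (n + 1) t \<oplus>\<^bsub>Chain B' (n + 1)\<^esub> diff B' (n + 2) t'"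
  have "p n (y \<ominus>\<^bsub>Chain B n\<^esub> diff B (n + 1) t) = \<zero>\<^bsub>Chain C n\<^esub>"
    using y t z S.p.d_f_1[of t n] by (simp add: S.p.f_minus)
  then obtain x where x: "x \<in> carrier (Chain A n)" "y \<ominus>\<^bsub>Chain B n\<^esub> diff B (n + 1) t = i n x"
    using S.ker_p[of "y \<ominus>\<^bsub>Chain B n\<^esub> diff B (n + 1) t" n] y t by auto
  have y_eq: "y = i n x \<oplus>\<^bsub>Chain B n\<^esub> diff B (n + 1) t"
    unfolding x(2)[symmetric] using y t by (simp add: S.B.M.minus_add_cancel)
  have "p' (n + 1) (y' \<ominus>\<^bsub>Chain B' (n + 1)\<^esub> ?u) = \<zero>\<^bsub>Chain C' (n + 1)\<^esub>"
    using y' t t' z S'.p.d_f_2[of t' n] by (simp add: S'.p.f_minus S'.p.f_add c_p)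
  then obtain x' where x': "x' \<in> carrier (Chain A' (n + 1))" "y' \<ominus>\<^bsub>Chain B' (n + 1)\<^esub> ?u = i' (n + 1) x'"
    using S'.ker_p[of "y' \<ominus>\<^bsub>Chain B' (n + 1)\<^esub> ?u" "n + 1"] y' t t' by auto
  have y'_eq: "y' = i' (n + 1) x' \<oplus>\<^bsub>Chain B' (n + 1)\<^esub> ?u"
    unfolding x'(2)[symmetric] using y' t t' by (simp add: S'.B.M.minus_add_cancel)
  have dx: "diff A n x = \<zero>\<^bsub>Chain A (n - 1)\<^esub>"
  proof (rule S.i_inj)
    have "diff B n (i n x \<oplus>\<^bsub>Chain B n\<^esub> diff B (n + 1) t) = \<zero>\<^bsub>Chain B (n - 1)\<^esub>"
      using dy y_eq by simp
    then show "i (n - 1) (diff A n x) = \<zero>\<^bsub>Chain B (n - 1)\<^esub>"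
      using x t by (simp add: S.B.d_add S.B.dd_1 S.i.d_f)
  qed (use x in auto)
  have ax: "a n x = diff A' (n + 1) x'"
  proof (rule S'.i_eq)
    have "i' n (a n x) \<oplus>\<^bsub>Chain B' n\<^esub> b n (diff B (n + 1) t) = b n y"
      unfolding y_eq using x t by (simp add: b.f_add b_i)
    also have "\<dots> = diff B' (n + 1) (i' (n + 1) x' \<oplus>\<^bsub>Chain B' (n + 1)\<^esub> ?u)"
      using by_eq y'_eq by simp
    also have "\<dots> = i' n (diff A' (n + 1) x') \<oplus>\<^bsub>Chain B' n\<^esub> b n (diff B (n + 1) t)"
      using x' t t' S'.i.d_f_1[of x' n] b.d_f_1[of t n] by (simp add: S'.B.d_add S'.B.dd_2)
    finally show "i' n (a n x) = i' n (diff A' (n + 1) x')"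
      using x x' t by simp
  qed (use x x' in auto)
  obtain s s' where s: "s \<in> carrier (Chain A (n + 1))" "s' \<in> carrier (Chain A' (n + 2))"
    "x = diff A (n + 1) s" "x' = a (n + 1) s \<oplus>\<^bsub>Chain A' (n + 1)\<^esub> diff A' (n + 2) s'"
    using a.cone_acyclicD[OF a[unfolded a.quasi_isomorphism_iff] x(1) x'(1) dx ax] by auto
  have 1: "y = diff B (n + 1) (i (n + 1) s \<oplus>\<^bsub>Chain B (n + 1)\<^esub> t)"
    unfolding y_eq s(3) using s t S.i.d_f_1[of s n] by (simp add: S.B.d_add)
  have "y' = (b (n + 1) (i (n + 1) s) \<oplus>\<^bsub>Chain B' (n + 1)\<^esub> diff B' (n + 2) (i' (n + 2) s'))
      \<oplus>\<^bsub>Chain B' (n + 1)\<^esub> ?u"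
    unfolding y'_eq s(4) using s t t' S'.i.d_f_2[of s' n] by (simp add: S'.i.f_add b_i)
  also have "\<dots> = b (n + 1) (i (n + 1) s \<oplus>\<^bsub>Chain B (n + 1)\<^esub> t) \<oplus>\<^bsub>Chain B' (n + 1)\<^esub>
      diff B' (n + 2) (i' (n + 2) s' \<oplus>\<^bsub>Chain B' (n + 2)\<^esub> t')"
    using s t t' by (simp add: b.f_add S'.B.d_add_2 S'.B.M.a_ac del: S'.B.d.f_add)
  finally show "\<exists>u\<in>carrier (Chain B (n + 1)). \<exists>v\<in>carrier (Chain B' (n + 2)).
      y = diff B (n + 1) u \<and> y' = b (n + 1) u \<oplus>\<^bsub>Chain B' (n + 1)\<^esub> diff B' (n + 2) v"
    using 1 s t t' by (intro bexI[of _ "i (n + 1) s \<oplus>\<^bsub>Chain B (n + 1)\<^esub> t"]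
        bexI[of _ "i' (n + 2) s' \<oplus>\<^bsub>Chain B' (n + 2)\<^esub> t'"]) auto
qed

end

section \<open>Ranks in the long exact homology sequence\<close>

lemma (in mod_hom) image_submodule:
  assumes "submodule R Y M" shows "submodule R (f ` Y) N"
proof -
  interpret Y: submodule R Y M by fact
  show ?thesis
  proof (rule submodule.intro[OF N.module_axioms])
    show "f ` Y \<subseteq> carrier N" using Y.subset f_im by blast
    show "\<zero>\<^bsub>N\<^esub> \<in> f ` Y" using Y.zero_closed f0_is_0 by (metis imageI)
    fix v w assume "v \<in> f ` Y" "w \<in> f ` Y"
    then obtain x y where xy: "x \<in> Y" "y \<in> Y" "v = f x" "w = f y" by blast
    then have "v \<oplus>\<^bsub>N\<^esub> w = f (x \<oplus>\<^bsub>M\<^esub> y)" using Y.subset by (simp add: subset_iff)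
    with xy show "v \<oplus>\<^bsub>N\<^esub> w \<in> f ` Y" by simp
  next
    fix c v assume c: "c \<in> carrier R" and "v \<in> f ` Y"
    then obtain x where x: "x \<in> Y" "v = f x" by blast
    then have "c \<odot>\<^bsub>N\<^esub> v = f (c \<odot>\<^bsub>M\<^esub> x)" using Y.subset c by (simp add: subset_iff)
    with x c show "c \<odot>\<^bsub>N\<^esub> v \<in> f ` Y" by simp
  qed
qed

lemma (in mod_hom) preimage_submodule:
  assumes "submodule R Y M" "submodule R X N" shows "submodule R {y \<in> Y. f y \<in> X} M"
proof -
  interpret Y: submodule R Y M by fact
  interpret X: submodule R X N by fact
  have [simp]: "y \<in> carrier M" if "y \<in> Y" for y using Y.subset that by blast
  show ?thesis
    by (rule submodule.intro[OF M.module_axioms]) auto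
qed

lemma (in module) sum_submodule:
  assumes "submodule R Y M" "submodule R X M" shows "submodule R {y \<oplus>\<^bsub>M\<^esub> x | y x. y \<in> Y \<and> x \<in> X} M"
proof -
  have "submodule_sum Y X = {y \<oplus>\<^bsub>M\<^esub> x | y x. y \<in> Y \<and> x \<in> X}"
    by (auto simp: submodule_sum_def image_def)
  then show ?thesis using sum_is_submodule[OF assms] by simp
qed

lemma (in module) carrier_submodule: "submodule R (carrier M) M"
  by (rule submodule.intro[OF module_axioms]) auto

lemma sq_rank_same:
  assumes "submodule_pair R M X X" "sq_fin R M X X" shows "sq_rank R M X X = 0"
  using subquotient_rank_filtration(2)[OF assms(1) assms(1,2)] by simp

definition hfin where "hfin R C n \<longleftrightarrow> has_finite_rank R (homology C n)"
definition hrank where "hrank R C n = module_rank R (homology C n)"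

lemma (in complex_over) hfin_eq: "hfin R C n = sq_fin R (Chain C n) (cycles C n) (boundaries C n)"
  by (simp add: hfin_def sq_fin_def homology_eq)

lemma (in complex_over) hrank_eq: "hrank R C n = sq_rank R (Chain C n) (cycles C n) (boundaries C n)"
  by (simp add: hrank_def sq_rank_def homology_eq)

lemma (in complex_over) submodule_pairI:
  "submodule R Y (Chain C n) \<Longrightarrow> submodule R X (Chain C n) \<Longrightarrow> X \<subseteq> Y \<Longrightarrow> submodule_pair R (Chain C n) Y X"
  by (rule submodule_pair.intro[OF domain_axioms M.module_axioms], rule submodule_pair_axioms.intro)

context short_exact
begin

text \<open>The long exact sequence is cut into short pieces, all written as subquotients of chain modules: \<open>K\<close> is the
  kernel of \<open>H A \<rightarrow> H B\<close>, \<open>I\<close> the image of this map and so the kernel of \<open>H B \<rightarrow> H C\<close>, and \<open>P\<close> the image of the latter map,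
  each as a submodule containing the boundaries. The cokernel of \<open>H B \<rightarrow> H C\<close> is isomorphic to \<open>Y/X\<close>, from where the
  differential of \<open>B\<close> leads to \<open>i K\<close> modulo the boundaries of \<open>A\<close>, one degree lower.\<close>

definition K where "K n = {a \<in> cycles A n. i n a \<in> boundaries B n}"
definition I where "I n = {y \<oplus>\<^bsub>Chain B n\<^esub> x | y x. y \<in> i n ` cycles A n \<and> x \<in> boundaries B n}"
definition P where "P n = p n ` cycles B n"
definition Y where "Y n = {b \<in> carrier (Chain B n). p n b \<in> cycles C n}"
definition X where "X n = {y \<oplus>\<^bsub>Chain B n\<^esub> x | y x. y \<in> cycles B n \<and> x \<in> i n ` carrier (Chain A n)}"

lemma cyc: "x \<in> cycles A n \<Longrightarrow> x \<in> carrier (Chain A n)" "y \<in> cycles B n \<Longrightarrow> y \<in> carrier (Chain B n)"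
    "z \<in> cycles C n \<Longrightarrow> z \<in> carrier (Chain C n)"
  by (auto simp: cycles_def)

lemma bnd: "x \<in> boundaries A n \<Longrightarrow> x \<in> carrier (Chain A n)" "y \<in> boundaries B n \<Longrightarrow> y \<in> carrier (Chain B n)"
    "z \<in> boundaries C n \<Longrightarrow> z \<in> carrier (Chain C n)"
  by (erule cyc(1)[OF subsetD[OF A.boundaries_subset]] cyc(2)[OF subsetD[OF B.boundaries_subset]]
      cyc(3)[OF subsetD[OF C.boundaries_subset]])+

lemma sub_K: "submodule R (K n) (Chain A n)"
  unfolding K_def by (rule i.f.preimage_submodule[OF A.submodule_cycles B.submodule_boundaries])

lemma sub_I: "submodule R (I n) (Chain B n)"
  unfolding I_def
  by (rule B.M.sum_submodule[OF i.f.image_submodule[OF A.submodule_cycles] B.submodule_boundaries])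

lemma sub_P: "submodule R (P n) (Chain C n)"
  unfolding P_def by (rule p.f.image_submodule[OF B.submodule_cycles])

lemma sub_Y: "submodule R (Y n) (Chain B n)"
  unfolding Y_def by (rule p.f.preimage_submodule[OF B.M.carrier_submodule C.submodule_cycles])

lemma sub_X: "submodule R (X n) (Chain B n)"
  unfolding X_def
  by (rule B.M.sum_submodule[OF B.submodule_cycles i.f.image_submodule[OF A.M.carrier_submodule]])

lemma K_pair: "submodule_pair R (Chain A n) (K n) (boundaries A n)"
  by (rule A.submodule_pairI[OF sub_K A.submodule_boundaries])
    (use A.boundaries_subset i.f_boundaries in \<open>auto simp: K_def\<close>)

lemma ZK_pair: "submodule_pair R (Chain A n) (cycles A n) (K n)"
  by (rule A.submodule_pairI[OF A.submodule_cycles sub_K]) (auto simp: K_def)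

lemma I_pair: "submodule_pair R (Chain B n) (I n) (boundaries B n)"
proof (rule B.submodule_pairI[OF sub_I B.submodule_boundaries], rule subsetI)
  fix x assume x: "x \<in> boundaries B n"
  have "\<zero>\<^bsub>Chain B n\<^esub> \<in> i n ` cycles A n"
    using i.f_zero[of n] A.H.Y.zero_closed[of n] by (metis imageI)
  then show "x \<in> I n"
    unfolding I_def using x bnd by (intro CollectI exI[of _ "\<zero>\<^bsub>Chain B n\<^esub>"] exI[of _ x]) auto
qed

lemma ZI_pair: "submodule_pair R (Chain B n) (cycles B n) (I n)"
proof (rule B.submodule_pairI[OF B.submodule_cycles sub_I], rule subsetI)
  fix x assume "x \<in> I n"
  then obtain a b where "a \<in> cycles A n" "b \<in> boundaries B n" "x = i n a \<oplus>\<^bsub>Chain B n\<^esub> b"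
    unfolding I_def by blast
  then show "x \<in> cycles B n"
    using i.f_cycles[of a n] subsetD[OF B.boundaries_subset[of n], of b] B.H.Y.m_closed[of "i n a" n b] by simp
qed

lemma P_pair: "submodule_pair R (Chain C n) (P n) (boundaries C n)"
proof (rule C.submodule_pairI[OF sub_P C.submodule_boundaries], rule subsetI)
  fix z assume "z \<in> boundaries C n"
  then obtain w where w: "w \<in> carrier (Chain C (n + 1))" "z = diff C (n + 1) w"
    unfolding boundaries_def by blast
  from p_surj[OF w(1)] obtain y where y: "y \<in> carrier (Chain B (n + 1))" "w = p (n + 1) y" by blast
  have "z = p n (diff B (n + 1) y)" using y w p.d_f_1[of y n] by simp
  moreover have "diff B (n + 1) y \<in> cycles B n" using y by (simp add: cycles_def B.dd_1)
  ultimately show "z \<in> P n" by (simp add: P_def)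
qed

lemma ZP_pair: "submodule_pair R (Chain C n) (cycles C n) (P n)"
  by (rule C.submodule_pairI[OF C.submodule_cycles sub_P]) (use p.f_cycles in \<open>auto simp: P_def\<close>)

lemma YX_pair: "submodule_pair R (Chain B n) (Y n) (X n)"
proof (rule B.submodule_pairI[OF sub_Y sub_X], rule subsetI)
  fix x assume "x \<in> X n"
  then obtain y a where ya: "y \<in> cycles B n" "a \<in> carrier (Chain A n)" "x = y \<oplus>\<^bsub>Chain B n\<^esub> i n a"
    unfolding X_def by blast
  then have "p n x = p n y" using cyc by (simp add: p.f_add p_i)
  then show "x \<in> Y n" using ya cyc p.f_cycles[OF ya(1)] by (simp add: Y_def)
qed

lemma image_pair: "submodule_pair R (Chain B n) (i n ` K n) (i n ` boundaries A n)"
  by (rule B.submodule_pairI[OF i.f.image_submodule[OF sub_K] i.f.image_submodule[OF A.submodule_boundaries]])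
    (rule image_mono[OF submodule_pair.X_Y[OF K_pair]])

lemma self_minus: "y \<in> carrier (Chain B n) \<Longrightarrow> y \<ominus>\<^bsub>Chain B n\<^esub> y = \<zero>\<^bsub>Chain B n\<^esub>"
  "z \<in> carrier (Chain C n) \<Longrightarrow> z \<ominus>\<^bsub>Chain C n\<^esub> z = \<zero>\<^bsub>Chain C n\<^esub>"
  by simp_all

text \<open>Induced by \<open>i\<close>: the image of \<open>H A \<rightarrow> H B\<close> is \<open>H A\<close> modulo the kernel.\<close>

lemma iso_ZK: "sq_fin R (Chain A n) (cycles A n) (K n) \<longleftrightarrow> sq_fin R (Chain B n) (I n) (boundaries B n)"
    "sq_fin R (Chain A n) (cycles A n) (K n) \<Longrightarrow>
     sq_rank R (Chain A n) (cycles A n) (K n) = sq_rank R (Chain B n) (I n) (boundaries B n)"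
proof -
  have 1: "i n y \<in> I n" if "y \<in> cycles A n" for y
    unfolding I_def using that cyc B.H.X.zero_closed[of n]
    by (intro CollectI exI[of _ "i n y"] exI[of _ "\<zero>\<^bsub>Chain B n\<^esub>"]) auto
  have 2: "\<exists>y\<in>cycles A n. y' \<ominus>\<^bsub>Chain B n\<^esub> i n y \<in> boundaries B n" if "y' \<in> I n" for y'
  proof -
    from that obtain a b where ab: "a \<in> cycles A n" "b \<in> boundaries B n" "y' = i n a \<oplus>\<^bsub>Chain B n\<^esub> b"
      unfolding I_def by blast
    then have "y' \<ominus>\<^bsub>Chain B n\<^esub> i n a = b"
      using B.M.add3_minus[of "i n a" n b "\<zero>\<^bsub>Chain B n\<^esub>"] cyc bnd by simp
    with ab show ?thesis by (intro bexI[of _ a]) simp_all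
  qed
  have h1: "i n y \<in> I n" if "y \<in> cycles A n" for y
    by (rule 1[OF that])
  have h2: "i n (x \<oplus>\<^bsub>Chain A n\<^esub> y) = i n x \<oplus>\<^bsub>Chain B n\<^esub> i n y"
    if "x \<in> cycles A n" "y \<in> cycles A n" for x y
    using that[THEN cyc(1)] by simp
  have h3: "i n (a \<odot>\<^bsub>Chain A n\<^esub> y) = a \<odot>\<^bsub>Chain B n\<^esub> i n y"
    if "a \<in> carrier R" "y \<in> cycles A n" for a y
    using that(1) cyc(1)[OF that(2)] by simp
  note * = subquotient_rank_iso[OF ZK_pair[of n] I_pair[of n], where f = "i n"]
  have 3: "i n y \<in> boundaries B n \<longleftrightarrow> y \<in> K n" if "y \<in> cycles A n" for y using that by (simp add: K_def)
  show "sq_fin R (Chain A n) (cycles A n) (K n) \<longleftrightarrow> sq_fin R (Chain B n) (I n) (boundaries B n)"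
    by (rule *(1)[OF h1 h2 h3 2 3])
  show "sq_fin R (Chain A n) (cycles A n) (K n) \<Longrightarrow>
     sq_rank R (Chain A n) (cycles A n) (K n) = sq_rank R (Chain B n) (I n) (boundaries B n)"
    by (rule *(2)[OF h1 h2 h3 2 3])
qed

text \<open>Induced by \<open>p\<close>: the image of \<open>H B \<rightarrow> H C\<close> is \<open>H B\<close> modulo the kernel.\<close>

lemma iso_ZI: "sq_fin R (Chain B n) (cycles B n) (I n) \<longleftrightarrow> sq_fin R (Chain C n) (P n) (boundaries C n)"
    "sq_fin R (Chain B n) (cycles B n) (I n) \<Longrightarrow>
     sq_rank R (Chain B n) (cycles B n) (I n) = sq_rank R (Chain C n) (P n) (boundaries C n)"
proof -
  have 2: "\<exists>y\<in>cycles B n. y' \<ominus>\<^bsub>Chain C n\<^esub> p n y \<in> boundaries C n" if "y' \<in> P n" for y'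
  proof -
    from that obtain y where y: "y \<in> cycles B n" "y' = p n y" unfolding P_def by blast
    then show ?thesis
      using cyc(2)[OF y(1)] C.H.X.zero_closed[of n] by (intro bexI[of _ y]) (simp_all add: self_minus)
  qed
  have 3: "p n y \<in> boundaries C n \<longleftrightarrow> y \<in> I n" if y: "y \<in> cycles B n" for y
  proof
    assume "p n y \<in> boundaries C n"
    then obtain w where w: "w \<in> carrier (Chain C (n + 1))" "p n y = diff C (n + 1) w"
      unfolding boundaries_def by blast
    from p_surj[OF w(1)] obtain v where v: "v \<in> carrier (Chain B (n + 1))" "w = p (n + 1) v" by blast
    have dv: "diff B (n + 1) v \<in> boundaries B n" using v by (auto simp: boundaries_def)
    have "p n (y \<ominus>\<^bsub>Chain B n\<^esub> diff B (n + 1) v) = \<zero>\<^bsub>Chain C n\<^esub>"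
      using y v w cyc p.d_f_1[of v n] by (simp add: p.f_minus self_minus)
    moreover have "y \<ominus>\<^bsub>Chain B n\<^esub> diff B (n + 1) v \<in> carrier (Chain B n)"
      using cyc(2)[OF y] v by simp
    ultimately obtain a where a: "a \<in> carrier (Chain A n)" "y \<ominus>\<^bsub>Chain B n\<^esub> diff B (n + 1) v = i n a"
      using ker_p by blast
    have "i (n - 1) (diff A n a) = diff B n (i n a)" using a by (simp add: i.d_f)
    also have "\<dots> = \<zero>\<^bsub>Chain B (n - 1)\<^esub>"
      unfolding a(2)[symmetric] using y v cyc(2)[OF y] by (simp add: B.d_minus B.dd_1 cycles_def)
    finally have "a \<in> cycles A n" using a i_inj[of "diff A n a" "n - 1"] by (simp add: cycles_def)
    moreover have "y = i n a \<oplus>\<^bsub>Chain B n\<^esub> diff B (n + 1) v"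
      unfolding a(2)[symmetric] using y v cyc by (simp add: B.M.minus_add_cancel)
    ultimately show "y \<in> I n" unfolding I_def using dv by blast
  next
    assume "y \<in> I n"
    then obtain a b where ab: "a \<in> cycles A n" "b \<in> boundaries B n" "y = i n a \<oplus>\<^bsub>Chain B n\<^esub> b"
      unfolding I_def by blast
    then have "p n y = p n b" using cyc bnd by (simp add: p.f_add p_i)
    then show "p n y \<in> boundaries C n" using p.f_boundaries[OF ab(2)] by simp
  qed
  have h1: "p n y \<in> P n" if "y \<in> cycles B n" for y
    using that by (simp add: P_def)
  have h2: "p n (x \<oplus>\<^bsub>Chain B n\<^esub> y) = p n x \<oplus>\<^bsub>Chain C n\<^esub> p n y"
    if "x \<in> cycles B n" "y \<in> cycles B n" for x y
    using that[THEN cyc(2)] by simp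
  have h3: "p n (a \<odot>\<^bsub>Chain B n\<^esub> y) = a \<odot>\<^bsub>Chain C n\<^esub> p n y"
    if "a \<in> carrier R" "y \<in> cycles B n" for a y
    using that(1) cyc(2)[OF that(2)] by simp
  note * = subquotient_rank_iso[OF ZI_pair[of n] P_pair[of n], where f = "p n"]
  show "sq_fin R (Chain B n) (cycles B n) (I n) \<longleftrightarrow> sq_fin R (Chain C n) (P n) (boundaries C n)"
    by (rule *(1)[OF h1 h2 h3 2 3])
  show "sq_fin R (Chain B n) (cycles B n) (I n) \<Longrightarrow>
     sq_rank R (Chain B n) (cycles B n) (I n) = sq_rank R (Chain C n) (P n) (boundaries C n)"
    by (rule *(2)[OF h1 h2 h3 2 3])
qed

lemma Y_in: "y \<in> Y n \<Longrightarrow> y \<in> carrier (Chain B n)" by (simp add: Y_def)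

lemma iso_YX: "sq_fin R (Chain B n) (Y n) (X n) \<longleftrightarrow> sq_fin R (Chain C n) (cycles C n) (P n)"
    "sq_fin R (Chain B n) (Y n) (X n) \<Longrightarrow>
     sq_rank R (Chain B n) (Y n) (X n) = sq_rank R (Chain C n) (cycles C n) (P n)"
proof -
  have P0: "\<zero>\<^bsub>Chain C n\<^esub> \<in> P n" by (rule submodule.zero_closed[OF sub_P])
  have 2: "\<exists>y\<in>Y n. y' \<ominus>\<^bsub>Chain C n\<^esub> p n y \<in> P n" if y': "y' \<in> cycles C n" for y'
  proof -
    from p_surj[OF cyc(3)[OF y']] obtain y where y: "y \<in> carrier (Chain B n)" "y' = p n y" by blast
    then show ?thesis using y' P0 by (intro bexI[of _ y]) (simp_all add: self_minus Y_def)
  qed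
  have 3: "p n y \<in> P n \<longleftrightarrow> y \<in> X n" if y: "y \<in> Y n" for y
  proof
    assume "p n y \<in> P n"
    then obtain z where z: "z \<in> cycles B n" "p n y = p n z" unfolding P_def by blast
    have "p n (y \<ominus>\<^bsub>Chain B n\<^esub> z) = \<zero>\<^bsub>Chain C n\<^esub>"
      using y z cyc Y_in by (simp add: p.f_minus self_minus)
    moreover have "y \<ominus>\<^bsub>Chain B n\<^esub> z \<in> carrier (Chain B n)"
      using cyc(2)[OF z(1)] Y_in[OF y] by simp
    ultimately obtain a where a: "a \<in> carrier (Chain A n)" "y \<ominus>\<^bsub>Chain B n\<^esub> z = i n a"
      using ker_p by blast
    have "y = i n a \<oplus>\<^bsub>Chain B n\<^esub> z"
      unfolding a(2)[symmetric] using y z cyc Y_in by (simp add: B.M.minus_add_cancel)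
    also have "\<dots> = z \<oplus>\<^bsub>Chain B n\<^esub> i n a" using a z cyc by (simp add: B.M.a_comm)
    finally show "y \<in> X n" unfolding X_def using z a by blast
  next
    assume "y \<in> X n"
    then obtain z a where za: "z \<in> cycles B n" "a \<in> carrier (Chain A n)" "y = z \<oplus>\<^bsub>Chain B n\<^esub> i n a"
      unfolding X_def by blast
    then have "p n y = p n z" using cyc by (simp add: p.f_add p_i)
    then show "p n y \<in> P n" using za by (simp add: P_def)
  qed
  have h1: "p n y \<in> cycles C n" if "y \<in> Y n" for y
    using that by (simp add: Y_def)
  have h2: "p n (x \<oplus>\<^bsub>Chain B n\<^esub> y) = p n x \<oplus>\<^bsub>Chain C n\<^esub> p n y"
    if "x \<in> Y n" "y \<in> Y n" for x y
    using that[THEN Y_in] by simp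
  have h3: "p n (a \<odot>\<^bsub>Chain B n\<^esub> y) = a \<odot>\<^bsub>Chain C n\<^esub> p n y"
    if "a \<in> carrier R" "y \<in> Y n" for a y
    using that(1) Y_in[OF that(2)] by simp
  note * = subquotient_rank_iso[OF YX_pair[of n] ZP_pair[of n], where f = "p n"]
  show "sq_fin R (Chain B n) (Y n) (X n) \<longleftrightarrow> sq_fin R (Chain C n) (cycles C n) (P n)"
    by (rule *(1)[OF h1 h2 h3 2 3])
  show "sq_fin R (Chain B n) (Y n) (X n) \<Longrightarrow>
     sq_rank R (Chain B n) (Y n) (X n) = sq_rank R (Chain C n) (cycles C n) (P n)"
    by (rule *(2)[OF h1 h2 h3 2 3])
qed

lemma K_in: "a \<in> K n \<Longrightarrow> a \<in> carrier (Chain A n)" by (simp add: K_def cycles_def)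

lemma iso_K: "sq_fin R (Chain A n) (K n) (boundaries A n) \<longleftrightarrow> sq_fin R (Chain B n) (i n ` K n) (i n ` boundaries A n)"
    "sq_fin R (Chain A n) (K n) (boundaries A n) \<Longrightarrow>
     sq_rank R (Chain A n) (K n) (boundaries A n) = sq_rank R (Chain B n) (i n ` K n) (i n ` boundaries A n)"
proof -
  have 2: "\<exists>y\<in>K n. y' \<ominus>\<^bsub>Chain B n\<^esub> i n y \<in> i n ` boundaries A n" if y': "y' \<in> i n ` K n" for y'
  proof -
    from y' obtain a where a: "a \<in> K n" "y' = i n a" by blast
    moreover have "\<zero>\<^bsub>Chain B n\<^esub> \<in> i n ` boundaries A n"
      using i.f_zero[of n] A.H.X.zero_closed[of n] by (metis imageI)
    ultimately show ?thesis using K_in by (intro bexI[of _ a]) (simp_all add: self_minus)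
  qed
  have 3: "i n y \<in> i n ` boundaries A n \<longleftrightarrow> y \<in> boundaries A n" if "y \<in> K n" for y
    using i_eq[OF K_in[OF that] bnd(1)] by blast
  have h1: "i n y \<in> i n ` K n" if "y \<in> K n" for y
    using that by simp
  have h2: "i n (x \<oplus>\<^bsub>Chain A n\<^esub> y) = i n x \<oplus>\<^bsub>Chain B n\<^esub> i n y"
    if "x \<in> K n" "y \<in> K n" for x y
    using that[THEN K_in] by simp
  have h3: "i n (a \<odot>\<^bsub>Chain A n\<^esub> y) = a \<odot>\<^bsub>Chain B n\<^esub> i n y"
    if "a \<in> carrier R" "y \<in> K n" for a y
    using that(1) K_in[OF that(2)] by simp
  note * = subquotient_rank_iso[OF K_pair[of n] image_pair[of n], where f = "i n"]
  show "sq_fin R (Chain A n) (K n) (boundaries A n) \<longleftrightarrow> sq_fin R (Chain B n) (i n ` K n) (i n ` boundaries A n)"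
    by (rule *(1)[OF h1 h2 h3 2 3])
  show "sq_fin R (Chain A n) (K n) (boundaries A n) \<Longrightarrow>
     sq_rank R (Chain A n) (K n) (boundaries A n) = sq_rank R (Chain B n) (i n ` K n) (i n ` boundaries A n)"
    by (rule *(2)[OF h1 h2 h3 2 3])
qed

lemma boundaries_prev: "boundaries D (n - 1) = diff D n ` carrier (Chain D n)"
  by (simp add: boundaries_def)

text \<open>The connecting homomorphism sends the class of \<open>p y\<close> to the class of \<open>i\<^sup>-\<^sup>1 (d y)\<close>.\<close>

lemma iso_connecting:
  "sq_fin R (Chain B n) (Y n) (X n) \<longleftrightarrow>
     sq_fin R (Chain B (n - 1)) (i (n - 1) ` K (n - 1)) (i (n - 1) ` boundaries A (n - 1))"
  "sq_fin R (Chain B n) (Y n) (X n) \<Longrightarrow> sq_rank R (Chain B n) (Y n) (X n) =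
     sq_rank R (Chain B (n - 1)) (i (n - 1) ` K (n - 1)) (i (n - 1) ` boundaries A (n - 1))"
proof -
  have 1: "diff B n y \<in> i (n - 1) ` K (n - 1)" if y: "y \<in> Y n" for y
  proof -
    have yc: "y \<in> carrier (Chain B n)" using y by (rule Y_in)
    have "p (n - 1) (diff B n y) = \<zero>\<^bsub>Chain C (n - 1)\<^esub>"
      using y yc by (simp add: Y_def cycles_def p.d_f)
    then obtain a where a: "a \<in> carrier (Chain A (n - 1))" "diff B n y = i (n - 1) a"
      using ker_p yc by blast
    have "i (n - 2) (diff A (n - 1) a) = \<zero>\<^bsub>Chain B (n - 2)\<^esub>"
      using a i.d_f[of a "n - 1"] B.dd[OF yc] by simp
    then have "diff A (n - 1) a = \<zero>\<^bsub>Chain A (n - 1 - 1)\<^esub>"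
      using i_inj[of "diff A (n - 1) a" "n - 2"] A.d_closed[OF a(1)] by simp
    moreover have "i (n - 1) a \<in> boundaries B (n - 1)"
      using a(2)[symmetric] yc by (simp add: boundaries_prev)
    ultimately have "a \<in> K (n - 1)" using a by (simp add: K_def cycles_def)
    with a show ?thesis by simp
  qed
  have 2: "\<exists>y\<in>Y n. y' \<ominus>\<^bsub>Chain B (n - 1)\<^esub> diff B n y \<in> i (n - 1) ` boundaries A (n - 1)"
    if y': "y' \<in> i (n - 1) ` K (n - 1)" for y'
  proof -
    from y' obtain a where a: "a \<in> K (n - 1)" "y' = i (n - 1) a" by blast
    then have "y' \<in> boundaries B (n - 1)" by (simp add: K_def)
    then obtain y where y: "y \<in> carrier (Chain B n)" "y' = diff B n y" by (auto simp: boundaries_prev)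
    have "diff C n (p n y) = \<zero>\<^bsub>Chain C (n - 1)\<^esub>"
      using y a K_in by (simp add: p.d_f flip: y(2)) (simp add: p_i)
    then have "y \<in> Y n" using y by (simp add: Y_def cycles_def)
    moreover have "\<zero>\<^bsub>Chain B (n - 1)\<^esub> \<in> i (n - 1) ` boundaries A (n - 1)"
      using i.f_zero[of "n - 1"] A.H.X.zero_closed[of "n - 1"] by (metis imageI)
    ultimately show ?thesis using y by (intro bexI[of _ y]) (simp_all add: self_minus)
  qed
  have 3: "diff B n y \<in> i (n - 1) ` boundaries A (n - 1) \<longleftrightarrow> y \<in> X n" if y: "y \<in> Y n" for y
  proof
    assume "diff B n y \<in> i (n - 1) ` boundaries A (n - 1)"
    then obtain a where a: "a \<in> carrier (Chain A n)" "diff B n y = i (n - 1) (diff A n a)"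
      unfolding boundaries_prev by blast
    then have "y \<ominus>\<^bsub>Chain B n\<^esub> i n a \<in> cycles B n"
      using y Y_in by (simp add: cycles_def B.d_minus i.d_f self_minus)
    moreover have "y = (y \<ominus>\<^bsub>Chain B n\<^esub> i n a) \<oplus>\<^bsub>Chain B n\<^esub> i n a"
      using y a Y_in by (simp add: B.M.minus_add_cancel)
    ultimately show "y \<in> X n" unfolding X_def using a by blast
  next
    assume "y \<in> X n"
    then obtain z a where za: "z \<in> cycles B n" "a \<in> carrier (Chain A n)" "y = z \<oplus>\<^bsub>Chain B n\<^esub> i n a"
      unfolding X_def by blast
    then have "diff B n y = i (n - 1) (diff A n a)" by (simp add: cycles_def B.d_add i.d_f)
    then show "diff B n y \<in> i (n - 1) ` boundaries A (n - 1)"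
      unfolding boundaries_prev using za by blast
  qed
  have h2: "diff B n (x \<oplus>\<^bsub>Chain B n\<^esub> y) = diff B n x \<oplus>\<^bsub>Chain B (n - 1)\<^esub> diff B n y"
    if "x \<in> Y n" "y \<in> Y n" for x y
    using that[THEN Y_in] by simp
  have h3: "diff B n (a \<odot>\<^bsub>Chain B n\<^esub> y) = a \<odot>\<^bsub>Chain B (n - 1)\<^esub> diff B n y"
    if "a \<in> carrier R" "y \<in> Y n" for a y
    using that(1) Y_in[OF that(2)] by simp
  note * = subquotient_rank_iso[OF YX_pair[of n] image_pair[of "n - 1"], where f = "diff B n"]
  show "sq_fin R (Chain B n) (Y n) (X n) \<longleftrightarrow>
     sq_fin R (Chain B (n - 1)) (i (n - 1) ` K (n - 1)) (i (n - 1) ` boundaries A (n - 1))"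
    by (rule *(1)[OF 1 h2 h3 2 3])
  show "sq_fin R (Chain B n) (Y n) (X n) \<Longrightarrow> sq_rank R (Chain B n) (Y n) (X n) =
     sq_rank R (Chain B (n - 1)) (i (n - 1) ` K (n - 1)) (i (n - 1) ` boundaries A (n - 1))"
    by (rule *(2)[OF 1 h2 h3 2 3])
qed

text \<open>The rank of the kernel of \<open>H\<^sub>n A \<rightarrow> H\<^sub>n B\<close>, and hence of the connecting homomorphism from \<open>H\<^sub>n\<^sub>+\<^sub>1 C\<close>.\<close>

definition kappa where "kappa n = sq_rank R (Chain A n) (K n) (boundaries A n)"

lemma A_filtration: "hfin R A n \<longleftrightarrow> sq_fin R (Chain A n) (cycles A n) (K n) \<and> sq_fin R (Chain A n) (K n) (boundaries A n)"
  "hfin R A n \<Longrightarrow> hrank R A n = sq_rank R (Chain A n) (cycles A n) (K n) + kappa n"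
  unfolding A.hfin_eq A.hrank_eq kappa_def
  using subquotient_rank_filtration[OF ZK_pair K_pair] by auto

lemma B_filtration: "hfin R B n \<longleftrightarrow> sq_fin R (Chain B n) (cycles B n) (I n) \<and> sq_fin R (Chain B n) (I n) (boundaries B n)"
  "hfin R B n \<Longrightarrow> hrank R B n = sq_rank R (Chain B n) (cycles B n) (I n) + sq_rank R (Chain B n) (I n) (boundaries B n)"
  unfolding B.hfin_eq B.hrank_eq using subquotient_rank_filtration[OF ZI_pair I_pair] by auto

lemma C_filtration: "hfin R C n \<longleftrightarrow> sq_fin R (Chain C n) (cycles C n) (P n) \<and> sq_fin R (Chain C n) (P n) (boundaries C n)"
  "hfin R C n \<Longrightarrow> hrank R C n = sq_rank R (Chain C n) (cycles C n) (P n) + sq_rank R (Chain C n) (P n) (boundaries C n)"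
  unfolding C.hfin_eq C.hrank_eq using subquotient_rank_filtration[OF ZP_pair P_pair] by auto

lemma connecting_fin: "sq_fin R (Chain C n) (cycles C n) (P n) \<longleftrightarrow>
    sq_fin R (Chain A (n - 1)) (K (n - 1)) (boundaries A (n - 1))"
  using iso_YX(1)[of n] iso_connecting(1)[of n] iso_K(1)[of "n - 1"] by simp

lemma connecting_rank: "sq_fin R (Chain C n) (cycles C n) (P n) \<Longrightarrow>
    sq_rank R (Chain C n) (cycles C n) (P n) = kappa (n - 1)"
  using iso_YX[of n] iso_connecting[of n] iso_K[of "n - 1"] by (simp add: kappa_def)

lemma hfin_C: "hfin R A n \<Longrightarrow> hfin R B n \<Longrightarrow> hfin R A (n - 1) \<Longrightarrow> hfin R C n"
  using A_filtration(1)[of "n - 1"] B_filtration(1)[of n] C_filtration(1)[of n] connecting_fin[of n] iso_ZI(1)[of n]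
  by blast

lemma hfin_B: "hfin R A n \<Longrightarrow> hfin R C n \<Longrightarrow> hfin R B n"
  using A_filtration(1)[of n] B_filtration(1)[of n] C_filtration(1)[of n] iso_ZI(1)[of n] iso_ZK(1)[of n]
  by blast

lemma long_exact_ranks:
  assumes "hfin R A n" "hfin R B n" "hfin R A (n - 1)"
  shows "hrank R C n + hrank R A n = hrank R B n + kappa n + kappa (n - 1)"
proof -
  note C = hfin_C[OF assms]
  have "hrank R A n = sq_rank R (Chain B n) (I n) (boundaries B n) + kappa n"
    using A_filtration[of n] iso_ZK[of n] assms by simp
  moreover have "hrank R B n = sq_rank R (Chain C n) (P n) (boundaries C n) + sq_rank R (Chain B n) (I n) (boundaries B n)"
    using B_filtration[of n] iso_ZI[of n] assms by simp
  moreover have "hrank R C n = kappa (n - 1) + sq_rank R (Chain C n) (P n) (boundaries C n)"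
    using C_filtration[of n] connecting_rank[of n] C by simp
  ultimately show ?thesis by simp
qed

lemma kappa_le: "hfin R A n \<Longrightarrow> kappa n \<le> hrank R A n"
  using A_filtration(2)[of n] by simp

lemma kappa_trivial:
  assumes "carrier (Chain A n) = {\<zero>\<^bsub>Chain A n\<^esub>}" "hfin R A n" shows "kappa n = 0"
proof -
  have "K n = {\<zero>\<^bsub>Chain A n\<^esub>}" "boundaries A n = {\<zero>\<^bsub>Chain A n\<^esub>}"
    using assms(1) K_in bnd(1) submodule.zero_closed[OF sub_K[of n]] A.H.X.zero_closed[of n] by blast+
  then show ?thesis
    using sq_rank_same[of R "Chain A n" "{\<zero>\<^bsub>Chain A n\<^esub>}"] K_pair[of n] A_filtration(1)[of n] assms(2)
    by (simp add: kappa_def)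
qed

lemma rank_exact_sequence:
  assumes A: "positive_complex A" "\<And>n. hfin R A n" and B: "\<And>n. hfin R B n"
  shows "rank_exact_sequence (\<lambda>n. real (hrank R A (int n))) (\<lambda>n. real (hrank R B (int n)))
    (\<lambda>n. real (hrank R C (int n))) (\<lambda>n. real (kappa (int n - 1)))"
proof
  show "real (kappa (int 0 - 1)) = 0"
    using kappa_trivial[of "- 1"] A by (simp add: positive_complex_def)
  show "real (kappa (int (Suc n) - 1)) \<le> real (hrank R A (int n))" for n
    using kappa_le[OF A(2), of "int n"] by simp
  show "real (hrank R C (int n)) = real (hrank R B (int n)) - real (hrank R A (int n)) +
      real (kappa (int (Suc n) - 1)) + real (kappa (int n - 1))" for n
  proof -
    have "real (hrank R C (int n) + hrank R A (int n)) = real (hrank R B (int n) + kappa (int n) + kappa (int n - 1))"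
      using long_exact_ranks[OF A(2) B A(2), of "int n"] by (simp only:)
    then show ?thesis by simp
  qed
qed auto

end

lemma Abel_complexes_iff:
  "C \<in> Abel_complexes R \<longleftrightarrow> chain_complex R C \<and> positive_complex C \<and> (\<forall>n. hfin R C n) \<and>
    Abel_controlled (\<lambda>n. real (hrank R C (int n)))"
  by (auto simp: Abel_complexes_def hfin_def hrank_def Abel_controlled_def homology_ranks_def[abs_def])

theorem (in short_exact) Abel_quotient:
  assumes "A \<in> Abel_complexes R" "B \<in> Abel_complexes R" shows "C \<in> Abel_complexes R"
proof -
  have A: "positive_complex A" "\<And>n. hfin R A n" "Abel_controlled (\<lambda>n. real (hrank R A (int n)))"
    and B: "positive_complex B" "\<And>n. hfin R B n" "Abel_controlled (\<lambda>n. real (hrank R B (int n)))"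
    using assms by (auto simp: Abel_complexes_iff)
  have "positive_complex C"
    unfolding positive_complex_def
  proof (intro allI impI)
    fix n :: int assume "n < 0"
    then have "carrier (Chain B n) = {\<zero>\<^bsub>Chain B n\<^esub>}" using B by (simp add: positive_complex_def)
    then have "z = \<zero>\<^bsub>Chain C n\<^esub>" if "z \<in> carrier (Chain C n)" for z
      using p_surj[OF that] p.f_zero[of n] by auto
    then show "carrier (Chain C n) = {\<zero>\<^bsub>Chain C n\<^esub>}" by auto
  qed
  then show ?thesis
    using rank_exact_sequence.Abel_controlled_C[OF rank_exact_sequence[OF A(1,2) B(2)] A(3) B(3)]
      hfin_C[OF A(2) B(2) A(2)] C.cx by (simp add: Abel_complexes_iff)
qed

theorem (in short_exact) Abel_middle:
  assumes "A \<in> Abel_complexes R" "C \<in> Abel_complexes R" shows "B \<in> Abel_complexes R"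
proof -
  have A: "positive_complex A" "\<And>n. hfin R A n" "Abel_controlled (\<lambda>n. real (hrank R A (int n)))"
    and C: "positive_complex C" "\<And>n. hfin R C n" "Abel_controlled (\<lambda>n. real (hrank R C (int n)))"
    using assms by (auto simp: Abel_complexes_iff)
  have B: "hfin R B n" for n by (rule hfin_B[OF A(2) C(2)])
  have "positive_complex B"
    unfolding positive_complex_def
  proof (intro allI impI)
    fix n :: int assume "n < 0"
    then have c: "carrier (Chain A n) = {\<zero>\<^bsub>Chain A n\<^esub>}" "carrier (Chain C n) = {\<zero>\<^bsub>Chain C n\<^esub>}"
      using A C by (simp_all add: positive_complex_def)
    have "y = \<zero>\<^bsub>Chain B n\<^esub>" if "y \<in> carrier (Chain B n)" for y
    proof -
      have "p n y = \<zero>\<^bsub>Chain C n\<^esub>" using that c(2) p.f_closed by blast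
      then show ?thesis using ker_p[OF that] c(1) i.f_zero[of n] by auto
    qed
    then show "carrier (Chain B n) = {\<zero>\<^bsub>Chain B n\<^esub>}" by auto
  qed
  then show ?thesis
    using rank_exact_sequence.Abel_controlled_B[OF rank_exact_sequence[OF A(1,2) B] A(3) C(3)]
      B B.cx by (simp add: Abel_complexes_iff)
qed

theorem (in cmap) Abel_quasi_isomorphism:
  assumes qi: "quasi_isomorphism C f D" and C: "positive_complex C" and D: "D \<in> Abel_complexes R"
  shows "C \<in> Abel_complexes R"
proof -
  have *: "(\<forall>x\<in>cycles C n. f n x \<in> boundaries D n \<longrightarrow> x \<in> boundaries C n) \<and>
      (\<forall>z\<in>cycles D n. \<exists>x\<in>cycles C n. z \<ominus>\<^bsub>Chain D n\<^esub> f n x \<in> boundaries D n)" for n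
    using qi unfolding quasi_isomorphism_def bij_betw_def homology_map_inj_iff homology_map_surj_iff by (rule spec)
  have inj: "f n x \<in> boundaries D n \<longleftrightarrow> x \<in> boundaries C n" if "x \<in> cycles C n" for n x
    using *[of n] that f_boundaries by blast
  have surj: "\<exists>x\<in>cycles C n. z \<ominus>\<^bsub>Chain D n\<^esub> f n x \<in> boundaries D n" if "z \<in> cycles D n" for n z
    using *[of n] that by blast
  have cyc: "x \<in> cycles C n \<Longrightarrow> x \<in> carrier (Chain C n)" for x n by (simp add: cycles_def)
  note iso = subquotient_rank_iso[OF C.H.submodule_pair_axioms D.H.submodule_pair_axioms]
  have fin: "hfin R C n \<longleftrightarrow> hfin R D n" for n
    unfolding C.hfin_eq D.hfin_eq
    by (rule iso(1)[where f = "f n"]) (use inj surj cyc f_cycles in \<open>simp_all add: f_add f_smult\<close>)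
  have D': "hfin R D n" for n using D by (simp add: Abel_complexes_iff)
  have "hrank R C n = hrank R D n" for n
    unfolding C.hrank_eq D.hrank_eq
    by (rule iso(2)[where f = "f n"])
      (use inj surj cyc f_cycles D' fin in \<open>simp_all add: f_add f_smult flip: C.hfin_eq\<close>)
  then show ?thesis using D C fin C.cx by (simp add: Abel_complexes_iff)
qed

section \<open>Pushouts of complexes\<close>

lemma complex_overI:
  assumes "domain R" "\<And>n. module R (Chain C n)"
    "\<And>n x. x \<in> carrier (Chain C n) \<Longrightarrow> diff C n x \<in> carrier (Chain C (n - 1))"
    "\<And>n x y. x \<in> carrier (Chain C n) \<Longrightarrow> y \<in> carrier (Chain C n) \<Longrightarrow>
      diff C n (x \<oplus>\<^bsub>Chain C n\<^esub> y) = diff C n x \<oplus>\<^bsub>Chain C (n - 1)\<^esub> diff C n y"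
    "\<And>n a x. a \<in> carrier R \<Longrightarrow> x \<in> carrier (Chain C n) \<Longrightarrow>
      diff C n (a \<odot>\<^bsub>Chain C n\<^esub> x) = a \<odot>\<^bsub>Chain C (n - 1)\<^esub> diff C n x"
    "\<And>n x. x \<in> carrier (Chain C n) \<Longrightarrow> diff C (n - 1) (diff C n x) = \<zero>\<^bsub>Chain C (n - 2)\<^esub>"
  shows "complex_over R C"
  using assms(1)
  by (intro complex_over.intro complex_over_axioms.intro)
    (auto simp: chain_complex_def module_hom_def assms)

lemma cmap_restrictI:
  assumes C: "complex_over R C" and D: "complex_over R D"
    and f: "\<And>n x. x \<in> carrier (Chain C n) \<Longrightarrow> f n x \<in> carrier (Chain D n)"
      "\<And>n x y. x \<in> carrier (Chain C n) \<Longrightarrow> y \<in> carrier (Chain C n) \<Longrightarrow>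
        f n (x \<oplus>\<^bsub>Chain C n\<^esub> y) = f n x \<oplus>\<^bsub>Chain D n\<^esub> f n y"
      "\<And>n a x. a \<in> carrier R \<Longrightarrow> x \<in> carrier (Chain C n) \<Longrightarrow>
        f n (a \<odot>\<^bsub>Chain C n\<^esub> x) = a \<odot>\<^bsub>Chain D n\<^esub> f n x"
      "\<And>n x. x \<in> carrier (Chain C n) \<Longrightarrow> diff D n (f n x) = f (n - 1) (diff C n x)"
  shows "cmap R C (\<lambda>n. \<lambda>x\<in>carrier (Chain C n). f n x) D"
proof -
  interpret C: complex_over R C by (rule C)
  interpret D: complex_over R D by (rule D)
  have "is_chain_map R C (\<lambda>n. \<lambda>x\<in>carrier (Chain C n). f n x) D"
    unfolding is_chain_map_def module_hom_def by (simp add: f Pi_def)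
  then show ?thesis by (intro cmap.intro cmap_axioms.intro C D)
qed

lemma cmap_compose:
  assumes f: "cmap R C f D" and g: "cmap R D g E"
  shows "cmap R C (\<lambda>n. compose (carrier (Chain C n)) (g n) (f n)) E"
proof -
  interpret f: cmap R C f D by (rule f)
  interpret g: cmap R D g E by (rule g)
  show ?thesis
    unfolding compose_def
    by (rule cmap_restrictI[OF f.C.complex_over_axioms g.D.complex_over_axioms])
      (simp_all add: f.d_f g.d_f)
qed

lemma cmap_zero:
  assumes C: "complex_over R C" and D: "complex_over R D"
  shows "cmap R C (\<lambda>n. \<lambda>x\<in>carrier (Chain C n). \<zero>\<^bsub>Chain D n\<^esub>) D"
proof -
  interpret C: complex_over R C by (rule C)
  interpret D: complex_over R D by (rule D)
  show ?thesis by (rule cmap_restrictI[OF C D]) simp_all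
qed

lemma cmap_id:
  assumes C: "complex_over R C" shows "cmap R C (\<lambda>n. \<lambda>x\<in>carrier (Chain C n). x) C"
proof -
  interpret C: complex_over R C by (rule C)
  show ?thesis by (rule cmap_restrictI[OF C C]) simp_all
qed

text \<open>A module structure is inherited by every image; \<open>\<pi>\<close> may identify elements.\<close>

lemma module_image:
  assumes S: "module R S" and car: "carrier N = \<pi> ` carrier S"
    and add: "\<And>x y. x \<in> carrier S \<Longrightarrow> y \<in> carrier S \<Longrightarrow> \<pi> x \<oplus>\<^bsub>N\<^esub> \<pi> y = \<pi> (x \<oplus>\<^bsub>S\<^esub> y)"
    and smult: "\<And>a x. a \<in> carrier R \<Longrightarrow> x \<in> carrier S \<Longrightarrow> a \<odot>\<^bsub>N\<^esub> \<pi> x = \<pi> (a \<odot>\<^bsub>S\<^esub> x)"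
    and zero: "\<zero>\<^bsub>N\<^esub> = \<pi> \<zero>\<^bsub>S\<^esub>"
  shows "module R N"
proof -
  interpret S: module R S by (rule S)
  show ?thesis
  proof (rule moduleI)
    show "cring R" by (rule S.R.is_cring)
    show "abelian_group N"
    proof (rule abelian_groupI)
      fix x y z assume "x \<in> carrier N" "y \<in> carrier N" "z \<in> carrier N"
      then obtain a b c where "a \<in> carrier S" "b \<in> carrier S" "c \<in> carrier S" "x = \<pi> a" "y = \<pi> b" "z = \<pi> c"
        unfolding car by blast
      then show "(x \<oplus>\<^bsub>N\<^esub> y) \<oplus>\<^bsub>N\<^esub> z = x \<oplus>\<^bsub>N\<^esub> (y \<oplus>\<^bsub>N\<^esub> z)" by (simp add: add S.a_assoc)
    next
      fix x y assume "x \<in> carrier N" "y \<in> carrier N"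
      then obtain a b where ab: "a \<in> carrier S" "b \<in> carrier S" "x = \<pi> a" "y = \<pi> b"
        unfolding car by blast
      then show "x \<oplus>\<^bsub>N\<^esub> y \<in> carrier N" by (simp add: add car)
      from ab show "x \<oplus>\<^bsub>N\<^esub> y = y \<oplus>\<^bsub>N\<^esub> x" by (simp add: add S.a_comm[of a b])
    next
      fix x assume "x \<in> carrier N"
      then obtain a where a: "a \<in> carrier S" "x = \<pi> a" unfolding car by blast
      then show "\<zero>\<^bsub>N\<^esub> \<oplus>\<^bsub>N\<^esub> x = x" by (simp add: add zero)
      from a show "\<exists>y\<in>carrier N. y \<oplus>\<^bsub>N\<^esub> x = \<zero>\<^bsub>N\<^esub>"
        by (intro bexI[of _ "\<pi> (\<ominus>\<^bsub>S\<^esub> a)"]) (simp_all add: add zero car S.l_neg)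
    qed (simp add: zero car)
  next
    fix a b x assume ab: "a \<in> carrier R" "b \<in> carrier R" and "x \<in> carrier N"
    then obtain u where u: "u \<in> carrier S" "x = \<pi> u" unfolding car by blast
    with ab show "(a \<oplus>\<^bsub>R\<^esub> b) \<odot>\<^bsub>N\<^esub> x = a \<odot>\<^bsub>N\<^esub> x \<oplus>\<^bsub>N\<^esub> b \<odot>\<^bsub>N\<^esub> x"
      by (simp add: add smult S.smult_l_distr)
    from u ab show "(a \<otimes>\<^bsub>R\<^esub> b) \<odot>\<^bsub>N\<^esub> x = a \<odot>\<^bsub>N\<^esub> (b \<odot>\<^bsub>N\<^esub> x)"
      by (simp add: smult S.smult_assoc1)
  next
    fix a x y assume a: "a \<in> carrier R" and "x \<in> carrier N" "y \<in> carrier N"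
    then obtain u v where "u \<in> carrier S" "x = \<pi> u" "v \<in> carrier S" "y = \<pi> v" unfolding car by blast
    with a show "a \<odot>\<^bsub>N\<^esub> (x \<oplus>\<^bsub>N\<^esub> y) = a \<odot>\<^bsub>N\<^esub> x \<oplus>\<^bsub>N\<^esub> a \<odot>\<^bsub>N\<^esub> y"
      by (simp add: add smult S.smult_r_distr)
  next
    fix a x assume a: "a \<in> carrier R" and "x \<in> carrier N"
    then obtain u where "u \<in> carrier S" "x = \<pi> u" unfolding car by blast
    with a show "a \<odot>\<^bsub>N\<^esub> x \<in> carrier N" by (simp add: smult car)
  next
    fix x assume "x \<in> carrier N"
    then show "\<one>\<^bsub>R\<^esub> \<odot>\<^bsub>N\<^esub> x = x" by (auto simp: smult car)
  qed
qed

text \<open>Cosets are not elements of the universe \<open>'u\<close>. A quotient with chain modules in \<open>'u\<close> is obtained by choosing a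
  representative of each coset.\<close>

lemma quotient_complex:
  fixes S :: "('a, 'u) module_complex"
  assumes S: "complex_over R S" and N: "\<And>n. submodule R (N n) (Chain S n)"
    and dN: "\<And>n x. x \<in> N n \<Longrightarrow> diff S n x \<in> N (n - 1)"
  obtains P :: "('a, 'u) module_complex" and \<pi> where "cmap R S \<pi> P"
    "\<And>n. carrier (Chain P n) = \<pi> n ` carrier (Chain S n)"
    "\<And>n s. s \<in> carrier (Chain S n) \<Longrightarrow> \<pi> n s = \<zero>\<^bsub>Chain P n\<^esub> \<longleftrightarrow> s \<in> N n"
proof -
  interpret S: complex_over R S by (rule S)
  interpret Q: submodule_pair R "Chain S n" "carrier (Chain S n)" "N n" for n
    by (rule S.submodule_pairI[OF S.M.carrier_submodule N submodule.subset[OF N]])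
  define pi where "pi n s = (SOME t. t \<in> Q.cls n s)" for n s
  have pi_mem: "pi n s \<in> Q.cls n s" if "s \<in> carrier (Chain S n)" for n s
    unfolding pi_def by (rule someI[of _ s]) (use that Q.X.zero_closed[of n] in \<open>metis S.M.l_zero Q.mem_cls\<close>)
  have pi_in: "pi n s \<in> carrier (Chain S n)" and pi_diff: "pi n s \<ominus>\<^bsub>Chain S n\<^esub> s \<in> N n"
    if s: "s \<in> carrier (Chain S n)" for n s
  proof -
    from pi_mem[OF s] obtain h where h: "h \<in> N n" "pi n s = h \<oplus>\<^bsub>Chain S n\<^esub> s" by (auto simp: Q.mem_cls)
    then show "pi n s \<in> carrier (Chain S n)" using Q.X_in s by simp
    have "pi n s \<ominus>\<^bsub>Chain S n\<^esub> s = h"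
      using h Q.X_in s by (simp add: S.M.minus_eq S.M.a_assoc S.M.r_neg)
    then show "pi n s \<ominus>\<^bsub>Chain S n\<^esub> s \<in> N n" using h by simp
  qed
  have pi_eq: "pi n s = pi n t \<longleftrightarrow> s \<ominus>\<^bsub>Chain S n\<^esub> t \<in> N n"
    if st: "s \<in> carrier (Chain S n)" "t \<in> carrier (Chain S n)" for n s t
  proof -
    have "Q.cls n (pi n s) = Q.cls n s" if "s \<in> carrier (Chain S n)" for s
      using pi_in[OF that] pi_diff[OF that] that by (subst Q.cls_eq_iff) auto
    then have "pi n s = pi n t \<longleftrightarrow> Q.cls n s = Q.cls n t" using st unfolding pi_def by metis
    then show ?thesis using st by (simp add: Q.cls_eq_iff)
  qed
  have pi_add: "pi n (pi n s \<oplus>\<^bsub>Chain S n\<^esub> pi n t) = pi n (s \<oplus>\<^bsub>Chain S n\<^esub> t)"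
    if st: "s \<in> carrier (Chain S n)" "t \<in> carrier (Chain S n)" for n s t
  proof -
    have "(pi n s \<oplus>\<^bsub>Chain S n\<^esub> pi n t) \<ominus>\<^bsub>Chain S n\<^esub> (s \<oplus>\<^bsub>Chain S n\<^esub> t) =
        (pi n s \<ominus>\<^bsub>Chain S n\<^esub> s) \<oplus>\<^bsub>Chain S n\<^esub> (pi n t \<ominus>\<^bsub>Chain S n\<^esub> t)"
      using st pi_in by (simp add: S.M.minus_eq S.M.minus_add S.M.a_ac)
    then show ?thesis using st pi_in pi_diff Q.X.m_closed by (subst pi_eq) auto
  qed
  have pi_smult: "pi n (a \<odot>\<^bsub>Chain S n\<^esub> pi n s) = pi n (a \<odot>\<^bsub>Chain S n\<^esub> s)"
    if a: "a \<in> carrier R" and s: "s \<in> carrier (Chain S n)" for n a s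
  proof -
    have "a \<odot>\<^bsub>Chain S n\<^esub> pi n s \<ominus>\<^bsub>Chain S n\<^esub> a \<odot>\<^bsub>Chain S n\<^esub> s = a \<odot>\<^bsub>Chain S n\<^esub> (pi n s \<ominus>\<^bsub>Chain S n\<^esub> s)"
      using a s pi_in by (simp add: S.M.minus_eq S.M.smult_r_distr S.M.smult_r_minus)
    then show ?thesis using a s pi_in pi_diff Q.X.smult_closed by (subst pi_eq) auto
  qed
  have pi_d: "pi (n - 1) (diff S n (pi n s)) = pi (n - 1) (diff S n s)"
    if s: "s \<in> carrier (Chain S n)" for n s
  proof -
    have eq: "diff S n (pi n s) \<ominus>\<^bsub>Chain S (n - 1)\<^esub> diff S n s = diff S n (pi n s \<ominus>\<^bsub>Chain S n\<^esub> s)"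
      using s pi_in by (simp add: S.d_minus)
    have "diff S n (pi n s) \<ominus>\<^bsub>Chain S (n - 1)\<^esub> diff S n s \<in> N (n - 1)"
      unfolding eq by (rule dN[OF pi_diff[OF s]])
    then show ?thesis using s pi_in by (subst pi_eq) simp_all
  qed
  define P :: "('a, 'u) module_complex" where
    "P = \<lparr>Chain = \<lambda>n. \<lparr>carrier = pi n ` carrier (Chain S n), monoid.mult = undefined, one = undefined,
        ring.zero = pi n \<zero>\<^bsub>Chain S n\<^esub>, add = \<lambda>s t. pi n (s \<oplus>\<^bsub>Chain S n\<^esub> t),
        smult = \<lambda>a s. pi n (a \<odot>\<^bsub>Chain S n\<^esub> s)\<rparr>,
      diff = \<lambda>n s. pi (n - 1) (diff S n s)\<rparr>"
  have P [simp]: "carrier (Chain P n) = pi n ` carrier (Chain S n)" "\<zero>\<^bsub>Chain P n\<^esub> = pi n \<zero>\<^bsub>Chain S n\<^esub>"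
    "s \<oplus>\<^bsub>Chain P n\<^esub> t = pi n (s \<oplus>\<^bsub>Chain S n\<^esub> t)" "a \<odot>\<^bsub>Chain P n\<^esub> s = pi n (a \<odot>\<^bsub>Chain S n\<^esub> s)"
    "diff P n s = pi (n - 1) (diff S n s)" for n s t a
    by (simp_all add: P_def)
  have P_mod: "module R (Chain P n)" for n
    by (rule module_image[OF S.M.module_axioms, of _ "pi n" n]) (simp_all add: pi_add pi_smult)
  have P_cx: "complex_over R P"
  proof (rule complex_overI[OF S.domain_axioms P_mod])
    fix n x assume "x \<in> carrier (Chain P n)"
    then obtain s where s: "s \<in> carrier (Chain S n)" "x = pi n s" by auto
    then show "diff P n x \<in> carrier (Chain P (n - 1))" by (simp add: pi_d)
    show "diff P (n - 1) (diff P n x) = \<zero>\<^bsub>Chain P (n - 2)\<^esub>"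
      using s pi_d[of "diff S n s" "n - 1"] by (simp add: pi_d S.dd)
    fix a assume "a \<in> carrier R"
    then show "diff P n (a \<odot>\<^bsub>Chain P n\<^esub> x) = a \<odot>\<^bsub>Chain P (n - 1)\<^esub> diff P n x"
      using s by (simp add: pi_d pi_smult)
  next
    fix n x y assume "x \<in> carrier (Chain P n)" "y \<in> carrier (Chain P n)"
    then obtain s t where st: "s \<in> carrier (Chain S n)" "t \<in> carrier (Chain S n)" "x = pi n s" "y = pi n t" by auto
    then show "diff P n (x \<oplus>\<^bsub>Chain P n\<^esub> y) = diff P n x \<oplus>\<^bsub>Chain P (n - 1)\<^esub> diff P n y"
      by (simp add: pi_d pi_add)
  qed
  let ?pi = "\<lambda>n. \<lambda>s\<in>carrier (Chain S n). pi n s"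
  have "cmap R S ?pi P"
    by (rule cmap_restrictI[OF S P_cx]) (simp_all add: pi_add pi_smult pi_d)
  moreover have "carrier (Chain P n) = ?pi n ` carrier (Chain S n)" for n by auto
  moreover have "?pi n s = \<zero>\<^bsub>Chain P n\<^esub> \<longleftrightarrow> s \<in> N n" if "s \<in> carrier (Chain S n)" for n s
    using that pi_eq[OF that S.M.zero_closed] S.M.minus_add_cancel[OF that S.M.zero_closed] by simp
  ultimately show thesis by (rule that)
qed

lemma module_zero_module: "domain R \<Longrightarrow> module R (zero_module :: ('a, 'u) module)"
  by (intro moduleI abelian_groupI) (auto simp: zero_module_def domain_def)

lemma zero_complex_simps [simp]: "Chain zero_complex n = zero_module" "diff zero_complex n x = undefined"
  "carrier zero_module = {undefined}" "\<zero>\<^bsub>zero_module\<^esub> = undefined"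
  by (simp_all add: zero_complex_def zero_module_def)

lemma complex_over_zero: "domain R \<Longrightarrow> complex_over R (zero_complex :: ('a, 'u) module_complex)"
  by (rule complex_overI) (auto simp: module_zero_module, auto simp: zero_module_def)

text \<open>\<open>P\<close> is the cokernel of \<open>(f, -g) : A \<rightarrow> B \<oplus> C\<close>. There is no reference to a universal property or to a category,
  so that this applies before \<open>P\<close> is known to be an Abel complex.\<close>

locale raw_pushout = f: cmap R A f B + g: cmap R A g C + i: cmap R B i P + j: cmap R C j P
  for R :: "('a, 'r) ring_scheme" (structure)
    and A :: "('a, 'u) module_complex" and f and B :: "('a, 'u) module_complex"
    and g and C :: "('a, 'u) module_complex" and i and P :: "('a, 'u) module_complex" and j +
  assumes comm: "a \<in> carrier (Chain A n) \<Longrightarrow> i n (f n a) = j n (g n a)"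
    and gen: "p \<in> carrier (Chain P n) \<Longrightarrow>
      \<exists>x\<in>carrier (Chain B n). \<exists>y\<in>carrier (Chain C n). p = i n x \<oplus>\<^bsub>Chain P n\<^esub> j n y"
    and rel: "x \<in> carrier (Chain B n) \<Longrightarrow> y \<in> carrier (Chain C n) \<Longrightarrow>
      i n x \<oplus>\<^bsub>Chain P n\<^esub> j n y = \<zero>\<^bsub>Chain P n\<^esub> \<Longrightarrow>
      \<exists>a\<in>carrier (Chain A n). x = f n a \<and> y = \<ominus>\<^bsub>Chain C n\<^esub> g n a"
begin

lemma induced:
  assumes u: "cmap R B u X" and v: "cmap R C v X"
    and uv: "\<And>n a. a \<in> carrier (Chain A n) \<Longrightarrow> u n (f n a) = v n (g n a)"
  obtains h where "cmap R P h X"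
    "\<And>n x y. x \<in> carrier (Chain B n) \<Longrightarrow> y \<in> carrier (Chain C n) \<Longrightarrow>
      h n (i n x \<oplus>\<^bsub>Chain P n\<^esub> j n y) = u n x \<oplus>\<^bsub>Chain X n\<^esub> v n y"
proof -
  interpret u: cmap R B u X by (rule u)
  interpret v: cmap R C v X by (rule v)
  define h where "h n p = (SOME q. \<exists>x\<in>carrier (Chain B n). \<exists>y\<in>carrier (Chain C n).
    p = i n x \<oplus>\<^bsub>Chain P n\<^esub> j n y \<and> q = u n x \<oplus>\<^bsub>Chain X n\<^esub> v n y)" for n p
  have h: "h n (i n x \<oplus>\<^bsub>Chain P n\<^esub> j n y) = u n x \<oplus>\<^bsub>Chain X n\<^esub> v n y"
    if xy: "x \<in> carrier (Chain B n)" "y \<in> carrier (Chain C n)" for n x y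
    unfolding h_def
  proof (rule someI2)
    show "\<exists>x'\<in>carrier (Chain B n). \<exists>y'\<in>carrier (Chain C n).
      i n x \<oplus>\<^bsub>Chain P n\<^esub> j n y = i n x' \<oplus>\<^bsub>Chain P n\<^esub> j n y' \<and>
      u n x \<oplus>\<^bsub>Chain X n\<^esub> v n y = u n x' \<oplus>\<^bsub>Chain X n\<^esub> v n y'"
      using xy by blast
    fix q assume "\<exists>x'\<in>carrier (Chain B n). \<exists>y'\<in>carrier (Chain C n).
      i n x \<oplus>\<^bsub>Chain P n\<^esub> j n y = i n x' \<oplus>\<^bsub>Chain P n\<^esub> j n y' \<and> q = u n x' \<oplus>\<^bsub>Chain X n\<^esub> v n y'"
    then obtain x' y' where x': "x' \<in> carrier (Chain B n)" "y' \<in> carrier (Chain C n)"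
      and eq: "i n x \<oplus>\<^bsub>Chain P n\<^esub> j n y = i n x' \<oplus>\<^bsub>Chain P n\<^esub> j n y'" and q: "q = u n x' \<oplus>\<^bsub>Chain X n\<^esub> v n y'"
      by blast
    have "i n (x \<ominus>\<^bsub>Chain B n\<^esub> x') \<oplus>\<^bsub>Chain P n\<^esub> j n (y \<ominus>\<^bsub>Chain C n\<^esub> y') =
        (i n x \<oplus>\<^bsub>Chain P n\<^esub> j n y) \<ominus>\<^bsub>Chain P n\<^esub> (i n x' \<oplus>\<^bsub>Chain P n\<^esub> j n y')"
      using xy x' by (simp add: i.f_minus j.f_minus i.D.M.minus_eq i.D.M.minus_add i.D.M.a_ac)
    also have "\<dots> = \<zero>\<^bsub>Chain P n\<^esub>" unfolding eq using x' by simp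
    finally obtain a where a: "a \<in> carrier (Chain A n)" "x \<ominus>\<^bsub>Chain B n\<^esub> x' = f n a"
      "y \<ominus>\<^bsub>Chain C n\<^esub> y' = \<ominus>\<^bsub>Chain C n\<^esub> g n a"
      using rel[of "x \<ominus>\<^bsub>Chain B n\<^esub> x'" n "y \<ominus>\<^bsub>Chain C n\<^esub> y'"] xy x' by auto
    have x: "x = f n a \<oplus>\<^bsub>Chain B n\<^esub> x'"
      unfolding a(2)[symmetric] using xy x' by (simp add: f.D.M.minus_add_cancel)
    have y: "y = \<ominus>\<^bsub>Chain C n\<^esub> g n a \<oplus>\<^bsub>Chain C n\<^esub> y'"
      unfolding a(3)[symmetric] using xy x' by (simp add: g.D.M.minus_add_cancel)
    have "u n x \<oplus>\<^bsub>Chain X n\<^esub> v n y = (v n (g n a) \<oplus>\<^bsub>Chain X n\<^esub> u n x') \<oplus>\<^bsub>Chain X n\<^esub>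
        (\<ominus>\<^bsub>Chain X n\<^esub> v n (g n a) \<oplus>\<^bsub>Chain X n\<^esub> v n y')"
      unfolding x y using a(1) x' by (simp add: uv v.f_neg)
    also have "\<dots> = u n x' \<oplus>\<^bsub>Chain X n\<^esub> v n y'"
      using a(1) x' u.D.M.r_neg1[of "v n (g n a)" n "u n x' \<oplus>\<^bsub>Chain X n\<^esub> v n y'"]
      by (simp add: u.D.M.a_ac)
    finally show "q = u n x \<oplus>\<^bsub>Chain X n\<^esub> v n y" using q by simp
  qed
  have "cmap R P (\<lambda>n. \<lambda>p\<in>carrier (Chain P n). h n p) X"
  proof (rule cmap_restrictI[OF i.D.complex_over_axioms u.D.complex_over_axioms])
    fix n p assume "p \<in> carrier (Chain P n)"
    then obtain x y where p: "x \<in> carrier (Chain B n)" "y \<in> carrier (Chain C n)" "p = i n x \<oplus>\<^bsub>Chain P n\<^esub> j n y"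
      using gen by blast
    then show "h n p \<in> carrier (Chain X n)" by (simp add: h)
    show "diff X n (h n p) = h (n - 1) (diff P n p)"
      using p by (simp add: h i.D.d_add u.D.d_add i.d_f j.d_f u.d_f v.d_f)
    fix a assume "a \<in> carrier R"
    then show "h n (a \<odot>\<^bsub>Chain P n\<^esub> p) = a \<odot>\<^bsub>Chain X n\<^esub> h n p"
      using p h[of "a \<odot>\<^bsub>Chain B n\<^esub> x" n "a \<odot>\<^bsub>Chain C n\<^esub> y"]
      by (simp add: h i.D.M.smult_r_distr u.D.M.smult_r_distr)
  next
    fix n p p' assume "p \<in> carrier (Chain P n)" "p' \<in> carrier (Chain P n)"
    then obtain x y x' y' where p: "x \<in> carrier (Chain B n)" "y \<in> carrier (Chain C n)" "p = i n x \<oplus>\<^bsub>Chain P n\<^esub> j n y"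
      and p': "x' \<in> carrier (Chain B n)" "y' \<in> carrier (Chain C n)" "p' = i n x' \<oplus>\<^bsub>Chain P n\<^esub> j n y'"
      using gen by metis
    have "p \<oplus>\<^bsub>Chain P n\<^esub> p' = i n (x \<oplus>\<^bsub>Chain B n\<^esub> x') \<oplus>\<^bsub>Chain P n\<^esub> j n (y \<oplus>\<^bsub>Chain C n\<^esub> y')"
      using p p' by (simp add: i.D.M.a_ac)
    then have "h n (p \<oplus>\<^bsub>Chain P n\<^esub> p') = u n (x \<oplus>\<^bsub>Chain B n\<^esub> x') \<oplus>\<^bsub>Chain X n\<^esub> v n (y \<oplus>\<^bsub>Chain C n\<^esub> y')"
      using p p' h[of "x \<oplus>\<^bsub>Chain B n\<^esub> x'" n "y \<oplus>\<^bsub>Chain C n\<^esub> y'"] by (simp del: i.f.f_add j.f.f_add)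
    also have "\<dots> = h n p \<oplus>\<^bsub>Chain X n\<^esub> h n p'"
      using p p' by (simp add: h u.D.M.a_ac)
    finally show "h n (p \<oplus>\<^bsub>Chain P n\<^esub> p') = h n p \<oplus>\<^bsub>Chain X n\<^esub> h n p'" .
  qed
  then show thesis
    by (rule that) (simp add: h)
qed

lemma i_add_j_zero: "x \<in> carrier (Chain B n) \<Longrightarrow> i n x = i n x \<oplus>\<^bsub>Chain P n\<^esub> j n \<zero>\<^bsub>Chain C n\<^esub>"
  and zero_add_j: "y \<in> carrier (Chain C n) \<Longrightarrow> j n y = i n \<zero>\<^bsub>Chain B n\<^esub> \<oplus>\<^bsub>Chain P n\<^esub> j n y"
  by simp_all

text \<open>A pushout along a map to a trivial complex is a cokernel.\<close>

lemma short_exact_if_trivial: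
  assumes inj: "\<And>n a. a \<in> carrier (Chain A n) \<Longrightarrow> f n a = \<zero>\<^bsub>Chain B n\<^esub> \<Longrightarrow> a = \<zero>\<^bsub>Chain A n\<^esub>"
    and triv: "\<And>n. carrier (Chain C n) = {\<zero>\<^bsub>Chain C n\<^esub>}"
  shows "short_exact R A f B i P"
proof (intro short_exact.intro short_exact_axioms.intro)
  fix n
  show "a = \<zero>\<^bsub>Chain A n\<^esub>" if "a \<in> carrier (Chain A n)" "f n a = \<zero>\<^bsub>Chain B n\<^esub>" for a
    using inj that .
  show "\<exists>y\<in>carrier (Chain B n). z = i n y" if "z \<in> carrier (Chain P n)" for z
    using gen[OF that] triv[of n] by auto
  show "i n (f n x) = \<zero>\<^bsub>Chain P n\<^esub>" if "x \<in> carrier (Chain A n)" for x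
    using comm[OF that] g.f_closed[OF that] triv[of n] by simp
  show "\<exists>x\<in>carrier (Chain A n). y = f n x" if "y \<in> carrier (Chain B n)" "i n y = \<zero>\<^bsub>Chain P n\<^esub>" for y
    using rel[OF that(1) g.D.M.zero_closed] that by auto
qed (rule f.C.complex_over_axioms f.D.complex_over_axioms i.D.complex_over_axioms f.cmap_axioms i.cmap_axioms)+

end

text \<open>The quotient of \<open>B \<oplus> C\<close>, encoded in \<open>'u\<close> by triples with a dummy third component.\<close>

lemma pushout_exists:
  fixes A B C :: "('a, 'u) module_complex" and enc :: "'u \<times> 'u \<times> 'u \<Rightarrow> 'u"
  assumes inj: "inj enc" and f: "cmap R A f B" and g: "cmap R A g C"
  obtains i and P :: "('a, 'u) module_complex" and j where "raw_pushout R A f B g C i P j"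
proof -
  interpret f: cmap R A f B by (rule f)
  interpret g: cmap R A g C by (rule g)
  have dec [simp]: "inv_into UNIV enc (enc t) = t" for t using inj by simp
  have enc_eq [simp]: "enc s = enc t \<longleftrightarrow> s = t" for s t using inj by (simp add: inj_eq)
  define S :: "('a, 'u) module_complex" where
    "S = \<lparr>Chain = \<lambda>n. direct_sum3 enc (Chain B n) (Chain C n) zero_module,
      diff = \<lambda>n s. case inv_into UNIV enc s of (x, y, z) \<Rightarrow> enc (diff B n x, diff C n y, undefined)\<rparr>"
  have S_carrier: "s \<in> carrier (Chain S n) \<longleftrightarrow>
      (\<exists>x\<in>carrier (Chain B n). \<exists>y\<in>carrier (Chain C n). s = enc (x, y, undefined))" for s n
    by (auto simp: S_def direct_sum3_def)
  have S_in: "enc (x, y, z) \<in> carrier (Chain S n) \<longleftrightarrow>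
      x \<in> carrier (Chain B n) \<and> y \<in> carrier (Chain C n) \<and> z = undefined" for x y z n
    by (auto simp: S_carrier)
  have zadd: "undefined \<oplus>\<^bsub>zero_module\<^esub> undefined = (undefined :: 'u)" "a \<odot>\<^bsub>zero_module\<^esub> undefined = (undefined :: 'u)"
    for a :: 'a by (simp_all add: zero_module_def)
  have S_ops: "\<zero>\<^bsub>Chain S n\<^esub> = enc (\<zero>\<^bsub>Chain B n\<^esub>, \<zero>\<^bsub>Chain C n\<^esub>, undefined)"
    "enc (x, y, undefined) \<oplus>\<^bsub>Chain S n\<^esub> enc (x', y', undefined) =
      enc (x \<oplus>\<^bsub>Chain B n\<^esub> x', y \<oplus>\<^bsub>Chain C n\<^esub> y', undefined)"
    "a \<odot>\<^bsub>Chain S n\<^esub> enc (x, y, undefined) = enc (a \<odot>\<^bsub>Chain B n\<^esub> x, a \<odot>\<^bsub>Chain C n\<^esub> y, undefined)"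
    "diff S n (enc (x, y, undefined)) = enc (diff B n x, diff C n y, undefined)" for n x y x' y' a
    by (simp_all add: S_def direct_sum3_def zadd)
  have S_mod: "module R (Chain S n)" for n
  proof (rule moduleI)
    show "cring R" by unfold_locales
    show "abelian_group (Chain S n)"
    proof (rule abelian_groupI)
      fix s assume "s \<in> carrier (Chain S n)"
      then obtain x y where "x \<in> carrier (Chain B n)" "y \<in> carrier (Chain C n)" "s = enc (x, y, undefined)"
        by (auto simp: S_carrier)
      then show "\<exists>t\<in>carrier (Chain S n). t \<oplus>\<^bsub>Chain S n\<^esub> s = \<zero>\<^bsub>Chain S n\<^esub>"
        by (intro bexI[of _ "enc (\<ominus>\<^bsub>Chain B n\<^esub> x, \<ominus>\<^bsub>Chain C n\<^esub> y, undefined)"])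
          (simp_all add: S_ops S_in f.D.M.l_neg g.D.M.l_neg)
    qed (auto simp: S_carrier S_ops f.D.M.a_assoc g.D.M.a_assoc intro: f.D.M.a_comm g.D.M.a_comm)
  qed (auto simp: S_carrier S_ops f.D.M.smult_l_distr g.D.M.smult_l_distr
      f.D.M.smult_r_distr g.D.M.smult_r_distr f.D.M.smult_assoc1 g.D.M.smult_assoc1)
  have dom: "domain R" by unfold_locales
  have S: "complex_over R S"
    by (rule complex_overI[OF dom S_mod])
      (auto simp: S_carrier S_ops f.D.d_add g.D.d_add f.D.d_smult g.D.d_smult f.D.dd g.D.dd)
  interpret S: complex_over R S by (rule S)
  define k where "k n a = enc (f n a, \<ominus>\<^bsub>Chain C n\<^esub> g n a, undefined)" for n a
  have k: "cmap R A (\<lambda>n. \<lambda>a\<in>carrier (Chain A n). k n a) S"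
    by (rule cmap_restrictI[OF f.C.complex_over_axioms S])
      (simp_all add: k_def S_in S_ops g.D.M.minus_add g.D.M.smult_r_minus f.d_f g.d_f g.D.d_neg)
  then interpret k: cmap R A "\<lambda>n. \<lambda>a\<in>carrier (Chain A n). k n a" S .
  \<comment> \<open>The kernel of \<open>B \<oplus> C \<rightarrow> P\<close> is to be the image of \<open>(f, -g)\<close>.\<close>
  define N where "N n = (\<lambda>a\<in>carrier (Chain A n). k n a) ` carrier (Chain A n)" for n
  have N: "submodule R (N n) (Chain S n)" for n
    unfolding N_def by (rule k.f.image_submodule[OF f.C.M.carrier_submodule])
  have dN: "diff S n x \<in> N (n - 1)" if "x \<in> N n" for n x
  proof -
    from that obtain a where a: "a \<in> carrier (Chain A n)" "x = k n a" by (auto simp: N_def)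
    then have "diff S n x = k (n - 1) (diff A n a)" using k.d_f[of a n] by simp
    then show ?thesis using a by (auto simp: N_def)
  qed
  obtain P :: "('a, 'u) module_complex" and \<pi> where pi: "cmap R S \<pi> P"
    and surj: "\<And>n. carrier (Chain P n) = \<pi> n ` carrier (Chain S n)"
    and ker: "\<And>n s. s \<in> carrier (Chain S n) \<Longrightarrow> \<pi> n s = \<zero>\<^bsub>Chain P n\<^esub> \<longleftrightarrow> s \<in> N n"
    by (rule quotient_complex[OF S N dN]) (assumption, rule that)
  interpret pi: cmap R S \<pi> P by (rule pi)
  define i where "i n x = \<pi> n (enc (x, \<zero>\<^bsub>Chain C n\<^esub>, undefined))" for n x
  define j where "j n y = \<pi> n (enc (\<zero>\<^bsub>Chain B n\<^esub>, y, undefined))" for n y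
  let ?i = "\<lambda>n. \<lambda>x\<in>carrier (Chain B n). i n x" and ?j = "\<lambda>n. \<lambda>y\<in>carrier (Chain C n). j n y"
  have i_hom: "cmap R B ?i P"
    by (rule cmap_restrictI[OF f.D.complex_over_axioms pi.D.complex_over_axioms])
      (simp_all add: i_def S_in S_ops pi.d_f flip: pi.f_add pi.f_smult)
  have j_hom: "cmap R C ?j P"
    by (rule cmap_restrictI[OF g.D.complex_over_axioms pi.D.complex_over_axioms])
      (simp_all add: j_def S_in S_ops pi.d_f flip: pi.f_add pi.f_smult)
  have ij: "i n x \<oplus>\<^bsub>Chain P n\<^esub> j n y = \<pi> n (enc (x, y, undefined))"
    if "x \<in> carrier (Chain B n)" "y \<in> carrier (Chain C n)" for n x y
    using that by (simp add: i_def j_def S_in S_ops flip: pi.f_add)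
  have "raw_pushout R A f B g C ?i P ?j"
  proof (intro raw_pushout.intro raw_pushout_axioms.intro f g i_hom j_hom)
    fix n p assume "p \<in> carrier (Chain P n)"
    then obtain x y where "x \<in> carrier (Chain B n)" "y \<in> carrier (Chain C n)" "p = \<pi> n (enc (x, y, undefined))"
      by (auto simp: surj S_carrier)
    then show "\<exists>x\<in>carrier (Chain B n). \<exists>y\<in>carrier (Chain C n). p = ?i n x \<oplus>\<^bsub>Chain P n\<^esub> ?j n y"
      by (intro bexI[of _ x] bexI[of _ y]) (simp_all add: ij)
  next
    fix n x y assume xy: "x \<in> carrier (Chain B n)" "y \<in> carrier (Chain C n)"
      and "?i n x \<oplus>\<^bsub>Chain P n\<^esub> ?j n y = \<zero>\<^bsub>Chain P n\<^esub>"
    then have "enc (x, y, undefined) \<in> N n" using ker[of "enc (x, y, undefined)" n] by (simp add: ij S_in)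
    then show "\<exists>a\<in>carrier (Chain A n). x = f n a \<and> y = \<ominus>\<^bsub>Chain C n\<^esub> g n a"
      by (auto simp: N_def k_def)
  next
    fix n a assume a: "a \<in> carrier (Chain A n)"
    have "i n (f n a) \<oplus>\<^bsub>Chain P n\<^esub> j n (\<ominus>\<^bsub>Chain C n\<^esub> g n a) = \<pi> n (k n a)"
      using a by (simp add: ij k_def)
    also have "\<dots> = \<zero>\<^bsub>Chain P n\<^esub>" using a by (subst ker) (auto simp: N_def k_def S_in)
    finally have "?i n (f n a) \<oplus>\<^bsub>Chain P n\<^esub> \<ominus>\<^bsub>Chain P n\<^esub> ?j n (g n a) = \<zero>\<^bsub>Chain P n\<^esub>"
      using a cmap.f_neg[OF j_hom, of "g n a" n] by simp
    then show "?i n (f n a) = ?j n (g n a)"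
      using a cmap.f_closed[OF i_hom, of "f n a" n] cmap.f_closed[OF j_hom, of "g n a" n]
      by (simp flip: pi.D.M.minus_eq)
  qed
  then show thesis by (rule that)
qed

text \<open>Along an injection \<open>f\<close>, the map \<open>j\<close> is injective and has the same cokernel as \<open>f\<close>.\<close>

lemma (in raw_pushout) pushout_quotient:
  fixes enc :: "'u \<times> 'u \<times> 'u \<Rightarrow> 'u"
  assumes enc: "inj enc"
    and inj: "\<And>n a. a \<in> carrier (Chain A n) \<Longrightarrow> f n a = \<zero>\<^bsub>Chain B n\<^esub> \<Longrightarrow> a = \<zero>\<^bsub>Chain A n\<^esub>"
  obtains q D z h where
    "raw_pushout R A f B (\<lambda>n. \<lambda>x\<in>carrier (Chain A n). undefined) zero_complex q D z"
    "short_exact R A f B q D" "short_exact R C j P h D"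
    "\<And>n x. x \<in> carrier (Chain B n) \<Longrightarrow> h n (i n x) = q n x"
proof -
  have Z: "complex_over R (zero_complex :: ('a, 'u) module_complex)"
    by (rule complex_over_zero) unfold_locales
  have gz: "cmap R A (\<lambda>n. \<lambda>x\<in>carrier (Chain A n). undefined) zero_complex"
    using cmap_zero[OF f.C.complex_over_axioms Z] by simp
  obtain q D z where D: "raw_pushout R A f B
      (\<lambda>n. \<lambda>x\<in>carrier (Chain A n). undefined) zero_complex q D z"
    by (rule pushout_exists[OF enc f.cmap_axioms gz])
  interpret D: raw_pushout R A f B "\<lambda>n. \<lambda>x\<in>carrier (Chain A n). undefined" zero_complex q D z
    by (rule D)
  have ses: "short_exact R A f B q D" by (rule D.short_exact_if_trivial[OF inj]) simp_all
  then interpret ses: short_exact R A f B q D .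
  have 0: "cmap R C (\<lambda>n. \<lambda>x\<in>carrier (Chain C n). \<zero>\<^bsub>Chain D n\<^esub>) D"
    by (rule cmap_zero[OF g.D.complex_over_axioms D.i.D.complex_over_axioms])
  obtain h where h: "cmap R P h D" and h_eq: "\<And>n x y. x \<in> carrier (Chain B n) \<Longrightarrow> y \<in> carrier (Chain C n) \<Longrightarrow>
      h n (i n x \<oplus>\<^bsub>Chain P n\<^esub> j n y) = q n x \<oplus>\<^bsub>Chain D n\<^esub> (\<lambda>x\<in>carrier (Chain C n). \<zero>\<^bsub>Chain D n\<^esub>) y"
    by (rule induced[OF D.i.cmap_axioms 0]) (simp add: ses.p_i, rule that)
  interpret h: cmap R P h D by (rule h)
  have h_eq': "h n (i n x \<oplus>\<^bsub>Chain P n\<^esub> j n y) = q n x"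
    if "x \<in> carrier (Chain B n)" "y \<in> carrier (Chain C n)" for n x y
    using that h_eq[OF that] by simp
  have h_i: "h n (i n x) = q n x" if "x \<in> carrier (Chain B n)" for n x
    using h_eq'[OF that g.D.M.zero_closed] that by simp
  have "short_exact R C j P h D"
  proof (intro short_exact.intro short_exact_axioms.intro)
    fix n
    show "y = \<zero>\<^bsub>Chain C n\<^esub>" if y: "y \<in> carrier (Chain C n)" "j n y = \<zero>\<^bsub>Chain P n\<^esub>" for y
    proof -
      have "i n \<zero>\<^bsub>Chain B n\<^esub> \<oplus>\<^bsub>Chain P n\<^esub> j n y = \<zero>\<^bsub>Chain P n\<^esub>" using y by simp
      from rel[OF f.D.M.zero_closed y(1) this] obtain a where
        a: "a \<in> carrier (Chain A n)" "\<zero>\<^bsub>Chain B n\<^esub> = f n a" "y = \<ominus>\<^bsub>Chain C n\<^esub> g n a" by blast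
      with inj[of a n] have "a = \<zero>\<^bsub>Chain A n\<^esub>" by simp
      with a(3) have "y = g n (\<ominus>\<^bsub>Chain A n\<^esub> \<zero>\<^bsub>Chain A n\<^esub>)" by (simp only: g.f_neg[OF f.C.M.zero_closed])
      also have "\<ominus>\<^bsub>Chain A n\<^esub> \<zero>\<^bsub>Chain A n\<^esub> = \<zero>\<^bsub>Chain A n\<^esub>"
        using f.C.M.l_neg[OF f.C.M.zero_closed, of n] by simp
      finally show ?thesis by simp
    qed
    show "\<exists>y\<in>carrier (Chain P n). z = h n y" if z: "z \<in> carrier (Chain D n)" for z
    proof -
      from ses.p_surj[OF z] obtain x where "x \<in> carrier (Chain B n)" "z = q n x" by blast
      then show ?thesis by (intro bexI[of _ "i n x"]) (simp_all add: h_i)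
    qed
    show "h n (j n x) = \<zero>\<^bsub>Chain D n\<^esub>" if "x \<in> carrier (Chain C n)" for x
      using h_eq'[OF f.D.M.zero_closed that] that by simp
    show "\<exists>x\<in>carrier (Chain C n). y = j n x" if y: "y \<in> carrier (Chain P n)" "h n y = \<zero>\<^bsub>Chain D n\<^esub>" for y
    proof -
      from gen[OF y(1)] obtain s t where st: "s \<in> carrier (Chain B n)" "t \<in> carrier (Chain C n)"
        "y = i n s \<oplus>\<^bsub>Chain P n\<^esub> j n t" by blast
      then have "q n s = \<zero>\<^bsub>Chain D n\<^esub>" using y(2) h_eq' by simp
      then obtain a where a: "a \<in> carrier (Chain A n)" "s = f n a" using ses.ker_p st by blast
      then have "y = j n (g n a \<oplus>\<^bsub>Chain C n\<^esub> t)" using st by (simp add: comm)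
      then show ?thesis using a st by blast
    qed
  qed (rule g.D.complex_over_axioms i.D.complex_over_axioms D.i.D.complex_over_axioms j.cmap_axioms h)+
  from D ses this h_i show thesis by (rule that)
qed

section \<open>The category of Abel complexes\<close>

text \<open>The map on the common cokernel \<open>D\<close> of \<open>f\<close> and \<open>j\<close> is a quasi-isomorphism because \<open>a\<close> and \<open>b\<close> are; then \<open>h\<close> is the
  middle of a map of the short exact sequences \<open>C \<rightarrow> P \<rightarrow> D\<close>.\<close>

lemma gluing_quasi_isomorphism:
  fixes A B C P A' B' C' P' :: "('a, 'u) module_complex" and enc :: "'u \<times> 'u \<times> 'u \<Rightarrow> 'u"
  assumes enc: "inj enc"
    and X: "raw_pushout R A f B g C i P j" and X': "raw_pushout R A' f' B' g' C' i' P' j'"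
    and inj: "\<And>n x. x \<in> carrier (Chain A n) \<Longrightarrow> f n x = \<zero>\<^bsub>Chain B n\<^esub> \<Longrightarrow> x = \<zero>\<^bsub>Chain A n\<^esub>"
      "\<And>n x. x \<in> carrier (Chain A' n) \<Longrightarrow> f' n x = \<zero>\<^bsub>Chain B' n\<^esub> \<Longrightarrow> x = \<zero>\<^bsub>Chain A' n\<^esub>"
    and a: "cmap R A a A'" "quasi_isomorphism A a A'"
    and b: "cmap R B b B'" "quasi_isomorphism B b B'"
    and c: "cmap R C c C'" "quasi_isomorphism C c C'"
    and h: "cmap R P h P'"
    and bf: "\<And>n x. x \<in> carrier (Chain A n) \<Longrightarrow> b n (f n x) = f' n (a n x)"
    and hi: "\<And>n x. x \<in> carrier (Chain B n) \<Longrightarrow> h n (i n x) = i' n (b n x)"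
    and hj: "\<And>n x. x \<in> carrier (Chain C n) \<Longrightarrow> h n (j n x) = j' n (c n x)"
  shows "quasi_isomorphism P h P'"
proof -
  interpret X: raw_pushout R A f B g C i P j by (rule X)
  interpret X': raw_pushout R A' f' B' g' C' i' P' j' by (rule X')
  interpret a: cmap R A a A' by (rule a)
  interpret b: cmap R B b B' by (rule b)
  interpret c: cmap R C c C' by (rule c)
  interpret h: cmap R P h P' by (rule h)
  obtain q D z k where
    D: "raw_pushout R A f B (\<lambda>n. \<lambda>x\<in>carrier (Chain A n). undefined) zero_complex q D z"
    and ses: "short_exact R A f B q D" "short_exact R C j P k D"
    and ki: "\<And>n x. x \<in> carrier (Chain B n) \<Longrightarrow> k n (i n x) = q n x"
    by (rule X.pushout_quotient[OF enc inj(1)]) (assumption+, rule that)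
  obtain q' D' z' k' where
    D': "raw_pushout R A' f' B' (\<lambda>n. \<lambda>x\<in>carrier (Chain A' n). undefined) zero_complex q' D' z'"
    and ses': "short_exact R A' f' B' q' D'" "short_exact R C' j' P' k' D'"
    and k'i': "\<And>n x. x \<in> carrier (Chain B' n) \<Longrightarrow> k' n (i' n x) = q' n x"
    by (rule X'.pushout_quotient[OF enc inj(2)]) (assumption+, rule that)
  interpret D: raw_pushout R A f B "\<lambda>n. \<lambda>x\<in>carrier (Chain A n). undefined" zero_complex q D z
    by (rule D)
  interpret D': raw_pushout R A' f' B' "\<lambda>n. \<lambda>x\<in>carrier (Chain A' n). undefined" zero_complex q' D' z'
    by (rule D')
  interpret s: short_exact R A f B q D by (rule ses)
  interpret t: short_exact R C j P k D by (rule ses)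
  interpret s': short_exact R A' f' B' q' D' by (rule ses')
  interpret t': short_exact R C' j' P' k' D' by (rule ses')
  have u: "cmap R B (\<lambda>n. compose (carrier (Chain B n)) (q' n) (b n)) D'"
    by (rule cmap_compose[OF b(1) D'.i.cmap_axioms])
  have v: "cmap R zero_complex (\<lambda>n. \<lambda>x\<in>carrier (Chain (zero_complex :: ('a, 'u) module_complex) n). \<zero>\<^bsub>Chain D' n\<^esub>) D'"
    by (rule cmap_zero[OF D.g.D.complex_over_axioms D'.i.D.complex_over_axioms])
  obtain \<gamma> where \<gamma>: "cmap R D \<gamma> D'" and
    \<gamma>_eq: "\<And>n x y. x \<in> carrier (Chain B n) \<Longrightarrow> y \<in> carrier (Chain (zero_complex :: ('a, 'u) module_complex) n) \<Longrightarrow>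
      \<gamma> n (q n x \<oplus>\<^bsub>Chain D n\<^esub> z n y) = compose (carrier (Chain B n)) (q' n) (b n) x \<oplus>\<^bsub>Chain D' n\<^esub>
        (\<lambda>x\<in>carrier (Chain (zero_complex :: ('a, 'u) module_complex) n). \<zero>\<^bsub>Chain D' n\<^esub>) y"
    by (rule D.induced[OF u v]) (simp add: compose_def bf s'.p_i, rule that)
  interpret \<gamma>: cmap R D \<gamma> D' by (rule \<gamma>)
  have \<gamma>_q: "\<gamma> n (q n x) = q' n (b n x)" if x: "x \<in> carrier (Chain B n)" for n x
  proof -
    have "z n undefined = \<zero>\<^bsub>Chain D n\<^esub>" using D.j.f_zero[of n] by simp
    then show ?thesis using \<gamma>_eq[OF x, of undefined] x by (simp add: compose_def)
  qed
  interpret S: short_exact_map R A f B q D A' f' B' q' D' a b \<gamma>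
    by (intro short_exact_map.intro short_exact_map_axioms.intro ses ses' a b \<gamma>) (simp_all add: bf \<gamma>_q)
  have \<gamma>_qi: "quasi_isomorphism D \<gamma> D'" by (rule S.quotient_quasi_isomorphism[OF a(2) b(2)])
  have \<gamma>_k: "\<gamma> n (k n p) = k' n (h n p)" if p: "p \<in> carrier (Chain P n)" for n p
  proof -
    from X.gen[OF p] obtain x y where xy: "x \<in> carrier (Chain B n)" "y \<in> carrier (Chain C n)"
      "p = i n x \<oplus>\<^bsub>Chain P n\<^esub> j n y" by blast
    then show ?thesis by (simp add: t.p_i t'.p_i ki k'i' \<gamma>_q hi hj)
  qed
  interpret T: short_exact_map R C j P k D C' j' P' k' D' c h \<gamma>
    by (intro short_exact_map.intro short_exact_map_axioms.intro ses ses' c h \<gamma>) (simp_all add: hj \<gamma>_k)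
  show ?thesis by (rule T.middle_quasi_isomorphism[OF c(2) \<gamma>_qi])
qed

lemma sq_fin_same:
  assumes "submodule_pair R M X X" shows "sq_fin R M X X"
proof -
  interpret submodule_pair R M X X by fact
  obtain \<phi> where L: "localization R M X X (tensor_fractions R SQ) \<phi>" by (rule localization_tensor)
  interpret L: localization R M X X "tensor_fractions R SQ" \<phi> by (rule L)
  have "v = \<zero>\<^bsub>tensor_fractions R SQ\<^esub>" if "v \<in> carrier (tensor_fractions R SQ)" for v
  proof -
    from that obtain s y where sy: "s \<in> carrier R" "s \<noteq> \<zero>\<^bsub>R\<^esub>" "y \<in> X"
      "v = fraction R \<one>\<^bsub>R\<^esub> s \<odot>\<^bsub>tensor_fractions R SQ\<^esub> \<phi> y" by (rule L.phi_cases)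
    have "\<phi> y = \<zero>\<^bsub>tensor_fractions R SQ\<^esub>"
      using sy by (subst L.phi_zero_iff) (auto intro!: bexI[of _ "\<one>\<^bsub>R\<^esub>"] simp: L.Y_in)
    with sy show ?thesis by simp
  qed
  then have "carrier (tensor_fractions R SQ) = {\<zero>\<^bsub>tensor_fractions R SQ\<^esub>}"
    using L.V.module.M.zero_closed by blast
  then have "L.V.module.gen_set {}" by (auto simp: L.V.module.span_def L.V.module.lincomb_def)
  then show ?thesis
    unfolding sq_fin_def has_finite_rank_def L.V.fin_dim_def by (intro exI[of _ "{}"]) simp
qed

lemma zero_complex_Abel:
  assumes "domain R" shows "(zero_complex :: ('a, 'u) module_complex) \<in> Abel_complexes R"
proof -
  let ?Z = "zero_complex :: ('a, 'u) module_complex"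
  interpret Z: complex_over R ?Z by (rule complex_over_zero[OF assms])
  have bz: "cycles ?Z n = boundaries ?Z n" for n
    by (auto simp: cycles_def boundaries_def)
  have pair: "submodule_pair R (Chain ?Z n) (boundaries ?Z n) (boundaries ?Z n)" for n
    using Z.H.submodule_pair_axioms[of n] by (simp add: bz)
  have fin: "hfin R ?Z n" for n
    unfolding Z.hfin_eq bz by (rule sq_fin_same[OF pair])
  have rank: "hrank R ?Z n = 0" for n
    unfolding Z.hrank_eq bz by (rule sq_rank_same[OF pair sq_fin_same[OF pair]])
  have "Abel_controlled (\<lambda>n. 0)"
    by (auto simp: Abel_controlled_def Abel_sequence_def controlled_absolute_growth_def intro!: exI[of _ 0])
  then show ?thesis
    using Z.cx fin by (simp add: Abel_complexes_iff rank positive_complex_def)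
qed

abbreviation src :: "('a, 'u) chain_map \<Rightarrow> ('a, 'u) module_complex" where "src f \<equiv> fst f"
abbreviation tgt :: "('a, 'u) chain_map \<Rightarrow> ('a, 'u) module_complex" where "tgt f \<equiv> snd (snd f)"
abbreviation app :: "('a, 'u) chain_map \<Rightarrow> int \<Rightarrow> 'u \<Rightarrow> 'u" where "app f \<equiv> fst (snd f)"

text \<open>The injection \<open>enc\<close> keeps direct sums, and with them pushouts, within the universe \<open>'u\<close>.\<close>

locale abel_cat = domain R for R :: "('a, 'r) ring_scheme" (structure) +
  fixes enc :: "'u \<times> 'u \<times> 'u \<Rightarrow> 'u"
  assumes inj_enc: "inj enc"
begin

abbreviation W where "W \<equiv> (Abel_category R :: (('a, 'u) module_complex, ('a, 'u) chain_map) waldhausen)"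

lemma W_simps [simp]:
  "Ob W = Abel_complexes R" "Dom W f = src f" "Cod W f = tgt f" "Zero W = zero_complex"
  by (simp_all add: Abel_category_def split_beta)

lemma complex_Ob: "C \<in> Abel_complexes R \<Longrightarrow> complex_over R C"
  by (intro complex_over.intro complex_over_axioms.intro domain_axioms) (simp add: Abel_complexes_def)

lemma cmap_iff: "C \<in> Abel_complexes R \<Longrightarrow> D \<in> Abel_complexes R \<Longrightarrow> cmap R C f D \<longleftrightarrow> is_chain_map R C f D"
  using complex_Ob by (auto intro: cmap.intro cmap_axioms.intro dest: cmap.chain_map)

lemma Arr_iff: "f \<in> Arr W \<longleftrightarrow>
    src f \<in> Abel_complexes R \<and> tgt f \<in> Abel_complexes R \<and> cmap R (src f) (app f) (tgt f)"
  by (cases f) (auto simp: Abel_category_def cmap_iff)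

lemma ArrI: "C \<in> Abel_complexes R \<Longrightarrow> D \<in> Abel_complexes R \<Longrightarrow> cmap R C \<phi> D \<Longrightarrow> (C, \<phi>, D) \<in> Arr W"
  by (simp add: Arr_iff)

lemma Arr_cmap: "f \<in> Arr W \<Longrightarrow> cmap R (src f) (app f) (tgt f)" by (simp add: Arr_iff)

lemma Hom_iff: "f \<in> Hom W A B \<longleftrightarrow> f \<in> Arr W \<and> src f = A \<and> tgt f = B"
  by (simp add: Hom_def)

lemma Idn_W: "Idn W C = (C, \<lambda>n. \<lambda>x\<in>carrier (Chain C n). x, C)"
  by (simp add: Abel_category_def)

lemma Comp_W: "g \<cdot>\<^bsub>W\<^esub> f = (src f, \<lambda>n. compose (carrier (Chain (src f) n)) (app g n) (app f n), tgt g)"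
  by (simp add: Abel_category_def split_beta)

lemma Comp_simps [simp]: "src (g \<cdot>\<^bsub>W\<^esub> f) = src f" "tgt (g \<cdot>\<^bsub>W\<^esub> f) = tgt g"
  by (simp_all add: Comp_W)

lemma app_Comp [simp]: "x \<in> carrier (Chain (src f) n) \<Longrightarrow> app (g \<cdot>\<^bsub>W\<^esub> f) n x = app g n (app f n x)"
  by (simp add: Comp_W compose_def)

lemma Idn_simps [simp]: "src (Idn W C) = C" "tgt (Idn W C) = C"
    "x \<in> carrier (Chain C n) \<Longrightarrow> app (Idn W C) n x = x"
  by (simp_all add: Idn_W)

lemma Cof_iff: "f \<in> Cof W \<longleftrightarrow> f \<in> Arr W \<and> (\<forall>n. inj_on (app f n) (carrier (Chain (src f) n)))"
  by (cases f) (auto simp: Abel_category_def)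

lemma Weq_iff: "f \<in> Weq W \<longleftrightarrow> f \<in> Arr W \<and> quasi_isomorphism (src f) (app f) (tgt f)"
  by (cases f) (auto simp: Abel_category_def)

lemma cof_arr: "f \<in> Cof W \<Longrightarrow> f \<in> Arr W" and weq_arr: "f \<in> Weq W \<Longrightarrow> f \<in> Arr W"
  by (simp_all add: Cof_iff Weq_iff)

lemma Arr_Ob [simp]: "f \<in> Arr W \<Longrightarrow> src f \<in> Abel_complexes R" "f \<in> Arr W \<Longrightarrow> tgt f \<in> Abel_complexes R"
  by (simp_all add: Arr_iff)

lemma arr_eqI:
  assumes f: "f \<in> Arr W" and g: "g \<in> Arr W" and "src f = src g" "tgt f = tgt g"
    and eq: "\<And>n x. x \<in> carrier (Chain (src f) n) \<Longrightarrow> app f n x = app g n x"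
  shows "f = g"
proof -
  have "app f n = app g n" for n
  proof (rule extensionalityI)
    show "app f n \<in> extensional (carrier (Chain (src f) n))"
      using cmap.chain_map[OF Arr_cmap[OF f]] by (simp add: is_chain_map_def)
    show "app g n \<in> extensional (carrier (Chain (src f) n))"
      using cmap.chain_map[OF Arr_cmap[OF g]] assms(3) by (simp add: is_chain_map_def)
  qed (rule eq)
  with assms(3,4) show ?thesis by (simp add: prod_eq_iff fun_eq_iff)
qed

lemma app_closed [simp]: "f \<in> Arr W \<Longrightarrow> x \<in> carrier (Chain (src f) n) \<Longrightarrow> app f n x \<in> carrier (Chain (tgt f) n)"
  by (rule cmap.f_closed[OF Arr_cmap])

lemma app_add: "f \<in> Arr W \<Longrightarrow> x \<in> carrier (Chain (src f) n) \<Longrightarrow> y \<in> carrier (Chain (src f) n) \<Longrightarrow>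
    app f n (x \<oplus>\<^bsub>Chain (src f) n\<^esub> y) = app f n x \<oplus>\<^bsub>Chain (tgt f) n\<^esub> app f n y"
  by (rule cmap.f_add[OF Arr_cmap])

lemma app_zero: "f \<in> Arr W \<Longrightarrow> app f n \<zero>\<^bsub>Chain (src f) n\<^esub> = \<zero>\<^bsub>Chain (tgt f) n\<^esub>"
  by (rule cmap.f_zero[OF Arr_cmap])

lemma arr_comp [simp]: "f \<in> Arr W \<Longrightarrow> g \<in> Arr W \<Longrightarrow> tgt f = src g \<Longrightarrow> g \<cdot>\<^bsub>W\<^esub> f \<in> Arr W"
  unfolding Arr_iff using cmap_compose[of R "src f" "app f" "tgt f" "app g" "tgt g"]
  by (simp add: Comp_W)

lemma arr_idn [simp]: "C \<in> Abel_complexes R \<Longrightarrow> Idn W C \<in> Arr W"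
  unfolding Arr_iff by (simp add: Idn_W cmap_id complex_Ob)

lemma arr_assoc: "f \<in> Arr W \<Longrightarrow> g \<in> Arr W \<Longrightarrow> h \<in> Arr W \<Longrightarrow> tgt f = src g \<Longrightarrow> tgt g = src h \<Longrightarrow>
    (h \<cdot>\<^bsub>W\<^esub> g) \<cdot>\<^bsub>W\<^esub> f = h \<cdot>\<^bsub>W\<^esub> (g \<cdot>\<^bsub>W\<^esub> f)"
  by (rule arr_eqI) (use app_closed[of f] in simp_all)

lemma arr_comp_idn: "f \<in> Arr W \<Longrightarrow> f \<cdot>\<^bsub>W\<^esub> Idn W (src f) = f"
  by (rule arr_eqI) simp_all

lemma arr_idn_comp: "f \<in> Arr W \<Longrightarrow> Idn W (tgt f) \<cdot>\<^bsub>W\<^esub> f = f"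
  by (rule arr_eqI) simp_all

sublocale category W
  by (rule category.intro) (simp_all add: arr_assoc arr_comp_idn arr_idn_comp)

lemma comp_eq_app: "g \<cdot>\<^bsub>W\<^esub> f = g' \<cdot>\<^bsub>W\<^esub> f' \<Longrightarrow> src f = src f' \<Longrightarrow> x \<in> carrier (Chain (src f) n) \<Longrightarrow>
    app g n (app f n x) = app g' n (app f' n x)"
  using app_Comp[of x f n g] app_Comp[of x f' n g'] by simp

lemma comp_id_app: "g \<cdot>\<^bsub>W\<^esub> f = Idn W C \<Longrightarrow> src f = C \<Longrightarrow> x \<in> carrier (Chain C n) \<Longrightarrow> app g n (app f n x) = x"
  using app_Comp[of x f n g] by simp

lemma Cof_iff_kernel: "f \<in> Cof W \<longleftrightarrow> f \<in> Arr W \<and>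
    (\<forall>n. \<forall>x\<in>carrier (Chain (src f) n). app f n x = \<zero>\<^bsub>Chain (tgt f) n\<^esub> \<longrightarrow> x = \<zero>\<^bsub>Chain (src f) n\<^esub>)"
proof (cases "f \<in> Arr W")
  case True
  interpret f: cmap R "src f" "app f" "tgt f" by (rule Arr_cmap[OF True])
  show ?thesis
    unfolding Cof_iff
  proof (intro conj_cong refl all_cong1 iffI ballI impI)
    fix n x assume "inj_on (app f n) (carrier (Chain (src f) n))" "x \<in> carrier (Chain (src f) n)"
      "app f n x = \<zero>\<^bsub>Chain (tgt f) n\<^esub>"
    then show "x = \<zero>\<^bsub>Chain (src f) n\<^esub>" by (metis f.f_zero f.C.M.zero_closed inj_onD)
  next
    fix n assume *: "\<forall>x\<in>carrier (Chain (src f) n). app f n x = \<zero>\<^bsub>Chain (tgt f) n\<^esub> \<longrightarrow> x = \<zero>\<^bsub>Chain (src f) n\<^esub>"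
    show "inj_on (app f n) (carrier (Chain (src f) n))"
    proof (rule inj_onI)
      fix x y assume xy: "x \<in> carrier (Chain (src f) n)" "y \<in> carrier (Chain (src f) n)" "app f n x = app f n y"
      then have "app f n (x \<ominus>\<^bsub>Chain (src f) n\<^esub> y) = \<zero>\<^bsub>Chain (tgt f) n\<^esub>" by (simp add: f.f_minus)
      then have "x \<ominus>\<^bsub>Chain (src f) n\<^esub> y = \<zero>\<^bsub>Chain (src f) n\<^esub>" using * xy by simp
      then show "x = y" using xy by simp
    qed
  qed
qed (simp add: Cof_iff)

lemma CofD: "f \<in> Cof W \<Longrightarrow> x \<in> carrier (Chain (src f) n) \<Longrightarrow> app f n x = \<zero>\<^bsub>Chain (tgt f) n\<^esub> \<Longrightarrow>
    x = \<zero>\<^bsub>Chain (src f) n\<^esub>"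
  unfolding Cof_iff_kernel by blast

definition zero_arr :: "('a, 'u) module_complex \<Rightarrow> ('a, 'u) module_complex \<Rightarrow> ('a, 'u) chain_map" where
  "zero_arr C D = (C, \<lambda>n. \<lambda>x\<in>carrier (Chain C n). \<zero>\<^bsub>Chain D n\<^esub>, D)"

lemma zero_arr [simp]: "src (zero_arr C D) = C" "tgt (zero_arr C D) = D"
    "x \<in> carrier (Chain C n) \<Longrightarrow> app (zero_arr C D) n x = \<zero>\<^bsub>Chain D n\<^esub>"
  by (simp_all add: zero_arr_def)

lemma zero_arr_Arr [simp]: "C \<in> Abel_complexes R \<Longrightarrow> D \<in> Abel_complexes R \<Longrightarrow> zero_arr C D \<in> Arr W"
  unfolding Arr_iff by (simp add: zero_arr_def cmap_zero complex_Ob)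

lemma zero_Ob [simp]: "zero_complex \<in> Abel_complexes R"
  by (rule zero_complex_Abel) (rule domain_axioms)

lemma trivial_zero_object:
  fixes Z :: "('a, 'u) module_complex"
  assumes Z: "Z \<in> Abel_complexes R" and triv: "\<And>n. carrier (Chain Z n) = {\<zero>\<^bsub>Chain Z n\<^esub>}"
  shows "is_zero_object W Z"
  unfolding is_zero_object_def W_simps
proof (intro conjI ballI Z)
  fix A :: "('a, 'u) module_complex" assume A: "A \<in> Abel_complexes R"
  show "\<exists>!f. f \<in> Hom W Z A"
  proof (rule ex1I[of _ "zero_arr Z A"])
    fix f assume "f \<in> Hom W Z A"
    then show "f = zero_arr Z A"
      using A Z triv app_zero[of f] by (intro arr_eqI) (auto simp: Hom_iff)
  qed (use A Z in \<open>simp add: Hom_iff\<close>)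
  show "\<exists>!f. f \<in> Hom W A Z"
  proof (rule ex1I[of _ "zero_arr A Z"])
    fix f assume f: "f \<in> Hom W A Z"
    have "app f n x = \<zero>\<^bsub>Chain Z n\<^esub>" if "x \<in> carrier (Chain A n)" for n x
    proof -
      have "app f n x \<in> carrier (Chain Z n)" using app_closed[of f x n] f that by (auto simp: Hom_iff)
      then show ?thesis unfolding triv by simp
    qed
    then show "f = zero_arr A Z"
      using A Z f by (intro arr_eqI) (auto simp: Hom_iff)
  qed (use A Z in \<open>simp add: Hom_iff\<close>)
qed

lemma zero_object: "is_zero_object W zero_complex"
  by (rule trivial_zero_object) simp_all

lemma from_zero: "f \<in> Hom W zero_complex A \<Longrightarrow> f = zero_arr zero_complex A"
  using zero_object by (metis Arr_Ob(2) Hom_iff W_simps(1) is_zero_object_def zero_Ob zero_arr zero_arr_Arr)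

lemma zero_arr_Cof: "A \<in> Abel_complexes R \<Longrightarrow> zero_arr zero_complex A \<in> Cof W"
  by (simp add: Cof_iff_kernel)

text \<open>Squares in the category that are pushouts of complexes elementwise.\<close>

definition exact_square where
  "exact_square f g i j \<longleftrightarrow> f \<in> Arr W \<and> g \<in> Arr W \<and> i \<in> Arr W \<and> j \<in> Arr W \<and>
     src f = src g \<and> src i = tgt f \<and> src j = tgt g \<and> tgt i = tgt j \<and>
     raw_pushout R (src f) (app f) (tgt f) (app g) (tgt g) (app i) (tgt i) (app j)"

lemma exact_squareI:
  assumes "f \<in> Arr W" "g \<in> Arr W" "i \<in> Arr W" "j \<in> Arr W"
    "src f = src g" "src i = tgt f" "src j = tgt g" "tgt i = tgt j"
    and "i \<cdot>\<^bsub>W\<^esub> f = j \<cdot>\<^bsub>W\<^esub> g"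
    and "\<And>n p. p \<in> carrier (Chain (tgt i) n) \<Longrightarrow> \<exists>x\<in>carrier (Chain (tgt f) n). \<exists>y\<in>carrier (Chain (tgt g) n).
      p = app i n x \<oplus>\<^bsub>Chain (tgt i) n\<^esub> app j n y"
    and "\<And>n x y. x \<in> carrier (Chain (tgt f) n) \<Longrightarrow> y \<in> carrier (Chain (tgt g) n) \<Longrightarrow>
      app i n x \<oplus>\<^bsub>Chain (tgt i) n\<^esub> app j n y = \<zero>\<^bsub>Chain (tgt i) n\<^esub> \<Longrightarrow>
      \<exists>a\<in>carrier (Chain (src f) n). x = app f n a \<and> y = \<ominus>\<^bsub>Chain (tgt g) n\<^esub> app g n a"
  shows "exact_square f g i j"
proof -
  have m: "cmap R (src f) (app f) (tgt f)" "cmap R (src f) (app g) (tgt g)"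
    "cmap R (tgt f) (app i) (tgt i)" "cmap R (tgt g) (app j) (tgt i)"
    using assms(1-8) Arr_cmap[of f] Arr_cmap[of g] Arr_cmap[of i] Arr_cmap[of j] by simp_all
  have "raw_pushout R (src f) (app f) (tgt f) (app g) (tgt g) (app i) (tgt i) (app j)"
    by (intro raw_pushout.intro raw_pushout_axioms.intro m assms(10,11)) (use comp_eq_app[OF assms(9)] assms(5) in auto)
  then show ?thesis using assms(1-8) by (simp add: exact_square_def)
qed

lemma exact_squareD:
  assumes "exact_square f g i j"
  shows "f \<in> Arr W" "g \<in> Arr W" "i \<in> Arr W" "j \<in> Arr W"
    "src f = src g" "src i = tgt f" "src j = tgt g" "tgt i = tgt j"
    "raw_pushout R (src f) (app f) (tgt f) (app g) (tgt g) (app i) (tgt i) (app j)"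
  using assms unfolding exact_square_def by blast+

lemma exact_square_pushout:
  assumes E: "exact_square f g i j" shows "is_pushout W f g i j"
proof -
  note A = exact_squareD(1-4)[OF E] and s = exact_squareD(5-8)[OF E] and raw = exact_squareD(9)[OF E]
  interpret raw: raw_pushout R "src f" "app f" "tgt f" "app g" "tgt g" "app i" "tgt i" "app j" by (rule raw)
  have ext: "\<exists>!h. h \<in> Hom W (tgt i) X \<and> h \<cdot>\<^bsub>W\<^esub> i = u \<and> h \<cdot>\<^bsub>W\<^esub> j = v"
    if X: "X \<in> Abel_complexes R" and u: "u \<in> Hom W (tgt f) X" and v: "v \<in> Hom W (tgt g) X"
      and eq: "u \<cdot>\<^bsub>W\<^esub> f = v \<cdot>\<^bsub>W\<^esub> g" for X u v
  proof -
    from u v have uv: "u \<in> Arr W" "v \<in> Arr W" "src u = tgt f" "src v = tgt g" "tgt u = X" "tgt v = X"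
      by (auto simp: Hom_iff)
    have cu: "cmap R (tgt f) (app u) X" and cv: "cmap R (tgt g) (app v) X"
      using Arr_cmap[of u] Arr_cmap[of v] uv by simp_all
    interpret u: cmap R "tgt f" "app u" X by (rule cu)
    obtain h where h: "cmap R (tgt i) h X" and h_eq: "\<And>n x y. x \<in> carrier (Chain (tgt f) n) \<Longrightarrow>
        y \<in> carrier (Chain (tgt g) n) \<Longrightarrow>
        h n (app i n x \<oplus>\<^bsub>Chain (tgt i) n\<^esub> app j n y) = app u n x \<oplus>\<^bsub>Chain X n\<^esub> app v n y"
      by (rule raw.induced[OF cu cv]) (erule comp_eq_app[OF eq s(1)], rule that)
    let ?h = "(tgt i, h, X)"
    have hA: "?h \<in> Arr W" by (rule ArrI[OF Arr_Ob(2)[OF A(3)] X h])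
    have "?h \<cdot>\<^bsub>W\<^esub> i = u"
    proof (rule arr_eqI)
      fix n x assume "x \<in> carrier (Chain (src (?h \<cdot>\<^bsub>W\<^esub> i)) n)"
      then have x: "x \<in> carrier (Chain (tgt f) n)" using s by simp
      have "h n (app i n x) = h n (app i n x \<oplus>\<^bsub>Chain (tgt i) n\<^esub> app j n \<zero>\<^bsub>Chain (tgt g) n\<^esub>)"
        by (rule arg_cong[OF raw.i_add_j_zero[OF x]])
      also have "\<dots> = app u n x \<oplus>\<^bsub>Chain X n\<^esub> app v n \<zero>\<^bsub>Chain (tgt g) n\<^esub>"
        by (rule h_eq[OF x raw.g.D.M.zero_closed])
      finally show "app (?h \<cdot>\<^bsub>W\<^esub> i) n x = app u n x"
        using x s uv app_zero[of v n] app_closed[of u x n] by simp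
    qed (use hA A s uv in simp_all)
    moreover have "?h \<cdot>\<^bsub>W\<^esub> j = v"
    proof (rule arr_eqI)
      fix n y assume "y \<in> carrier (Chain (src (?h \<cdot>\<^bsub>W\<^esub> j)) n)"
      then have y: "y \<in> carrier (Chain (tgt g) n)" using s by simp
      have "h n (app j n y) = h n (app i n \<zero>\<^bsub>Chain (tgt f) n\<^esub> \<oplus>\<^bsub>Chain (tgt i) n\<^esub> app j n y)"
        by (rule arg_cong[OF raw.zero_add_j[OF y]])
      also have "\<dots> = app u n \<zero>\<^bsub>Chain (tgt f) n\<^esub> \<oplus>\<^bsub>Chain X n\<^esub> app v n y"
        by (rule h_eq[OF raw.f.D.M.zero_closed y])
      finally show "app (?h \<cdot>\<^bsub>W\<^esub> j) n y = app v n y"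
        using y s uv app_zero[of u n] app_closed[of v y n] by simp
    qed (use hA A s uv in simp_all)
    moreover have "h' = ?h" if h': "h' \<in> Hom W (tgt i) X" "h' \<cdot>\<^bsub>W\<^esub> i = u" "h' \<cdot>\<^bsub>W\<^esub> j = v" for h'
    proof (rule arr_eqI)
      fix n p assume "p \<in> carrier (Chain (src h') n)"
      then have "p \<in> carrier (Chain (tgt i) n)" using h' by (simp add: Hom_iff)
      from raw.gen[OF this] obtain x y where xy: "x \<in> carrier (Chain (tgt f) n)" "y \<in> carrier (Chain (tgt g) n)"
        "p = app i n x \<oplus>\<^bsub>Chain (tgt i) n\<^esub> app j n y" by blast
      have "app h' n p = app h' n (app i n x) \<oplus>\<^bsub>Chain X n\<^esub> app h' n (app j n y)"
        using app_add[of h' "app i n x" n "app j n y"] h'(1) xy by (auto simp: Hom_iff)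
      also have "\<dots> = app u n x \<oplus>\<^bsub>Chain X n\<^esub> app v n y"
        using app_Comp[of x i n h'] app_Comp[of y j n h'] h' xy s by simp
      finally show "app h' n p = app ?h n p" using h_eq xy by simp
    qed (use h' hA in \<open>simp_all add: Hom_iff\<close>)
    ultimately show ?thesis using hA by (intro ex1I[of _ ?h]) (auto simp: Hom_iff)
  qed
  have sq: "i \<cdot>\<^bsub>W\<^esub> f = j \<cdot>\<^bsub>W\<^esub> g"
  proof (rule arr_eqI)
    fix n x assume "x \<in> carrier (Chain (src (i \<cdot>\<^bsub>W\<^esub> f)) n)"
    then have "x \<in> carrier (Chain (src f) n)" "x \<in> carrier (Chain (src g) n)" using s(1) by simp_all
    with raw.comm[OF this(1)] show "app (i \<cdot>\<^bsub>W\<^esub> f) n x = app (j \<cdot>\<^bsub>W\<^esub> g) n x" by simp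
  qed (use A s in simp_all)
  show ?thesis
    unfolding is_pushout_def W_simps by (intro conjI ballI impI A s sq ext; assumption)
qed

lemma exact_square_exists:
  assumes f: "f \<in> Cof W" and g: "g \<in> Arr W" and fg: "src f = src g"
  obtains i j where "exact_square f g i j"
proof -
  have fA: "f \<in> Arr W" by (rule cof_arr[OF f])
  have cg: "cmap R (src f) (app g) (tgt g)" using Arr_cmap[OF g] fg by simp
  obtain i P j where raw: "raw_pushout R (src f) (app f) (tgt f) (app g) (tgt g) i P j"
    by (rule pushout_exists[OF inj_enc Arr_cmap[OF fA] cg])
  interpret raw: raw_pushout R "src f" "app f" "tgt f" "app g" "tgt g" i P j by (rule raw)
  obtain q D z h where D: "short_exact R (src f) (app f) (tgt f) q D" "short_exact R (tgt g) j P h D"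
    by (rule raw.pushout_quotient[OF inj_enc CofD[OF f]])
  have "D \<in> Abel_complexes R" by (rule short_exact.Abel_quotient[OF D(1)]) (use fA in simp_all)
  then have P: "P \<in> Abel_complexes R" by (rule short_exact.Abel_middle[OF D(2), rotated]) (use g in simp)
  have "(tgt f, i, P) \<in> Arr W" "(tgt g, j, P) \<in> Arr W"
    by (rule ArrI[OF Arr_Ob(2)[OF fA] P raw.i.cmap_axioms], rule ArrI[OF Arr_Ob(2)[OF g] P raw.j.cmap_axioms])
  then have "exact_square f g (tgt f, i, P) (tgt g, j, P)"
    unfolding exact_square_def fst_conv snd_conv by (intro conjI fA g fg raw refl)
  then show thesis by (rule that)
qed

text \<open>Comparison with an elementwise pushout: both have the universal property, so the isomorphism between them
  transports the description.\<close>

lemma pushout_exact_square: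
  assumes po: "is_pushout W f g i j" and f: "f \<in> Cof W" shows "exact_square f g i j"
proof -
  from po have A: "f \<in> Arr W" "g \<in> Arr W" "i \<in> Arr W" "j \<in> Arr W"
    and s: "src f = src g" "src i = tgt f" "src j = tgt g" "tgt i = tgt j"
    and sq: "i \<cdot>\<^bsub>W\<^esub> f = j \<cdot>\<^bsub>W\<^esub> g"
    and univ: "\<And>X u v. X \<in> Abel_complexes R \<Longrightarrow> u \<in> Hom W (tgt f) X \<Longrightarrow> v \<in> Hom W (tgt g) X \<Longrightarrow>
      u \<cdot>\<^bsub>W\<^esub> f = v \<cdot>\<^bsub>W\<^esub> g \<Longrightarrow> \<exists>!h. h \<in> Hom W (tgt i) X \<and> h \<cdot>\<^bsub>W\<^esub> i = u \<and> h \<cdot>\<^bsub>W\<^esub> j = v"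
    unfolding is_pushout_def W_simps by blast+
  obtain i0 j0 where E: "exact_square f g i0 j0" by (rule exact_square_exists[OF f A(2) s(1)])
  note A0 = exact_squareD(3,4)[OF E] and s0 = exact_squareD(6,7)[OF E] exact_squareD(8)[OF E, symmetric]
    and raw = exact_squareD(9)[OF E]
  interpret raw: raw_pushout R "src f" "app f" "tgt f" "app g" "tgt g" "app i0" "tgt i0" "app j0" by (rule raw)
  have univ0: "X \<in> Abel_complexes R \<Longrightarrow> u \<in> Hom W (tgt f) X \<Longrightarrow> v \<in> Hom W (tgt g) X \<Longrightarrow>
      u \<cdot>\<^bsub>W\<^esub> f = v \<cdot>\<^bsub>W\<^esub> g \<Longrightarrow> \<exists>!h. h \<in> Hom W (tgt i0) X \<and> h \<cdot>\<^bsub>W\<^esub> i0 = u \<and> h \<cdot>\<^bsub>W\<^esub> j0 = v"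
    and sq0: "i0 \<cdot>\<^bsub>W\<^esub> f = j0 \<cdot>\<^bsub>W\<^esub> g" for X u v
    using exact_square_pushout[OF E] unfolding is_pushout_def W_simps by blast+
  obtain h where h: "h \<in> Hom W (tgt i0) (tgt i)" "h \<cdot>\<^bsub>W\<^esub> i0 = i" "h \<cdot>\<^bsub>W\<^esub> j0 = j"
    using univ0[of "tgt i" i j] A s sq by (auto simp: Hom_iff)
  obtain h' where h': "h' \<in> Hom W (tgt i) (tgt i0)" "h' \<cdot>\<^bsub>W\<^esub> i = i0" "h' \<cdot>\<^bsub>W\<^esub> j = j0"
    using univ[of "tgt i0" i0 j0] A0 s0 sq0 by (auto simp: Hom_iff)
  have hA: "h \<in> Arr W" "src h = tgt i0" "tgt h = tgt i" and h'A: "h' \<in> Arr W" "src h' = tgt i" "tgt h' = tgt i0"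
    using h(1) h'(1) by (auto simp: Hom_iff)
  have "h \<cdot>\<^bsub>W\<^esub> h' = Idn W (tgt i)"
  proof -
    have "\<exists>!k. k \<in> Hom W (tgt i) (tgt i) \<and> k \<cdot>\<^bsub>W\<^esub> i = i \<and> k \<cdot>\<^bsub>W\<^esub> j = j"
      using univ[of "tgt i" i j] A s sq by (auto simp: Hom_iff)
    moreover have "h \<cdot>\<^bsub>W\<^esub> h' \<in> Hom W (tgt i) (tgt i)" using hA h'A by (simp add: Hom_iff)
    moreover have "(h \<cdot>\<^bsub>W\<^esub> h') \<cdot>\<^bsub>W\<^esub> i = i" "(h \<cdot>\<^bsub>W\<^esub> h') \<cdot>\<^bsub>W\<^esub> j = j"
      using h h' hA h'A A s by (simp_all add: arr_assoc)
    moreover have "Idn W (tgt i) \<in> Hom W (tgt i) (tgt i)" using A by (simp add: Hom_iff)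
    moreover have "Idn W (tgt i) \<cdot>\<^bsub>W\<^esub> i = i" "Idn W (tgt i) \<cdot>\<^bsub>W\<^esub> j = j"
      using arr_idn_comp[OF A(3)] arr_idn_comp[OF A(4)] s by simp_all
    ultimately show ?thesis by blast
  qed
  note hh' = comp_id_app[OF this h'A(2)]
  have i_app: "app i n x = app h n (app i0 n x)" if "x \<in> carrier (Chain (tgt f) n)" for n x
    using app_Comp[of x i0 n h] h(2) s0 that by simp
  have j_app: "app j n y = app h n (app j0 n y)" if "y \<in> carrier (Chain (tgt g) n)" for n y
    using app_Comp[of y j0 n h] h(3) s0 that by simp
  have i0_app: "app i0 n x = app h' n (app i n x)" if "x \<in> carrier (Chain (tgt f) n)" for n x
    using app_Comp[of x i n h'] h'(2) s that by simp
  have j0_app: "app j0 n y = app h' n (app j n y)" if "y \<in> carrier (Chain (tgt g) n)" for n y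
    using app_Comp[of y j n h'] h'(3) s that by simp
  show ?thesis
  proof (rule exact_squareI[OF A s sq])
    fix n p assume p: "p \<in> carrier (Chain (tgt i) n)"
    then have "app h' n p \<in> carrier (Chain (tgt i0) n)" using app_closed[of h' p n] h'A by simp
    from raw.gen[OF this] obtain x y where xy: "x \<in> carrier (Chain (tgt f) n)" "y \<in> carrier (Chain (tgt g) n)"
      "app h' n p = app i0 n x \<oplus>\<^bsub>Chain (tgt i0) n\<^esub> app j0 n y" by blast
    have "p = app h n (app h' n p)" using hh'[OF p] by simp
    also have "\<dots> = app i n x \<oplus>\<^bsub>Chain (tgt i) n\<^esub> app j n y"
      unfolding xy(3) using app_add[OF hA(1), of "app i0 n x" n "app j0 n y"] xy(1,2) hA(2,3)
      by (simp add: i_app j_app)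
    finally show "\<exists>x\<in>carrier (Chain (tgt f) n). \<exists>y\<in>carrier (Chain (tgt g) n).
        p = app i n x \<oplus>\<^bsub>Chain (tgt i) n\<^esub> app j n y" using xy by blast
  next
    fix n x y assume xy: "x \<in> carrier (Chain (tgt f) n)" "y \<in> carrier (Chain (tgt g) n)"
      and eq: "app i n x \<oplus>\<^bsub>Chain (tgt i) n\<^esub> app j n y = \<zero>\<^bsub>Chain (tgt i) n\<^esub>"
    have c: "app i n x \<in> carrier (Chain (tgt i) n)" "app j n y \<in> carrier (Chain (tgt i) n)"
      using app_closed[OF A(3), of x n] app_closed[OF A(4), of y n] s xy by simp_all
    have "app i0 n x \<oplus>\<^bsub>Chain (tgt i0) n\<^esub> app j0 n y = app h' n (app i n x \<oplus>\<^bsub>Chain (tgt i) n\<^esub> app j n y)"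
      using app_add[OF h'A(1), of "app i n x" n "app j n y"] c xy h'A by (simp add: i0_app j0_app)
    also have "\<dots> = \<zero>\<^bsub>Chain (tgt i0) n\<^esub>" unfolding eq using app_zero[OF h'A(1), of n] h'A by simp
    finally show "\<exists>a\<in>carrier (Chain (src f) n). x = app f n a \<and> y = \<ominus>\<^bsub>Chain (tgt g) n\<^esub> app g n a"
      by (rule raw.rel[OF xy])
  qed
qed

lemma homology_map_Comp:
  assumes f: "f \<in> Arr W" and g: "g \<in> Arr W" and fg: "tgt f = src g"
    and X: "X \<in> carrier (homology (src f) n)"
  shows "homology_map (app (g \<cdot>\<^bsub>W\<^esub> f)) (tgt g) n X = homology_map (app g) (tgt g) n (homology_map (app f) (tgt f) n X)"
    and "homology_map (app f) (tgt f) n X \<in> carrier (homology (tgt f) n)"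
proof -
  interpret f: cmap R "src f" "app f" "tgt f" by (rule Arr_cmap[OF f])
  have cg: "cmap R (tgt f) (app g) (tgt g)" using Arr_cmap[OF g] fg by simp
  interpret g: cmap R "tgt f" "app g" "tgt g" by (rule cg)
  have "cmap R (src f) (app (g \<cdot>\<^bsub>W\<^esub> f)) (tgt g)" using Arr_cmap[OF arr_comp[OF f g fg]] by simp
  then interpret gf: cmap R "src f" "app (g \<cdot>\<^bsub>W\<^esub> f)" "tgt g" .
  from X obtain x where x: "x \<in> cycles (src f) n" "X = f.C.H.cls n x"
    unfolding f.C.homology_eq f.C.H.SQ_carrier by blast
  then have "x \<in> carrier (Chain (src f) n)" by (simp add: cycles_def)
  then show "homology_map (app (g \<cdot>\<^bsub>W\<^esub> f)) (tgt g) n X = homology_map (app g) (tgt g) n (homology_map (app f) (tgt f) n X)"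
    using x f.f_cycles[OF x(1)] by (simp add: gf.homology_map_cls f.homology_map_cls g.homology_map_cls)
  show "homology_map (app f) (tgt f) n X \<in> carrier (homology (tgt f) n)"
    using x f.f_cycles[OF x(1)] by (simp add: f.homology_map_cls f.D.homology_eq f.D.H.SQ_carrier)
qed

text \<open>Bijections satisfy two out of three.\<close>

lemma saturation: "saturation_axiom W"
  unfolding saturation_axiom_def W_simps
proof (intro ballI impI)
  fix f g assume f: "f \<in> Arr W" and g: "g \<in> Arr W" and fg: "tgt f = src g"
  let ?F = "\<lambda>n. homology_map (app f) (tgt f) n" and ?G = "\<lambda>n. homology_map (app g) (tgt g) n"
    and ?H = "\<lambda>n. homology_map (app (g \<cdot>\<^bsub>W\<^esub> f)) (tgt g) n"
  let ?A = "\<lambda>n. carrier (homology (src f) n)" and ?B = "\<lambda>n. carrier (homology (tgt f) n)"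
    and ?C = "\<lambda>n. carrier (homology (tgt g) n)"
  have F: "f \<in> Weq W \<longleftrightarrow> (\<forall>n. bij_betw (?F n) (?A n) (?B n))"
    and G: "g \<in> Weq W \<longleftrightarrow> (\<forall>n. bij_betw (?G n) (?B n) (?C n))"
    using f g fg by (simp_all add: Weq_iff quasi_isomorphism_def)
  have "g \<cdot>\<^bsub>W\<^esub> f \<in> Weq W \<longleftrightarrow> (\<forall>n. bij_betw (?H n) (?A n) (?C n))"
    using f g fg by (simp add: Weq_iff quasi_isomorphism_def)
  moreover have "bij_betw (?H n) (?A n) (?C n) \<longleftrightarrow> bij_betw (?G n \<circ> ?F n) (?A n) (?C n)" for n
    by (rule bij_betw_cong) (simp add: homology_map_Comp[OF f g fg])
  ultimately have H: "g \<cdot>\<^bsub>W\<^esub> f \<in> Weq W \<longleftrightarrow> (\<forall>n. bij_betw (?G n \<circ> ?F n) (?A n) (?C n))" by simp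
  have sub: "?F n ` ?A n \<subseteq> ?B n" for n using homology_map_Comp(2)[OF f g fg] by blast
  show "(f \<in> Weq W \<and> g \<in> Weq W \<longrightarrow> g \<cdot>\<^bsub>W\<^esub> f \<in> Weq W) \<and>
        (f \<in> Weq W \<and> g \<cdot>\<^bsub>W\<^esub> f \<in> Weq W \<longrightarrow> g \<in> Weq W) \<and>
        (g \<in> Weq W \<and> g \<cdot>\<^bsub>W\<^esub> f \<in> Weq W \<longrightarrow> f \<in> Weq W)"
    unfolding F G H using bij_betw_comp_iff bij_betw_comp_iff2[OF _ sub] bij_betw_trans by blast
qed

lemma iso_app:
  assumes "is_iso_arrow W f"
  obtains g where "f \<in> Arr W" "g \<in> Arr W" "src g = tgt f" "tgt g = src f"
    "\<And>n x. x \<in> carrier (Chain (src f) n) \<Longrightarrow> app g n (app f n x) = x"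
    "\<And>n y. y \<in> carrier (Chain (tgt f) n) \<Longrightarrow> app f n (app g n y) = y"
proof -
  from assms obtain g where f: "f \<in> Arr W" and g: "g \<in> Arr W" "src g = tgt f" "tgt g = src f"
    and gf: "g \<cdot>\<^bsub>W\<^esub> f = Idn W (src f)" and fg: "f \<cdot>\<^bsub>W\<^esub> g = Idn W (tgt f)"
    by (auto simp: is_iso_arrow_def Hom_iff)
  show thesis
    using f g comp_id_app[OF gf] comp_id_app[OF fg] by (intro that[of g]) simp_all
qed

lemma iso_Cof: assumes "is_iso_arrow W f" shows "f \<in> Cof W"
proof -
  obtain g where f: "f \<in> Arr W" and "g \<in> Arr W" "src g = tgt f" "tgt g = src f"
    and gf: "\<And>n x. x \<in> carrier (Chain (src f) n) \<Longrightarrow> app g n (app f n x) = x"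
    and "\<And>n y. y \<in> carrier (Chain (tgt f) n) \<Longrightarrow> app f n (app g n y) = y"
    by (rule iso_app[OF assms]) (rule that)
  have "inj_on (app f n) (carrier (Chain (src f) n))" for n
    by (rule inj_on_inverseI) (rule gf)
  with f show ?thesis by (simp add: Cof_iff)
qed

lemma iso_Weq: assumes "is_iso_arrow W f" shows "f \<in> Weq W"
proof -
  obtain g where f: "f \<in> Arr W" and g: "g \<in> Arr W" "src g = tgt f" "tgt g = src f"
    and gf: "\<And>n x. x \<in> carrier (Chain (src f) n) \<Longrightarrow> app g n (app f n x) = x"
    and fg: "\<And>n y. y \<in> carrier (Chain (tgt f) n) \<Longrightarrow> app f n (app g n y) = y"
    by (rule iso_app[OF assms]) (rule that)
  interpret f: cmap R "src f" "app f" "tgt f" by (rule Arr_cmap[OF f])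
  have "cmap R (tgt f) (app g) (src f)" using Arr_cmap[OF g(1)] g by simp
  then interpret g: cmap R "tgt f" "app g" "src f" .
  have "f.cone_acyclic"
    unfolding f.cone_acyclic_def
  proof (intro allI ballI impI)
    fix n x w assume x: "x \<in> carrier (Chain (src f) n)" and w: "w \<in> carrier (Chain (tgt f) (n + 1))"
      and fx: "app f n x = diff (tgt f) (n + 1) w"
    have "x = diff (src f) (n + 1) (app g (n + 1) w)"
      using gf[OF x] fx w g.d_f_1[of w n] by simp
    moreover have "w = app f (n + 1) (app g (n + 1) w) \<oplus>\<^bsub>Chain (tgt f) (n + 1)\<^esub>
        diff (tgt f) (n + 2) \<zero>\<^bsub>Chain (tgt f) (n + 2)\<^esub>"
      using fg[OF w] w f.D.d_zero[of "n + 2"] by (simp add: algebra_simps)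
    ultimately show "\<exists>y\<in>carrier (Chain (src f) (n + 1)). \<exists>v\<in>carrier (Chain (tgt f) (n + 2)).
        x = diff (src f) (n + 1) y \<and> w = app f (n + 1) y \<oplus>\<^bsub>Chain (tgt f) (n + 1)\<^esub> diff (tgt f) (n + 2) v"
      using w by blast
  qed
  then show ?thesis using f by (simp add: Weq_iff f.quasi_isomorphism_iff)
qed

text \<open>A cofibration sequence is a short exact sequence of complexes, as its defining pushout is elementwise.\<close>

lemma extension: "extension_axiom W"
  unfolding extension_axiom_def
proof (intro allI impI, elim conjE)
  fix f q f' q' a b c
  assume c1: "is_cofibration_sequence W f q" and c2: "is_cofibration_sequence W f' q'"
    and a: "a \<in> Hom W (Dom W f) (Dom W f')" and b: "b \<in> Hom W (Cod W f) (Cod W f')"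
    and c: "c \<in> Hom W (Cod W q) (Cod W q')"
    and bf: "b \<cdot>\<^bsub>W\<^esub> f = f' \<cdot>\<^bsub>W\<^esub> a" and cq: "c \<cdot>\<^bsub>W\<^esub> q = q' \<cdot>\<^bsub>W\<^esub> b"
    and aw: "a \<in> Weq W" and cw: "c \<in> Weq W"
  have ses: "short_exact R (src f) (app f) (tgt f) (app q) (tgt q) \<and> src q = tgt f"
    if "is_cofibration_sequence W f q" for f q
  proof -
    from that obtain t z where f: "f \<in> Cof W" and t: "t \<in> Hom W (src f) zero_complex"
      and z: "z \<in> Hom W zero_complex (tgt q)" and po: "is_pushout W f t q z"
      by (auto simp: is_cofibration_sequence_def)
    note E = pushout_exact_square[OF po f]
    have "tgt t = zero_complex" using t by (simp add: Hom_iff)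
    then have raw: "raw_pushout R (src f) (app f) (tgt f) (app t) zero_complex (app q) (tgt q) (app z)"
      using exact_squareD(9)[OF E] by simp
    have "src q = tgt f" by (rule exact_squareD(6)[OF E])
    moreover have "short_exact R (src f) (app f) (tgt f) (app q) (tgt q)"
      by (rule raw_pushout.short_exact_if_trivial[OF raw]) (use CofD[OF f] in simp_all)
    ultimately show ?thesis by simp
  qed
  note s1 = ses[OF c1] and s2 = ses[OF c2]
  have m: "cmap R (src f) (app a) (src f')" "cmap R (tgt f) (app b) (tgt f')" "cmap R (tgt q) (app c) (tgt q')"
    using a b c Arr_cmap[of a] Arr_cmap[of b] Arr_cmap[of c] by (auto simp: Hom_iff)
  have "short_exact_map R (src f) (app f) (tgt f) (app q) (tgt q) (src f') (app f') (tgt f') (app q') (tgt q')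
      (app a) (app b) (app c)"
    using s1 s2 m a b comp_eq_app[OF bf] comp_eq_app[OF cq]
    by (intro short_exact_map.intro short_exact_map_axioms.intro) (auto simp: Hom_iff)
  from short_exact_map.middle_quasi_isomorphism[OF this] aw cw a b c show "b \<in> Weq W"
    by (auto simp: Weq_iff Hom_iff)
qed

lemma gluing:
  assumes f: "f \<in> Cof W" "f' \<in> Cof W" and E: "exact_square f g i j" "exact_square f' g' i' j'"
    and a: "a \<in> Weq W" "src a = src f" "tgt a = src f'"
    and b: "b \<in> Weq W" "src b = tgt f" "tgt b = tgt f'"
    and c: "c \<in> Weq W" "src c = tgt g" "tgt c = tgt g'"
    and bf: "b \<cdot>\<^bsub>W\<^esub> f = f' \<cdot>\<^bsub>W\<^esub> a"
    and h: "h \<in> Arr W" "src h = tgt i" "tgt h = tgt i'" and hi: "h \<cdot>\<^bsub>W\<^esub> i = i' \<cdot>\<^bsub>W\<^esub> b" and hj: "h \<cdot>\<^bsub>W\<^esub> j = j' \<cdot>\<^bsub>W\<^esub> c"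
  shows "h \<in> Weq W"
proof -
  have m: "cmap R (src f) (app a) (src f')" "cmap R (tgt f) (app b) (tgt f')"
    "cmap R (tgt g) (app c) (tgt g')" "cmap R (tgt i) (app h) (tgt i')"
    using Arr_cmap[OF weq_arr[OF a(1)]] Arr_cmap[OF weq_arr[OF b(1)]] Arr_cmap[OF weq_arr[OF c(1)]]
      Arr_cmap[OF h(1)] a b c h by simp_all
  have "quasi_isomorphism (tgt i) (app h) (tgt i')"
  proof (rule gluing_quasi_isomorphism[OF inj_enc])
    show "raw_pushout R (src f) (app f) (tgt f) (app g) (tgt g) (app i) (tgt i) (app j)"
      "raw_pushout R (src f') (app f') (tgt f') (app g') (tgt g') (app i') (tgt i') (app j')"
      using exact_squareD(9)[OF E(1)] exact_squareD(9)[OF E(2)] .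
    show "quasi_isomorphism (src f) (app a) (src f')" "quasi_isomorphism (tgt f) (app b) (tgt f')"
      "quasi_isomorphism (tgt g) (app c) (tgt g')"
      using a b c by (simp_all add: Weq_iff)
  qed (use m CofD[OF f(1)] CofD[OF f(2)] comp_eq_app[OF bf] comp_eq_app[OF hi] comp_eq_app[OF hj] a b c
      exact_squareD(6,7)[OF E(1)] in simp_all)
  then show ?thesis using h by (simp add: Weq_iff)
qed

sublocale waldhausen_category W
proof (intro waldhausen_category.intro category_with_cofibrations.intro category_axioms
    category_with_cofibrations_axioms.intro waldhausen_category_axioms.intro)
  show "is_zero_object W (Zero W)" using zero_object by simp
  show "Cof W \<subseteq> Arr W" "Weq W \<subseteq> Arr W" using cof_arr weq_arr by blast+
  show "g \<cdot>\<^bsub>W\<^esub> f \<in> Cof W" if "f \<in> Cof W" "g \<in> Cof W" "Cod W f = Dom W g" for f g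
    unfolding Cof_iff_kernel
  proof (intro conjI allI ballI impI)
    have A: "f \<in> Arr W" "g \<in> Arr W" "tgt f = src g" using that cof_arr by simp_all
    then show "g \<cdot>\<^bsub>W\<^esub> f \<in> Arr W" by simp
    fix n x assume "x \<in> carrier (Chain (src (g \<cdot>\<^bsub>W\<^esub> f)) n)"
      "app (g \<cdot>\<^bsub>W\<^esub> f) n x = \<zero>\<^bsub>Chain (tgt (g \<cdot>\<^bsub>W\<^esub> f)) n\<^esub>"
    then have x: "x \<in> carrier (Chain (src f) n)" and "app g n (app f n x) = \<zero>\<^bsub>Chain (tgt g) n\<^esub>" by simp_all
    moreover have "app f n x \<in> carrier (Chain (src g) n)" using app_closed[OF A(1) x] A(3) by simp
    ultimately have "app f n x = \<zero>\<^bsub>Chain (tgt f) n\<^esub>" using CofD[OF that(2)] A(3) by simp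
    then show "x = \<zero>\<^bsub>Chain (src (g \<cdot>\<^bsub>W\<^esub> f)) n\<^esub>" using CofD[OF that(1) x] by simp
  qed
  show "is_iso_arrow W f \<Longrightarrow> f \<in> Cof W" "is_iso_arrow W f \<Longrightarrow> f \<in> Weq W" for f
    by (rule iso_Cof iso_Weq; assumption)+
  show "f \<in> Cof W" if "A \<in> Ob W" "f \<in> Hom W (Zero W) A" for A f
    using that from_zero[of f A] zero_arr_Cof[of A] by simp
  show "\<exists>i j. is_pushout W f g i j" if "f \<in> Cof W" "g \<in> Arr W" "Dom W f = Dom W g" for f g
    using exact_square_exists[of f g] that exact_square_pushout by (metis W_simps(2))
  show "j \<in> Cof W" if f: "f \<in> Cof W" and po: "is_pushout W f g i j" for f g i j
  proof -
    note E = pushout_exact_square[OF po f]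
    note s = exact_squareD(4,7,8)[OF E]
    have raw: "raw_pushout R (src f) (app f) (tgt f) (app g) (tgt g) (app i) (tgt j) (app j)"
      using exact_squareD(9)[OF E] s(3) by simp
    interpret raw: raw_pushout R "src f" "app f" "tgt f" "app g" "tgt g" "app i" "tgt j" "app j" by (rule raw)
    obtain q D z h where "short_exact R (tgt g) (app j) (tgt j) h D"
      by (rule raw.pushout_quotient[OF inj_enc CofD[OF f]])
    then show ?thesis using s short_exact.i_inj by (fastforce simp: Cof_iff_kernel)
  qed
  show "g \<cdot>\<^bsub>W\<^esub> f \<in> Weq W" if "f \<in> Weq W" "g \<in> Weq W" "Cod W f = Dom W g" for f g
    using that saturation weq_arr unfolding saturation_axiom_def by blast
  show "h \<in> Weq W" if "f \<in> Cof W" "is_pushout W f g i j" "f' \<in> Cof W" "is_pushout W f' g' i' j'"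
    "a \<in> Weq W" "a \<in> Hom W (Dom W f) (Dom W f')" "b \<in> Weq W" "b \<in> Hom W (Cod W f) (Cod W f')"
    "c \<in> Weq W" "c \<in> Hom W (Cod W g) (Cod W g')" "b \<cdot>\<^bsub>W\<^esub> f = f' \<cdot>\<^bsub>W\<^esub> a" "c \<cdot>\<^bsub>W\<^esub> g = g' \<cdot>\<^bsub>W\<^esub> a"
    "h \<in> Hom W (Cod W i) (Cod W i')" "h \<cdot>\<^bsub>W\<^esub> i = i' \<cdot>\<^bsub>W\<^esub> b" "h \<cdot>\<^bsub>W\<^esub> j = j' \<cdot>\<^bsub>W\<^esub> c"
    for f g i j f' g' i' j' a b c h
  proof -
    have e: "src a = src f" "tgt a = src f'" "src b = tgt f" "tgt b = tgt f'" "src c = tgt g" "tgt c = tgt g'"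
      "h \<in> Arr W" "src h = tgt i" "tgt h = tgt i'"
      using that(6,8,10,13) unfolding Hom_iff W_simps by blast+
    show ?thesis
      by (rule gluing[OF that(1,3) pushout_exact_square[OF that(2,1)] pushout_exact_square[OF that(4,3)]
            that(5) e(1,2) that(7) e(3,4) that(9) e(5,6) that(11) e(7-9) that(14,15)])
  qed
qed

end

section \<open>Mapping cylinders as functors on arrows\<close>

lemma (in abelian_group) add_minus_cancel:
  assumes "a \<in> carrier G" "b \<in> carrier G" "c \<in> carrier G"
  shows "(a \<oplus> b) \<oplus> (c \<ominus> b) = a \<oplus> c"
proof -
  have "b \<oplus> (c \<oplus> \<ominus> b) = c" using assms by (simp add: a_comm[of c "\<ominus> b"] r_neg2)
  then show ?thesis using assms by (simp add: minus_eq a_assoc)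
qed

lemma (in abelian_group) neg_zero: "\<ominus> \<zero> = \<zero>"
  using l_neg[OF zero_closed] by simp

lemma (in abelian_group) add_minus_left:
  "a \<in> carrier G \<Longrightarrow> b \<in> carrier G \<Longrightarrow> (a \<oplus> b) \<ominus> a = b"
  by (simp add: minus_eq a_comm[of a b] a_assoc r_neg)

lemma cmap_extensionalI:
  assumes C: "complex_over R C" and D: "complex_over R D"
    and extens: "\<And>n. f n \<in> extensional (carrier (Chain C n))"
    and f: "\<And>n x. x \<in> carrier (Chain C n) \<Longrightarrow> f n x \<in> carrier (Chain D n)"
      "\<And>n x y. x \<in> carrier (Chain C n) \<Longrightarrow> y \<in> carrier (Chain C n) \<Longrightarrow>
        f n (x \<oplus>\<^bsub>Chain C n\<^esub> y) = f n x \<oplus>\<^bsub>Chain D n\<^esub> f n y"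
      "\<And>n a x. a \<in> carrier R \<Longrightarrow> x \<in> carrier (Chain C n) \<Longrightarrow>
        f n (a \<odot>\<^bsub>Chain C n\<^esub> x) = a \<odot>\<^bsub>Chain D n\<^esub> f n x"
      "\<And>n x. x \<in> carrier (Chain C n) \<Longrightarrow> diff D n (f n x) = f (n - 1) (diff C n x)"
  shows "cmap R C f D"
proof -
  have "(\<lambda>n. \<lambda>x\<in>carrier (Chain C n). f n x) = f"
    by (rule ext) (rule extensional_restrict[OF extens])
  then show ?thesis using cmap_restrictI[OF C D f] by simp
qed

text \<open>A complex \<open>T\<close> with coordinates: \<open>e\<close> identifies \<open>C\<^sub>n \<oplus> C\<^sub>n\<^sub>-\<^sub>1 \<oplus> D\<^sub>n\<close> with \<open>T\<^sub>n\<close> so that the operations become those of the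
  mapping cylinder of \<open>f\<close>. Leaving \<open>e\<close> open allows both the encoding of triples and, if \<open>C\<close> is the zero
  complex, the projection \<open>(x, y, z) \<mapsto> z\<close> with \<open>T = D\<close>.\<close>

locale cylinder_copy = f: cmap R C f D
  for R :: "('a, 'r) ring_scheme" (structure) and C :: "('a, 'u) module_complex"
    and f and D :: "('a, 'u) module_complex" +
  fixes T :: "('a, 'u) module_complex" and e :: "'u \<times> 'u \<times> 'u \<Rightarrow> 'u"
  assumes e_eq: "\<lbrakk>x \<in> carrier (Chain C n); y \<in> carrier (Chain C (n - 1)); z \<in> carrier (Chain D n);
      x' \<in> carrier (Chain C n); y' \<in> carrier (Chain C (n - 1)); z' \<in> carrier (Chain D n);
      e (x, y, z) = e (x', y', z')\<rbrakk> \<Longrightarrow> x = x' \<and> y = y' \<and> z = z'"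
    and T_carrier: "carrier (Chain T n) =
      e ` (carrier (Chain C n) \<times> carrier (Chain C (n - 1)) \<times> carrier (Chain D n))"
    and T_zero: "\<zero>\<^bsub>Chain T n\<^esub> = e (\<zero>\<^bsub>Chain C n\<^esub>, \<zero>\<^bsub>Chain C (n - 1)\<^esub>, \<zero>\<^bsub>Chain D n\<^esub>)"
    and T_add: "\<lbrakk>x \<in> carrier (Chain C n); y \<in> carrier (Chain C (n - 1)); z \<in> carrier (Chain D n);
      x' \<in> carrier (Chain C n); y' \<in> carrier (Chain C (n - 1)); z' \<in> carrier (Chain D n)\<rbrakk> \<Longrightarrow>
      e (x, y, z) \<oplus>\<^bsub>Chain T n\<^esub> e (x', y', z') =
        e (x \<oplus>\<^bsub>Chain C n\<^esub> x', y \<oplus>\<^bsub>Chain C (n - 1)\<^esub> y', z \<oplus>\<^bsub>Chain D n\<^esub> z')"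
    and T_smult: "\<lbrakk>a \<in> carrier R; x \<in> carrier (Chain C n); y \<in> carrier (Chain C (n - 1)); z \<in> carrier (Chain D n)\<rbrakk> \<Longrightarrow>
      a \<odot>\<^bsub>Chain T n\<^esub> e (x, y, z) = e (a \<odot>\<^bsub>Chain C n\<^esub> x, a \<odot>\<^bsub>Chain C (n - 1)\<^esub> y, a \<odot>\<^bsub>Chain D n\<^esub> z)"
    and T_diff: "\<lbrakk>x \<in> carrier (Chain C n); y \<in> carrier (Chain C (n - 1)); z \<in> carrier (Chain D n)\<rbrakk> \<Longrightarrow>
      diff T n (e (x, y, z)) = e (diff C n x \<oplus>\<^bsub>Chain C (n - 1)\<^esub> y,
        \<ominus>\<^bsub>Chain C (n - 2)\<^esub> diff C (n - 1) y, diff D n z \<ominus>\<^bsub>Chain D (n - 1)\<^esub> f (n - 1) y)"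
begin

lemma T_in: "x \<in> carrier (Chain C n) \<Longrightarrow> y \<in> carrier (Chain C (n - 1)) \<Longrightarrow> z \<in> carrier (Chain D n) \<Longrightarrow>
    e (x, y, z) \<in> carrier (Chain T n)"
  by (simp add: T_carrier)

lemma T_cases:
  assumes "s \<in> carrier (Chain T n)"
  obtains x y z where "x \<in> carrier (Chain C n)" "y \<in> carrier (Chain C (n - 1))" "z \<in> carrier (Chain D n)"
    "s = e (x, y, z)"
  using assms unfolding T_carrier by blast

lemma T_zeroD: "\<lbrakk>x \<in> carrier (Chain C n); y \<in> carrier (Chain C (n - 1)); z \<in> carrier (Chain D n);
    e (x, y, z) = \<zero>\<^bsub>Chain T n\<^esub>\<rbrakk> \<Longrightarrow> x = \<zero>\<^bsub>Chain C n\<^esub> \<and> y = \<zero>\<^bsub>Chain C (n - 1)\<^esub> \<and> z = \<zero>\<^bsub>Chain D n\<^esub>"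
  unfolding T_zero
  by (rule e_eq) (assumption | rule f.C.M.zero_closed f.D.M.zero_closed)+

lemma T_module: "module R (Chain T n)"
proof (rule moduleI)
  show "cring R" by unfold_locales
  show "abelian_group (Chain T n)"
  proof (rule abelian_groupI)
    fix s assume "s \<in> carrier (Chain T n)"
    then obtain x y z where "x \<in> carrier (Chain C n)" "y \<in> carrier (Chain C (n - 1))" "z \<in> carrier (Chain D n)"
      "s = e (x, y, z)" by (rule T_cases)
    then show "\<exists>t\<in>carrier (Chain T n). t \<oplus>\<^bsub>Chain T n\<^esub> s = \<zero>\<^bsub>Chain T n\<^esub>"
      by (intro bexI[of _ "e (\<ominus>\<^bsub>Chain C n\<^esub> x, \<ominus>\<^bsub>Chain C (n - 1)\<^esub> y, \<ominus>\<^bsub>Chain D n\<^esub> z)"])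
        (simp_all add: T_add T_in T_zero f.C.M.l_neg f.D.M.l_neg)
  qed (auto elim!: T_cases simp: T_in T_add T_zero f.C.M.a_ac f.D.M.a_ac)
qed (auto elim!: T_cases simp: T_in T_add T_smult f.C.M.smult_l_distr f.D.M.smult_l_distr
    f.C.M.smult_r_distr f.D.M.smult_r_distr f.C.M.smult_assoc1 f.D.M.smult_assoc1)

lemma T_complex: "complex_over R T"
proof (rule complex_overI[OF f.C.domain_axioms T_module])
  fix n s assume s: "s \<in> carrier (Chain T n)"
  then obtain x y z where xyz: "x \<in> carrier (Chain C n)" "y \<in> carrier (Chain C (n - 1))" "z \<in> carrier (Chain D n)"
    and s_eq: "s = e (x, y, z)" by (rule T_cases)
  have y: "diff C (n - 1) y \<in> carrier (Chain C (n - 1 - 1))" "diff C (n - 1) y \<in> carrier (Chain C (n - 2))"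
    using f.C.d_closed[OF xyz(2)] by simp_all
  have in1: "diff C n x \<oplus>\<^bsub>Chain C (n - 1)\<^esub> y \<in> carrier (Chain C (n - 1))"
    and in2: "\<ominus>\<^bsub>Chain C (n - 2)\<^esub> diff C (n - 1) y \<in> carrier (Chain C (n - 1 - 1))"
    and in3: "diff D n z \<ominus>\<^bsub>Chain D (n - 1)\<^esub> f (n - 1) y \<in> carrier (Chain D (n - 1))"
    using xyz y by simp_all
  show "diff T n s \<in> carrier (Chain T (n - 1))"
    unfolding s_eq T_diff[OF xyz] by (rule T_in[OF in1 in2 in3])
  have 1: "diff C (n - 1) (diff C n x \<oplus>\<^bsub>Chain C (n - 1)\<^esub> y) \<oplus>\<^bsub>Chain C (n - 1 - 1)\<^esub>
      \<ominus>\<^bsub>Chain C (n - 2)\<^esub> diff C (n - 1) y = \<zero>\<^bsub>Chain C (n - 2)\<^esub>"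
    using xyz y by (simp add: f.C.d_add f.C.dd f.C.M.r_neg)
  have 2: "diff C (n - 1 - 1) (\<ominus>\<^bsub>Chain C (n - 2)\<^esub> diff C (n - 1) y) = \<zero>\<^bsub>Chain C (n - 3)\<^esub>"
    using f.C.d_neg[OF y(2)] f.C.dd[OF xyz(2)] by simp
  have 3: "diff D (n - 1) (diff D n z \<ominus>\<^bsub>Chain D (n - 1)\<^esub> f (n - 1) y) \<ominus>\<^bsub>Chain D (n - 1 - 1)\<^esub>
      f (n - 1 - 1) (\<ominus>\<^bsub>Chain C (n - 2)\<^esub> diff C (n - 1) y) = \<zero>\<^bsub>Chain D (n - 2)\<^esub>"
  proof -
    have "diff D (n - 1) (diff D n z \<ominus>\<^bsub>Chain D (n - 1)\<^esub> f (n - 1) y) =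
        \<ominus>\<^bsub>Chain D (n - 2)\<^esub> f (n - 2) (diff C (n - 1) y)"
      using xyz y f.d_f[OF xyz(2)] by (simp add: f.D.d_minus f.D.dd f.D.M.minus_eq)
    moreover have "f (n - 1 - 1) (\<ominus>\<^bsub>Chain C (n - 2)\<^esub> diff C (n - 1) y) =
        \<ominus>\<^bsub>Chain D (n - 2)\<^esub> f (n - 2) (diff C (n - 1) y)"
      using f.f_neg[OF y(2)] by simp
    ultimately show ?thesis using y by (simp add: f.D.M.minus_eq f.D.M.l_neg)
  qed
  show "diff T (n - 1) (diff T n s) = \<zero>\<^bsub>Chain T (n - 2)\<^esub>"
    unfolding s_eq T_diff[OF xyz] T_diff[OF in1 in2 in3] using 1 2 3 by (simp add: T_zero f.C.M.neg_zero)
next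
  fix n s s' assume s: "s \<in> carrier (Chain T n)" and s': "s' \<in> carrier (Chain T n)"
  from s obtain x y z where xyz: "x \<in> carrier (Chain C n)" "y \<in> carrier (Chain C (n - 1))" "z \<in> carrier (Chain D n)"
    and s_eq: "s = e (x, y, z)" by (rule T_cases)
  from s' obtain x' y' z' where xyz': "x' \<in> carrier (Chain C n)" "y' \<in> carrier (Chain C (n - 1))" "z' \<in> carrier (Chain D n)"
    and s'_eq: "s' = e (x', y', z')" by (rule T_cases)
  have y: "diff C (n - 1) y \<in> carrier (Chain C (n - 2))" "diff C (n - 1) y' \<in> carrier (Chain C (n - 2))"
    using f.C.d_closed[OF xyz(2)] f.C.d_closed[OF xyz'(2)] by simp_all
  have d: "diff C (n - 1) (y \<oplus>\<^bsub>Chain C (n - 1)\<^esub> y') = diff C (n - 1) y \<oplus>\<^bsub>Chain C (n - 2)\<^esub> diff C (n - 1) y'"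
    using f.C.d_add[OF xyz(2) xyz'(2)] by simp
  show "diff T n (s \<oplus>\<^bsub>Chain T n\<^esub> s') = diff T n s \<oplus>\<^bsub>Chain T (n - 1)\<^esub> diff T n s'"
    using xyz xyz' y unfolding s_eq s'_eq
    by (simp add: T_add T_diff f.C.d_add f.D.d_add f.f_add d f.D.M.minus_eq f.D.M.minus_add
        f.C.M.minus_add f.C.M.a_ac f.D.M.a_ac)
next
  fix n a s assume a: "a \<in> carrier R" and s: "s \<in> carrier (Chain T n)"
  from s obtain x y z where xyz: "x \<in> carrier (Chain C n)" "y \<in> carrier (Chain C (n - 1))" "z \<in> carrier (Chain D n)"
    and s_eq: "s = e (x, y, z)" by (rule T_cases)
  have y: "diff C (n - 1) y \<in> carrier (Chain C (n - 2))"
    using f.C.d_closed[OF xyz(2)] by simp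
  have d: "diff C (n - 1) (a \<odot>\<^bsub>Chain C (n - 1)\<^esub> y) = a \<odot>\<^bsub>Chain C (n - 2)\<^esub> diff C (n - 1) y"
    using f.C.d_smult[OF a xyz(2)] by simp
  show "diff T n (a \<odot>\<^bsub>Chain T n\<^esub> s) = a \<odot>\<^bsub>Chain T (n - 1)\<^esub> diff T n s"
    using a xyz y unfolding s_eq
    by (simp add: T_smult T_diff f.C.d_smult f.D.d_smult f.f_smult d f.D.M.minus_eq
        f.C.M.smult_r_distr f.D.M.smult_r_distr f.C.M.smult_r_minus f.D.M.smult_r_minus)
qed

lemma T_positive:
  assumes C: "positive_complex C" and D: "positive_complex D" shows "positive_complex T"
  unfolding positive_complex_def
proof (intro allI impI)
  fix n :: int assume "n < 0"
  then have "carrier (Chain C n) = {\<zero>\<^bsub>Chain C n\<^esub>}" "carrier (Chain C (n - 1)) = {\<zero>\<^bsub>Chain C (n - 1)\<^esub>}"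
    "carrier (Chain D n) = {\<zero>\<^bsub>Chain D n\<^esub>}"
    using C D by (simp_all add: positive_complex_def)
  then show "carrier (Chain T n) = {\<zero>\<^bsub>Chain T n\<^esub>}" by (simp add: T_carrier T_zero)
qed

lemma proj_chain_map:
  assumes ext: "\<And>n. P n \<in> extensional (carrier (Chain T n))"
    and P: "\<And>n x y z. x \<in> carrier (Chain C n) \<Longrightarrow> y \<in> carrier (Chain C (n - 1)) \<Longrightarrow> z \<in> carrier (Chain D n) \<Longrightarrow>
      P n (e (x, y, z)) = f n x \<oplus>\<^bsub>Chain D n\<^esub> z"
  shows "cmap R T P D"
proof (rule cmap_extensionalI[OF T_complex f.D.complex_over_axioms ext])
  fix n s assume "s \<in> carrier (Chain T n)"
  then obtain x y z where xyz: "x \<in> carrier (Chain C n)" "y \<in> carrier (Chain C (n - 1))" "z \<in> carrier (Chain D n)"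
    and s_eq: "s = e (x, y, z)" by (rule T_cases)
  show "P n s \<in> carrier (Chain D n)" using xyz by (simp add: s_eq P)
  have y: "diff C (n - 1) y \<in> carrier (Chain C (n - 1 - 1))" "diff C (n - 1) y \<in> carrier (Chain C (n - 2))"
    using f.C.d_closed[OF xyz(2)] by simp_all
  have "P (n - 1) (diff T n s) = f (n - 1) (diff C n x \<oplus>\<^bsub>Chain C (n - 1)\<^esub> y) \<oplus>\<^bsub>Chain D (n - 1)\<^esub>
      (diff D n z \<ominus>\<^bsub>Chain D (n - 1)\<^esub> f (n - 1) y)"
    unfolding s_eq T_diff[OF xyz] by (rule P) (use xyz y in simp_all)
  also have "\<dots> = f (n - 1) (diff C n x) \<oplus>\<^bsub>Chain D (n - 1)\<^esub> diff D n z"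
    using xyz by (simp add: f.f_add f.D.M.add_minus_cancel)
  finally show "diff D n (P n s) = P (n - 1) (diff T n s)"
    using xyz by (simp add: s_eq P f.D.d_add f.d_f)
  fix s' assume "s' \<in> carrier (Chain T n)"
  then obtain x' y' z' where xyz': "x' \<in> carrier (Chain C n)" "y' \<in> carrier (Chain C (n - 1))" "z' \<in> carrier (Chain D n)"
    and s'_eq: "s' = e (x', y', z')" by (rule T_cases)
  show "P n (s \<oplus>\<^bsub>Chain T n\<^esub> s') = P n s \<oplus>\<^bsub>Chain D n\<^esub> P n s'"
    using xyz xyz' by (simp add: s_eq s'_eq T_add P f.f_add f.D.M.a_ac)
next
  fix n a s assume a: "a \<in> carrier R" and "s \<in> carrier (Chain T n)"
  then obtain x y z where xyz: "x \<in> carrier (Chain C n)" "y \<in> carrier (Chain C (n - 1))" "z \<in> carrier (Chain D n)"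
    and s_eq: "s = e (x, y, z)" by (blast elim: T_cases)
  show "P n (a \<odot>\<^bsub>Chain T n\<^esub> s) = a \<odot>\<^bsub>Chain D n\<^esub> P n s"
    using a xyz by (simp add: s_eq T_smult P f.f_smult f.D.M.smult_r_distr)
qed

text \<open>If \<open>s = (x, y, z)\<close> is a cycle with \<open>f x + z = d w\<close>, then \<open>s\<close> is the boundary of \<open>(0, x, w)\<close>, which projects to \<open>w\<close>.\<close>

lemma proj_quasi_isomorphism:
  assumes cP: "cmap R T P D"
    and P: "\<And>n x y z. x \<in> carrier (Chain C n) \<Longrightarrow> y \<in> carrier (Chain C (n - 1)) \<Longrightarrow> z \<in> carrier (Chain D n) \<Longrightarrow>
      P n (e (x, y, z)) = f n x \<oplus>\<^bsub>Chain D n\<^esub> z"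
  shows "quasi_isomorphism T P D"
proof -
  interpret P: cmap R T P D by (rule cP)
  have "P.cone_acyclic"
    unfolding P.cone_acyclic_def
  proof (intro allI ballI impI)
    fix n s w assume s: "s \<in> carrier (Chain T n)" and w: "w \<in> carrier (Chain D (n + 1))"
      and ds: "diff T n s = \<zero>\<^bsub>Chain T (n - 1)\<^esub>" and Ps: "P n s = diff D (n + 1) w"
    from s obtain x y z where xyz: "x \<in> carrier (Chain C n)" "y \<in> carrier (Chain C (n - 1))" "z \<in> carrier (Chain D n)"
      and s_eq: "s = e (x, y, z)" by (rule T_cases)
    have "diff C (n - 1) y \<in> carrier (Chain C (n - 2))" using f.C.d_closed[OF xyz(2)] by simp
    then have "diff C n x \<oplus>\<^bsub>Chain C (n - 1)\<^esub> y = \<zero>\<^bsub>Chain C (n - 1)\<^esub>"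
      using T_zeroD[of "diff C n x \<oplus>\<^bsub>Chain C (n - 1)\<^esub> y" "n - 1" "\<ominus>\<^bsub>Chain C (n - 2)\<^esub> diff C (n - 1) y"
          "diff D n z \<ominus>\<^bsub>Chain D (n - 1)\<^esub> f (n - 1) y"] xyz ds
      by (simp add: s_eq T_diff)
    then have y: "\<ominus>\<^bsub>Chain C (n - 1)\<^esub> diff C n x = y"
      by (intro f.C.M.minus_equality) (use xyz in \<open>simp_all add: f.C.M.a_comm\<close>)
    have "f n x \<oplus>\<^bsub>Chain D n\<^esub> z = diff D (n + 1) w" using Ps P[OF xyz] s_eq by simp
    then have z: "diff D (n + 1) w \<ominus>\<^bsub>Chain D n\<^esub> f n x = z"
      using f.D.M.add_minus_left[OF f.f_closed[OF xyz(1)] xyz(3)] by simp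
    let ?t = "e (\<zero>\<^bsub>Chain C (n + 1)\<^esub>, x, w)"
    have x: "x \<in> carrier (Chain C (n + 1 - 1))" using xyz by simp
    have "diff T (n + 1) ?t = s"
      using T_diff[OF f.C.M.zero_closed x w] xyz y z by (simp add: s_eq)
    moreover have "P (n + 1) ?t = w" using P[OF f.C.M.zero_closed x w] w by simp
    moreover have "?t \<in> carrier (Chain T (n + 1))" by (rule T_in[OF f.C.M.zero_closed x w])
    ultimately show "\<exists>t\<in>carrier (Chain T (n + 1)). \<exists>v\<in>carrier (Chain D (n + 2)).
        s = diff T (n + 1) t \<and> w = P (n + 1) t \<oplus>\<^bsub>Chain D (n + 1)\<^esub> diff D (n + 2) v"
      using w f.D.d_zero[of "n + 2"]
      by (intro bexI[of _ ?t] bexI[of _ "\<zero>\<^bsub>Chain D (n + 2)\<^esub>"]) (simp_all add: algebra_simps)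
  qed
  then show ?thesis by (simp add: P.quasi_isomorphism_iff)
qed

end


lemma (in abel_cat) ArrI_ends:
  "src f = C \<and> tgt f = D \<Longrightarrow> C \<in> Abel_complexes R \<Longrightarrow> D \<in> Abel_complexes R \<Longrightarrow> cmap R C (app f) D \<Longrightarrow> f \<in> Arr W"
  using ArrI[of C D "app f"] by (cases f) simp

lemma (in abel_cat) arrow_category_Arr:
  "(f, a, b, g) \<in> Arr (arrow_category W) \<longleftrightarrow> f \<in> Arr W \<and> g \<in> Arr W \<and> a \<in> Arr W \<and> b \<in> Arr W \<and>
     src a = src f \<and> tgt a = src g \<and> src b = tgt f \<and> tgt b = tgt g \<and> b \<cdot>\<^bsub>W\<^esub> f = g \<cdot>\<^bsub>W\<^esub> a"
  by (auto simp: arrow_category_def Hom_iff)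

text \<open>Functorial data \<open>T\<close> all of whose parts have the coordinate expressions of the mapping cylinder. With the
  conditions on ends and on extensionality, these expressions determine the chain maps.\<close>

locale cylinder_model = abel_cat R enc
  for R :: "('a, 'r) ring_scheme" (structure) and enc :: "'u \<times> 'u \<times> 'u \<Rightarrow> 'u" +
  fixes T :: "(('a, 'u) module_complex, ('a, 'u) chain_map) cylinder"
    and e :: "('a, 'u) chain_map \<Rightarrow> 'u \<times> 'u \<times> 'u \<Rightarrow> 'u"
  assumes copy: "f \<in> Arr W \<Longrightarrow> cylinder_copy R (src f) (app f) (tgt f) (Cyl T f) (e f)"
    and front_ends: "f \<in> Arr W \<Longrightarrow> src (front_incl T f) = src f \<and> tgt (front_incl T f) = Cyl T f"
    and front_ext: "f \<in> Arr W \<Longrightarrow> app (front_incl T f) n \<in> extensional (carrier (Chain (src f) n))"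
    and front_app: "\<lbrakk>f \<in> Arr W; x \<in> carrier (Chain (src f) n)\<rbrakk> \<Longrightarrow>
      app (front_incl T f) n x = e f (x, \<zero>\<^bsub>Chain (src f) (n - 1)\<^esub>, \<zero>\<^bsub>Chain (tgt f) n\<^esub>)"
    and back_ends: "f \<in> Arr W \<Longrightarrow> src (back_incl T f) = tgt f \<and> tgt (back_incl T f) = Cyl T f"
    and back_ext: "f \<in> Arr W \<Longrightarrow> app (back_incl T f) n \<in> extensional (carrier (Chain (tgt f) n))"
    and back_app: "\<lbrakk>f \<in> Arr W; z \<in> carrier (Chain (tgt f) n)\<rbrakk> \<Longrightarrow>
      app (back_incl T f) n z = e f (\<zero>\<^bsub>Chain (src f) n\<^esub>, \<zero>\<^bsub>Chain (src f) (n - 1)\<^esub>, z)"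
    and proj_ends: "f \<in> Arr W \<Longrightarrow> src (proj T f) = Cyl T f \<and> tgt (proj T f) = tgt f"
    and proj_ext: "f \<in> Arr W \<Longrightarrow> app (proj T f) n \<in> extensional (carrier (Chain (Cyl T f) n))"
    and proj_app: "\<lbrakk>f \<in> Arr W; x \<in> carrier (Chain (src f) n); y \<in> carrier (Chain (src f) (n - 1));
      z \<in> carrier (Chain (tgt f) n)\<rbrakk> \<Longrightarrow> app (proj T f) n (e f (x, y, z)) = app f n x \<oplus>\<^bsub>Chain (tgt f) n\<^esub> z"
    and map_ends: "(f, a, b, g) \<in> Arr (arrow_category W) \<Longrightarrow>
      src (Cyl_map T (f, a, b, g)) = Cyl T f \<and> tgt (Cyl_map T (f, a, b, g)) = Cyl T g"
    and map_ext: "(f, a, b, g) \<in> Arr (arrow_category W) \<Longrightarrow>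
      app (Cyl_map T (f, a, b, g)) n \<in> extensional (carrier (Chain (Cyl T f) n))"
    and map_app: "\<lbrakk>(f, a, b, g) \<in> Arr (arrow_category W); x \<in> carrier (Chain (src f) n);
      y \<in> carrier (Chain (src f) (n - 1)); z \<in> carrier (Chain (tgt f) n)\<rbrakk> \<Longrightarrow>
      app (Cyl_map T (f, a, b, g)) n (e f (x, y, z)) = e g (app a n x, app a (n - 1) y, app b n z)"
begin

lemmas Cyl_cases = cylinder_copy.T_cases[OF copy]
  and Cyl_in = cylinder_copy.T_in[OF copy]
  and Cyl_add = cylinder_copy.T_add[OF copy]
  and Cyl_zeroD = cylinder_copy.T_zeroD[OF copy]

lemma proj_cmap: "f \<in> Arr W \<Longrightarrow> cmap R (Cyl T f) (app (proj T f)) (tgt f)"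
  by (rule cylinder_copy.proj_chain_map[OF copy proj_ext proj_app])

lemma proj_qi: "f \<in> Arr W \<Longrightarrow> quasi_isomorphism (Cyl T f) (app (proj T f)) (tgt f)"
  by (rule cylinder_copy.proj_quasi_isomorphism[OF copy proj_cmap proj_app])

lemma positive_Ob: "C \<in> Abel_complexes R \<Longrightarrow> positive_complex C"
  by (simp add: Abel_complexes_def)

text \<open>Homology is that of the target, along the projection.\<close>

lemma Cyl_Ob [simp]: "f \<in> Arr W \<Longrightarrow> Cyl T f \<in> Abel_complexes R"
  by (rule cmap.Abel_quasi_isomorphism[OF proj_cmap proj_qi
        cylinder_copy.T_positive[OF copy positive_Ob positive_Ob]]) simp_all

lemma proj_Arr: "f \<in> Arr W \<Longrightarrow> proj T f \<in> Arr W"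
  by (rule ArrI_ends[OF proj_ends _ _ proj_cmap]) simp_all

lemma proj_Weq: "f \<in> Arr W \<Longrightarrow> proj T f \<in> Weq W"
  using proj_ends[of f] proj_qi[of f] proj_Arr[of f] by (simp add: Weq_iff)

lemma cylinder_axiom: "cylinder_axiom W T"
  by (simp add: cylinder_axiom_def proj_Weq)

lemma front_Arr:
  assumes f: "f \<in> Arr W" shows "front_incl T f \<in> Arr W"
proof -
  interpret f: cmap R "src f" "app f" "tgt f" by (rule Arr_cmap[OF f])
  interpret K: cylinder_copy R "src f" "app f" "tgt f" "Cyl T f" "e f" by (rule copy[OF f])
  have "cmap R (src f) (app (front_incl T f)) (Cyl T f)"
  proof (rule cmap_extensionalI[OF f.C.complex_over_axioms K.T_complex front_ext[OF f]])
    fix n x assume x: "x \<in> carrier (Chain (src f) n)"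
    have z: "diff (src f) (n - 1) \<zero>\<^bsub>Chain (src f) (n - 1)\<^esub> = \<zero>\<^bsub>Chain (src f) (n - 2)\<^esub>"
      using f.C.d_zero[of "n - 1"] by simp
    have m: "\<ominus>\<^bsub>Chain (src f) m\<^esub> \<zero>\<^bsub>Chain (src f) m\<^esub> = \<zero>\<^bsub>Chain (src f) m\<^esub>"
      "\<zero>\<^bsub>Chain (tgt f) m\<^esub> \<ominus>\<^bsub>Chain (tgt f) m\<^esub> \<zero>\<^bsub>Chain (tgt f) m\<^esub> = \<zero>\<^bsub>Chain (tgt f) m\<^esub>" for m
      by (simp_all add: f.C.M.neg_zero f.D.M.minus_eq f.D.M.neg_zero)
    show "diff (Cyl T f) n (app (front_incl T f) n x) = app (front_incl T f) (n - 1) (diff (src f) n x)"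
      using x by (simp add: front_app[OF f] K.T_diff z m)
  qed (simp_all add: front_app[OF f] K.T_in K.T_add K.T_smult)
  then show ?thesis by (rule ArrI_ends[OF front_ends[OF f], rotated 2]) (use f in simp_all)
qed

lemma back_Arr:
  assumes f: "f \<in> Arr W" shows "back_incl T f \<in> Arr W"
proof -
  interpret f: cmap R "src f" "app f" "tgt f" by (rule Arr_cmap[OF f])
  interpret K: cylinder_copy R "src f" "app f" "tgt f" "Cyl T f" "e f" by (rule copy[OF f])
  have "cmap R (tgt f) (app (back_incl T f)) (Cyl T f)"
  proof (rule cmap_extensionalI[OF f.D.complex_over_axioms K.T_complex back_ext[OF f]])
    fix n x assume x: "x \<in> carrier (Chain (tgt f) n)"
    have z: "diff (src f) (n - 1) \<zero>\<^bsub>Chain (src f) (n - 1)\<^esub> = \<zero>\<^bsub>Chain (src f) (n - 2)\<^esub>"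
      using f.C.d_zero[of "n - 1"] by simp
    have m: "\<ominus>\<^bsub>Chain (src f) m\<^esub> \<zero>\<^bsub>Chain (src f) m\<^esub> = \<zero>\<^bsub>Chain (src f) m\<^esub>"
      "v \<in> carrier (Chain (tgt f) m) \<Longrightarrow> v \<ominus>\<^bsub>Chain (tgt f) m\<^esub> \<zero>\<^bsub>Chain (tgt f) m\<^esub> = v" for m v
      by (simp_all add: f.C.M.neg_zero f.D.M.minus_eq f.D.M.neg_zero)
    show "diff (Cyl T f) n (app (back_incl T f) n x) = app (back_incl T f) (n - 1) (diff (tgt f) n x)"
      using x by (simp add: back_app[OF f] K.T_diff z m)
  qed (simp_all add: back_app[OF f] K.T_in K.T_add K.T_smult)
  then show ?thesis by (rule ArrI_ends[OF back_ends[OF f], rotated 2]) (use f in simp_all)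
qed

lemma map_Arr:
  assumes F: "(f, a, b, g) \<in> Arr (arrow_category W)" shows "Cyl_map T (f, a, b, g) \<in> Arr W"
proof -
  from F have f: "f \<in> Arr W" and g: "g \<in> Arr W" and ab: "a \<in> Arr W" "b \<in> Arr W"
    and s: "src a = src f" "tgt a = src g" "src b = tgt f" "tgt b = tgt g" and sq: "b \<cdot>\<^bsub>W\<^esub> f = g \<cdot>\<^bsub>W\<^esub> a"
    by (simp_all add: arrow_category_Arr)
  interpret f: cmap R "src f" "app f" "tgt f" by (rule Arr_cmap[OF f])
  interpret g: cmap R "src g" "app g" "tgt g" by (rule Arr_cmap[OF g])
  have cab: "cmap R (src f) (app a) (src g)" "cmap R (tgt f) (app b) (tgt g)"
    using Arr_cmap[OF ab(1)] Arr_cmap[OF ab(2)] s by simp_all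
  interpret a: cmap R "src f" "app a" "src g" by (rule cab)
  interpret b: cmap R "tgt f" "app b" "tgt g" by (rule cab)
  interpret K: cylinder_copy R "src f" "app f" "tgt f" "Cyl T f" "e f" by (rule copy[OF f])
  interpret L: cylinder_copy R "src g" "app g" "tgt g" "Cyl T g" "e g" by (rule copy[OF g])
  have "cmap R (Cyl T f) (app (Cyl_map T (f, a, b, g))) (Cyl T g)"
  proof (rule cmap_extensionalI[OF K.T_complex L.T_complex map_ext[OF F]])
    fix n s assume "s \<in> carrier (Chain (Cyl T f) n)"
    then obtain x y z where xyz: "x \<in> carrier (Chain (src f) n)" "y \<in> carrier (Chain (src f) (n - 1))"
      "z \<in> carrier (Chain (tgt f) n)" and s_eq: "s = e f (x, y, z)" by (rule K.T_cases)
    show "app (Cyl_map T (f, a, b, g)) n s \<in> carrier (Chain (Cyl T g) n)"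
      using xyz by (simp add: s_eq map_app[OF F] L.T_in)
    have y: "diff (src f) (n - 1) y \<in> carrier (Chain (src f) (n - 1 - 1))"
      "diff (src f) (n - 1) y \<in> carrier (Chain (src f) (n - 2))"
      using f.C.d_closed[OF xyz(2)] by simp_all
    have "diff (src g) (n - 1) (app a (n - 1) y) = app a (n - 2) (diff (src f) (n - 1) y)"
      using a.d_f[OF xyz(2)] by simp
    moreover have "app b (n - 1) (app f (n - 1) y) = app g (n - 1) (app a (n - 1) y)"
      using comp_eq_app[OF sq _ xyz(2)] s by simp
    ultimately have "diff (Cyl T g) n (app (Cyl_map T (f, a, b, g)) n s) =
        e g (app a (n - 1) (diff (src f) n x \<oplus>\<^bsub>Chain (src f) (n - 1)\<^esub> y),
          app a (n - 1 - 1) (\<ominus>\<^bsub>Chain (src f) (n - 2)\<^esub> diff (src f) (n - 1) y),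
          app b (n - 1) (diff (tgt f) n z \<ominus>\<^bsub>Chain (tgt f) (n - 1)\<^esub> app f (n - 1) y))"
      using xyz y by (simp add: s_eq map_app[OF F] L.T_diff a.f_add b.f_minus a.f_neg a.d_f b.d_f)
    also have "\<dots> = app (Cyl_map T (f, a, b, g)) (n - 1) (diff (Cyl T f) n s)"
      unfolding s_eq K.T_diff[OF xyz] by (rule map_app[OF F, symmetric]) (use xyz y in simp_all)
    finally show "diff (Cyl T g) n (app (Cyl_map T (f, a, b, g)) n s) =
        app (Cyl_map T (f, a, b, g)) (n - 1) (diff (Cyl T f) n s)" .
    fix s' assume "s' \<in> carrier (Chain (Cyl T f) n)"
    then obtain x' y' z' where xyz': "x' \<in> carrier (Chain (src f) n)" "y' \<in> carrier (Chain (src f) (n - 1))"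
      "z' \<in> carrier (Chain (tgt f) n)" and s'_eq: "s' = e f (x', y', z')" by (rule K.T_cases)
    show "app (Cyl_map T (f, a, b, g)) n (s \<oplus>\<^bsub>Chain (Cyl T f) n\<^esub> s') =
        app (Cyl_map T (f, a, b, g)) n s \<oplus>\<^bsub>Chain (Cyl T g) n\<^esub> app (Cyl_map T (f, a, b, g)) n s'"
      using xyz xyz' by (simp add: s_eq s'_eq map_app[OF F] K.T_add L.T_add a.f_add b.f_add)
  next
    fix n r s assume r: "r \<in> carrier R" and "s \<in> carrier (Chain (Cyl T f) n)"
    then obtain x y z where xyz: "x \<in> carrier (Chain (src f) n)" "y \<in> carrier (Chain (src f) (n - 1))"
      "z \<in> carrier (Chain (tgt f) n)" and s_eq: "s = e f (x, y, z)" by (blast elim: K.T_cases)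
    show "app (Cyl_map T (f, a, b, g)) n (r \<odot>\<^bsub>Chain (Cyl T f) n\<^esub> s) =
        r \<odot>\<^bsub>Chain (Cyl T g) n\<^esub> app (Cyl_map T (f, a, b, g)) n s"
      using r xyz by (simp add: s_eq map_app[OF F] K.T_smult L.T_smult a.f_smult b.f_smult)
  qed
  then show ?thesis by (rule ArrI_ends[OF map_ends[OF F], rotated 2]) (use f g in simp_all)
qed

lemma Cyl_eqI:
  assumes f: "f \<in> Arr W" and u: "u \<in> Arr W" "src u = Cyl T f" and v: "v \<in> Arr W" "src v = Cyl T f"
    and uv: "tgt u = tgt v"
    and eq: "\<And>n x y z. x \<in> carrier (Chain (src f) n) \<Longrightarrow> y \<in> carrier (Chain (src f) (n - 1)) \<Longrightarrow>
      z \<in> carrier (Chain (tgt f) n) \<Longrightarrow> app u n (e f (x, y, z)) = app v n (e f (x, y, z))"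
  shows "u = v"
proof (rule arr_eqI[OF u(1) v(1) _ uv])
  show "src u = src v" using u v by simp
  fix n s assume "s \<in> carrier (Chain (src u) n)"
  then have "s \<in> carrier (Chain (Cyl T f) n)" using u by simp
  then show "app u n s = app v n s" by (rule Cyl_cases[OF f]) (simp add: eq)
qed

lemma proj_front: "f \<in> Arr W \<Longrightarrow> proj T f \<cdot>\<^bsub>W\<^esub> front_incl T f = f"
  and proj_back: "f \<in> Arr W \<Longrightarrow> proj T f \<cdot>\<^bsub>W\<^esub> back_incl T f = Idn W (tgt f)"
proof -
  assume f: "f \<in> Arr W"
  interpret f: cmap R "src f" "app f" "tgt f" by (rule Arr_cmap[OF f])
  note s = front_ends[OF f] back_ends[OF f] proj_ends[OF f] and A = f front_Arr[OF f] back_Arr[OF f] proj_Arr[OF f]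
  show "proj T f \<cdot>\<^bsub>W\<^esub> front_incl T f = f"
    by (rule arr_eqI) (use s A in \<open>simp_all add: front_app proj_app\<close>)
  show "proj T f \<cdot>\<^bsub>W\<^esub> back_incl T f = Idn W (tgt f)"
    by (rule arr_eqI) (use s A in \<open>simp_all add: back_app proj_app\<close>)
qed

lemma map_front: "(f, a, b, g) \<in> Arr (arrow_category W) \<Longrightarrow>
    Cyl_map T (f, a, b, g) \<cdot>\<^bsub>W\<^esub> front_incl T f = front_incl T g \<cdot>\<^bsub>W\<^esub> a"
  and map_back: "(f, a, b, g) \<in> Arr (arrow_category W) \<Longrightarrow>
    Cyl_map T (f, a, b, g) \<cdot>\<^bsub>W\<^esub> back_incl T f = back_incl T g \<cdot>\<^bsub>W\<^esub> b"
  and map_proj: "(f, a, b, g) \<in> Arr (arrow_category W) \<Longrightarrow>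
    proj T g \<cdot>\<^bsub>W\<^esub> Cyl_map T (f, a, b, g) = b \<cdot>\<^bsub>W\<^esub> proj T f"
proof -
  assume F: "(f, a, b, g) \<in> Arr (arrow_category W)"
  then have f: "f \<in> Arr W" and g: "g \<in> Arr W" and ab: "a \<in> Arr W" "b \<in> Arr W"
    and s: "src a = src f" "tgt a = src g" "src b = tgt f" "tgt b = tgt g" and sq: "b \<cdot>\<^bsub>W\<^esub> f = g \<cdot>\<^bsub>W\<^esub> a"
    by (simp_all add: arrow_category_Arr)
  interpret f: cmap R "src f" "app f" "tgt f" by (rule Arr_cmap[OF f])
  interpret g: cmap R "src g" "app g" "tgt g" by (rule Arr_cmap[OF g])
  note S = front_ends[OF f] back_ends[OF f] proj_ends[OF f] front_ends[OF g] back_ends[OF g] proj_ends[OF g]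
    map_ends[OF F] s
  note A = f g ab front_Arr[OF f] back_Arr[OF f] proj_Arr[OF f] front_Arr[OF g] back_Arr[OF g] proj_Arr[OF g]
    map_Arr[OF F]
  have ac: "x \<in> carrier (Chain (src f) n) \<Longrightarrow> app a n x \<in> carrier (Chain (src g) n)"
    and bc: "z \<in> carrier (Chain (tgt f) n) \<Longrightarrow> app b n z \<in> carrier (Chain (tgt g) n)"
    and a0: "app a n \<zero>\<^bsub>Chain (src f) n\<^esub> = \<zero>\<^bsub>Chain (src g) n\<^esub>"
    and b0: "app b n \<zero>\<^bsub>Chain (tgt f) n\<^esub> = \<zero>\<^bsub>Chain (tgt g) n\<^esub>" for n x z
    using app_closed[OF ab(1), of x n] app_closed[OF ab(2), of z n] app_zero[OF ab(1), of n] app_zero[OF ab(2), of n] s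
    by simp_all
  show "Cyl_map T (f, a, b, g) \<cdot>\<^bsub>W\<^esub> front_incl T f = front_incl T g \<cdot>\<^bsub>W\<^esub> a"
    by (rule arr_eqI) (use S A ac a0 b0 in \<open>simp_all add: front_app map_app[OF F]\<close>)
  show "Cyl_map T (f, a, b, g) \<cdot>\<^bsub>W\<^esub> back_incl T f = back_incl T g \<cdot>\<^bsub>W\<^esub> b"
    by (rule arr_eqI) (use S A bc a0 b0 in \<open>simp_all add: back_app map_app[OF F]\<close>)
  show "proj T g \<cdot>\<^bsub>W\<^esub> Cyl_map T (f, a, b, g) = b \<cdot>\<^bsub>W\<^esub> proj T f"
  proof (rule Cyl_eqI[OF f])
    fix n x y z assume xyz: "x \<in> carrier (Chain (src f) n)" "y \<in> carrier (Chain (src f) (n - 1))"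
      "z \<in> carrier (Chain (tgt f) n)"
    have "app b n (app f n x) = app g n (app a n x)" using comp_eq_app[OF sq _ xyz(1)] s by simp
    then show "app (proj T g \<cdot>\<^bsub>W\<^esub> Cyl_map T (f, a, b, g)) n (e f (x, y, z)) = app (b \<cdot>\<^bsub>W\<^esub> proj T f) n (e f (x, y, z))"
      using xyz S Cyl_in[OF f xyz] app_add[OF ab(2), of "app f n x" n z] ac bc
      by (simp add: map_app[OF F] proj_app[OF f] proj_app[OF g])
  qed (use S A in simp_all)
qed

lemma cylinder_functor_arrows: "is_functor (arrow_category W) W (Cyl T) (Cyl_map T)"
  unfolding is_functor_def
proof (intro conjI ballI impI)
  fix f assume "f \<in> Ob (arrow_category W)"
  then have f: "f \<in> Arr W" by (simp add: arrow_category_def)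
  then show "Cyl T f \<in> Ob W" by simp
  have I: "(f, Idn W (src f), Idn W (tgt f), f) \<in> Arr (arrow_category W)"
    using f by (simp add: arrow_category_Arr arr_comp_idn arr_idn_comp)
  have "Cyl_map T (f, Idn W (src f), Idn W (tgt f), f) = Idn W (Cyl T f)"
    by (rule Cyl_eqI[OF f]) (use map_Arr[OF I] map_ends[OF I] f in \<open>simp_all add: map_app[OF I] Cyl_in\<close>)
  then show "Cyl_map T (Idn (arrow_category W) f) = Idn W (Cyl T f)"
    by (simp add: arrow_category_def)
next
  fix F assume F: "F \<in> Arr (arrow_category W)"
  obtain f a b g where F_eq: "F = (f, a, b, g)" by (cases F)
  note F' = F[unfolded F_eq]
  show "Cyl_map T F \<in> Hom W (Cyl T (Dom (arrow_category W) F)) (Cyl T (Cod (arrow_category W) F))"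
    using map_Arr[OF F'] map_ends[OF F'] by (simp add: F_eq Hom_iff arrow_category_def)
  fix G assume G: "G \<in> Arr (arrow_category W)" and "Cod (arrow_category W) F = Dom (arrow_category W) G"
  then obtain c d h where G_eq: "G = (g, c, d, h)" by (cases G) (auto simp: F_eq arrow_category_def)
  note G' = G[unfolded G_eq]
  from F' G' have A: "f \<in> Arr W" "a \<in> Arr W" "b \<in> Arr W" "c \<in> Arr W" "d \<in> Arr W" "g \<in> Arr W" "h \<in> Arr W"
    and s: "src a = src f" "tgt a = src g" "src b = tgt f" "tgt b = tgt g"
      "src c = src g" "tgt c = src h" "src d = tgt g" "tgt d = tgt h"
    and sq: "b \<cdot>\<^bsub>W\<^esub> f = g \<cdot>\<^bsub>W\<^esub> a" "d \<cdot>\<^bsub>W\<^esub> g = h \<cdot>\<^bsub>W\<^esub> c"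
    by (simp_all add: arrow_category_Arr)
  have "(d \<cdot>\<^bsub>W\<^esub> b) \<cdot>\<^bsub>W\<^esub> f = h \<cdot>\<^bsub>W\<^esub> (c \<cdot>\<^bsub>W\<^esub> a)"
    using A s sq by (simp add: arr_assoc flip: sq(2)) (simp add: arr_assoc[symmetric] sq)
  then have GF: "(f, c \<cdot>\<^bsub>W\<^esub> a, d \<cdot>\<^bsub>W\<^esub> b, h) \<in> Arr (arrow_category W)"
    using A s by (simp add: arrow_category_Arr)
  have ac: "x \<in> carrier (Chain (src f) n) \<Longrightarrow> app a n x \<in> carrier (Chain (src g) n)"
    and bc: "z \<in> carrier (Chain (tgt f) n) \<Longrightarrow> app b n z \<in> carrier (Chain (tgt g) n)" for n x z
    using app_closed[OF A(2), of x n] app_closed[OF A(3), of z n] s by simp_all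
  have "Cyl_map T (f, c \<cdot>\<^bsub>W\<^esub> a, d \<cdot>\<^bsub>W\<^esub> b, h) = Cyl_map T G \<cdot>\<^bsub>W\<^esub> Cyl_map T F"
    by (rule Cyl_eqI[OF A(1)]) (use map_Arr[OF F'] map_Arr[OF G'] map_Arr[OF GF] map_ends[OF F'] map_ends[OF G']
      map_ends[OF GF] s ac bc in \<open>simp_all add: map_app[OF F'] map_app[OF G'] map_app[OF GF] Cyl_in[OF A(1)] F_eq G_eq\<close>)
  then show "Cyl_map T (G \<cdot>\<^bsub>arrow_category W\<^esub> F) = Cyl_map T G \<cdot>\<^bsub>W\<^esub> Cyl_map T F"
    by (simp add: F_eq G_eq arrow_category_def)
qed

lemma cylinder_diagram: "cylinder_diagram W T"
  unfolding cylinder_diagram_def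
  using cylinder_functor_arrows front_Arr front_ends back_Arr back_ends proj_Arr proj_ends proj_front proj_back
    map_front map_back map_proj
  by (auto simp: Hom_iff)

end

section \<open>Pushouts of arrows and of cofibrations\<close>

context abel_cat
begin

lemma arrow_simps [simp]:
  "Ob (arrow_category W) = Arr W" "Dom (arrow_category W) (f, a, b, g) = f" "Cod (arrow_category W) (f, a, b, g) = g"
  "Idn (arrow_category W) f = (f, Idn W (src f), Idn W (tgt f), f)"
  "(g, c, d, h) \<cdot>\<^bsub>arrow_category W\<^esub> (f, a, b, g') = (f, c \<cdot>\<^bsub>W\<^esub> a, d \<cdot>\<^bsub>W\<^esub> b, h)"
  by (simp_all add: arrow_category_def)

lemma F1_simps [simp]:
  "Ob (F1_category W) = Cof W" "Dom (F1_category W) (f, a, b, g) = f" "Cod (F1_category W) (f, a, b, g) = g"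
  "Idn (F1_category W) f = (f, Idn W (src f), Idn W (tgt f), f)"
  "(g, c, d, h) \<cdot>\<^bsub>F1_category W\<^esub> (f, a, b, g') = (f, c \<cdot>\<^bsub>W\<^esub> a, d \<cdot>\<^bsub>W\<^esub> b, h)"
  "(f, a, b, g) \<in> Arr (F1_category W) \<longleftrightarrow> (f, a, b, g) \<in> Arr (arrow_category W) \<and> f \<in> Cof W \<and> g \<in> Cof W"
  by (simp_all add: F1_category_def arrow_category_def)

lemma F1_Hom: "F \<in> Hom (F1_category W) f g \<longleftrightarrow>
    (\<exists>a b. F = (f, a, b, g) \<and> (f, a, b, g) \<in> Arr (arrow_category W) \<and> f \<in> Cof W \<and> g \<in> Cof W)"
  by (cases F) (auto simp: Hom_def)

lemma zero_object_unique:
  assumes "is_zero_object W Z" and A: "A \<in> Abel_complexes R"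
  shows "\<exists>!f. f \<in> Hom W Z A" "\<exists>!f. f \<in> Hom W A Z"
proof -
  have *: "\<forall>A\<in>Abel_complexes R. (\<exists>!f. f \<in> Hom W Z A) \<and> (\<exists>!f. f \<in> Hom W A Z)"
    using assms(1) unfolding is_zero_object_def W_simps by (rule conjunct2)
  show "\<exists>!f. f \<in> Hom W Z A" by (rule bspec[OF * A, THEN conjunct1])
  show "\<exists>!f. f \<in> Hom W A Z" by (rule bspec[OF * A, THEN conjunct2])
qed

text \<open>Squares between \<open>z\<close> and another arrow commute since they start or end in a zero object.\<close>

lemma F1_zero_object:
  assumes z: "z \<in> Cof W" and Z: "is_zero_object W (src z)" "is_zero_object W (tgt z)"
  shows "is_zero_object (F1_category W) z"
  unfolding is_zero_object_def
proof (intro conjI ballI)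
  show "z \<in> Ob (F1_category W)" using z by simp
  fix g assume "g \<in> Ob (F1_category W)"
  then have g: "g \<in> Cof W" by simp
  have zA: "z \<in> Arr W" and gA: "g \<in> Arr W" using z g by (simp_all add: cof_arr)
  note from_unique = zero_object_unique(1)[OF Z(1)] zero_object_unique(1)[OF Z(2)]
    and to_unique = zero_object_unique(2)[OF Z(1)] zero_object_unique(2)[OF Z(2)]
  obtain a b where a: "a \<in> Hom W (src z) (src g)" and b: "b \<in> Hom W (tgt z) (tgt g)"
    using from_unique Arr_Ob[OF gA] by blast
  have "b \<cdot>\<^bsub>W\<^esub> z \<in> Hom W (src z) (tgt g)" "g \<cdot>\<^bsub>W\<^esub> a \<in> Hom W (src z) (tgt g)"
    using a b zA gA by (simp_all add: Hom_iff)
  then have "b \<cdot>\<^bsub>W\<^esub> z = g \<cdot>\<^bsub>W\<^esub> a" using from_unique(1)[OF Arr_Ob(2)[OF gA]] by blast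
  then have "(z, a, b, g) \<in> Hom (F1_category W) z g"
    using a b zA gA z g by (simp add: F1_Hom arrow_category_Arr Hom_iff)
  moreover have "F = (z, a, b, g)" if "F \<in> Hom (F1_category W) z g" for F
  proof -
    from that obtain a' b' where F: "F = (z, a', b', g)" "(z, a', b', g) \<in> Arr (arrow_category W)"
      by (auto simp: F1_Hom)
    then have "a' \<in> Hom W (src z) (src g)" "b' \<in> Hom W (tgt z) (tgt g)"
      by (simp_all add: arrow_category_Arr Hom_iff)
    then have "a' = a" "b' = b" using a b from_unique Arr_Ob[OF gA] by blast+
    then show ?thesis using F by simp
  qed
  ultimately show "\<exists>!F. F \<in> Hom (F1_category W) z g" by blast
  obtain c d where c: "c \<in> Hom W (src g) (src z)" and d: "d \<in> Hom W (tgt g) (tgt z)"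
    using to_unique Arr_Ob[OF gA] by blast
  have "d \<cdot>\<^bsub>W\<^esub> g \<in> Hom W (src g) (tgt z)" "z \<cdot>\<^bsub>W\<^esub> c \<in> Hom W (src g) (tgt z)"
    using c d zA gA by (simp_all add: Hom_iff)
  then have "d \<cdot>\<^bsub>W\<^esub> g = z \<cdot>\<^bsub>W\<^esub> c" using to_unique(2)[OF Arr_Ob(1)[OF gA]] by blast
  then have "(g, c, d, z) \<in> Hom (F1_category W) g z"
    using c d zA gA z g by (simp add: F1_Hom arrow_category_Arr Hom_iff)
  moreover have "F = (g, c, d, z)" if "F \<in> Hom (F1_category W) g z" for F
  proof -
    from that obtain a' b' where F: "F = (g, a', b', z)" "(g, a', b', z) \<in> Arr (arrow_category W)"
      by (auto simp: F1_Hom)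
    then have "a' \<in> Hom W (src g) (src z)" "b' \<in> Hom W (tgt g) (tgt z)"
      by (simp_all add: arrow_category_Arr Hom_iff)
    then have "a' = c" "b' = d" using c d to_unique Arr_Ob[OF gA] by blast+
    then show ?thesis using F by simp
  qed
  ultimately show "\<exists>!F. F \<in> Hom (F1_category W) g z" by blast
qed

text \<open>Pasting a commutative square \<open>f' p = q f\<close> with a triangle \<open>k q = u\<close>.\<close>

lemma paste:
  assumes "f' \<cdot>\<^bsub>W\<^esub> p = q \<cdot>\<^bsub>W\<^esub> f" "k \<cdot>\<^bsub>W\<^esub> q = u"
    and "f \<in> Arr W" "f' \<in> Arr W" "p \<in> Arr W" "q \<in> Arr W" "k \<in> Arr W"
    and "tgt p = src f'" "tgt f = src q" "tgt f' = src k" "tgt q = src k"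
  shows "(k \<cdot>\<^bsub>W\<^esub> f') \<cdot>\<^bsub>W\<^esub> p = u \<cdot>\<^bsub>W\<^esub> f"
proof -
  have "(k \<cdot>\<^bsub>W\<^esub> f') \<cdot>\<^bsub>W\<^esub> p = k \<cdot>\<^bsub>W\<^esub> (f' \<cdot>\<^bsub>W\<^esub> p)" by (rule arr_assoc) (use assms in simp_all)
  also have "\<dots> = k \<cdot>\<^bsub>W\<^esub> (q \<cdot>\<^bsub>W\<^esub> f)" by (simp only: assms(1))
  also have "\<dots> = (k \<cdot>\<^bsub>W\<^esub> q) \<cdot>\<^bsub>W\<^esub> f" by (rule arr_assoc[symmetric]) (use assms in simp_all)
  finally show ?thesis by (simp only: assms(2))
qed

lemma pushoutD:
  assumes "is_pushout W f g i j"
  shows "f \<in> Arr W" "g \<in> Arr W" "i \<in> Arr W" "j \<in> Arr W"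
    "src f = src g" "src i = tgt f" "src j = tgt g" "tgt i = tgt j" "i \<cdot>\<^bsub>W\<^esub> f = j \<cdot>\<^bsub>W\<^esub> g"
    "\<And>u v. u \<in> Arr W \<Longrightarrow> v \<in> Arr W \<Longrightarrow> src u = tgt f \<Longrightarrow> src v = tgt g \<Longrightarrow> tgt u = tgt v \<Longrightarrow>
      u \<cdot>\<^bsub>W\<^esub> f = v \<cdot>\<^bsub>W\<^esub> g \<Longrightarrow> \<exists>!h. h \<in> Hom W (tgt i) (tgt u) \<and> h \<cdot>\<^bsub>W\<^esub> i = u \<and> h \<cdot>\<^bsub>W\<^esub> j = v"
proof -
  show "f \<in> Arr W" "g \<in> Arr W" "i \<in> Arr W" "j \<in> Arr W"
    "src f = src g" "src i = tgt f" "src j = tgt g" "tgt i = tgt j" "i \<cdot>\<^bsub>W\<^esub> f = j \<cdot>\<^bsub>W\<^esub> g"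
    using assms unfolding is_pushout_def W_simps by blast+
  have *: "\<forall>X \<in> Abel_complexes R. \<forall>u \<in> Hom W (tgt f) X. \<forall>v \<in> Hom W (tgt g) X. u \<cdot>\<^bsub>W\<^esub> f = v \<cdot>\<^bsub>W\<^esub> g \<longrightarrow>
      (\<exists>!h. h \<in> Hom W (tgt i) X \<and> h \<cdot>\<^bsub>W\<^esub> i = u \<and> h \<cdot>\<^bsub>W\<^esub> j = v)"
    using assms unfolding is_pushout_def W_simps by (elim conjE)
  fix u v assume "u \<in> Arr W" "v \<in> Arr W" "src u = tgt f" "src v = tgt g" "tgt u = tgt v"
    and eq: "u \<cdot>\<^bsub>W\<^esub> f = v \<cdot>\<^bsub>W\<^esub> g"
  then show "\<exists>!h. h \<in> Hom W (tgt i) (tgt u) \<and> h \<cdot>\<^bsub>W\<^esub> i = u \<and> h \<cdot>\<^bsub>W\<^esub> j = v"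
    by (intro *[rule_format] eq) (simp_all add: Hom_iff)
qed

lemma pushoutI:
  assumes "f \<in> Arr W" "g \<in> Arr W" "i \<in> Arr W" "j \<in> Arr W"
    "src f = src g" "src i = tgt f" "src j = tgt g" "tgt i = tgt j" "i \<cdot>\<^bsub>W\<^esub> f = j \<cdot>\<^bsub>W\<^esub> g"
    and ex: "\<And>u v. u \<in> Arr W \<Longrightarrow> v \<in> Arr W \<Longrightarrow> src u = tgt f \<Longrightarrow> src v = tgt g \<Longrightarrow> tgt u = tgt v \<Longrightarrow>
      u \<cdot>\<^bsub>W\<^esub> f = v \<cdot>\<^bsub>W\<^esub> g \<Longrightarrow> \<exists>h. h \<in> Hom W (tgt i) (tgt u) \<and> h \<cdot>\<^bsub>W\<^esub> i = u \<and> h \<cdot>\<^bsub>W\<^esub> j = v \<and>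
        (\<forall>k. k \<in> Hom W (tgt i) (tgt u) \<longrightarrow> k \<cdot>\<^bsub>W\<^esub> i = u \<longrightarrow> k \<cdot>\<^bsub>W\<^esub> j = v \<longrightarrow> k = h)"
  shows "is_pushout W f g i j"
proof -
  have "\<exists>!h. h \<in> Hom W (tgt i) X \<and> h \<cdot>\<^bsub>W\<^esub> i = u \<and> h \<cdot>\<^bsub>W\<^esub> j = v"
    if u: "u \<in> Hom W (tgt f) X" and v: "v \<in> Hom W (tgt g) X" and eq: "u \<cdot>\<^bsub>W\<^esub> f = v \<cdot>\<^bsub>W\<^esub> g" for X u v
  proof -
    have u': "u \<in> Arr W" "src u = tgt f" "tgt u = X" and v': "v \<in> Arr W" "src v = tgt g" "tgt v = X"
      using u v unfolding Hom_iff by blast+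
    have "tgt u = tgt v" using u' v' by simp
    from ex[OF u'(1) v'(1) u'(2) v'(2) this eq, unfolded u'(3)] obtain h where
      h: "h \<in> Hom W (tgt i) X \<and> h \<cdot>\<^bsub>W\<^esub> i = u \<and> h \<cdot>\<^bsub>W\<^esub> j = v"
      and *: "\<And>k. k \<in> Hom W (tgt i) X \<Longrightarrow> k \<cdot>\<^bsub>W\<^esub> i = u \<Longrightarrow> k \<cdot>\<^bsub>W\<^esub> j = v \<Longrightarrow> k = h"
      by blast
    show ?thesis by (rule ex1I[of _ h], rule h, elim conjE, rule *)
  qed
  then show ?thesis unfolding is_pushout_def W_simps by (intro conjI ballI impI assms(1-9); assumption)
qed

text \<open>Taking the target of an arrow is left adjoint to \<open>X \<mapsto> Idn X\<close>, and taking its source is left adjoint to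
  \<open>X \<mapsto> (X \<rightarrow> 0)\<close>; so both preserve pushouts. The proof tests the universal property on arrows of these two forms.\<close>

lemma arrow_pushout_components:
  assumes po: "is_pushout (arrow_category W) F G I J"
  obtains f0 a b f1 c d f2 p q f3 r s where
    "F = (f0, a, b, f1)" "G = (f0, c, d, f2)" "I = (f1, p, q, f3)" "J = (f2, r, s, f3)"
    "(f0, a, b, f1) \<in> Arr (arrow_category W)" "(f0, c, d, f2) \<in> Arr (arrow_category W)"
    "(f1, p, q, f3) \<in> Arr (arrow_category W)" "(f2, r, s, f3) \<in> Arr (arrow_category W)"
    "is_pushout W a c p r" "is_pushout W b d q s"
proof -
  obtain f0 a b f1 where F_eq: "F = (f0, a, b, f1)" by (cases F)
  from po obtain c d f2 where G_eq: "G = (f0, c, d, f2)"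
    by (cases G) (auto simp: is_pushout_def F_eq)
  from po obtain p q f3 where I_eq: "I = (f1, p, q, f3)"
    by (cases I) (auto simp: is_pushout_def F_eq)
  from po obtain r s where J_eq: "J = (f2, r, s, f3)"
    by (cases J) (auto simp: is_pushout_def G_eq I_eq)
  note po' = po[unfolded F_eq G_eq I_eq J_eq]
  from po' have A: "(f0, a, b, f1) \<in> Arr (arrow_category W)" "(f0, c, d, f2) \<in> Arr (arrow_category W)"
    "(f1, p, q, f3) \<in> Arr (arrow_category W)" "(f2, r, s, f3) \<in> Arr (arrow_category W)"
    unfolding is_pushout_def by blast+
  from po' have comm: "p \<cdot>\<^bsub>W\<^esub> a = r \<cdot>\<^bsub>W\<^esub> c" "q \<cdot>\<^bsub>W\<^esub> b = s \<cdot>\<^bsub>W\<^esub> d"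
    unfolding is_pushout_def arrow_simps by blast+
  have po_univ: "\<forall>x \<in> Arr W. \<forall>U \<in> Hom (arrow_category W) f1 x. \<forall>V \<in> Hom (arrow_category W) f2 x.
      U \<cdot>\<^bsub>arrow_category W\<^esub> (f0, a, b, f1) = V \<cdot>\<^bsub>arrow_category W\<^esub> (f0, c, d, f2) \<longrightarrow>
      (\<exists>!h. h \<in> Hom (arrow_category W) f3 x \<and> h \<cdot>\<^bsub>arrow_category W\<^esub> (f1, p, q, f3) = U \<and>
        h \<cdot>\<^bsub>arrow_category W\<^esub> (f2, r, s, f3) = V)"
    using po' unfolding is_pushout_def arrow_simps(1-3) by (elim conjE)
  have univ: "\<exists>h0 h1. (f3, h0, h1, x) \<in> Arr (arrow_category W) \<and> h0 \<cdot>\<^bsub>W\<^esub> p = u0 \<and> h1 \<cdot>\<^bsub>W\<^esub> q = u1 \<and>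
      h0 \<cdot>\<^bsub>W\<^esub> r = v0 \<and> h1 \<cdot>\<^bsub>W\<^esub> s = v1 \<and>
      (\<forall>k0 k1. (f3, k0, k1, x) \<in> Arr (arrow_category W) \<longrightarrow> k0 \<cdot>\<^bsub>W\<^esub> p = u0 \<longrightarrow> k1 \<cdot>\<^bsub>W\<^esub> q = u1 \<longrightarrow>
        k0 \<cdot>\<^bsub>W\<^esub> r = v0 \<longrightarrow> k1 \<cdot>\<^bsub>W\<^esub> s = v1 \<longrightarrow> k0 = h0 \<and> k1 = h1)"
    if U: "(f1, u0, u1, x) \<in> Arr (arrow_category W)" and V: "(f2, v0, v1, x) \<in> Arr (arrow_category W)"
      and uv: "u0 \<cdot>\<^bsub>W\<^esub> a = v0 \<cdot>\<^bsub>W\<^esub> c" "u1 \<cdot>\<^bsub>W\<^esub> b = v1 \<cdot>\<^bsub>W\<^esub> d" for x u0 u1 v0 v1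
  proof -
    have x: "x \<in> Arr W" using U unfolding arrow_category_Arr by blast
    have "\<exists>!h. h \<in> Hom (arrow_category W) f3 x \<and>
        h \<cdot>\<^bsub>arrow_category W\<^esub> (f1, p, q, f3) = (f1, u0, u1, x) \<and>
        h \<cdot>\<^bsub>arrow_category W\<^esub> (f2, r, s, f3) = (f2, v0, v1, x)"
      using po_univ[rule_format, of x "(f1, u0, u1, x)" "(f2, v0, v1, x)"] x U V uv by (simp add: Hom_def)
    then obtain h where h: "h \<in> Hom (arrow_category W) f3 x"
        "h \<cdot>\<^bsub>arrow_category W\<^esub> (f1, p, q, f3) = (f1, u0, u1, x)"
        "h \<cdot>\<^bsub>arrow_category W\<^esub> (f2, r, s, f3) = (f2, v0, v1, x)"
      and uniq: "\<And>k. k \<in> Hom (arrow_category W) f3 x \<Longrightarrow>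
        k \<cdot>\<^bsub>arrow_category W\<^esub> (f1, p, q, f3) = (f1, u0, u1, x) \<Longrightarrow>
        k \<cdot>\<^bsub>arrow_category W\<^esub> (f2, r, s, f3) = (f2, v0, v1, x) \<Longrightarrow> k = h"
      by (elim ex1E) blast
    from h(1) obtain h0 h1 where h_eq: "h = (f3, h0, h1, x)" by (cases h) (auto simp: Hom_def)
    have "k0 = h0 \<and> k1 = h1" if "(f3, k0, k1, x) \<in> Arr (arrow_category W)" "k0 \<cdot>\<^bsub>W\<^esub> p = u0" "k1 \<cdot>\<^bsub>W\<^esub> q = u1"
        "k0 \<cdot>\<^bsub>W\<^esub> r = v0" "k1 \<cdot>\<^bsub>W\<^esub> s = v1" for k0 k1
      using uniq[of "(f3, k0, k1, x)"] that by (simp add: Hom_def h_eq)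
    moreover have "(f3, h0, h1, x) \<in> Arr (arrow_category W)" using h(1) by (simp add: Hom_def h_eq)
    moreover have "h0 \<cdot>\<^bsub>W\<^esub> p = u0" "h1 \<cdot>\<^bsub>W\<^esub> q = u1" "h0 \<cdot>\<^bsub>W\<^esub> r = v0" "h1 \<cdot>\<^bsub>W\<^esub> s = v1"
      using h(2,3) by (simp_all add: h_eq)
    ultimately show ?thesis by blast
  qed
  have arr: "f0 \<in> Arr W" "f1 \<in> Arr W" "f2 \<in> Arr W" "f3 \<in> Arr W" "a \<in> Arr W" "b \<in> Arr W" "c \<in> Arr W" "d \<in> Arr W"
      "p \<in> Arr W" "q \<in> Arr W" "r \<in> Arr W" "s \<in> Arr W"
    and ends: "src a = src f0" "tgt a = src f1" "src b = tgt f0" "tgt b = tgt f1"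
      "src c = src f0" "tgt c = src f2" "src d = tgt f0" "tgt d = tgt f2"
      "src p = src f1" "tgt p = src f3" "src q = tgt f1" "tgt q = tgt f3"
      "src r = src f2" "tgt r = src f3" "src s = tgt f2" "tgt s = tgt f3"
    and sq: "b \<cdot>\<^bsub>W\<^esub> f0 = f1 \<cdot>\<^bsub>W\<^esub> a" "d \<cdot>\<^bsub>W\<^esub> f0 = f2 \<cdot>\<^bsub>W\<^esub> c" "q \<cdot>\<^bsub>W\<^esub> f1 = f3 \<cdot>\<^bsub>W\<^esub> p" "s \<cdot>\<^bsub>W\<^esub> f2 = f3 \<cdot>\<^bsub>W\<^esub> r"
    using A unfolding arrow_category_Arr by blast+
  have "is_pushout W b d q s"
  proof (rule pushoutI)
    fix u v assume uv: "u \<in> Arr W" "v \<in> Arr W" "src u = tgt b" "src v = tgt d" "tgt u = tgt v"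
      and eq: "u \<cdot>\<^bsub>W\<^esub> b = v \<cdot>\<^bsub>W\<^esub> d"
    let ?x = "Idn W (tgt u)"
    have U: "(f1, u \<cdot>\<^bsub>W\<^esub> f1, u, ?x) \<in> Arr (arrow_category W)"
      unfolding arrow_category_Arr using arr_idn_comp[of "u \<cdot>\<^bsub>W\<^esub> f1"] uv arr ends by simp
    have V: "(f2, v \<cdot>\<^bsub>W\<^esub> f2, v, ?x) \<in> Arr (arrow_category W)"
      unfolding arrow_category_Arr using arr_idn_comp[of "v \<cdot>\<^bsub>W\<^esub> f2"] uv arr ends by simp
    have "(u \<cdot>\<^bsub>W\<^esub> f1) \<cdot>\<^bsub>W\<^esub> a = (u \<cdot>\<^bsub>W\<^esub> b) \<cdot>\<^bsub>W\<^esub> f0"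
      by (rule paste[OF sq(1)[symmetric] refl]) (use uv arr ends in simp_all)
    also have "\<dots> = (v \<cdot>\<^bsub>W\<^esub> f2) \<cdot>\<^bsub>W\<^esub> c"
      by (rule paste[OF sq(2)[symmetric] eq[symmetric], symmetric]) (use uv arr ends in simp_all)
    finally obtain h0 h1 where h: "(f3, h0, h1, ?x) \<in> Arr (arrow_category W)" "h1 \<cdot>\<^bsub>W\<^esub> q = u" "h1 \<cdot>\<^bsub>W\<^esub> s = v"
      and uniq: "\<And>k0 k1. (f3, k0, k1, ?x) \<in> Arr (arrow_category W) \<Longrightarrow> k0 \<cdot>\<^bsub>W\<^esub> p = u \<cdot>\<^bsub>W\<^esub> f1 \<Longrightarrow> k1 \<cdot>\<^bsub>W\<^esub> q = u \<Longrightarrow>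
        k0 \<cdot>\<^bsub>W\<^esub> r = v \<cdot>\<^bsub>W\<^esub> f2 \<Longrightarrow> k1 \<cdot>\<^bsub>W\<^esub> s = v \<Longrightarrow> k1 = h1"
      using univ[OF U V _ eq] by blast
    have "k = h1" if k: "k \<in> Hom W (tgt q) (tgt u)" "k \<cdot>\<^bsub>W\<^esub> q = u" "k \<cdot>\<^bsub>W\<^esub> s = v" for k
    proof (rule uniq[OF _ _ k(2) _ k(3)])
      have k': "k \<in> Arr W" "src k = tgt f3" "tgt k = tgt u" using k(1) ends unfolding Hom_iff by simp_all
      show "(f3, k \<cdot>\<^bsub>W\<^esub> f3, k, ?x) \<in> Arr (arrow_category W)"
        unfolding arrow_category_Arr using arr_idn_comp[of "k \<cdot>\<^bsub>W\<^esub> f3"] uv k' arr ends by simp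
      show "(k \<cdot>\<^bsub>W\<^esub> f3) \<cdot>\<^bsub>W\<^esub> p = u \<cdot>\<^bsub>W\<^esub> f1"
        by (rule paste[OF sq(3)[symmetric] k(2)]) (use k' arr ends in simp_all)
      show "(k \<cdot>\<^bsub>W\<^esub> f3) \<cdot>\<^bsub>W\<^esub> r = v \<cdot>\<^bsub>W\<^esub> f2"
        by (rule paste[OF sq(4)[symmetric] k(3)]) (use k' arr ends in simp_all)
    qed
    moreover have "h1 \<in> Hom W (tgt q) (tgt u)"
      using h(1) ends unfolding arrow_category_Arr Hom_iff by simp
    ultimately show "\<exists>h. h \<in> Hom W (tgt q) (tgt u) \<and> h \<cdot>\<^bsub>W\<^esub> q = u \<and> h \<cdot>\<^bsub>W\<^esub> s = v \<and>
        (\<forall>k. k \<in> Hom W (tgt q) (tgt u) \<longrightarrow> k \<cdot>\<^bsub>W\<^esub> q = u \<longrightarrow> k \<cdot>\<^bsub>W\<^esub> s = v \<longrightarrow> k = h)"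
      using h(2,3) by blast
  qed (use arr ends comm in simp_all)
  moreover have "is_pushout W a c p r"
  proof (rule pushoutI)
    fix u v assume uv: "u \<in> Arr W" "v \<in> Arr W" "src u = tgt a" "src v = tgt c" "tgt u = tgt v"
      and eq: "u \<cdot>\<^bsub>W\<^esub> a = v \<cdot>\<^bsub>W\<^esub> c"
    let ?O = "zero_complex :: ('a, 'u) module_complex"
    let ?x = "zero_arr (tgt u) ?O"
    have to_zero: "k = l" if "k \<in> Arr W" "l \<in> Arr W" "src k = src l" "tgt k = ?O" "tgt l = ?O" for k l
      using zero_object that unfolding is_zero_object_def W_simps by (metis Arr_Ob(1) Hom_iff)
    have test: "(g, k, zero_arr (tgt g) ?O, ?x) \<in> Arr (arrow_category W)"
      if "g \<in> Arr W" "k \<in> Arr W" "src k = src g" "tgt k = tgt u" for g k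
      unfolding arrow_category_Arr using that uv by (intro conjI to_zero) simp_all
    have U: "(f1, u, zero_arr (tgt f1) ?O, ?x) \<in> Arr (arrow_category W)"
      and V: "(f2, v, zero_arr (tgt f2) ?O, ?x) \<in> Arr (arrow_category W)"
      by (rule test; use uv arr ends in simp)+
    have "zero_arr (tgt f1) ?O \<cdot>\<^bsub>W\<^esub> b = zero_arr (tgt f2) ?O \<cdot>\<^bsub>W\<^esub> d"
      by (rule to_zero) (use arr ends in simp_all)
    then obtain h0 h1 where h: "(f3, h0, h1, ?x) \<in> Arr (arrow_category W)" "h0 \<cdot>\<^bsub>W\<^esub> p = u" "h0 \<cdot>\<^bsub>W\<^esub> r = v"
      and uniq: "\<And>k0 k1. (f3, k0, k1, ?x) \<in> Arr (arrow_category W) \<Longrightarrow> k0 \<cdot>\<^bsub>W\<^esub> p = u \<Longrightarrow>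
        k1 \<cdot>\<^bsub>W\<^esub> q = zero_arr (tgt f1) ?O \<Longrightarrow> k0 \<cdot>\<^bsub>W\<^esub> r = v \<Longrightarrow> k1 \<cdot>\<^bsub>W\<^esub> s = zero_arr (tgt f2) ?O \<Longrightarrow> k0 = h0"
      using univ[OF U V eq] by blast
    have "k = h0" if k: "k \<in> Hom W (tgt p) (tgt u)" "k \<cdot>\<^bsub>W\<^esub> p = u" "k \<cdot>\<^bsub>W\<^esub> r = v" for k
    proof (rule uniq[OF _ k(2) _ k(3)])
      show "(f3, k, zero_arr (tgt f3) ?O, ?x) \<in> Arr (arrow_category W)"
        by (rule test) (use k(1) arr ends in \<open>simp_all add: Hom_iff\<close>)
    qed (rule to_zero; use arr ends in simp)+
    moreover have "h0 \<in> Hom W (tgt p) (tgt u)"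
      using h(1) ends unfolding arrow_category_Arr Hom_iff by simp
    ultimately show "\<exists>h. h \<in> Hom W (tgt p) (tgt u) \<and> h \<cdot>\<^bsub>W\<^esub> p = u \<and> h \<cdot>\<^bsub>W\<^esub> r = v \<and>
        (\<forall>k. k \<in> Hom W (tgt p) (tgt u) \<longrightarrow> k \<cdot>\<^bsub>W\<^esub> p = u \<longrightarrow> k \<cdot>\<^bsub>W\<^esub> r = v \<longrightarrow> k = h)"
      using h(2,3) by blast
  qed (use arr ends comm in simp_all)
  ultimately show thesis using F_eq G_eq I_eq J_eq A by (intro that)
qed

text \<open>The two component maps out of the pushouts form a morphism of arrows, because the square in question commutes
  after restriction along \<open>p\<close> and \<open>r\<close>, and these are jointly epimorphic.\<close>

lemma F1_pushoutI:
  assumes A: "(f0, a, b, f1) \<in> Arr (F1_category W)" "(f0, c, d, f2) \<in> Arr (F1_category W)"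
      "(f1, p, q, f3) \<in> Arr (F1_category W)" "(f2, r, s, f3) \<in> Arr (F1_category W)"
    and po: "is_pushout W a c p r" "is_pushout W b d q s"
  shows "is_pushout (F1_category W) (f0, a, b, f1) (f0, c, d, f2) (f1, p, q, f3) (f2, r, s, f3)"
proof -
  note D = pushoutD[OF po(1)] and E = pushoutD[OF po(2)]
  have arr: "f1 \<in> Arr W" "f2 \<in> Arr W" "f3 \<in> Arr W"
    and ends: "src a = src f0" "tgt a = src f1" "src b = tgt f0" "tgt b = tgt f1"
      "src c = src f0" "tgt c = src f2" "src d = tgt f0" "tgt d = tgt f2"
      "src p = src f1" "tgt p = src f3" "src q = tgt f1" "tgt q = tgt f3"
      "src r = src f2" "tgt r = src f3" "src s = tgt f2" "tgt s = tgt f3"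
    and sq: "q \<cdot>\<^bsub>W\<^esub> f1 = f3 \<cdot>\<^bsub>W\<^esub> p" "s \<cdot>\<^bsub>W\<^esub> f2 = f3 \<cdot>\<^bsub>W\<^esub> r" and f3: "f3 \<in> Cof W"
    using A unfolding F1_simps arrow_category_Arr by blast+
  have "\<exists>!h. h \<in> Hom (F1_category W) f3 x \<and> h \<cdot>\<^bsub>F1_category W\<^esub> (f1, p, q, f3) = U \<and>
      h \<cdot>\<^bsub>F1_category W\<^esub> (f2, r, s, f3) = V"
    if U: "U \<in> Hom (F1_category W) f1 x" and V: "V \<in> Hom (F1_category W) f2 x"
      and UV: "U \<cdot>\<^bsub>F1_category W\<^esub> (f0, a, b, f1) = V \<cdot>\<^bsub>F1_category W\<^esub> (f0, c, d, f2)" for x U V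
  proof -
    from U obtain u0 u1 where U_eq: "U = (f1, u0, u1, x)" and "(f1, u0, u1, x) \<in> Arr (arrow_category W)"
      and x: "x \<in> Cof W" by (auto simp: F1_Hom)
    then have u: "u0 \<in> Arr W" "u1 \<in> Arr W" "src u0 = src f1" "tgt u0 = src x" "src u1 = tgt f1" "tgt u1 = tgt x"
      "u1 \<cdot>\<^bsub>W\<^esub> f1 = x \<cdot>\<^bsub>W\<^esub> u0" unfolding arrow_category_Arr by blast+
    from V obtain v0 v1 where V_eq: "V = (f2, v0, v1, x)" and "(f2, v0, v1, x) \<in> Arr (arrow_category W)"
      by (auto simp: F1_Hom)
    then have v: "v0 \<in> Arr W" "v1 \<in> Arr W" "src v0 = src f2" "tgt v0 = src x" "src v1 = tgt f2" "tgt v1 = tgt x"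
      "v1 \<cdot>\<^bsub>W\<^esub> f2 = x \<cdot>\<^bsub>W\<^esub> v0" unfolding arrow_category_Arr by blast+
    from UV have uv: "u0 \<cdot>\<^bsub>W\<^esub> a = v0 \<cdot>\<^bsub>W\<^esub> c" "u1 \<cdot>\<^bsub>W\<^esub> b = v1 \<cdot>\<^bsub>W\<^esub> d" by (simp_all add: U_eq V_eq)
    have xA: "x \<in> Arr W" by (rule cof_arr[OF x])
    have "\<exists>!h. h \<in> Hom W (tgt p) (tgt u0) \<and> h \<cdot>\<^bsub>W\<^esub> p = u0 \<and> h \<cdot>\<^bsub>W\<^esub> r = v0"
      by (rule D(10)) (use u v uv ends in simp_all)
    then obtain h0 where h0: "h0 \<in> Hom W (tgt p) (tgt u0)" "h0 \<cdot>\<^bsub>W\<^esub> p = u0" "h0 \<cdot>\<^bsub>W\<^esub> r = v0"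
      and uniq0: "\<And>k. k \<in> Hom W (tgt p) (tgt u0) \<Longrightarrow> k \<cdot>\<^bsub>W\<^esub> p = u0 \<Longrightarrow> k \<cdot>\<^bsub>W\<^esub> r = v0 \<Longrightarrow> k = h0"
      by (elim ex1E) blast
    have "\<exists>!h. h \<in> Hom W (tgt q) (tgt u1) \<and> h \<cdot>\<^bsub>W\<^esub> q = u1 \<and> h \<cdot>\<^bsub>W\<^esub> s = v1"
      by (rule E(10)) (use u v uv ends in simp_all)
    then obtain h1 where h1: "h1 \<in> Hom W (tgt q) (tgt u1)" "h1 \<cdot>\<^bsub>W\<^esub> q = u1" "h1 \<cdot>\<^bsub>W\<^esub> s = v1"
      and uniq1: "\<And>k. k \<in> Hom W (tgt q) (tgt u1) \<Longrightarrow> k \<cdot>\<^bsub>W\<^esub> q = u1 \<Longrightarrow> k \<cdot>\<^bsub>W\<^esub> s = v1 \<Longrightarrow> k = h1"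
      by (elim ex1E) blast
    have h0': "h0 \<in> Arr W" "src h0 = src f3" "tgt h0 = src x" and h1': "h1 \<in> Arr W" "src h1 = tgt f3" "tgt h1 = tgt x"
      using h0(1) h1(1) ends u unfolding Hom_iff by simp_all
    \<comment> \<open>Both composites \<open>src f3 \<rightarrow> tgt x\<close> restrict to the same arrows along \<open>p\<close> and \<open>r\<close>.\<close>
    have e1: "(h1 \<cdot>\<^bsub>W\<^esub> f3) \<cdot>\<^bsub>W\<^esub> p = u1 \<cdot>\<^bsub>W\<^esub> f1" "(h1 \<cdot>\<^bsub>W\<^esub> f3) \<cdot>\<^bsub>W\<^esub> r = v1 \<cdot>\<^bsub>W\<^esub> f2"
      by (rule paste[OF sq(1)[symmetric] h1(2)]; use h1' arr D E ends in simp)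
        (rule paste[OF sq(2)[symmetric] h1(3)]; use h1' arr D E ends in simp)
    have e0: "(x \<cdot>\<^bsub>W\<^esub> h0) \<cdot>\<^bsub>W\<^esub> p = u1 \<cdot>\<^bsub>W\<^esub> f1" "(x \<cdot>\<^bsub>W\<^esub> h0) \<cdot>\<^bsub>W\<^esub> r = v1 \<cdot>\<^bsub>W\<^esub> f2"
      using arr_assoc[of p h0 x] arr_assoc[of r h0 x] h0 h0' xA D(3,4) ends u v by simp_all
    have "\<exists>!k. k \<in> Hom W (tgt p) (tgt (u1 \<cdot>\<^bsub>W\<^esub> f1)) \<and> k \<cdot>\<^bsub>W\<^esub> p = u1 \<cdot>\<^bsub>W\<^esub> f1 \<and> k \<cdot>\<^bsub>W\<^esub> r = v1 \<cdot>\<^bsub>W\<^esub> f2"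
    proof (rule D(10))
      have "(x \<cdot>\<^bsub>W\<^esub> u0) \<cdot>\<^bsub>W\<^esub> a = (x \<cdot>\<^bsub>W\<^esub> v0) \<cdot>\<^bsub>W\<^esub> c"
        using arr_assoc[of a u0 x] arr_assoc[of c v0 x] u v uv D(1,2) ends xA by simp
      then show "(u1 \<cdot>\<^bsub>W\<^esub> f1) \<cdot>\<^bsub>W\<^esub> a = (v1 \<cdot>\<^bsub>W\<^esub> f2) \<cdot>\<^bsub>W\<^esub> c" using u(7) v(7) by simp
    qed (use u(1-6) v(1-6) arr ends in simp_all)
    moreover have "h1 \<cdot>\<^bsub>W\<^esub> f3 \<in> Hom W (tgt p) (tgt (u1 \<cdot>\<^bsub>W\<^esub> f1))" "x \<cdot>\<^bsub>W\<^esub> h0 \<in> Hom W (tgt p) (tgt (u1 \<cdot>\<^bsub>W\<^esub> f1))"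
      using h0' h1' arr ends xA u by (simp_all add: Hom_iff)
    ultimately have sq': "h1 \<cdot>\<^bsub>W\<^esub> f3 = x \<cdot>\<^bsub>W\<^esub> h0" using e0 e1 by blast
    let ?h = "(f3, h0, h1, x)"
    have "?h \<in> Hom (F1_category W) f3 x"
      using h0' h1' arr xA x f3 sq' by (simp add: F1_Hom arrow_category_Arr)
    moreover have "k = ?h" if k: "k \<in> Hom (F1_category W) f3 x" "k \<cdot>\<^bsub>F1_category W\<^esub> (f1, p, q, f3) = U"
      "k \<cdot>\<^bsub>F1_category W\<^esub> (f2, r, s, f3) = V" for k
    proof -
      from k(1) obtain k0 k1 where k_eq: "k = (f3, k0, k1, x)" and kA: "(f3, k0, k1, x) \<in> Arr (arrow_category W)"
        by (auto simp: F1_Hom)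
      have "k0 = h0" by (rule uniq0) (use k kA ends u in \<open>simp_all add: k_eq U_eq V_eq arrow_category_Arr Hom_iff\<close>)
      moreover have "k1 = h1" by (rule uniq1) (use k kA ends u in \<open>simp_all add: k_eq U_eq V_eq arrow_category_Arr Hom_iff\<close>)
      ultimately show ?thesis by (simp add: k_eq)
    qed
    moreover have "?h \<cdot>\<^bsub>F1_category W\<^esub> (f1, p, q, f3) = U" "?h \<cdot>\<^bsub>F1_category W\<^esub> (f2, r, s, f3) = V"
      using h0 h1 by (simp_all add: U_eq V_eq)
    ultimately show ?thesis by (intro ex1I[of _ ?h] conjI; (elim conjE)?) assumption+
  qed
  then show ?thesis
    unfolding is_pushout_def F1_simps(2,3,5) using A D(9) E(9) by simp
qed

end

section \<open>Coproducts of Abel complexes\<close>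

lemma (in abel_cat) from_zero_eq:
  assumes "k \<in> Arr W" "l \<in> Arr W" "src k = zero_complex" "src l = zero_complex" "tgt k = tgt l"
  shows "k = l"
  using from_zero[of k "tgt k"] from_zero[of l "tgt l"] assms by (simp add: Hom_iff)

text \<open>Cyl 1 quantifies over all choices of coproducts; one of them is fixed here.\<close>

locale coproduct_choice = abel_cat R enc
  for R :: "('a, 'r) ring_scheme" (structure) and enc :: "'u \<times> 'u \<times> 'u \<Rightarrow> 'u" +
  fixes i j :: "('a, 'u) module_complex \<Rightarrow> ('a, 'u) module_complex \<Rightarrow> ('a, 'u) chain_map"
  assumes coproduct: "A \<in> Abel_complexes R \<Longrightarrow> B \<in> Abel_complexes R \<Longrightarrow> is_coproduct W A B (i A B) (j A B)"
begin

definition cop where "cop A B = tgt (i A B)"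

text \<open>The element \<open>(x, y)\<close> of the direct sum.\<close>

definition pair where "pair A B n x y = app (i A B) n x \<oplus>\<^bsub>Chain (cop A B) n\<^esub> app (j A B) n y"

lemma cop_arr:
  assumes "A \<in> Abel_complexes R" "B \<in> Abel_complexes R"
  shows "i A B \<in> Arr W" "j A B \<in> Arr W" "src (i A B) = A" "src (j A B) = B"
    "tgt (i A B) = cop A B" "tgt (j A B) = cop A B"
  using coproduct[OF assms] unfolding is_coproduct_def W_simps cop_def by (blast, blast, blast, blast, blast, metis)

lemma cop_Ob [simp]: "A \<in> Abel_complexes R \<Longrightarrow> B \<in> Abel_complexes R \<Longrightarrow> cop A B \<in> Abel_complexes R"
  using cop_arr(1,5) Arr_Ob(2) by metis

lemma cop_univ:
  assumes A: "A \<in> Abel_complexes R" and B: "B \<in> Abel_complexes R"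
    and u: "u \<in> Arr W" "src u = A" and v: "v \<in> Arr W" "src v = B" and uv: "tgt u = tgt v"
  shows "\<exists>!h. h \<in> Hom W (cop A B) (tgt u) \<and> h \<cdot>\<^bsub>W\<^esub> i A B = u \<and> h \<cdot>\<^bsub>W\<^esub> j A B = v"
proof -
  have "\<forall>X \<in> Abel_complexes R. \<forall>u \<in> Hom W A X. \<forall>v \<in> Hom W B X.
      \<exists>!h. h \<in> Hom W (cop A B) X \<and> h \<cdot>\<^bsub>W\<^esub> i A B = u \<and> h \<cdot>\<^bsub>W\<^esub> j A B = v"
    using coproduct[OF A B] unfolding is_coproduct_def W_simps cop_def by (elim conjE)
  from this[rule_format, of "tgt u" u v] show ?thesis using u v uv by (simp add: Hom_iff)
qed

text \<open>A coproduct is a pushout over the zero complex, and hence a direct sum of complexes.\<close>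

lemma cop_square:
  fixes A B :: "('a, 'u) module_complex"
  assumes A: "A \<in> Abel_complexes R" and B: "B \<in> Abel_complexes R"
  shows "exact_square (zero_arr zero_complex A) (zero_arr zero_complex B) (i A B) (j A B)"
proof (rule pushout_exact_square[OF _ zero_arr_Cof[OF A]], rule pushoutI)
  note c = cop_arr[OF A B]
  show "i A B \<cdot>\<^bsub>W\<^esub> zero_arr zero_complex A = j A B \<cdot>\<^bsub>W\<^esub> zero_arr zero_complex B"
    by (rule from_zero_eq) (use c A B in simp_all)
  fix u v assume "u \<in> Arr W" "v \<in> Arr W" "src u = tgt (zero_arr zero_complex A)" "src v = tgt (zero_arr zero_complex B)"
    "tgt u = tgt v"
  then have "\<exists>!h. h \<in> Hom W (cop A B) (tgt u) \<and> h \<cdot>\<^bsub>W\<^esub> i A B = u \<and> h \<cdot>\<^bsub>W\<^esub> j A B = v"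
    by (intro cop_univ[OF A B]) simp_all
  then show "\<exists>h. h \<in> Hom W (tgt (i A B)) (tgt u) \<and> h \<cdot>\<^bsub>W\<^esub> i A B = u \<and> h \<cdot>\<^bsub>W\<^esub> j A B = v \<and>
      (\<forall>k. k \<in> Hom W (tgt (i A B)) (tgt u) \<longrightarrow> k \<cdot>\<^bsub>W\<^esub> i A B = u \<longrightarrow> k \<cdot>\<^bsub>W\<^esub> j A B = v \<longrightarrow> k = h)"
    unfolding c(5) by (elim ex1E) blast
qed (use cop_arr[OF A B] A B in simp_all)

lemma cop_raw:
  fixes A B :: "('a, 'u) module_complex"
  assumes A: "A \<in> Abel_complexes R" and B: "B \<in> Abel_complexes R"
  shows "raw_pushout R zero_complex (app (zero_arr zero_complex A)) A (app (zero_arr zero_complex B)) B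
    (app (i A B)) (cop A B) (app (j A B))"
  using exact_squareD(9)[OF cop_square[OF A B]] cop_arr(5)[OF A B] by simp

context
  fixes A B :: "('a, 'u) module_complex"
  assumes A: "A \<in> Abel_complexes R" and B: "B \<in> Abel_complexes R"
begin

interpretation raw: raw_pushout R zero_complex "app (zero_arr zero_complex A)" A "app (zero_arr zero_complex B)" B
    "app (i A B)" "cop A B" "app (j A B)"
  by (rule cop_raw[OF A B])

lemma pair_in: "x \<in> carrier (Chain A n) \<Longrightarrow> y \<in> carrier (Chain B n) \<Longrightarrow> pair A B n x y \<in> carrier (Chain (cop A B) n)"
  by (simp add: pair_def)

lemma pair_cases:
  assumes "p \<in> carrier (Chain (cop A B) n)"
  obtains x y where "x \<in> carrier (Chain A n)" "y \<in> carrier (Chain B n)" "p = pair A B n x y"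
  using raw.gen[OF assms] unfolding pair_def by blast

lemma pair_add: "\<lbrakk>x \<in> carrier (Chain A n); y \<in> carrier (Chain B n); x' \<in> carrier (Chain A n); y' \<in> carrier (Chain B n)\<rbrakk> \<Longrightarrow>
    pair A B n x y \<oplus>\<^bsub>Chain (cop A B) n\<^esub> pair A B n x' y' = pair A B n (x \<oplus>\<^bsub>Chain A n\<^esub> x') (y \<oplus>\<^bsub>Chain B n\<^esub> y')"
  by (simp add: pair_def raw.i.f_add raw.j.f_add raw.i.D.M.a_ac)

lemma pair_zero: "pair A B n \<zero>\<^bsub>Chain A n\<^esub> \<zero>\<^bsub>Chain B n\<^esub> = \<zero>\<^bsub>Chain (cop A B) n\<^esub>"
  by (simp add: pair_def)

lemma pair_neg: "\<lbrakk>x \<in> carrier (Chain A n); y \<in> carrier (Chain B n)\<rbrakk> \<Longrightarrow>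
    pair A B n (\<ominus>\<^bsub>Chain A n\<^esub> x) (\<ominus>\<^bsub>Chain B n\<^esub> y) = \<ominus>\<^bsub>Chain (cop A B) n\<^esub> pair A B n x y"
  by (simp add: pair_def raw.i.f_neg raw.j.f_neg raw.i.D.M.minus_add)

lemma pair_zeroD:
  assumes "x \<in> carrier (Chain A n)" "y \<in> carrier (Chain B n)" "pair A B n x y = \<zero>\<^bsub>Chain (cop A B) n\<^esub>"
  shows "x = \<zero>\<^bsub>Chain A n\<^esub> \<and> y = \<zero>\<^bsub>Chain B n\<^esub>"
  using raw.rel[OF assms(1,2)] assms(3) raw.f.D.M.neg_zero raw.g.D.M.neg_zero by (auto simp: pair_def)

lemma copair:
  assumes u: "u \<in> Arr W" "src u = A" and v: "v \<in> Arr W" "src v = B" and uv: "tgt u = tgt v"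
  shows "copair W (i A B) (j A B) u v \<in> Arr W" "src (copair W (i A B) (j A B) u v) = cop A B"
    "tgt (copair W (i A B) (j A B) u v) = tgt u"
    "copair W (i A B) (j A B) u v \<cdot>\<^bsub>W\<^esub> i A B = u" "copair W (i A B) (j A B) u v \<cdot>\<^bsub>W\<^esub> j A B = v"
    "x \<in> carrier (Chain A n) \<Longrightarrow> y \<in> carrier (Chain B n) \<Longrightarrow>
      app (copair W (i A B) (j A B) u v) n (pair A B n x y) = app u n x \<oplus>\<^bsub>Chain (tgt u) n\<^esub> app v n y"
proof -
  let ?h = "copair W (i A B) (j A B) u v"
  note c = cop_arr[OF A B]
  have *: "?h \<in> Hom W (cop A B) (tgt u) \<and> ?h \<cdot>\<^bsub>W\<^esub> i A B = u \<and> ?h \<cdot>\<^bsub>W\<^esub> j A B = v"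
    unfolding copair_def W_simps c(5) by (rule theI'[OF cop_univ[OF A B u v uv]])
  then show h: "?h \<in> Arr W" "src ?h = cop A B" "tgt ?h = tgt u" "?h \<cdot>\<^bsub>W\<^esub> i A B = u" "?h \<cdot>\<^bsub>W\<^esub> j A B = v"
    unfolding Hom_iff by blast+
  assume x: "x \<in> carrier (Chain A n)" and y: "y \<in> carrier (Chain B n)"
  have "app ?h n (app (i A B) n x) = app u n x" "app ?h n (app (j A B) n y) = app v n y"
    using app_Comp[of x "i A B" n ?h] app_Comp[of y "j A B" n ?h] h c x y by simp_all
  then show "app ?h n (pair A B n x y) = app u n x \<oplus>\<^bsub>Chain (tgt u) n\<^esub> app v n y"
    using app_add[OF h(1), of "app (i A B) n x" n "app (j A B) n y"] h x y by (simp add: pair_def)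
qed

lemma cop_eqI:
  assumes u: "u \<in> Arr W" "src u = cop A B" and v: "v \<in> Arr W" "src v = cop A B" and uv: "tgt u = tgt v"
    and eq: "\<And>n x y. x \<in> carrier (Chain A n) \<Longrightarrow> y \<in> carrier (Chain B n) \<Longrightarrow>
      app u n (pair A B n x y) = app v n (pair A B n x y)"
  shows "u = v"
proof (rule arr_eqI[OF u(1) v(1) _ uv])
  show "src u = src v" using u v by simp
  fix n p assume "p \<in> carrier (Chain (src u) n)"
  then have "p \<in> carrier (Chain (cop A B) n)" using u by simp
  then show "app u n p = app v n p" by (rule pair_cases) (simp add: eq)
qed

end

definition sum_map where
  "sum_map a b = copair W (i (src a) (src b)) (j (src a) (src b)) (i (tgt a) (tgt b) \<cdot>\<^bsub>W\<^esub> a) (j (tgt a) (tgt b) \<cdot>\<^bsub>W\<^esub> b)"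

lemma sum_map:
  assumes a: "a \<in> Arr W" and b: "b \<in> Arr W"
  shows "sum_map a b \<in> Arr W" "src (sum_map a b) = cop (src a) (src b)" "tgt (sum_map a b) = cop (tgt a) (tgt b)"
    "sum_map a b \<cdot>\<^bsub>W\<^esub> i (src a) (src b) = i (tgt a) (tgt b) \<cdot>\<^bsub>W\<^esub> a"
    "sum_map a b \<cdot>\<^bsub>W\<^esub> j (src a) (src b) = j (tgt a) (tgt b) \<cdot>\<^bsub>W\<^esub> b"
    "x \<in> carrier (Chain (src a) n) \<Longrightarrow> y \<in> carrier (Chain (src b) n) \<Longrightarrow>
      app (sum_map a b) n (pair (src a) (src b) n x y) = pair (tgt a) (tgt b) n (app a n x) (app b n y)"
proof -
  note O = Arr_Ob[OF a] Arr_Ob[OF b]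
  note c = cop_arr[OF O(2,4)]
  let ?u = "i (tgt a) (tgt b) \<cdot>\<^bsub>W\<^esub> a" and ?v = "j (tgt a) (tgt b) \<cdot>\<^bsub>W\<^esub> b"
  have u: "?u \<in> Arr W" "src ?u = src a" and v: "?v \<in> Arr W" "src ?v = src b" and uv: "tgt ?u = tgt ?v"
    and t: "tgt ?u = cop (tgt a) (tgt b)"
    using a b c by simp_all
  note h = copair[OF O(1,3) u v uv, folded sum_map_def]
  show "sum_map a b \<in> Arr W" "src (sum_map a b) = cop (src a) (src b)" "tgt (sum_map a b) = cop (tgt a) (tgt b)"
    "sum_map a b \<cdot>\<^bsub>W\<^esub> i (src a) (src b) = ?u" "sum_map a b \<cdot>\<^bsub>W\<^esub> j (src a) (src b) = ?v"
    using h(1-5) t by simp_all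
  show "x \<in> carrier (Chain (src a) n) \<Longrightarrow> y \<in> carrier (Chain (src b) n) \<Longrightarrow>
      app (sum_map a b) n (pair (src a) (src b) n x y) = pair (tgt a) (tgt b) n (app a n x) (app b n y)"
    using h(6)[of x n y] t by (simp add: pair_def)
qed

text \<open>Gluing over the zero complex.\<close>

lemma sum_map_Weq:
  assumes a: "a \<in> Weq W" and b: "b \<in> Weq W" shows "sum_map a b \<in> Weq W"
proof -
  note A = weq_arr[OF a] weq_arr[OF b]
  note O = Arr_Ob[OF A(1)] Arr_Ob[OF A(2)]
  note s = sum_map[OF A] and c = cop_arr[OF O(1,3)] cop_arr[OF O(2,4)]
  let ?O = "zero_complex :: ('a, 'u) module_complex"
  have "is_iso_arrow W (Idn W ?O)"
    unfolding is_iso_arrow_def using arr_idn_comp[of "Idn W ?O"]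
    by (intro conjI bexI[of _ "Idn W ?O"]) (simp_all add: Hom_iff)
  then have "Idn W ?O \<in> Weq W" by (rule iso_Weq)
  moreover have "a \<cdot>\<^bsub>W\<^esub> zero_arr ?O (src a) = zero_arr ?O (tgt a) \<cdot>\<^bsub>W\<^esub> Idn W ?O"
    by (rule from_zero_eq) (use A in simp_all)
  ultimately show ?thesis
    using a b s c
    by - (rule gluing[OF zero_arr_Cof[OF O(1)] zero_arr_Cof[OF O(2)] cop_square[OF O(1,3)] cop_square[OF O(2,4)],
          where a = "Idn W ?O" and b = a and c = b]; simp)
qed

text \<open>Elementwise pushouts are cokernels, and a direct sum of cokernels is a cokernel of the direct sum.\<close>

lemma sum_map_square:
  assumes E: "exact_square a c p r" and F: "exact_square b d q s"
  shows "exact_square (sum_map a b) (sum_map c d) (sum_map p q) (sum_map r s)"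
proof -
  note EA = exact_squareD(1-4)[OF E] and Es = exact_squareD(5-8)[OF E]
    and FA = exact_squareD(1-4)[OF F] and Fs = exact_squareD(5-8)[OF F]
  note ab = sum_map[OF EA(1) FA(1)] and cd = sum_map[OF EA(2) FA(2)] and pq = sum_map[OF EA(3) FA(3)]
    and rs = sum_map[OF EA(4) FA(4)]
  interpret E: raw_pushout R "src a" "app a" "tgt a" "app c" "tgt c" "app p" "tgt p" "app r"
    by (rule exact_squareD(9)[OF E])
  interpret F: raw_pushout R "src b" "app b" "tgt b" "app d" "tgt d" "app q" "tgt q" "app s"
    by (rule exact_squareD(9)[OF F])
  note O = Arr_Ob[OF EA(1)] Arr_Ob[OF FA(1)] Arr_Ob[OF EA(2)] Arr_Ob[OF FA(2)] Arr_Ob[OF EA(3)] Arr_Ob[OF FA(3)]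
  have ab_app: "x \<in> carrier (Chain (src a) n) \<Longrightarrow> z \<in> carrier (Chain (src b) n) \<Longrightarrow>
      app (sum_map a b) n (pair (src a) (src b) n x z) = pair (tgt a) (tgt b) n (app a n x) (app b n z)"
    and cd_app: "x \<in> carrier (Chain (src a) n) \<Longrightarrow> z \<in> carrier (Chain (src b) n) \<Longrightarrow>
      app (sum_map c d) n (pair (src a) (src b) n x z) = pair (tgt c) (tgt d) n (app c n x) (app d n z)"
    and pq_app: "x' \<in> carrier (Chain (tgt a) n) \<Longrightarrow> z' \<in> carrier (Chain (tgt b) n) \<Longrightarrow>
      app (sum_map p q) n (pair (tgt a) (tgt b) n x' z') = pair (tgt p) (tgt q) n (app p n x') (app q n z')"
    and rs_app: "x'' \<in> carrier (Chain (tgt c) n) \<Longrightarrow> z'' \<in> carrier (Chain (tgt d) n) \<Longrightarrow>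
      app (sum_map r s) n (pair (tgt c) (tgt d) n x'' z'') = pair (tgt p) (tgt q) n (app r n x'') (app s n z'')"
    for x z x' z' x'' z'' n
    using ab(6) cd(6) pq(6) rs(6) Es Fs by simp_all
  have ends: "src (sum_map a b) = cop (src a) (src b)" "tgt (sum_map a b) = cop (tgt a) (tgt b)"
    "src (sum_map c d) = cop (src a) (src b)" "tgt (sum_map c d) = cop (tgt c) (tgt d)"
    "src (sum_map p q) = cop (tgt a) (tgt b)" "tgt (sum_map p q) = cop (tgt p) (tgt q)"
    "src (sum_map r s) = cop (tgt c) (tgt d)" "tgt (sum_map r s) = cop (tgt p) (tgt q)"
    using ab cd pq rs Es Fs by simp_all
  show ?thesis
  proof (rule exact_squareI[OF ab(1) cd(1) pq(1) rs(1)], unfold ends)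
    show "sum_map p q \<cdot>\<^bsub>W\<^esub> sum_map a b = sum_map r s \<cdot>\<^bsub>W\<^esub> sum_map c d"
      by (rule cop_eqI[OF O(1,3)]) (use ends ab(1) cd(1) pq(1) rs(1) in
        \<open>simp_all add: pair_in[OF O(1,3)] ab_app cd_app pq_app rs_app E.comm F.comm\<close>)
  next
    fix n w assume "w \<in> carrier (Chain (cop (tgt p) (tgt q)) n)"
    then obtain u v where uv: "u \<in> carrier (Chain (tgt p) n)" "v \<in> carrier (Chain (tgt q) n)"
      and w: "w = pair (tgt p) (tgt q) n u v" by (rule pair_cases[OF O(10,12)])
    from E.gen[OF uv(1)] obtain x x' where x: "x \<in> carrier (Chain (tgt a) n)" "x' \<in> carrier (Chain (tgt c) n)"
      "u = app p n x \<oplus>\<^bsub>Chain (tgt p) n\<^esub> app r n x'" by blast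
    from F.gen[OF uv(2)] obtain z z' where z: "z \<in> carrier (Chain (tgt b) n)" "z' \<in> carrier (Chain (tgt d) n)"
      "v = app q n z \<oplus>\<^bsub>Chain (tgt q) n\<^esub> app s n z'" by blast
    have "w = app (sum_map p q) n (pair (tgt a) (tgt b) n x z) \<oplus>\<^bsub>Chain (cop (tgt p) (tgt q)) n\<^esub>
        app (sum_map r s) n (pair (tgt c) (tgt d) n x' z')"
      using x z by (simp add: w pq_app rs_app pair_add[OF O(10,12)])
    then show "\<exists>x\<in>carrier (Chain (cop (tgt a) (tgt b)) n). \<exists>y\<in>carrier (Chain (cop (tgt c) (tgt d)) n).
        w = app (sum_map p q) n x \<oplus>\<^bsub>Chain (cop (tgt p) (tgt q)) n\<^esub> app (sum_map r s) n y"
      using pair_in[OF O(2,4) x(1) z(1)] pair_in[OF O(6,8) x(2) z(2)] by blast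
  next
    fix n s1 s2 assume s1: "s1 \<in> carrier (Chain (cop (tgt a) (tgt b)) n)"
      and s2: "s2 \<in> carrier (Chain (cop (tgt c) (tgt d)) n)"
      and eq: "app (sum_map p q) n s1 \<oplus>\<^bsub>Chain (cop (tgt p) (tgt q)) n\<^esub> app (sum_map r s) n s2 =
        \<zero>\<^bsub>Chain (cop (tgt p) (tgt q)) n\<^esub>"
    obtain x z where xz: "x \<in> carrier (Chain (tgt a) n)" "z \<in> carrier (Chain (tgt b) n)"
      and s1_eq: "s1 = pair (tgt a) (tgt b) n x z" using s1 by (rule pair_cases[OF O(2,4)])
    obtain x' z' where xz': "x' \<in> carrier (Chain (tgt c) n)" "z' \<in> carrier (Chain (tgt d) n)"
      and s2_eq: "s2 = pair (tgt c) (tgt d) n x' z'" using s2 by (rule pair_cases[OF O(6,8)])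
    have "app p n x \<oplus>\<^bsub>Chain (tgt p) n\<^esub> app r n x' = \<zero>\<^bsub>Chain (tgt p) n\<^esub> \<and>
        app q n z \<oplus>\<^bsub>Chain (tgt q) n\<^esub> app s n z' = \<zero>\<^bsub>Chain (tgt q) n\<^esub>"
      by (rule pair_zeroD[OF O(10,12)])
        (use xz xz' eq in \<open>simp_all add: s1_eq s2_eq pq_app rs_app pair_add[OF O(10,12)]\<close>)
    then obtain \<alpha> \<beta> where ab': "\<alpha> \<in> carrier (Chain (src a) n)" "x = app a n \<alpha>" "x' = \<ominus>\<^bsub>Chain (tgt c) n\<^esub> app c n \<alpha>"
      "\<beta> \<in> carrier (Chain (src b) n)" "z = app b n \<beta>" "z' = \<ominus>\<^bsub>Chain (tgt d) n\<^esub> app d n \<beta>"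
      using E.rel[OF xz(1) xz'(1)] F.rel[OF xz(2) xz'(2)] by blast
    then have "s1 = app (sum_map a b) n (pair (src a) (src b) n \<alpha> \<beta>)"
      "s2 = \<ominus>\<^bsub>Chain (cop (tgt c) (tgt d)) n\<^esub> app (sum_map c d) n (pair (src a) (src b) n \<alpha> \<beta>)"
      by (simp_all add: s1_eq s2_eq ab_app cd_app pair_neg[OF O(6,8)])
    then show "\<exists>t\<in>carrier (Chain (cop (src a) (src b)) n). s1 = app (sum_map a b) n t \<and>
        s2 = \<ominus>\<^bsub>Chain (cop (tgt c) (tgt d)) n\<^esub> app (sum_map c d) n t"
      using pair_in[OF O(1,3) ab'(1,4)] by blast
  qed (rule refl)+
qed

end

section \<open>The inclusions of both ends of the mapping cylinder\<close>

context cylinder_copy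
begin

lemma T_neg:
  assumes "x \<in> carrier (Chain C n)" "y \<in> carrier (Chain C (n - 1))" "z \<in> carrier (Chain D n)"
  shows "e (\<ominus>\<^bsub>Chain C n\<^esub> x, \<ominus>\<^bsub>Chain C (n - 1)\<^esub> y, \<ominus>\<^bsub>Chain D n\<^esub> z) = \<ominus>\<^bsub>Chain T n\<^esub> e (x, y, z)"
proof -
  interpret T: module R "Chain T n" by (rule T_module)
  show ?thesis
    by (rule T.minus_equality[symmetric])
      (use assms in \<open>simp_all add: T_add T_in T_zero f.C.M.l_neg f.D.M.l_neg\<close>)
qed

end

lemma (in abel_cat) F1_CofI:
  assumes "(f, a, b, g) \<in> Arr (F1_category W)" "a \<in> Cof W" "is_pushout W f a i j" "h \<in> Hom W (tgt i) (tgt g)"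
    "h \<cdot>\<^bsub>W\<^esub> i = b" "h \<cdot>\<^bsub>W\<^esub> j = g" "h \<in> Cof W"
  shows "(f, a, b, g) \<in> Cof (F1_category W)"
proof -
  have "\<exists>i j h. is_pushout W f a i j \<and> h \<in> Hom W (Cod W i) (Cod W g) \<and> h \<cdot>\<^bsub>W\<^esub> i = b \<and> h \<cdot>\<^bsub>W\<^esub> j = g \<and> h \<in> Cof W"
    unfolding W_simps using assms(3-7) by blast
  with assms(1,2) show ?thesis by (simp add: F1_category_def del: W_simps)
qed

locale cylinder_inclusions = cylinder_model R enc T e + coproduct_choice R enc i j
  for R :: "('a, 'r) ring_scheme" (structure) and enc :: "'u \<times> 'u \<times> 'u \<Rightarrow> 'u" and T e i j
begin

definition incl where
  "incl f = copair W (i (src f) (tgt f)) (j (src f) (tgt f)) (front_incl T f) (back_incl T f)"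

text \<open>The functor from arrows to cofibrations that Cyl 1 is about, on morphisms.\<close>

abbreviation cyl_arrow where
  "cyl_arrow \<equiv> (\<lambda>(f, a, b, g). (incl f, sum_map a b, Cyl_map T (f, a, b, g), incl g))"

lemma incl:
  assumes f: "f \<in> Arr W"
  shows "incl f \<in> Arr W" "src (incl f) = cop (src f) (tgt f)" "tgt (incl f) = Cyl T f"
    "x \<in> carrier (Chain (src f) n) \<Longrightarrow> z \<in> carrier (Chain (tgt f) n) \<Longrightarrow>
      app (incl f) n (pair (src f) (tgt f) n x z) = e f (x, \<zero>\<^bsub>Chain (src f) (n - 1)\<^esub>, z)"
proof -
  interpret f: cmap R "src f" "app f" "tgt f" by (rule Arr_cmap[OF f])
  have ends: "src (front_incl T f) = src f" "tgt (front_incl T f) = Cyl T f" "src (back_incl T f) = tgt f"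
    "tgt (front_incl T f) = tgt (back_incl T f)"
    using front_ends[OF f] back_ends[OF f] by simp_all
  note h = copair[OF Arr_Ob[OF f] front_Arr[OF f] ends(1) back_Arr[OF f] ends(3,4), folded incl_def]
  show "incl f \<in> Arr W" "src (incl f) = cop (src f) (tgt f)" "tgt (incl f) = Cyl T f"
    using h(1-3) ends by simp_all
  show "x \<in> carrier (Chain (src f) n) \<Longrightarrow> z \<in> carrier (Chain (tgt f) n) \<Longrightarrow>
      app (incl f) n (pair (src f) (tgt f) n x z) = e f (x, \<zero>\<^bsub>Chain (src f) (n - 1)\<^esub>, z)"
    using h(6)[of x n z] ends by (simp add: front_app[OF f] back_app[OF f] Cyl_add[OF f])
qed

text \<open>The element \<open>(x, z)\<close> goes to \<open>(x, 0, z)\<close>.\<close>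

lemma incl_Cof:
  assumes f: "f \<in> Arr W" shows "incl f \<in> Cof W"
  unfolding Cof_iff_kernel
proof (intro conjI allI ballI impI)
  interpret f: cmap R "src f" "app f" "tgt f" by (rule Arr_cmap[OF f])
  fix n p assume "p \<in> carrier (Chain (src (incl f)) n)" and 0: "app (incl f) n p = \<zero>\<^bsub>Chain (tgt (incl f)) n\<^esub>"
  then have "p \<in> carrier (Chain (cop (src f) (tgt f)) n)" by (simp add: incl[OF f])
  then obtain x z where xz: "x \<in> carrier (Chain (src f) n)" "z \<in> carrier (Chain (tgt f) n)"
    and p: "p = pair (src f) (tgt f) n x z" by (rule pair_cases[OF Arr_Ob[OF f]])
  have "x = \<zero>\<^bsub>Chain (src f) n\<^esub> \<and> \<zero>\<^bsub>Chain (src f) (n - 1)\<^esub> = \<zero>\<^bsub>Chain (src f) (n - 1)\<^esub> \<and> z = \<zero>\<^bsub>Chain (tgt f) n\<^esub>"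
    by (rule Cyl_zeroD[OF f xz(1) f.C.M.zero_closed xz(2)]) (use 0 xz in \<open>simp add: p incl[OF f]\<close>)
  then show "p = \<zero>\<^bsub>Chain (src (incl f)) n\<^esub>"
    by (simp add: p incl[OF f] pair_zero[OF Arr_Ob[OF f]])
qed (rule incl(1)[OF f])

lemma cyl_arrow_Arr:
  assumes F: "(f, a, b, g) \<in> Arr (arrow_category W)"
  shows "cyl_arrow (f, a, b, g) \<in> Arr (F1_category W)"
proof -
  from F have f: "f \<in> Arr W" and g: "g \<in> Arr W" and ab: "a \<in> Arr W" "b \<in> Arr W"
    and s: "src a = src f" "tgt a = src g" "src b = tgt f" "tgt b = tgt g"
    by (simp_all add: arrow_category_Arr)
  interpret f: cmap R "src f" "app f" "tgt f" by (rule Arr_cmap[OF f])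
  note S = sum_map[OF ab, unfolded s] and m = map_Arr[OF F] map_ends[OF F] and If = incl[OF f] and Ig = incl[OF g]
  have c: "x \<in> carrier (Chain (src f) n) \<Longrightarrow> app a n x \<in> carrier (Chain (src g) n)"
    "z \<in> carrier (Chain (tgt f) n) \<Longrightarrow> app b n z \<in> carrier (Chain (tgt g) n)"
    "app a n \<zero>\<^bsub>Chain (src f) n\<^esub> = \<zero>\<^bsub>Chain (src g) n\<^esub>" for n x z
    using app_closed[OF ab(1), of x n] app_closed[OF ab(2), of z n] app_zero[OF ab(1), of n] s by simp_all
  have "Cyl_map T (f, a, b, g) \<cdot>\<^bsub>W\<^esub> incl f = incl g \<cdot>\<^bsub>W\<^esub> sum_map a b"
    by (rule cop_eqI[OF Arr_Ob[OF f]])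
      (use S(1-3) m If(1-3) Ig(1-3) in \<open>simp_all add: pair_in[OF Arr_Ob[OF f]] If(4) Ig(4) S(6) c map_app[OF F]\<close>)
  then show ?thesis
    using S(1-3) m If(1-3) Ig(1-3) incl_Cof[OF f] incl_Cof[OF g] by (simp add: arrow_category_Arr)
qed

lemma cyl_arrow_functor: "is_functor (arrow_category W) (F1_category W) incl cyl_arrow"
  unfolding is_functor_def
proof (intro conjI ballI impI)
  fix f assume "f \<in> Ob (arrow_category W)"
  then have f: "f \<in> Arr W" by simp
  then show "incl f \<in> Ob (F1_category W)" by (simp add: incl_Cof)
  note O = Arr_Ob[OF f]
  note S = sum_map[OF arr_idn[OF O(1)] arr_idn[OF O(2)], unfolded Idn_simps]
  have "sum_map (Idn W (src f)) (Idn W (tgt f)) = Idn W (cop (src f) (tgt f))"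
    by (rule cop_eqI[OF O]) (use S O in \<open>simp_all add: pair_in\<close>)
  moreover have "Cyl_map T (f, Idn W (src f), Idn W (tgt f), f) = Idn W (Cyl T f)"
    using cylinder_functor_arrows f by (simp add: is_functor_def)
  ultimately show "cyl_arrow (Idn (arrow_category W) f) = Idn (F1_category W) (incl f)"
    using incl[OF f] by simp
next
  fix F assume F: "F \<in> Arr (arrow_category W)"
  obtain f a b g where F_eq: "F = (f, a, b, g)" by (cases F)
  note F' = F[unfolded F_eq]
  show "cyl_arrow F \<in> Hom (F1_category W) (incl (Dom (arrow_category W) F)) (incl (Cod (arrow_category W) F))"
    using cyl_arrow_Arr[OF F'] by (simp add: F_eq F1_Hom)
  fix G assume G: "G \<in> Arr (arrow_category W)" and FG: "Cod (arrow_category W) F = Dom (arrow_category W) G"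
  then obtain c d h where G_eq: "G = (g, c, d, h)" by (cases G) (auto simp: F_eq)
  note G' = G[unfolded G_eq]
  from F' G' have A: "f \<in> Arr W" "a \<in> Arr W" "b \<in> Arr W" "c \<in> Arr W" "d \<in> Arr W"
    and s: "src a = src f" "tgt a = src g" "src b = tgt f" "tgt b = tgt g" "src c = src g" "src d = tgt g"
    by (simp_all add: arrow_category_Arr)
  have ca: "c \<cdot>\<^bsub>W\<^esub> a \<in> Arr W" and db: "d \<cdot>\<^bsub>W\<^esub> b \<in> Arr W" using A s by simp_all
  note S = sum_map[OF A(2,3)] sum_map[OF A(4,5)] sum_map[OF ca db]
  have m: "x \<in> carrier (Chain (src f) n) \<Longrightarrow> app a n x \<in> carrier (Chain (src g) n)"
    "z \<in> carrier (Chain (tgt f) n) \<Longrightarrow> app b n z \<in> carrier (Chain (tgt g) n)" for n x z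
    using app_closed[OF A(2), of x n] app_closed[OF A(3), of z n] s by simp_all
  have S_app: "x \<in> carrier (Chain (src f) n) \<Longrightarrow> z \<in> carrier (Chain (tgt f) n) \<Longrightarrow>
      app (sum_map a b) n (pair (src f) (tgt f) n x z) = pair (src g) (tgt g) n (app a n x) (app b n z)"
    "x' \<in> carrier (Chain (src g) n) \<Longrightarrow> z' \<in> carrier (Chain (tgt g) n) \<Longrightarrow>
      app (sum_map c d) n (pair (src g) (tgt g) n x' z') = pair (tgt c) (tgt d) n (app c n x') (app d n z')"
    "x \<in> carrier (Chain (src f) n) \<Longrightarrow> z \<in> carrier (Chain (tgt f) n) \<Longrightarrow>
      app (sum_map (c \<cdot>\<^bsub>W\<^esub> a) (d \<cdot>\<^bsub>W\<^esub> b)) n (pair (src f) (tgt f) n x z) =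
        pair (tgt c) (tgt d) n (app c n (app a n x)) (app d n (app b n z))" for x z x' z' n
    using S(6)[of x n z] S(12)[of x' n z'] S(18)[of x n z] s by simp_all
  have "sum_map (c \<cdot>\<^bsub>W\<^esub> a) (d \<cdot>\<^bsub>W\<^esub> b) = sum_map c d \<cdot>\<^bsub>W\<^esub> sum_map a b"
    by (rule cop_eqI[OF Arr_Ob[OF A(1)]])
      (use S(1-3,7-9,13-15) s in \<open>simp_all add: pair_in[OF Arr_Ob[OF A(1)]] S_app m\<close>)
  moreover have "Cyl_map T (G \<cdot>\<^bsub>arrow_category W\<^esub> F) = Cyl_map T G \<cdot>\<^bsub>W\<^esub> Cyl_map T F"
    using cylinder_functor_arrows F G FG unfolding is_functor_def by blast
  ultimately show "cyl_arrow (G \<cdot>\<^bsub>arrow_category W\<^esub> F) = cyl_arrow G \<cdot>\<^bsub>F1_category W\<^esub> cyl_arrow F"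
    by (simp add: F_eq G_eq)
qed

text \<open>Both \<open>0 \<or> 0\<close> and \<open>T(0 \<rightarrow> 0)\<close> have zero as their only element, and every such complex is a zero object.\<close>

lemma incl_zero_object: "is_zero_object (F1_category W) (incl (Idn W zero_complex))"
proof -
  let ?O = "zero_complex :: ('a, 'u) module_complex"
  let ?f = "Idn W ?O"
  have f: "?f \<in> Arr W" by simp
  have ends: "src ?f = ?O" "tgt ?f = ?O" by simp_all
  note I = incl[OF f, unfolded ends]
  have O: "carrier (Chain ?O n) = {\<zero>\<^bsub>Chain ?O n\<^esub>}" for n by simp
  have "carrier (Chain (cop ?O ?O) n) \<subseteq> {\<zero>\<^bsub>Chain (cop ?O ?O) n\<^esub>}" for n
  proof
    fix p assume "p \<in> carrier (Chain (cop ?O ?O) n)"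
    then obtain x y where "x \<in> carrier (Chain ?O n)" "y \<in> carrier (Chain ?O n)" "p = pair ?O ?O n x y"
      by (rule pair_cases[OF zero_Ob zero_Ob])
    then show "p \<in> {\<zero>\<^bsub>Chain (cop ?O ?O) n\<^esub>}"
      using O[of n] pair_zero[OF zero_Ob zero_Ob, of n] by simp
  qed
  moreover have "\<zero>\<^bsub>Chain (cop ?O ?O) n\<^esub> \<in> carrier (Chain (cop ?O ?O) n)" for n
    using pair_in[OF zero_Ob zero_Ob, of _ n] pair_zero[OF zero_Ob zero_Ob, of n] O[of n] by (metis singletonI)
  ultimately have "carrier (Chain (cop ?O ?O) n) = {\<zero>\<^bsub>Chain (cop ?O ?O) n\<^esub>}" for n by blast
  then have 1: "is_zero_object W (cop ?O ?O)" by (intro trivial_zero_object cop_Ob zero_Ob)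
  interpret K: cylinder_copy R "src ?f" "app ?f" "tgt ?f" "Cyl T ?f" "e ?f" by (rule copy[OF f])
  have "carrier (Chain (Cyl T ?f) n) = {\<zero>\<^bsub>Chain (Cyl T ?f) n\<^esub>}" for n
    unfolding K.T_carrier K.T_zero ends O[of n] O[of "n - 1"] by simp
  then have 2: "is_zero_object W (Cyl T ?f)" by (intro trivial_zero_object Cyl_Ob f)
  show ?thesis
    by (rule F1_zero_object[OF incl_Cof[OF f]]) (use 1 2 I in simp_all)
qed

text \<open>The induced map of cylinders is compared with \<open>b\<close> along the projections, which are weak equivalences.\<close>

lemma cyl_arrow_Weq:
  assumes F: "(f, a, b, g) \<in> Arr (arrow_category W)" and a: "a \<in> Weq W" and b: "b \<in> Weq W"
  shows "sum_map a b \<in> Weq W" "Cyl_map T (f, a, b, g) \<in> Weq W"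
proof -
  show "sum_map a b \<in> Weq W" by (rule sum_map_Weq[OF a b])
  from F have f: "f \<in> Arr W" and g: "g \<in> Arr W" and s: "src b = tgt f" "tgt b = tgt g"
    by (simp_all add: arrow_category_Arr)
  have "b \<cdot>\<^bsub>W\<^esub> proj T f \<in> Weq W"
    by (rule Weq_Comp[OF proj_Weq[OF f] b]) (use proj_ends[OF f] s in simp)
  then have "proj T g \<cdot>\<^bsub>W\<^esub> Cyl_map T (f, a, b, g) \<in> Weq W" by (simp only: map_proj[OF F])
  moreover have "Cod W (Cyl_map T (f, a, b, g)) = Dom W (proj T g)"
    using map_ends[OF F] proj_ends[OF g] by simp
  ultimately show "Cyl_map T (f, a, b, g) \<in> Weq W"
    using saturation map_Arr[OF F] proj_Arr[OF g] proj_Weq[OF g] unfolding saturation_axiom_def by blast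
qed

text \<open>The map from the pushout of \<open>T(f)\<close> and \<open>src g \<or> tgt g\<close> over \<open>src f \<or> tgt f\<close> to \<open>T(g)\<close> sends the class of \<open>(x, y, z)\<close>
  and \<open>(u, v)\<close> to \<open>(a x + u, a y, b z + v)\<close>. If this vanishes, then \<open>y = 0\<close> as \<open>a\<close> is injective, \<open>(x, 0, z)\<close> comes from
  \<open>(x, z)\<close>, and \<open>(u, v)\<close> is the negative of the image of \<open>(x, z)\<close>; so the class is zero.\<close>

lemma cyl_arrow_Cof:
  assumes F: "(f, a, b, g) \<in> Arr (arrow_category W)" and a: "a \<in> Cof W" and b: "b \<in> Cof W"
  shows "cyl_arrow (f, a, b, g) \<in> Cof (F1_category W)"
proof -
  from F have f: "f \<in> Arr W" and g: "g \<in> Arr W" and ab: "a \<in> Arr W" "b \<in> Arr W"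
    and s: "src a = src f" "tgt a = src g" "src b = tgt f" "tgt b = tgt g"
    by (simp_all add: arrow_category_Arr)
  note Of = Arr_Ob[OF f] and Og = Arr_Ob[OF g]
  note S = sum_map[OF ab, unfolded s] and m = map_Arr[OF F] map_ends[OF F] and If = incl[OF f] and Ig = incl[OF g]
  have cab: "cmap R (src f) (app a) (src g)" "cmap R (tgt f) (app b) (tgt g)"
    using Arr_cmap[OF ab(1)] Arr_cmap[OF ab(2)] s by simp_all
  interpret a: cmap R "src f" "app a" "src g" by (rule cab)
  interpret b: cmap R "tgt f" "app b" "tgt g" by (rule cab)
  let ?M = "Cyl_map T (f, a, b, g)"
  have sq: "?M \<cdot>\<^bsub>W\<^esub> incl f = incl g \<cdot>\<^bsub>W\<^esub> sum_map a b"
    using cyl_arrow_Arr[OF F] by (simp add: arrow_category_Arr)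
  have sum_Cof: "sum_map a b \<in> Cof W"
    unfolding Cof_iff_kernel
  proof (intro conjI allI ballI impI)
    fix n p assume "p \<in> carrier (Chain (src (sum_map a b)) n)"
      and 0: "app (sum_map a b) n p = \<zero>\<^bsub>Chain (tgt (sum_map a b)) n\<^esub>"
    then have "p \<in> carrier (Chain (cop (src f) (tgt f)) n)" by (simp add: S)
    then obtain x z where xz: "x \<in> carrier (Chain (src f) n)" "z \<in> carrier (Chain (tgt f) n)"
      and p: "p = pair (src f) (tgt f) n x z" by (rule pair_cases[OF Of])
    have "app a n x = \<zero>\<^bsub>Chain (src g) n\<^esub> \<and> app b n z = \<zero>\<^bsub>Chain (tgt g) n\<^esub>"
      by (rule pair_zeroD[OF Og]) (use 0 xz in \<open>simp_all add: p S\<close>)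
    then have "x = \<zero>\<^bsub>Chain (src f) n\<^esub>" "z = \<zero>\<^bsub>Chain (tgt f) n\<^esub>"
      using CofD[OF a, of x n] CofD[OF b, of z n] xz s by simp_all
    then show "p = \<zero>\<^bsub>Chain (src (sum_map a b)) n\<^esub>" by (simp add: p S pair_zero[OF Of])
  qed (rule S(1))
  have "src (incl f) = src (sum_map a b)" using If S by simp
  then obtain I J where E: "exact_square (incl f) (sum_map a b) I J"
    by (rule exact_square_exists[OF incl_Cof[OF f] S(1)])
  note EA = exact_squareD(1-4)[OF E] and Es = exact_squareD(5-8)[OF E]
  interpret E: raw_pushout R "src (incl f)" "app (incl f)" "tgt (incl f)" "app (sum_map a b)" "tgt (sum_map a b)"
      "app I" "tgt I" "app J"
    by (rule exact_squareD(9)[OF E])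
  note po = exact_square_pushout[OF E]
  have "\<exists>!h. h \<in> Hom W (tgt I) (tgt ?M) \<and> h \<cdot>\<^bsub>W\<^esub> I = ?M \<and> h \<cdot>\<^bsub>W\<^esub> J = incl g"
    by (rule pushoutD(10)[OF po]) (use m If Ig S sq in simp_all)
  then obtain h where h: "h \<in> Hom W (tgt I) (tgt ?M)" "h \<cdot>\<^bsub>W\<^esub> I = ?M" "h \<cdot>\<^bsub>W\<^esub> J = incl g" by blast
  have h': "h \<in> Arr W" "src h = tgt I" "tgt h = Cyl T g" using h(1) m unfolding Hom_iff by simp_all
  have "h \<in> Cof W"
    unfolding Cof_iff_kernel
  proof (intro conjI allI ballI impI h')
    fix n w assume "w \<in> carrier (Chain (src h) n)" and 0: "app h n w = \<zero>\<^bsub>Chain (tgt h) n\<^esub>"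
    then have "w \<in> carrier (Chain (tgt I) n)" using h' by simp
    from E.gen[OF this] obtain s t where "s \<in> carrier (Chain (tgt (incl f)) n)"
      "t \<in> carrier (Chain (tgt (sum_map a b)) n)" and w: "w = app I n s \<oplus>\<^bsub>Chain (tgt I) n\<^esub> app J n t" by blast
    then have s: "s \<in> carrier (Chain (Cyl T f) n)" and t: "t \<in> carrier (Chain (cop (src g) (tgt g)) n)"
      by (simp_all add: If S)
    obtain x y z where xyz: "x \<in> carrier (Chain (src f) n)" "y \<in> carrier (Chain (src f) (n - 1))"
      "z \<in> carrier (Chain (tgt f) n)" and s_eq: "s = e f (x, y, z)" using s by (rule Cyl_cases[OF f])
    obtain u v where uv: "u \<in> carrier (Chain (src g) n)" "v \<in> carrier (Chain (tgt g) n)"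
      and t_eq: "t = pair (src g) (tgt g) n u v" using t by (rule pair_cases[OF Og])
    have "app h n (app I n s) = app ?M n s" "app h n (app J n t) = app (incl g) n t"
      using app_Comp[of s I n h] app_Comp[of t J n h] h(2,3) s t Es If S by simp_all
    moreover have "app I n s \<in> carrier (Chain (tgt I) n)" "app J n t \<in> carrier (Chain (tgt I) n)"
      using s t If S by simp_all
    ultimately have "e g (app a n x \<oplus>\<^bsub>Chain (src g) n\<^esub> u, app a (n - 1) y, app b n z \<oplus>\<^bsub>Chain (tgt g) n\<^esub> v) =
        \<zero>\<^bsub>Chain (Cyl T g) n\<^esub>"
      using app_add[OF h'(1), of "app I n s" n "app J n t"] 0 h' xyz uv
      by (simp add: w s_eq t_eq map_app[OF F] Ig Cyl_add[OF g])
    then have *: "app a n x \<oplus>\<^bsub>Chain (src g) n\<^esub> u = \<zero>\<^bsub>Chain (src g) n\<^esub>"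
      "app a (n - 1) y = \<zero>\<^bsub>Chain (src g) (n - 1)\<^esub>" "app b n z \<oplus>\<^bsub>Chain (tgt g) n\<^esub> v = \<zero>\<^bsub>Chain (tgt g) n\<^esub>"
      using Cyl_zeroD[OF g, of "app a n x \<oplus>\<^bsub>Chain (src g) n\<^esub> u" n "app a (n - 1) y" "app b n z \<oplus>\<^bsub>Chain (tgt g) n\<^esub> v"] xyz uv
      by simp_all
    then have "y = \<zero>\<^bsub>Chain (src f) (n - 1)\<^esub>" using CofD[OF a, of y "n - 1"] xyz s by (simp add: \<open>src a = src f\<close> \<open>tgt a = src g\<close>)
    then have s_eq': "s = app (incl f) n (pair (src f) (tgt f) n x z)" using xyz by (simp add: s_eq If)
    have pxz: "pair (src f) (tgt f) n x z \<in> carrier (Chain (cop (src f) (tgt f)) n)"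
      using xyz by (simp add: pair_in[OF Of])
    have "app I n s = app J n (pair (src g) (tgt g) n (app a n x) (app b n z))"
      using E.comm[of "pair (src f) (tgt f) n x z" n] pxz xyz by (simp add: s_eq' If S)
    then have "w = app J n (pair (src g) (tgt g) n (app a n x) (app b n z) \<oplus>\<^bsub>Chain (cop (src g) (tgt g)) n\<^esub> t)"
      using E.j.f_add[of "pair (src g) (tgt g) n (app a n x) (app b n z)" n t] t xyz
      by (simp add: w S pair_in[OF Og])
    also have "pair (src g) (tgt g) n (app a n x) (app b n z) \<oplus>\<^bsub>Chain (cop (src g) (tgt g)) n\<^esub> t =
        \<zero>\<^bsub>Chain (cop (src g) (tgt g)) n\<^esub>"
      using xyz uv * by (simp add: t_eq pair_add[OF Og] pair_zero[OF Og])
    finally show "w = \<zero>\<^bsub>Chain (src h) n\<^esub>" using E.j.f_zero[of n] h' S by simp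
  qed
  moreover have "h \<in> Hom W (tgt I) (Cyl T g)" using h(1) m by simp
  ultimately show ?thesis
    unfolding split_conv using cyl_arrow_Arr[OF F] sum_Cof po h(2,3) Ig(3)
    by (intro F1_CofI[of _ _ _ _ I J h]) simp_all
qed

text \<open>In coordinates, the square is the sum of the square of the sources in degrees \<open>n\<close> and \<open>n - 1\<close> and that of the targets.\<close>

lemma Cyl_map_square:
  assumes F: "(f0, a, b, f1) \<in> Arr (arrow_category W)" and G: "(f0, c, d, f2) \<in> Arr (arrow_category W)"
    and I: "(f1, p, q, f3) \<in> Arr (arrow_category W)" and J: "(f2, r, s, f3) \<in> Arr (arrow_category W)"
    and E: "exact_square a c p r" and E': "exact_square b d q s"
  shows "exact_square (Cyl_map T (f0, a, b, f1)) (Cyl_map T (f0, c, d, f2))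
    (Cyl_map T (f1, p, q, f3)) (Cyl_map T (f2, r, s, f3))"
proof -
  have A: "f0 \<in> Arr W" "f1 \<in> Arr W" "f2 \<in> Arr W" "f3 \<in> Arr W"
    and ends: "src a = src f0" "tgt a = src f1" "src b = tgt f0" "tgt b = tgt f1"
      "tgt c = src f2" "tgt d = tgt f2" "tgt p = src f3" "tgt q = tgt f3"
    using F G I J unfolding arrow_category_Arr by blast+
  interpret E: raw_pushout R "src f0" "app a" "src f1" "app c" "src f2" "app p" "src f3" "app r"
    using exact_squareD(9)[OF E] ends by simp
  interpret E': raw_pushout R "tgt f0" "app b" "tgt f1" "app d" "tgt f2" "app q" "tgt f3" "app s"
    using exact_squareD(9)[OF E'] ends by simp
  note m = map_Arr[OF F] map_Arr[OF G] map_Arr[OF I] map_Arr[OF J] map_ends[OF F] map_ends[OF G] map_ends[OF I] map_ends[OF J]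
  have s: "src (Cyl_map T (f0, a, b, f1)) = Cyl T f0" "tgt (Cyl_map T (f0, a, b, f1)) = Cyl T f1"
    "src (Cyl_map T (f0, c, d, f2)) = Cyl T f0" "tgt (Cyl_map T (f0, c, d, f2)) = Cyl T f2"
    "src (Cyl_map T (f1, p, q, f3)) = Cyl T f1" "tgt (Cyl_map T (f1, p, q, f3)) = Cyl T f3"
    "src (Cyl_map T (f2, r, s, f3)) = Cyl T f2" "tgt (Cyl_map T (f2, r, s, f3)) = Cyl T f3"
    using m by simp_all
  show ?thesis
  proof (rule exact_squareI[OF m(1-4)], unfold s)
    show "Cyl_map T (f1, p, q, f3) \<cdot>\<^bsub>W\<^esub> Cyl_map T (f0, a, b, f1) = Cyl_map T (f2, r, s, f3) \<cdot>\<^bsub>W\<^esub> Cyl_map T (f0, c, d, f2)"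
      by (rule Cyl_eqI[OF A(1)]) (use m(1-4) s in \<open>simp_all add: Cyl_in[OF A(1)] map_app[OF F] map_app[OF G]
        map_app[OF I] map_app[OF J] E.comm E'.comm\<close>)
  next
    fix n w assume "w \<in> carrier (Chain (Cyl T f3) n)"
    then obtain x y z where xyz: "x \<in> carrier (Chain (src f3) n)" "y \<in> carrier (Chain (src f3) (n - 1))"
      "z \<in> carrier (Chain (tgt f3) n)" and w: "w = e f3 (x, y, z)" by (rule Cyl_cases[OF A(4)])
    from E.gen[OF xyz(1)] obtain x1 x2 where x: "x1 \<in> carrier (Chain (src f1) n)" "x2 \<in> carrier (Chain (src f2) n)"
      "x = app p n x1 \<oplus>\<^bsub>Chain (src f3) n\<^esub> app r n x2" by blast
    from E.gen[OF xyz(2)] obtain y1 y2 where y: "y1 \<in> carrier (Chain (src f1) (n - 1))"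
      "y2 \<in> carrier (Chain (src f2) (n - 1))"
      "y = app p (n - 1) y1 \<oplus>\<^bsub>Chain (src f3) (n - 1)\<^esub> app r (n - 1) y2" by blast
    from E'.gen[OF xyz(3)] obtain z1 z2 where z: "z1 \<in> carrier (Chain (tgt f1) n)" "z2 \<in> carrier (Chain (tgt f2) n)"
      "z = app q n z1 \<oplus>\<^bsub>Chain (tgt f3) n\<^esub> app s n z2" by blast
    have "w = app (Cyl_map T (f1, p, q, f3)) n (e f1 (x1, y1, z1)) \<oplus>\<^bsub>Chain (Cyl T f3) n\<^esub>
        app (Cyl_map T (f2, r, s, f3)) n (e f2 (x2, y2, z2))"
      using x y z by (simp add: w map_app[OF I] map_app[OF J] Cyl_add[OF A(4)])
    then show "\<exists>v1\<in>carrier (Chain (Cyl T f1) n). \<exists>v2\<in>carrier (Chain (Cyl T f2) n).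
        w = app (Cyl_map T (f1, p, q, f3)) n v1 \<oplus>\<^bsub>Chain (Cyl T f3) n\<^esub> app (Cyl_map T (f2, r, s, f3)) n v2"
      using Cyl_in[OF A(2) x(1) y(1) z(1)] Cyl_in[OF A(3) x(2) y(2) z(2)] by blast
  next
    fix n v1 v2 assume v1: "v1 \<in> carrier (Chain (Cyl T f1) n)" and v2: "v2 \<in> carrier (Chain (Cyl T f2) n)"
      and eq: "app (Cyl_map T (f1, p, q, f3)) n v1 \<oplus>\<^bsub>Chain (Cyl T f3) n\<^esub> app (Cyl_map T (f2, r, s, f3)) n v2 =
        \<zero>\<^bsub>Chain (Cyl T f3) n\<^esub>"
    obtain x1 y1 z1 where 1: "x1 \<in> carrier (Chain (src f1) n)" "y1 \<in> carrier (Chain (src f1) (n - 1))"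
      "z1 \<in> carrier (Chain (tgt f1) n)" and v1_eq: "v1 = e f1 (x1, y1, z1)" using v1 by (rule Cyl_cases[OF A(2)])
    obtain x2 y2 z2 where 2: "x2 \<in> carrier (Chain (src f2) n)" "y2 \<in> carrier (Chain (src f2) (n - 1))"
      "z2 \<in> carrier (Chain (tgt f2) n)" and v2_eq: "v2 = e f2 (x2, y2, z2)" using v2 by (rule Cyl_cases[OF A(3)])
    have "app p n x1 \<oplus>\<^bsub>Chain (src f3) n\<^esub> app r n x2 = \<zero>\<^bsub>Chain (src f3) n\<^esub> \<and>
        app p (n - 1) y1 \<oplus>\<^bsub>Chain (src f3) (n - 1)\<^esub> app r (n - 1) y2 = \<zero>\<^bsub>Chain (src f3) (n - 1)\<^esub> \<and>
        app q n z1 \<oplus>\<^bsub>Chain (tgt f3) n\<^esub> app s n z2 = \<zero>\<^bsub>Chain (tgt f3) n\<^esub>"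
      by (rule Cyl_zeroD[OF A(4)])
        (use eq 1 2 in \<open>simp_all add: v1_eq v2_eq map_app[OF I] map_app[OF J] Cyl_add[OF A(4)]\<close>)
    then obtain \<alpha> \<beta> \<gamma> where abc: "\<alpha> \<in> carrier (Chain (src f0) n)" "x1 = app a n \<alpha>" "x2 = \<ominus>\<^bsub>Chain (src f2) n\<^esub> app c n \<alpha>"
      "\<beta> \<in> carrier (Chain (src f0) (n - 1))" "y1 = app a (n - 1) \<beta>" "y2 = \<ominus>\<^bsub>Chain (src f2) (n - 1)\<^esub> app c (n - 1) \<beta>"
      "\<gamma> \<in> carrier (Chain (tgt f0) n)" "z1 = app b n \<gamma>" "z2 = \<ominus>\<^bsub>Chain (tgt f2) n\<^esub> app d n \<gamma>"
      using E.rel[OF 1(1) 2(1)] E.rel[OF 1(2) 2(2)] E'.rel[OF 1(3) 2(3)] by blast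
    then have "v1 = app (Cyl_map T (f0, a, b, f1)) n (e f0 (\<alpha>, \<beta>, \<gamma>))"
      "v2 = \<ominus>\<^bsub>Chain (Cyl T f2) n\<^esub> app (Cyl_map T (f0, c, d, f2)) n (e f0 (\<alpha>, \<beta>, \<gamma>))"
      by (simp_all add: v1_eq v2_eq map_app[OF F] map_app[OF G] cylinder_copy.T_neg[OF copy[OF A(3)]])
    then show "\<exists>v\<in>carrier (Chain (Cyl T f0) n). v1 = app (Cyl_map T (f0, a, b, f1)) n v \<and>
        v2 = \<ominus>\<^bsub>Chain (Cyl T f2) n\<^esub> app (Cyl_map T (f0, c, d, f2)) n v"
      using Cyl_in[OF A(1) abc(1,4,7)] by blast
  qed (rule refl)+
qed

theorem cyl_arrow_exact: "exact_functor (arrow_category W) (F1_category W) incl cyl_arrow"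
  unfolding exact_functor_def
proof (intro conjI allI impI cyl_arrow_functor)
  show "is_zero_object (F1_category W) (incl (Zero (arrow_category W)))"
    using incl_zero_object by (simp add: arrow_category_def)
  have *: "(f, a, b, g) \<in> Cof (arrow_category W) \<longleftrightarrow> (f, a, b, g) \<in> Arr (arrow_category W) \<and> a \<in> Cof W \<and> b \<in> Cof W"
    "(f, a, b, g) \<in> Weq (arrow_category W) \<longleftrightarrow> (f, a, b, g) \<in> Arr (arrow_category W) \<and> a \<in> Weq W \<and> b \<in> Weq W"
    for f a b g by (auto simp: arrow_category_def)
  show "cyl_arrow ` Cof (arrow_category W) \<subseteq> Cof (F1_category W)"
    using cyl_arrow_Cof by (auto simp: *)
  show "cyl_arrow ` Weq (arrow_category W) \<subseteq> Weq (F1_category W)"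
  proof (intro image_subsetI)
    fix F assume "F \<in> Weq (arrow_category W)"
    moreover obtain f a b g where F_eq: "F = (f, a, b, g)" by (cases F)
    ultimately have F: "(f, a, b, g) \<in> Arr (arrow_category W)" and w: "a \<in> Weq W" "b \<in> Weq W" by (simp_all add: *)
    have "F' \<in> Weq (F1_category W)" if "F' = (f, a, b, g)" "F' \<in> Arr (F1_category W)" "a \<in> Weq W" "b \<in> Weq W" for F' f a b g
      using that by (auto simp: F1_category_def *)
    then show "cyl_arrow F \<in> Weq (F1_category W)"
      using cyl_arrow_Arr[OF F] cyl_arrow_Weq[OF F w] by (simp only: F_eq split_conv)
  qed
  fix F G I J assume FG: "F \<in> Cof (arrow_category W) \<and> is_pushout (arrow_category W) F G I J"
  then obtain f0 a b f1 c d f2 p q f3 r s where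
    eq: "F = (f0, a, b, f1)" "G = (f0, c, d, f2)" "I = (f1, p, q, f3)" "J = (f2, r, s, f3)"
    and A: "(f0, a, b, f1) \<in> Arr (arrow_category W)" "(f0, c, d, f2) \<in> Arr (arrow_category W)"
      "(f1, p, q, f3) \<in> Arr (arrow_category W)" "(f2, r, s, f3) \<in> Arr (arrow_category W)"
    and po: "is_pushout W a c p r" "is_pushout W b d q s"
    using arrow_pushout_components by blast
  from FG eq have "a \<in> Cof W" "b \<in> Cof W" by (simp_all add: *)
  then have E: "exact_square a c p r" "exact_square b d q s" using po pushout_exact_square by blast+
  show "is_pushout (F1_category W) (cyl_arrow F) (cyl_arrow G) (cyl_arrow I) (cyl_arrow J)"
    unfolding eq split_conv
    by (rule F1_pushoutI[OF cyl_arrow_Arr[OF A(1), unfolded split_conv] cyl_arrow_Arr[OF A(2), unfolded split_conv]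
          cyl_arrow_Arr[OF A(3), unfolded split_conv] cyl_arrow_Arr[OF A(4), unfolded split_conv]
          exact_square_pushout[OF sum_map_square[OF E]] exact_square_pushout[OF Cyl_map_square[OF A E]]])
qed

end

theorem (in cylinder_model) Cyl1: "Cyl1 W T"
  unfolding Cyl1_def Let_def W_simps
proof (intro allI impI)
  fix i j :: "('a, 'u) module_complex \<Rightarrow> ('a, 'u) module_complex \<Rightarrow> ('a, 'u) chain_map"
  assume "\<forall>A\<in>Abel_complexes R. \<forall>B\<in>Abel_complexes R. is_coproduct W A B (i A B) (j A B)"
  then interpret cylinder_inclusions R enc T e i j by unfold_locales blast
  show "exact_functor (arrow_category W) (F1_category W)
      (\<lambda>f. copair W (i (src f) (tgt f)) (j (src f) (tgt f)) (front_incl T f) (back_incl T f))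
      (\<lambda>(f, a, b, g).
         (copair W (i (src f) (tgt f)) (j (src f) (tgt f)) (front_incl T f) (back_incl T f),
          copair W (i (src a) (src b)) (j (src a) (src b)) (i (tgt a) (tgt b) \<cdot>\<^bsub>W\<^esub> a) (j (tgt a) (tgt b) \<cdot>\<^bsub>W\<^esub> b),
          Cyl_map T (f, a, b, g),
          copair W (i (src g) (tgt g)) (j (src g) (tgt g)) (front_incl T g) (back_incl T g)))"
    using cyl_arrow_exact unfolding incl_def sum_map_def .
qed

section \<open>The usual mapping cylinder and its normalization\<close>

context abel_cat
begin

lemma arr_extensional: "f \<in> Arr W \<Longrightarrow> app f n \<in> extensional (carrier (Chain (src f) n))"
  using cmap.chain_map[OF Arr_cmap[of f]] by (simp add: is_chain_map_def)

lemma cylinder_complex_copy: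
  assumes f: "f \<in> Arr W"
  shows "cylinder_copy R (src f) (app f) (tgt f) (cylinder_complex enc f) enc"
proof -
  obtain C \<phi> D where f_eq: "f = (C, \<phi>, D)" by (cases f)
  have dec: "inv_into UNIV enc (enc t) = t" for t using inj_enc by simp
  have eq: "enc s = enc t \<longleftrightarrow> s = t" for s t using inj_enc by (simp add: inj_eq)
  have "cmap R C \<phi> D" using Arr_cmap[OF f] by (simp add: f_eq)
  then show ?thesis
    unfolding f_eq fst_conv snd_conv
    by (rule cylinder_copy.intro, unfold_locales)
      (simp_all add: cylinder_complex_def direct_sum3_def dec eq)
qed

sublocale standard: cylinder_model R enc "mapping_cylinder enc" "\<lambda>_. enc"
proof (intro cylinder_model.intro abel_cat_axioms cylinder_model_axioms.intro)
  have dec: "inv_into UNIV enc (enc t) = t" for t using inj_enc by simp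
  have in_cyl: "enc (x, y, z) \<in> carrier (Chain (cylinder_complex enc f) n)"
    if "x \<in> carrier (Chain (src f) n)" "y \<in> carrier (Chain (src f) (n - 1))" "z \<in> carrier (Chain (tgt f) n)"
    for f :: "('a, 'u) chain_map" and n x y z
    using that by (cases f) (simp add: cylinder_complex_def direct_sum3_def)
  fix f assume f: "f \<in> Arr W"
  show "cylinder_copy R (src f) (app f) (tgt f) (Cyl (mapping_cylinder enc) f) enc"
    using cylinder_complex_copy[OF f] by (simp add: mapping_cylinder_def)
  show "src (front_incl (mapping_cylinder enc) f) = src f \<and>
      tgt (front_incl (mapping_cylinder enc) f) = Cyl (mapping_cylinder enc) f"
    "src (back_incl (mapping_cylinder enc) f) = tgt f \<and>
      tgt (back_incl (mapping_cylinder enc) f) = Cyl (mapping_cylinder enc) f"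
    "src (proj (mapping_cylinder enc) f) = Cyl (mapping_cylinder enc) f \<and>
      tgt (proj (mapping_cylinder enc) f) = tgt f"
    "app (front_incl (mapping_cylinder enc) f) n \<in> extensional (carrier (Chain (src f) n))"
    "app (back_incl (mapping_cylinder enc) f) n \<in> extensional (carrier (Chain (tgt f) n))"
    "app (proj (mapping_cylinder enc) f) n \<in> extensional (carrier (Chain (Cyl (mapping_cylinder enc) f) n))"
    "x \<in> carrier (Chain (src f) n) \<Longrightarrow> app (front_incl (mapping_cylinder enc) f) n x =
      enc (x, \<zero>\<^bsub>Chain (src f) (n - 1)\<^esub>, \<zero>\<^bsub>Chain (tgt f) n\<^esub>)"
    "z \<in> carrier (Chain (tgt f) n) \<Longrightarrow> app (back_incl (mapping_cylinder enc) f) n z =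
      enc (\<zero>\<^bsub>Chain (src f) n\<^esub>, \<zero>\<^bsub>Chain (src f) (n - 1)\<^esub>, z)" for n x z
    by (cases f; simp add: mapping_cylinder_def)+
  show "app (proj (mapping_cylinder enc) f) n (enc (x, y, z)) = app f n x \<oplus>\<^bsub>Chain (tgt f) n\<^esub> z"
    if "x \<in> carrier (Chain (src f) n)" "y \<in> carrier (Chain (src f) (n - 1))" "z \<in> carrier (Chain (tgt f) n)"
    for n x y z
    using in_cyl[OF that] by (cases f) (simp add: mapping_cylinder_def dec)
next
  have dec: "inv_into UNIV enc (enc t) = t" for t using inj_enc by simp
  have in_cyl: "enc (x, y, z) \<in> carrier (Chain (cylinder_complex enc f) n)"
    if "x \<in> carrier (Chain (src f) n)" "y \<in> carrier (Chain (src f) (n - 1))" "z \<in> carrier (Chain (tgt f) n)"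
    for f :: "('a, 'u) chain_map" and n x y z
    using that by (cases f) (simp add: cylinder_complex_def direct_sum3_def)
  fix f a b g assume F: "(f, a, b, g) \<in> Arr (arrow_category W)"
  show "src (Cyl_map (mapping_cylinder enc) (f, a, b, g)) = Cyl (mapping_cylinder enc) f \<and>
      tgt (Cyl_map (mapping_cylinder enc) (f, a, b, g)) = Cyl (mapping_cylinder enc) g"
    "app (Cyl_map (mapping_cylinder enc) (f, a, b, g)) n \<in>
      extensional (carrier (Chain (Cyl (mapping_cylinder enc) f) n))" for n
    by (cases a; cases b; simp add: mapping_cylinder_def)+
  show "app (Cyl_map (mapping_cylinder enc) (f, a, b, g)) n (enc (x, y, z)) =
      enc (app a n x, app a (n - 1) y, app b n z)"
    if "x \<in> carrier (Chain (src f) n)" "y \<in> carrier (Chain (src f) (n - 1))" "z \<in> carrier (Chain (tgt f) n)"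
    for n x y z
    using in_cyl[OF that] by (cases a; cases b) (simp add: mapping_cylinder_def dec)
qed

end

context cylinder_model
begin

lemma Cyl2_up_to_iso: "Cyl2_up_to_iso W T"
  unfolding Cyl2_up_to_iso_def W_simps
proof (intro ballI)
  fix A :: "('a, 'u) module_complex" and f
  assume "f \<in> Hom W zero_complex A"
  then have f: "f \<in> Arr W" and s: "src f = zero_complex" "tgt f = A" unfolding Hom_iff by blast+
  interpret f: cmap R "src f" "app f" "tgt f" by (rule Arr_cmap[OF f])
  note ends = back_ends[OF f] proj_ends[OF f] and A = back_Arr[OF f] proj_Arr[OF f]
  have "back_incl T f \<cdot>\<^bsub>W\<^esub> proj T f = Idn W (Cyl T f)"
  proof (rule Cyl_eqI[OF f])
    fix n x y z assume xyz: "x \<in> carrier (Chain (src f) n)" "y \<in> carrier (Chain (src f) (n - 1))"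
      "z \<in> carrier (Chain (tgt f) n)"
    then have "x = \<zero>\<^bsub>Chain (src f) n\<^esub>" "y = \<zero>\<^bsub>Chain (src f) (n - 1)\<^esub>" by (simp_all add: s)
    then show "app (back_incl T f \<cdot>\<^bsub>W\<^esub> proj T f) n (e f (x, y, z)) = app (Idn W (Cyl T f)) n (e f (x, y, z))"
      using xyz ends Cyl_in[OF f xyz] by (simp add: proj_app[OF f] back_app[OF f])
  qed (use A ends f in simp_all)
  then show "back_incl T f \<in> Hom W A (Cyl T f) \<and> proj T f \<in> Hom W (Cyl T f) A \<and>
      proj T f \<cdot>\<^bsub>W\<^esub> back_incl T f = Idn W A \<and> back_incl T f \<cdot>\<^bsub>W\<^esub> proj T f = Idn W (Cyl T f)"
    using proj_back[OF f] A ends s by (simp add: Hom_iff)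
qed

lemma identified_copy:
  assumes f: "f \<in> Arr W" and s: "src f = zero_complex"
  shows "cylinder_copy R (src f) (app f) (tgt f) (tgt f) (\<lambda>(x, y, z). z)"
proof -
  interpret f: cmap R "src f" "app f" "tgt f" by (rule Arr_cmap[OF f])
  have c: "carrier (Chain (src f) n) = {\<zero>\<^bsub>Chain (src f) n\<^esub>}" for n by (simp add: s)
  have im: "(\<lambda>(x, y, z). z) ` ({u} \<times> {v} \<times> Z) = Z" for u v :: 'u and Z :: "'u set" by force
  show ?thesis
    by (rule cylinder_copy.intro[OF f.cmap_axioms], rule cylinder_copy_axioms.intro)
      (simp_all add: c im f.D.M.minus_eq f.D.M.neg_zero)
qed

text \<open>For an arrow out of the distinguished zero object, \<open>x\<close> and \<open>y\<close> are zero; the comparison \<open>to'\<close> is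
  the projection, \<open>(0, 0, z) \<mapsto> z\<close>, and \<open>from'\<close> is the back inclusion, its inverse. On all other arrows they are
  identities, so the coordinates remain.\<close>

lemma identified: "cylinder_model R enc (identify_Cyl2 W T) (\<lambda>f. if src f = zero_complex then (\<lambda>(x, y, z). z) else e f)"
proof -
  let ?e = "\<lambda>f. if src f = zero_complex then (\<lambda>(x, y, z). z) else e f"
  let ?T = "identify_Cyl2 W T"
  define from' where "from' f = (if src f = zero_complex then back_incl T f else Idn W (Cyl T f))" for f
  define to' where "to' f = (if src f = zero_complex then proj T f else Idn W (Cyl T f))" for f
  have defs: "Cyl ?T f = (if src f = zero_complex then tgt f else Cyl T f)"
    "Cyl_map ?T (f, a, b, g) = to' g \<cdot>\<^bsub>W\<^esub> Cyl_map T (f, a, b, g) \<cdot>\<^bsub>W\<^esub> from' f"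
    "front_incl ?T f = to' f \<cdot>\<^bsub>W\<^esub> front_incl T f" "back_incl ?T f = to' f \<cdot>\<^bsub>W\<^esub> back_incl T f"
    "proj ?T f = proj T f \<cdot>\<^bsub>W\<^esub> from' f" for f a b g
    by (simp_all add: identify_Cyl2_def Let_def from'_def to'_def)
  have ends: "src (to' f) = Cyl T f" "tgt (to' f) = Cyl ?T f" "src (from' f) = Cyl ?T f" "tgt (from' f) = Cyl T f"
    "to' f \<in> Arr W" "from' f \<in> Arr W" if f: "f \<in> Arr W" for f
    using f proj_ends[OF f] back_ends[OF f] proj_Arr[OF f] back_Arr[OF f] by (simp_all add: to'_def from'_def defs(1))
  have trivial: "x = \<zero>\<^bsub>Chain (src f) n\<^esub>" if "src f = zero_complex" "x \<in> carrier (Chain (src f) n)"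
    for f :: "('a, 'u) chain_map" and x n
    using that by simp
  have to_app: "app (to' f) n (e f (x, y, z)) = ?e f (x, y, z)"
    and from_app: "app (from' f) n (?e f (x, y, z)) = e f (x, y, z)"
    if f: "f \<in> Arr W" and xyz: "x \<in> carrier (Chain (src f) n)" "y \<in> carrier (Chain (src f) (n - 1))"
      "z \<in> carrier (Chain (tgt f) n)" for f n x y z
  proof -
    interpret f: cmap R "src f" "app f" "tgt f" by (rule Arr_cmap[OF f])
    have "app (proj T f) n (e f (x, y, z)) = z \<and> app (back_incl T f) n z = e f (x, y, z)"
      if "src f = zero_complex"
    proof -
      have "x = \<zero>\<^bsub>Chain (src f) n\<^esub>" "y = \<zero>\<^bsub>Chain (src f) (n - 1)\<^esub>" by (rule trivial; fact)+
      then show ?thesis using xyz by (simp add: proj_app[OF f] back_app[OF f])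
    qed
    then show "app (to' f) n (e f (x, y, z)) = ?e f (x, y, z)" "app (from' f) n (?e f (x, y, z)) = e f (x, y, z)"
      using Cyl_in[OF f xyz] by (simp_all add: to'_def from'_def)
  qed
  have copy': "cylinder_copy R (src f) (app f) (tgt f) (Cyl ?T f) (?e f)" if f: "f \<in> Arr W" for f
    using identified_copy[OF f] copy[OF f] by (simp add: defs(1))
  have e_in: "?e f (x, y, z) \<in> carrier (Chain (Cyl ?T f) n)"
    if "f \<in> Arr W" "x \<in> carrier (Chain (src f) n)" "y \<in> carrier (Chain (src f) (n - 1))"
      "z \<in> carrier (Chain (tgt f) n)" for f x y z n
    by (rule cylinder_copy.T_in[OF copy'[OF that(1)] that(2-4)])
  show ?thesis
  proof (intro cylinder_model.intro abel_cat_axioms cylinder_model_axioms.intro)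
    fix f assume f: "f \<in> Arr W"
    interpret f: cmap R "src f" "app f" "tgt f" by (rule Arr_cmap[OF f])
    note E = ends[OF f] and S = front_ends[OF f] back_ends[OF f] proj_ends[OF f]
      and A = front_Arr[OF f] back_Arr[OF f] proj_Arr[OF f]
    have arr: "front_incl ?T f \<in> Arr W" "back_incl ?T f \<in> Arr W" "proj ?T f \<in> Arr W"
      using E S A by (simp_all add: defs(3-5))
    show "cylinder_copy R (src f) (app f) (tgt f) (Cyl ?T f) (?e f)" by (rule copy'[OF f])
    show fe: "src (front_incl ?T f) = src f \<and> tgt (front_incl ?T f) = Cyl ?T f"
      and be: "src (back_incl ?T f) = tgt f \<and> tgt (back_incl ?T f) = Cyl ?T f"
      and pe: "src (proj ?T f) = Cyl ?T f \<and> tgt (proj ?T f) = tgt f"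
      using E S by (simp_all add: defs(3-5))
    show "app (front_incl ?T f) n \<in> extensional (carrier (Chain (src f) n))"
      "app (back_incl ?T f) n \<in> extensional (carrier (Chain (tgt f) n))"
      "app (proj ?T f) n \<in> extensional (carrier (Chain (Cyl ?T f) n))" for n
      using arr_extensional[OF arr(1), of n] arr_extensional[OF arr(2), of n] arr_extensional[OF arr(3), of n] fe be pe
      by simp_all
    show "app (front_incl ?T f) n x = ?e f (x, \<zero>\<^bsub>Chain (src f) (n - 1)\<^esub>, \<zero>\<^bsub>Chain (tgt f) n\<^esub>)"
      if x: "x \<in> carrier (Chain (src f) n)" for n x
      using S x to_app[OF f x f.C.M.zero_closed f.D.M.zero_closed] by (simp add: defs(3) front_app[OF f] del: zero_complex_simps)
    show "app (back_incl ?T f) n z = ?e f (\<zero>\<^bsub>Chain (src f) n\<^esub>, \<zero>\<^bsub>Chain (src f) (n - 1)\<^esub>, z)"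
      if z: "z \<in> carrier (Chain (tgt f) n)" for n z
      using S z to_app[OF f f.C.M.zero_closed f.C.M.zero_closed z] by (simp add: defs(4) back_app[OF f] del: zero_complex_simps)
    show "app (proj ?T f) n (?e f (x, y, z)) = app f n x \<oplus>\<^bsub>Chain (tgt f) n\<^esub> z"
      if xyz: "x \<in> carrier (Chain (src f) n)" "y \<in> carrier (Chain (src f) (n - 1))" "z \<in> carrier (Chain (tgt f) n)"
      for n x y z
    proof -
      have i: "?e f (x, y, z) \<in> carrier (Chain (src (from' f)) n)" using e_in[OF f xyz] E by simp
      show ?thesis unfolding defs(5) app_Comp[OF i] from_app[OF f xyz] by (rule proj_app[OF f xyz])
    qed
  next
    fix f a b g assume F: "(f, a, b, g) \<in> Arr (arrow_category W)"
    then have f: "f \<in> Arr W" and g: "g \<in> Arr W" and ab: "a \<in> Arr W" "b \<in> Arr W"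
      and s: "src a = src f" "tgt a = src g" "src b = tgt f" "tgt b = tgt g"
      by (simp_all add: arrow_category_Arr)
    note E = ends[OF f] ends[OF g] and m = map_Arr[OF F] map_ends[OF F]
    have arr: "Cyl_map ?T (f, a, b, g) \<in> Arr W" using E m by (simp add: defs(2))
    show me: "src (Cyl_map ?T (f, a, b, g)) = Cyl ?T f \<and> tgt (Cyl_map ?T (f, a, b, g)) = Cyl ?T g"
      using E by (simp add: defs(2))
    show "app (Cyl_map ?T (f, a, b, g)) n \<in> extensional (carrier (Chain (Cyl ?T f) n))" for n
      using arr_extensional[OF arr, of n] me by simp
    show "app (Cyl_map ?T (f, a, b, g)) n (?e f (x, y, z)) = ?e g (app a n x, app a (n - 1) y, app b n z)"
      if xyz: "x \<in> carrier (Chain (src f) n)" "y \<in> carrier (Chain (src f) (n - 1))" "z \<in> carrier (Chain (tgt f) n)"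
      for n x y z
    proof -
      have c: "app a n x \<in> carrier (Chain (src g) n)" "app a (n - 1) y \<in> carrier (Chain (src g) (n - 1))"
        "app b n z \<in> carrier (Chain (tgt g) n)"
        using app_closed[OF ab(1), of x n] app_closed[OF ab(1), of y "n - 1"] app_closed[OF ab(2), of z n] xyz s by simp_all
      have i: "?e f (x, y, z) \<in> carrier (Chain (src (from' f)) n)" using e_in[OF f xyz] E by simp
      then have i': "?e f (x, y, z) \<in> carrier (Chain (src (Cyl_map T (f, a, b, g) \<cdot>\<^bsub>W\<^esub> from' f)) n)" by simp
      show ?thesis
        unfolding defs(2) app_Comp[OF i'] app_Comp[OF i] from_app[OF f xyz] map_app[OF F xyz] by (rule to_app[OF g c])
    qed
  qed
qed

lemma identified_Cyl2: "Cyl2 W (identify_Cyl2 W T)"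
  unfolding Cyl2_def W_simps
proof (intro ballI)
  fix A :: "('a, 'u) module_complex" and f
  assume "f \<in> Hom W zero_complex A"
  then have "f \<in> Arr W" "src f = zero_complex" "tgt f = A" unfolding Hom_iff by blast+
  then show "Cyl (identify_Cyl2 W T) f = A \<and> back_incl (identify_Cyl2 W T) f = Idn W A \<and>
      proj (identify_Cyl2 W T) f = Idn W A"
    using proj_back[of f] by (simp add: identify_Cyl2_def Let_def)
qed

end

lemma abel_catI:
  assumes "noetherian_domain R" "inj enc" shows "abel_cat R enc"
  by (intro abel_cat.intro abel_cat_axioms.intro assms(2)) (use assms(1) in \<open>simp add: noetherian_domain_def\<close>)

theorem theorem6p1:
  fixes R :: "('a, 'r) ring_scheme"
    and enc :: "'u \<times> 'u \<times> 'u \<Rightarrow> 'u"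
  assumes "noetherian_domain R"
    and "inj enc"
  shows "let CA = (Abel_category R :: (('a, 'u) module_complex, ('a, 'u) chain_map) waldhausen);
             T = mapping_cylinder enc
         in (waldhausen_category CA \<and> saturation_axiom CA \<and> extension_axiom CA) \<and>
            (cylinder_diagram CA T \<and> Cyl1 CA T \<and> Cyl2_up_to_iso CA T \<and> cylinder_axiom CA T \<and>
             cylinder_functor CA (identify_Cyl2 CA T) \<and> cylinder_axiom CA (identify_Cyl2 CA T))"
proof -
  interpret abel_cat R enc by (rule abel_catI[OF assms])
  interpret identified: cylinder_model R enc "identify_Cyl2 W (mapping_cylinder enc)"
      "\<lambda>f. if src f = zero_complex then (\<lambda>(x, y, z). z) else enc"
    by (rule standard.identified)
  show ?thesis
    unfolding Let_def cylinder_functor_def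
    by (intro conjI waldhausen_category_axioms saturation extension standard.cylinder_diagram standard.Cyl1
        standard.Cyl2_up_to_iso standard.cylinder_axiom identified.cylinder_diagram identified.Cyl1
        standard.identified_Cyl2 identified.cylinder_axiom)
qed

end
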